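(* The ramification curve $R$ of the finite morphism $p:S\to P$ is a singular irreducible member of the Wiman-Edge pencil, and hence is obtained as an $\mathfrak{A}_5$-curve from a projective line with a nontrivial $\mathfrak{A}_5$-action by identifying the two points of each of the $6$ antipodal pairs of the $12$-element $\mathfrak{A}_5$-orbit so as to produce $6$ ordinary nodes.
   Context: The base field is $\mathbb{C}$. $S$ is the quintic del Pezzo surface (blow-up of $\mathbb{P}^2$ in four points no three of which are collinear), with a fixed isomorphism $\mathrm{Aut}(S)\cong\mathfrak{S}_5$, anticanonically embedded in $\check{\mathbb{P}}(E_S)$, where $E_S:=H^0(S,\omega_S^{-1})$ (dimension $6$) and $\check{\mathbb{P}}(U):=\mathbb{P}(U^\vee)$ denotes the projective space of one-dimensional subspaces of $U^\vee$. As an $\mathfrak{A}_5$-representation $E_S=I_S\oplus I'_S$ with $I_S,I'_S$ irreducible of dimension $3$ and inequivalent. Put $P:=\check{\mathbb{P}}(I_S)$ and $P':=\check{\mathbb{P}}(I'_S)$, disjoint planes in $\check{\mathbb{P}}(E_S)$. The projection with center $P'$ restricts to a finite $\mathfrak{A}_5$-equivariant morphism $p:S\to P$ of degree $5$; $R$ is its ramification divisor (defined by the Jacobian determinant). The space $H^0(S,\omega_S^{-2})^{\mathfrak{A}_5}$ is $2$-dimensional; the Wiman-Edge pencil is the pencil of curves in $|-2K_S|$ given by the divisors of its nonzero elements. A nontrivial action of $\mathfrak{A}_5$ on $\mathbb{P}^1$ is the action of the rotation group of a regular icosahedron drawn on the Riemann sphere; it has a unique orbit of size $12$ (the vertices),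 and two distinct points of this orbit form an antipodal pair when they are opposite vertices, equivalently when they have the same $\mathfrak{A}_5$-stabilizer. *)

theory Defs
  imports
    "HOL-Analysis.Analysis"
    "HOL-Library.Landau_Symbols"
    "HOL-Algebra.Sym_Groups"
    "HOL-Algebra.Group_Action"
begin

section \<open>Projective sets, regular maps, automorphisms\<close>

definition ppoint :: "complex^'n \<Rightarrow> (complex^'n) set"
  where "ppoint v = vec.span {v}"

definition proj_space :: "(complex^'n) set set"
  where "proj_space = {ppoint v | v. v \<noteq> 0}"

definition forms :: "nat \<Rightarrow> (complex^'n \<Rightarrow> complex) set"
  where "forms d = {f. \<exists>c :: ('n \<Rightarrow> nat) \<Rightarrow> complex. \<forall>x.
    f x = (\<Sum>m | (\<Sum>i\<in>UNIV. m i) = d. c m * (\<Prod>i\<in>UNIV. x $ i ^ m i))}"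

definition zariski_closed :: "(complex^'n) set set \<Rightarrow> bool"
  where "zariski_closed Z \<longleftrightarrow>
    (\<exists>Q. Q \<subseteq> (\<Union>d. forms d) \<and> Z = {s \<in> proj_space. \<forall>f\<in>Q. \<forall>v\<in>s. f v = 0})"

definition irreducible_subset :: "(complex^'n) set set \<Rightarrow> bool"
  where "irreducible_subset C \<longleftrightarrow> C \<noteq> {} \<and>
    (\<forall>Z Z'. zariski_closed Z \<and> zariski_closed Z' \<and> C \<subseteq> Z \<union> Z' \<longrightarrow> C \<subseteq> Z \<or> C \<subseteq> Z')"

definition regular_map ::
    "(complex^'n) set set \<Rightarrow> (complex^'m) set set \<Rightarrow> ((complex^'n) set \<Rightarrow> (complex^'m) set) \<Rightarrow> bool"
  where "regular_map X Y f \<longleftrightarrow> f \<in> X \<rightarrow> Y \<and>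
    (\<forall>s\<in>X. \<exists>d Q. (\<forall>i. (\<lambda>v. Q v $ i) \<in> forms d) \<and>
       (\<exists>v. s = ppoint v \<and> Q v \<noteq> 0) \<and>
       (\<forall>v. ppoint v \<in> X \<and> Q v \<noteq> 0 \<longrightarrow> f (ppoint v) = ppoint (Q v)))"

definition aut_group :: "(complex^'n) set set \<Rightarrow> ((complex^'n) set \<Rightarrow> (complex^'n) set) monoid"
  where "aut_group X = (BijGroup X)\<lparr>carrier :=
    {f \<in> Bij X. regular_map X X f \<and> regular_map X X (inv_into X f)}\<rparr>"

section \<open>The blow-up of the plane in four points\<close>

definition no_three_collinear :: "(4 \<Rightarrow> complex^3) \<Rightarrow> bool"
  where "no_three_collinear p \<longleftrightarrow>
    (\<forall>i j k. distinct [i, j, k] \<longrightarrow> det (vector [p i, p j, p k] :: complex^3^3) \<noteq> 0)"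

definition off_centres :: "(4 \<Rightarrow> complex^3) \<Rightarrow> complex^3 \<Rightarrow> bool"
  where "off_centres p x \<longleftrightarrow> (\<forall>i. x \<notin> ppoint (p i))"

text \<open>
  Let \<open>\<pi>\<close> be the blow-down from \<open>S\<close> to the plane, \<open>E i\<close> the exceptional curve over \<open>p i\<close>,
  and \<open>\<omega>\<close> the canonical sheaf of \<open>S\<close>.  Since \<open>\<omega>\<^sup>-\<^sup>k\<close> is
  \<open>\<pi>\<^sup>*O(3k)(- k \<Sum> E i)\<close>, its sections are the forms of degree \<open>3k\<close> vanishing to order at least
  \<open>k\<close> at every \<open>p i\<close>.  The form \<open>f\<close> stands for the section \<open>f / \<Omega>\<^sup>k\<close>, where
  \<open>\<Omega>\<close> is the 2-form on the plane with \<open>\<Omega>\<^sub>x(v, w) = det (x, v, w)\<close> and values in \<open>O(3)\<close>.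
\<close>

definition antican_sections :: "(4 \<Rightarrow> complex^3) \<Rightarrow> nat \<Rightarrow> (complex^3 \<Rightarrow> complex) set"
  where "antican_sections p k = {f \<in> forms (3 * k).
    \<forall>i v. \<exists>h :: complex poly. \<forall>t. f (p i + t *s v) = t ^ k * poly h t}"

definition comb :: "(complex^3 \<Rightarrow> complex^6) \<Rightarrow> complex^6 \<Rightarrow> complex^3 \<Rightarrow> complex"
  where "comb b c = (\<lambda>x. \<Sum>j\<in>UNIV. c $ j * b x $ j)"

text \<open>
  The components of \<open>b\<close> form a basis of \<open>E\<^sub>S\<close>, the space of sections of \<open>\<omega>\<^sup>-\<^sup>1\<close>.  It identifies
  \<open>E\<^sub>S\<close> with \<open>complex^6\<close> by \<open>c \<mapsto> comb b c\<close>, and the dual of \<open>E\<^sub>S\<close> with \<open>complex^6\<close> in the dual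
  coordinates, so that the evaluation at \<open>x\<close> becomes \<open>b x\<close>.
\<close>

definition antican_basis :: "(4 \<Rightarrow> complex^3) \<Rightarrow> (complex^3 \<Rightarrow> complex^6) \<Rightarrow> bool"
  where "antican_basis p b \<longleftrightarrow> (\<forall>f. f \<in> antican_sections p 1 \<longleftrightarrow> (\<exists>!c. f = comb b c))"

text \<open>
  The anticanonical image of the point of \<open>E i\<close> given by the tangent direction \<open>v\<close> at \<open>p i\<close>:
  near this point a section \<open>f\<close> of \<open>\<omega>\<^sup>-\<^sup>1\<close> is \<open>f (p i + t v) / t\<close>.
\<close>

definition exc_point ::
    "(4 \<Rightarrow> complex^3) \<Rightarrow> (complex^3 \<Rightarrow> complex^6) \<Rightarrow> 4 \<Rightarrow> complex^3 \<Rightarrow> (complex^6) set"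
  where "exc_point p b i v = ppoint (\<chi> j. deriv (\<lambda>t. b (p i + t *s v) $ j) 0)"

definition del_pezzo :: "(4 \<Rightarrow> complex^3) \<Rightarrow> (complex^3 \<Rightarrow> complex^6) \<Rightarrow> (complex^6) set set"
  where "del_pezzo p b =
    {ppoint (b x) | x. off_centres p x} \<union> {exc_point p b i v | i v. v \<notin> ppoint (p i)}"

section \<open>The action of automorphisms on sections\<close>

text \<open>
  \<open>pullback p b g k f f'\<close> says that \<open>f'\<close> is the pullback under \<open>g\<close> of the section \<open>f\<close> of
  \<open>\<omega>\<^sup>-\<^sup>k\<close>, that is \<open>g\<^sup>*(\<Omega>\<^sup>k / f) = \<Omega>\<^sup>k / f'\<close> on the dense open subset of \<open>S\<close> where neither the
  argument nor its image under \<open>g\<close> is on an exceptional curve.  There \<open>G\<close> is a local lift of \<open>g\<close>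
  to \<open>complex^3\<close> with Jacobian matrix \<open>M\<close>; the equation does not depend on the choice of the lift.
\<close>

definition pullback ::
    "(4 \<Rightarrow> complex^3) \<Rightarrow> (complex^3 \<Rightarrow> complex^6) \<Rightarrow> ((complex^6) set \<Rightarrow> (complex^6) set) \<Rightarrow> nat \<Rightarrow>
     (complex^3 \<Rightarrow> complex) \<Rightarrow> (complex^3 \<Rightarrow> complex) \<Rightarrow> bool"
  where "pullback p b g k f f' \<longleftrightarrow>
    (\<forall>x y. off_centres p x \<and> off_centres p y \<and> g (ppoint (b x)) = ppoint (b y) \<longrightarrow>
      (\<exists>U G M. open U \<and> x \<in> U \<and>
         (\<forall>u\<in>U. off_centres p u \<and> off_centres p (G u) \<and> g (ppoint (b u)) = ppoint (b (G u))) \<and>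
         (G has_derivative (\<lambda>v. M *v v)) (at x) \<and>
         (\<forall>v w. f' x * det (vector [G x, M *v v, M *v w] :: complex^3^3) ^ k =
                f (G x) * det (vector [x, v, w] :: complex^3^3) ^ k)))"

text \<open>
  In the sequel \<open>\<theta>\<close> is an action of the symmetric group on \<open>S\<close>; subspaces of \<open>E\<^sub>S\<close> are given in
  coordinates.  Pullback is a right action, which has the same invariant subspaces and the same
  intertwining maps as the corresponding left action.
\<close>

definition A5_invariant ::
    "(4 \<Rightarrow> complex^3) \<Rightarrow> (complex^3 \<Rightarrow> complex^6) \<Rightarrow>
     ((nat \<Rightarrow> nat) \<Rightarrow> (complex^6) set \<Rightarrow> (complex^6) set) \<Rightarrow> (complex^6) set \<Rightarrow> bool"
  where "A5_invariant p b \<theta> W \<longleftrightarrow> vec.subspace W \<and>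
    (\<forall>g\<in>carrier (alt_group 5). \<forall>c\<in>W. \<exists>c'\<in>W. pullback p b (\<theta> g) 1 (comb b c) (comb b c'))"

definition A5_irreducible ::
    "(4 \<Rightarrow> complex^3) \<Rightarrow> (complex^3 \<Rightarrow> complex^6) \<Rightarrow>
     ((nat \<Rightarrow> nat) \<Rightarrow> (complex^6) set \<Rightarrow> (complex^6) set) \<Rightarrow> (complex^6) set \<Rightarrow> bool"
  where "A5_irreducible p b \<theta> W \<longleftrightarrow> A5_invariant p b \<theta> W \<and> W \<noteq> {0} \<and>
    (\<forall>V\<subseteq>W. A5_invariant p b \<theta> V \<longrightarrow> V = {0} \<or> V = W)"

definition A5_equivalent ::
    "(4 \<Rightarrow> complex^3) \<Rightarrow> (complex^3 \<Rightarrow> complex^6) \<Rightarrow>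
     ((nat \<Rightarrow> nat) \<Rightarrow> (complex^6) set \<Rightarrow> (complex^6) set) \<Rightarrow>
     (complex^6) set \<Rightarrow> (complex^6) set \<Rightarrow> bool"
  where "A5_equivalent p b \<theta> W W' \<longleftrightarrow>
    (\<exists>T. Vector_Spaces.linear (*s) (*s) T \<and> bij_betw T W W' \<and>
      (\<forall>g\<in>carrier (alt_group 5). \<forall>c\<in>W. \<forall>c'\<in>W.
         pullback p b (\<theta> g) 1 (comb b c) (comb b c') \<longrightarrow>
         pullback p b (\<theta> g) 1 (comb b (T c)) (comb b (T c'))))"

text \<open>The members of the Wiman-Edge pencil are the divisors of the nonzero elements of this space.\<close>

definition wiman_edge_sections ::
    "(4 \<Rightarrow> complex^3) \<Rightarrow> (complex^3 \<Rightarrow> complex^6) \<Rightarrow>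
     ((nat \<Rightarrow> nat) \<Rightarrow> (complex^6) set \<Rightarrow> (complex^6) set) \<Rightarrow> (complex^3 \<Rightarrow> complex) set"
  where "wiman_edge_sections p b \<theta> = {f \<in> antican_sections p 2.
    \<forall>g\<in>carrier (alt_group 5). pullback p b (\<theta> g) 2 f f}"

section \<open>Divisors of sections\<close>

text \<open>
  \<open>local_equation p b k f s h\<close>: in a chart of the blow-up centred at \<open>s\<close>, the divisor of the
  section \<open>f\<close> of \<open>\<omega>\<^sup>-\<^sup>k\<close> has the equation \<open>h\<close>.  Off the exceptional curves the chart is an affine
  chart of the plane.  At a point of \<open>E i\<close> the blow-down is \<open>(t, u) \<mapsto> p i + t (v + u w)\<close> in the
  chart, with \<open>E i\<close> given by \<open>t = 0\<close>; continuity determines \<open>h\<close> on \<open>E i\<close>.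
\<close>

definition local_equation ::
    "(4 \<Rightarrow> complex^3) \<Rightarrow> (complex^3 \<Rightarrow> complex^6) \<Rightarrow> nat \<Rightarrow> (complex^3 \<Rightarrow> complex) \<Rightarrow>
     (complex^6) set \<Rightarrow> (complex \<times> complex \<Rightarrow> complex) \<Rightarrow> bool"
  where "local_equation p b k f s h \<longleftrightarrow>
    (\<exists>x v w. off_centres p x \<and> s = ppoint (b x) \<and> det (vector [x, v, w] :: complex^3^3) \<noteq> 0 \<and>
       (\<forall>t u. h (t, u) = f (x + t *s v + u *s w))) \<or>
    (\<exists>i v w. s = exc_point p b i v \<and> det (vector [p i, v, w] :: complex^3^3) \<noteq> 0 \<and>
       continuous_on UNIV h \<and>
       (\<forall>t u. f (p i + t *s (v + u *s w)) = t ^ k * h (t, u)))"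

definition divisor_support ::
    "(4 \<Rightarrow> complex^3) \<Rightarrow> (complex^3 \<Rightarrow> complex^6) \<Rightarrow> nat \<Rightarrow> (complex^3 \<Rightarrow> complex) \<Rightarrow> (complex^6) set set"
  where "divisor_support p b k f =
    {s \<in> del_pezzo p b. \<exists>h. local_equation p b k f s h \<and> h 0 = 0}"

definition singular_points ::
    "(4 \<Rightarrow> complex^3) \<Rightarrow> (complex^3 \<Rightarrow> complex^6) \<Rightarrow> nat \<Rightarrow> (complex^3 \<Rightarrow> complex) \<Rightarrow> (complex^6) set set"
  where "singular_points p b k f =
    {s \<in> del_pezzo p b. \<exists>h. local_equation p b k f s h \<and> h 0 = 0 \<and>
       (h has_derivative (\<lambda>_. 0)) (at 0)}"

text \<open>
  Ordinary node: the Taylor expansion of a local equation begins with a quadratic form that is the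
  product of two independent linear forms.
\<close>

definition ordinary_nodes ::
    "(4 \<Rightarrow> complex^3) \<Rightarrow> (complex^3 \<Rightarrow> complex^6) \<Rightarrow> nat \<Rightarrow> (complex^3 \<Rightarrow> complex) \<Rightarrow> (complex^6) set set"
  where "ordinary_nodes p b k f =
    {s \<in> del_pezzo p b. \<exists>h \<alpha> \<beta> \<gamma>. local_equation p b k f s h \<and> h 0 = 0 \<and>
       \<beta>\<^sup>2 - 4 * \<alpha> * \<gamma> \<noteq> 0 \<and>
       (\<lambda>z. h z - (\<alpha> * (fst z)\<^sup>2 + \<beta> * fst z * snd z + \<gamma> * (snd z)\<^sup>2))
         \<in> o[at 0](\<lambda>z. of_real (norm z ^ 2))}"

text \<open>
  A divisor is an irreducible curve, that is a prime divisor, when its support is irreducible and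
  its multiplicity along the support is one; the latter means that not all its points are singular.
\<close>

definition irreducible_divisor ::
    "(4 \<Rightarrow> complex^3) \<Rightarrow> (complex^3 \<Rightarrow> complex^6) \<Rightarrow> nat \<Rightarrow> (complex^3 \<Rightarrow> complex) \<Rightarrow> bool"
  where "irreducible_divisor p b k f \<longleftrightarrow>
    irreducible_subset (divisor_support p b k f) \<and>
    singular_points p b k f \<noteq> divisor_support p b k f"

section \<open>The projection to a plane and its ramification\<close>

text \<open>
  For a subspace \<open>I\<close> of \<open>E\<^sub>S\<close>: its annihilator in the dual of \<open>E\<^sub>S\<close>.  If \<open>E\<^sub>S\<close> is the direct sum of
  \<open>I\<close> and \<open>I'\<close>, the dual of \<open>I'\<close> as a subspace of the dual of \<open>E\<^sub>S\<close> is \<open>annihilator I\<close>; so the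
  plane \<open>P'\<close> consists of the lines in \<open>annihilator I\<close>.
\<close>

definition annihilator :: "(complex^6) set \<Rightarrow> (complex^6) set"
  where "annihilator I = {v. \<forall>c\<in>I. (\<Sum>j\<in>UNIV. c $ j * v $ j) = 0}"

definition jacobian_det :: "(complex^3 \<Rightarrow> complex^3) \<Rightarrow> complex^3 \<Rightarrow> complex"
  where "jacobian_det F x = det ((\<chi> i j. deriv (\<lambda>t. F (x + t *s axis j 1) $ i) 0) :: complex^3^3)"

text \<open>
  A linear map \<open>A\<close> to \<open>complex^3\<close> with kernel \<open>annihilator I\<close> is the projection with centre \<open>P'\<close>,
  in linear coordinates of \<open>P\<close>.  Hence \<open>A *v b x\<close>, whose components are a basis of the sections in
  \<open>I\<close>, gives the restriction of the projection to \<open>S\<close> in homogeneous coordinates of both planes.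
  Its Jacobian determinant \<open>J\<close> satisfies \<open>3 det (F, DF v, DF w) = J det (x, v, w)\<close> with
  \<open>F x = A *v b x\<close>, so it is (up to a constant) the pullback of 2-forms, as a section of
  \<open>\<omega>\<^sub>S \<otimes> p\<^sup>*\<omega>\<^sub>P\<^sup>-\<^sup>1 = \<omega>\<^sub>S \<otimes> p\<^sup>*O(3) = \<omega>\<^sub>S\<^sup>-\<^sup>2\<close>.
\<close>

definition ramification_section ::
    "(complex^3 \<Rightarrow> complex^6) \<Rightarrow> complex^6^3 \<Rightarrow> complex^3 \<Rightarrow> complex"
  where "ramification_section b A = jacobian_det (\<lambda>x. A *v b x)"

section \<open>Antipodal pairs\<close>

definition vertex_orbit ::
    "((nat \<Rightarrow> nat) \<Rightarrow> (complex^2) set \<Rightarrow> (complex^2) set) \<Rightarrow> (complex^2) set set"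
  where "vertex_orbit \<tau> = {x \<in> proj_space. card (orbit (alt_group 5) \<tau> x) = 12}"

definition antipodal ::
    "((nat \<Rightarrow> nat) \<Rightarrow> (complex^2) set \<Rightarrow> (complex^2) set) \<Rightarrow> (complex^2) set \<Rightarrow> (complex^2) set \<Rightarrow> bool"
  where "antipodal \<tau> x y \<longleftrightarrow> x \<in> vertex_orbit \<tau> \<and> y \<in> vertex_orbit \<tau> \<and> x \<noteq> y \<and>
    stabilizer (alt_group 5) \<tau> x = stabilizer (alt_group 5) \<tau> y"

end

theory Submission
  imports Defs "HOL-Algebra.Multiplicative_Group"
begin

text \<open>
  In suitable coordinates of the plane the four points are \<open>(1,1,1)\<close>, \<open>(1,-1,-1)\<close>, \<open>(-1,1,-1)\<close>,
  \<open>(-1,-1,1)\<close>. The conics through them are \<open>m1 x1^2 + m2 x2^2 + m3 x3^2 = 0\<close> with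
  \<open>m1 + m2 + m3 = 0\<close>, so \<open>S\<close> is the surface of the pairs of a point \<open>x\<close> and a conic \<open>m\<close> of the
  pencil through it. Let \<open>r\<close> be a root of \<open>r^2 = r + 1\<close>. The three functions
  \<open>u_i = x_i (r m_(i+1) + (r-1) m_(i+2))\<close> and their conjugates \<open>v_i\<close> under \<open>r \<mapsto> 1 - r\<close> are
  coordinates for the anticanonical embedding, in which the surface is the intersection of five
  quadrics. These coordinates show the symmetry: even sign changes, the cyclic permutation and a
  pair of matrices of order five, conjugate under \<open>r \<mapsto> 1 - r\<close>, preserve the quadrics and act by
  orthogonal matrices \<open>S\<close> on \<open>u\<close> and \<open>T\<close> on \<open>v\<close>. Since \<open>\<theta>\<close> is onto, these automorphisms are values
  of \<open>\<theta>\<close>; the elements of the alternating group that act in this way form a subgroup of order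
  divisible by 4, 3 and 5, hence the whole group (\<open>theta_alt\<close>).

  The blocks \<open>u\<close> and \<open>v\<close> are the two inequivalent icosahedral representations, so an invariant
  subspace of dimension three is one of them (\<open>A5_invariant_cases\<close>). After exchanging \<open>r\<close> and
  \<open>1 - r\<close> if necessary, the projection is \<open>(x, m) \<mapsto> u\<close> up to a linear map; on the plane it is
  \<open>cubic_map r\<close>. Its Jacobian determinant is the sextic \<open>4 |v|^2 - |u|^2\<close>, where the norm is the
  sum of squares (\<open>det_cubic_deriv\<close>). So \<open>R\<close> is cut out on \<open>S\<close> by a quadric invariant under
  orthogonal block matrices, and it belongs to the Wiman-Edge pencil (\<open>pullback_f\<close>).

  The sextic is a cubic form in the squares of the coordinates, which makes its singular points
  computable: they are the six points \<open>(0, \<plusminus>r, 1)\<close> and their cyclic permutations, and the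
  expansion there begins with a nondegenerate quadratic form (\<open>singular_points_eq\<close>). The curve has
  an explicit parametrisation by the conic \<open>a1^2 + a2^2 + a3^2 = 0\<close>, on which the icosahedral
  group acts by \<open>T\<close>. Two parameters have the same image only if they differ by the sign of one
  coordinate \<open>a_i\<close> and a certain form, the \<open>i\<close>th component of \<open>vertex_forms\<close>, vanishes at both
  (\<open>nu_eq_iff\<close>). This happens at twelve points, two over each node, and the parametrisation shows
  that the curve is irreducible.

  It remains to recognise these twelve points in terms of the action on the line. They form an
  orbit (\<open>orbit_vertices\<close>). If another orbit had twelve points, an element \<open>g\<close> of order five in one of
  its stabilizers would act on the twelve vertices with at least two fixed points, because
  \<open>12 mod 5 = 2\<close>; together with its fixed point in the other orbit these are three, but a
  projectivity with three fixed points is the identity (\<open>vertex_orbit_eq\<close>). In the same way, a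
  stabilizer of order five fixes a vertex and its partner over the same node and nothing else, so
  that antipodal points are the points with the same image (\<open>nu_eq_antipodal\<close>).
\<close>

section \<open>Forms and functions that are polynomial along lines\<close>

lemma finite_exponents: "finite {m :: 'n::finite \<Rightarrow> nat. (\<Sum>i\<in>UNIV. m i) = d}"
proof (rule finite_subset)
  show "{m :: 'n \<Rightarrow> nat. (\<Sum>i\<in>UNIV. m i) = d} \<subseteq> (UNIV \<rightarrow>\<^sub>E {..d})"
    by (auto simp: PiE_def extensional_def) (metis finite_code member_le_sum UNIV_I le0)
qed (simp add: finite_PiE)

lemma formsI:
  "(\<And>x. f x = (\<Sum>m | (\<Sum>i\<in>UNIV. m i) = d. c m * (\<Prod>i\<in>UNIV. x $ i ^ m i))) \<Longrightarrow> f \<in> forms d"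
  unfolding forms_def by blast

lemma forms_const: "(\<lambda>x::complex^'n. a) \<in> forms 0"
  unfolding forms_def
proof (intro CollectI exI[of _ "\<lambda>_. a"] allI)
  fix x :: "complex^'n"
  have "{m :: 'n \<Rightarrow> nat. (\<Sum>i\<in>UNIV. m i) = 0} = {\<lambda>_. 0}" by auto
  then show "a = (\<Sum>m | (\<Sum>i\<in>UNIV. m i) = 0. a * (\<Prod>i\<in>UNIV. x $ i ^ m i))" by simp
qed

lemma forms_coord: "(\<lambda>x::complex^'n. x $ i) \<in> forms 1"
proof -
  let ?e = "\<lambda>j. if j = i then 1 else 0 :: nat"
  have "x $ i = (\<Sum>m | (\<Sum>i\<in>UNIV. m i) = 1. (if m = ?e then 1 else 0) * (\<Prod>i\<in>UNIV. x $ i ^ m i))" (is "_ = ?S")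
    for x :: "complex^'n"
  proof -
    have "?S = (\<Sum>m\<in>{m. (\<Sum>i\<in>UNIV. m i) = 1}. if m = ?e then (\<Prod>i\<in>UNIV. x $ i ^ ?e i) else 0)"
      by (rule sum.cong) auto
    also have "\<dots> = (\<Prod>i\<in>UNIV. x $ i ^ ?e i)"
      by (subst sum.delta) (auto simp: finite_exponents)
    also have "\<dots> = (\<Prod>j\<in>UNIV. if j = i then x $ j else 1)"
      by (rule prod.cong) auto
    finally show ?thesis by simp
  qed
  then show ?thesis by (rule formsI)
qed

lemma forms_add:
  assumes "f \<in> forms d" "g \<in> forms d"
  shows "(\<lambda>x. f x + g x) \<in> forms d"
proof -
  obtain c c' where "\<forall>x. f x = (\<Sum>m | (\<Sum>i\<in>UNIV. m i) = d. c m * (\<Prod>i\<in>UNIV. x $ i ^ m i))"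
    "\<forall>x. g x = (\<Sum>m | (\<Sum>i\<in>UNIV. m i) = d. c' m * (\<Prod>i\<in>UNIV. x $ i ^ m i))"
    using assms unfolding forms_def by blast
  then have "f x + g x = (\<Sum>m | (\<Sum>i\<in>UNIV. m i) = d. (c m + c' m) * (\<Prod>i\<in>UNIV. x $ i ^ m i))" for x
    by (simp add: sum.distrib distrib_right)
  then show ?thesis by (rule formsI)
qed

text \<open>
  The coefficients of the product are the convolution of the coefficients.
\<close>

lemma forms_mult:
  fixes f g :: "complex^'n \<Rightarrow> complex"
  assumes "f \<in> forms d" "g \<in> forms e"
  shows "(\<lambda>x. f x * g x) \<in> forms (d + e)"
proof -
  define E where "E d = {m :: 'n \<Rightarrow> nat. (\<Sum>i\<in>UNIV. m i) = d}" for d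
  obtain c c' where f: "\<And>x. f x = (\<Sum>m\<in>E d. c m * (\<Prod>i\<in>UNIV. x $ i ^ m i))"
    and g: "\<And>x. g x = (\<Sum>m\<in>E e. c' m * (\<Prod>i\<in>UNIV. x $ i ^ m i))"
    using assms unfolding forms_def E_def by blast
  define plus :: "('n \<Rightarrow> nat) \<times> ('n \<Rightarrow> nat) \<Rightarrow> 'n \<Rightarrow> nat" where "plus = (\<lambda>(m, n) i. m i + n i)"
  define C where "C k = (\<Sum>(m, n) | (m, n) \<in> E d \<times> E e \<and> plus (m, n) = k. c m * c' n)" for k :: "'n \<Rightarrow> nat"
  have fin: "finite (E n)" for n unfolding E_def by (rule finite_exponents)
  have "f x * g x = (\<Sum>k\<in>E (d + e). C k * (\<Prod>i\<in>UNIV. x $ i ^ k i))" for x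
  proof -
    define h where "h = (\<lambda>mn. c (fst mn) * c' (snd mn) * (\<Prod>i\<in>UNIV. x $ i ^ plus mn i))"
    have "f x * g x = (\<Sum>mn\<in>E d \<times> E e. h mn)"
      unfolding f g sum_product sum.cartesian_product h_def plus_def
      by (rule sum.cong) (auto simp: power_add prod.distrib)
    also have "\<dots> = (\<Sum>k\<in>E (d + e). \<Sum>mn\<in>{mn \<in> E d \<times> E e. plus mn = k}. h mn)"
      by (rule sum.group[symmetric]) (auto simp: fin, auto simp: E_def plus_def sum.distrib)
    also have "\<dots> = (\<Sum>k\<in>E (d + e). C k * (\<Prod>i\<in>UNIV. x $ i ^ k i))"
    proof (rule sum.cong[OF refl])
      fix k
      have "{mn. (case mn of (m, n) \<Rightarrow> (m, n) \<in> E d \<times> E e \<and> plus (m, n) = k)} = {mn \<in> E d \<times> E e. plus mn = k}"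
        by auto
      then show "(\<Sum>mn\<in>{mn \<in> E d \<times> E e. plus mn = k}. h mn) = C k * (\<Prod>i\<in>UNIV. x $ i ^ k i)"
        unfolding C_def sum_distrib_right h_def by (auto intro!: sum.cong)
    qed
    finally show ?thesis .
  qed
  then show ?thesis unfolding E_def by (rule formsI)
qed

lemma forms_cmult: "f \<in> forms d \<Longrightarrow> (\<lambda>x. a * f x) \<in> forms d"
  using forms_mult[OF forms_const[of a], of f d] by simp

lemma forms_zero: "(\<lambda>x. 0) \<in> forms d"
  unfolding forms_def by (auto intro!: exI[of _ "\<lambda>_. 0"])

lemma forms_sum: "(\<And>i. i \<in> S \<Longrightarrow> f i \<in> forms d) \<Longrightarrow> (\<lambda>x. \<Sum>i\<in>S. f i x) \<in> forms d"
  by (induction S rule: infinite_finite_induct) (auto simp: forms_zero forms_add)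

lemma forms_uminus: "f \<in> forms d \<Longrightarrow> (\<lambda>x. - f x) \<in> forms d"
  using forms_cmult[of f d "-1"] by simp

lemma forms_diff: "f \<in> forms d \<Longrightarrow> g \<in> forms d \<Longrightarrow> (\<lambda>x. f x - g x) \<in> forms d"
  using forms_add[of f d "\<lambda>x. - g x"] forms_uminus[of g d] by simp

lemma forms_power: "f \<in> forms d \<Longrightarrow> (\<lambda>x. f x ^ n) \<in> forms (n * d)"
proof (induction n)
  case 0
  then show ?case using forms_const[of 1] by simp
next
  case (Suc n)
  then show ?case using forms_mult[of f d "\<lambda>x. f x ^ n"] by simp
qed

lemma forms_matrix: "(\<lambda>x. ((A :: complex^'n^'m) *v x) $ i) \<in> forms 1"
  unfolding matrix_vector_mult_def by (simp del: One_nat_def, intro forms_sum forms_cmult forms_coord)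

lemma forms_prod: "finite S \<Longrightarrow> (\<And>i. i \<in> S \<Longrightarrow> f i \<in> forms (d i)) \<Longrightarrow> (\<lambda>x. \<Prod>i\<in>S. f i x) \<in> forms (\<Sum>i\<in>S. d i)"
proof (induction S rule: finite_induct)
  case empty
  then show ?case using forms_const[of 1] by simp
next
  case (insert a S)
  then show ?case using forms_mult[of "f a" "d a" "\<lambda>x. \<Prod>i\<in>S. f i x"] by simp
qed

lemma forms_compose:
  assumes f: "f \<in> forms d" and Q: "\<And>i. (\<lambda>v. Q v $ i) \<in> forms e"
  shows "(\<lambda>v. f (Q v)) \<in> forms (d * e)"
proof -
  obtain c where c: "\<And>x. f x = (\<Sum>m | (\<Sum>i\<in>UNIV. m i) = d. c m * (\<Prod>i\<in>UNIV. x $ i ^ m i))"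
    using f unfolding forms_def by blast
  have "(\<lambda>v. \<Prod>i\<in>UNIV. Q v $ i ^ m i) \<in> forms (d * e)" if "(\<Sum>i\<in>UNIV. m i) = d" for m
  proof -
    have "(\<lambda>v. \<Prod>i\<in>UNIV. Q v $ i ^ m i) \<in> forms (\<Sum>i\<in>UNIV. m i * e)"
      by (intro forms_prod forms_power Q) auto
    then show ?thesis using that by (simp flip: sum_distrib_right)
  qed
  then show ?thesis unfolding c by (auto intro!: forms_sum forms_cmult)
qed

lemma forms_homogeneous:
  assumes "f \<in> forms d" shows "f (a *s x) = a ^ d * f x"
proof -
  obtain c where "\<And>x. f x = (\<Sum>m | (\<Sum>i\<in>UNIV. m i) = d. c m * (\<Prod>i\<in>UNIV. x $ i ^ m i))"
    using assms unfolding forms_def by blast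
  then show ?thesis
    by (auto simp: power_mult_distrib prod.distrib sum_distrib_left power_sum[symmetric] intro!: sum.cong)
qed

text \<open>
  Evaluation on lines turns identities of forms into identities of polynomials in one variable.
  This suffices to see that these functions have no zero divisors, which is all that the
  irreducibility of the curve and the uniqueness of pullbacks need.
\<close>

definition line_poly :: "(complex^'n \<Rightarrow> complex) \<Rightarrow> bool"
  where "line_poly f \<longleftrightarrow> (\<forall>x y. \<exists>q. \<forall>t. f (x + t *s y) = poly q t)"

lemma line_poly_const: "line_poly (\<lambda>x. a)"
  unfolding line_poly_def by (auto intro!: exI[of _ "[:a:]"])

lemma line_poly_coord: "line_poly (\<lambda>x. x $ i)"
  unfolding line_poly_def
  by (intro allI, rule_tac x = "[:x $ i, y $ i:]" in exI) simp

lemma line_poly_add: "line_poly f \<Longrightarrow> line_poly g \<Longrightarrow> line_poly (\<lambda>x. f x + g x)"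
  unfolding line_poly_def by (metis poly_add)

lemma line_poly_mult: "line_poly f \<Longrightarrow> line_poly g \<Longrightarrow> line_poly (\<lambda>x. f x * g x)"
  unfolding line_poly_def by (metis poly_mult)

lemma line_poly_sum: "(\<And>i. i \<in> S \<Longrightarrow> line_poly (f i)) \<Longrightarrow> line_poly (\<lambda>x. \<Sum>i\<in>S. f i x)"
  by (induction S rule: infinite_finite_induct) (auto simp: line_poly_const line_poly_add)

lemma line_poly_prod: "(\<And>i. i \<in> S \<Longrightarrow> line_poly (f i)) \<Longrightarrow> line_poly (\<lambda>x. \<Prod>i\<in>S. f i x)"
  by (induction S rule: infinite_finite_induct) (auto simp: line_poly_const line_poly_mult)

lemma line_poly_power: "line_poly f \<Longrightarrow> line_poly (\<lambda>x. f x ^ n)"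
  by (induction n) (auto simp: line_poly_const line_poly_mult)

lemma line_poly_forms: assumes "f \<in> forms d" shows "line_poly f"
proof -
  obtain c where "f = (\<lambda>x. \<Sum>m | (\<Sum>i\<in>UNIV. m i) = d. c m * (\<Prod>i\<in>UNIV. x $ i ^ m i))"
    using assms unfolding forms_def by blast
  then show ?thesis
    by (auto intro!: line_poly_sum line_poly_mult line_poly_const line_poly_prod line_poly_power line_poly_coord)
qed

lemma line_poly_domain:
  assumes f: "line_poly f" and g: "line_poly g" and "f x \<noteq> 0" and "g y \<noteq> 0"
  shows "\<exists>z. f z \<noteq> 0 \<and> g z \<noteq> 0"
proof -
  obtain q1 where q1: "\<And>t. f (x + t *s (y - x)) = poly q1 t" using f unfolding line_poly_def by blast
  obtain q2 where q2: "\<And>t. g (x + t *s (y - x)) = poly q2 t" using g unfolding line_poly_def by blast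
  have "poly q1 0 \<noteq> 0" using q1[of 0] assms(3) by simp
  moreover have "poly q2 1 \<noteq> 0" using q2[of 1] assms(4) by simp
  ultimately have "q1 * q2 \<noteq> 0" by auto
  then obtain t where "poly (q1 * q2) t \<noteq> 0" using poly_all_0_iff_0 by blast
  then show ?thesis using q1[of t] q2[of t] by (metis mult_not_zero poly_mult)
qed

lemma ppoint_eq_range: "ppoint v = range (\<lambda>a. a *s v)"
  unfolding ppoint_def vec.span_singleton ..

lemma mem_ppoint: "w \<in> ppoint v \<longleftrightarrow> (\<exists>a. w = a *s v)"
  unfolding ppoint_eq_range by auto

lemma ppoint_self: "v \<in> ppoint v" unfolding mem_ppoint by (metis vector_smult_lid)

lemma ppoint_scale: "a \<noteq> 0 \<Longrightarrow> ppoint (a *s v) = ppoint v"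
  unfolding ppoint_eq_range
  by (auto simp: vector_smult_assoc image_iff)
    (metis mult.commute nonzero_eq_divide_eq)

lemma ppoint_eq_iff: "v \<noteq> 0 \<Longrightarrow> ppoint v = ppoint w \<longleftrightarrow> (\<exists>a. a \<noteq> 0 \<and> v = a *s w)"
  by (metis mem_ppoint ppoint_scale ppoint_self vector_smult_lzero)

lemma ppoint_zero: "ppoint 0 = {0}"
  unfolding ppoint_eq_range by auto

lemma ppoint_nonzero: "ppoint v = ppoint w \<Longrightarrow> v \<noteq> 0 \<longleftrightarrow> w \<noteq> 0"
  by (metis ppoint_zero ppoint_self singletonD)

lemma ppoint_matrix: "(\<lambda>w. (A :: complex^'n^'m) *v w) ` ppoint v = ppoint (A *v v)"
  unfolding ppoint_eq_range by (auto simp: image_image vector_scalar_commute)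

lemma regular_map_matrix:
  fixes A :: "complex^'n^'m"
  assumes "X \<subseteq> proj_space" and "\<And>s. s \<in> X \<Longrightarrow> f s = (\<lambda>w. A *v w) ` s"
    and "f \<in> X \<rightarrow> Y" and "Y \<subseteq> proj_space"
  shows "regular_map X Y f"
  unfolding regular_map_def
proof (intro conjI ballI)
  fix s assume s: "s \<in> X"
  then obtain v where v: "s = ppoint v" "v \<noteq> 0" using assms(1) unfolding proj_space_def by auto
  have "f s \<in> proj_space" using s assms(3,4) by auto
  then have "A *v v \<noteq> 0" using assms(2)[OF s] v
    unfolding proj_space_def ppoint_matrix by (auto simp: ppoint_matrix) (metis ppoint_nonzero)
  then show "\<exists>d Q. (\<forall>i. (\<lambda>v. Q v $ i) \<in> forms d) \<and> (\<exists>v. s = ppoint v \<and> Q v \<noteq> 0) \<and>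
         (\<forall>v. ppoint v \<in> X \<and> Q v \<noteq> 0 \<longrightarrow> f (ppoint v) = ppoint (Q v))"
    using v assms(2)
    by (intro exI[of _ 1] exI[of _ "\<lambda>v. A *v v"])
      (auto simp del: One_nat_def simp: forms_matrix ppoint_matrix)
qed (rule assms(3))

section \<open>The surface and its curve in icosahedral coordinates\<close>

text \<open>
  The conic of the pencil through \<open>x\<close>, as a point of the line \<open>m1 + m2 + m3 = 0\<close>; it vanishes
  exactly at the four centres.
\<close>

definition kap :: "complex^3 \<Rightarrow> complex^3"
  where "kap x = vector [(x$2)\<^sup>2 - (x$3)\<^sup>2, (x$3)\<^sup>2 - (x$1)\<^sup>2, (x$1)\<^sup>2 - (x$2)\<^sup>2]"

text \<open>
  One of the two blocks of anticanonical coordinates of the pair \<open>(x, m)\<close>; the other one is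
  obtained by replacing \<open>r\<close> by \<open>1 - r\<close>.
\<close>

definition lin :: "complex \<Rightarrow> complex^3 \<Rightarrow> complex^3 \<Rightarrow> complex^3"
  where "lin r x m = vector [x$1 * (r * m$2 + (r - 1) * m$3), x$2 * (r * m$3 + (r - 1) * m$1),
     x$3 * (r * m$1 + (r - 1) * m$2)]"

definition incid :: "complex^3 \<Rightarrow> complex^3 \<Rightarrow> bool"
  where "incid x m \<longleftrightarrow> m$1 + m$2 + m$3 = 0 \<and> m$1 * (x$1)\<^sup>2 + m$2 * (x$2)\<^sup>2 + m$3 * (x$3)\<^sup>2 = 0"

text \<open>
  Five quadrics whose intersection is the anticanonical surface. The first three are permuted
  cyclically; the cyclic image of the last two is a consequence of them.
\<close>

definition quads :: "complex \<Rightarrow> complex^3 \<Rightarrow> complex^3 \<Rightarrow> bool"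
  where "quads r u v \<longleftrightarrow>
    2*u$1*u$2 + r*u$1* v$2 + (1-r)*u$2* v$1 + 2* v$1* v$2 = 0 \<and>
    2*u$2*u$3 + r*u$2* v$3 + (1-r)*u$3* v$2 + 2* v$2* v$3 = 0 \<and>
    2*u$3*u$1 + r*u$3* v$1 + (1-r)*u$1* v$3 + 2* v$3* v$1 = 0 \<and>
    (u$1-v$1)*(u$1-v$1) = (u$2-v$2)*((1-r)*u$2 - r* v$2) + (u$3-v$3)*(r*u$3 + (r-1)* v$3) \<and>
    (u$2-v$2)*(u$2-v$2) = (u$3-v$3)*((1-r)*u$3 - r* v$3) + (u$1-v$1)*(r*u$1 + (r-1)* v$1)"

lemma vec3_eq_iff: "(x :: complex^3) = y \<longleftrightarrow> x$1 = y$1 \<and> x$2 = y$2 \<and> x$3 = y$3"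
  by (simp add: vec_eq_iff forall_3)

lemma quads_lin:
  assumes "r * r = r + 1" "incid x m"
  shows "quads r (lin r x m) (lin (1 - r) x m)"
proof -
  define a where "a = x$1" define b where "b = x$2" define c where "c = x$3"
  define d where "d = m$1" define e where "e = m$2"
  have m3: "m$3 = - d - e" using assms(2) by (simp add: incid_def d_def e_def algebra_simps eq_neg_iff_add_eq_0)
  have h: "d * (a*a) + e * (b*b) = (d + e) * (c*c)"
    using assms(2) m3 unfolding incid_def a_def b_def c_def d_def e_def
    by (simp add: power2_eq_square algebra_simps)
  show ?thesis unfolding quads_def lin_def vector_3 m3
    unfolding a_def[symmetric] b_def[symmetric] c_def[symmetric] d_def[symmetric] e_def[symmetric]
    using assms(1) h apply (intro conjI)
    subgoal by Groebner_Basis.algebra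
    subgoal by Groebner_Basis.algebra
    subgoal by Groebner_Basis.algebra
    subgoal by Groebner_Basis.algebra
    subgoal by Groebner_Basis.algebra
    done
qed


text \<open>
  A rotation of order five of the icosahedron; together with even sign changes and cyclic
  permutations it generates the icosahedral group.
\<close>

definition rot5 :: "complex \<Rightarrow> complex^3^3"
  where "rot5 r = vector [vector [(r - 1)/2, -1/2, -r/2], vector [1/2, r/2, (1 - r)/2], vector [r/2, (1 - r)/2, 1/2]]"

lemma rot5_mult:
  "(rot5 r *v u)$1 = ((r-1)*u$1 - u$2 - r*u$3)/2"
  "(rot5 r *v u)$2 = (u$1 + r*u$2 + (1-r)*u$3)/2"
  "(rot5 r *v u)$3 = (r*u$1+(1-r)*u$2+u$3)/2"
  by (simp_all add: rot5_def matrix_vector_mult_def sum_3 field_simps)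

lemma orth_rot5: "r * r = r + 1 \<Longrightarrow> transpose (rot5 r) ** rot5 r = mat 1"
  by (simp add: rot5_def vec_eq_iff forall_3 matrix_matrix_mult_def transpose_def mat_def sum_3) 
     (simp add: field_simps)

lemma det_rot5: "r * r = r + 1 \<Longrightarrow> det (rot5 r) = 1"
  by (simp add: rot5_def det_3)  (simp add: field_simps)

lemma quads_rot5:
  assumes r: "r * r = r + 1" and q: "quads r u v"
  shows "quads r (rot5 r *v u) (rot5 (1 - r) *v v)"
proof -
  define a where "a = u$1" define b where "b = u$2" define c where "c = u$3"
  define d where "d = v$1" define e where "e = v$2" define f where "f = v$3"
  define h where "h = (1/2::complex)"
  have hh: "x / 2 = h * x" for x by (simp add: h_def)
  note q' = q[unfolded quads_def a_def[symmetric] b_def[symmetric] c_def[symmetric] d_def[symmetric] e_def[symmetric] f_def[symmetric]]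
  show ?thesis unfolding quads_def rot5_mult hh
    unfolding a_def[symmetric] b_def[symmetric] c_def[symmetric] d_def[symmetric] e_def[symmetric] f_def[symmetric]
    using q' r apply (intro conjI)
    subgoal by Groebner_Basis.algebra
    subgoal by Groebner_Basis.algebra
    subgoal by Groebner_Basis.algebra
    subgoal by Groebner_Basis.algebra
    subgoal by Groebner_Basis.algebra
    done
qed


text \<open>
  On the surface this matrix is \<open>2 r - 1\<close> times the matrix \<open>x_i m_j\<close> of rank one. The entries are
  linear in \<open>(u, v)\<close>, which gives the Segre coordinates of \<open>(x, m)\<close> back from the anticanonical
  ones.
\<close>

definition rank_one_entry :: "complex \<Rightarrow> complex^3 \<Rightarrow> complex^3 \<Rightarrow> complex^3^3"
  where "rank_one_entry r u v = vector [
    vector [- (u$1 - v$1), r * u$1 + (r-1) * v$1, (1-r) * u$1 - r * v$1],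
    vector [(1-r) * u$2 - r * v$2, - (u$2 - v$2), r * u$2 + (r-1) * v$2],
    vector [r * u$3 + (r-1) * v$3, (1-r) * u$3 - r * v$3, - (u$3 - v$3)]]"

lemma cross_zero:
  fixes a b :: "complex^3"
  assumes "a \<noteq> 0" "a$1*b$2 = a$2*b$1" "a$2*b$3 = a$3*b$2" "a$3*b$1 = a$1*b$3"
  shows "\<exists>t. b = t *s a"
proof -
  consider "a$1 \<noteq> 0" | "a$2 \<noteq> 0" | "a$3 \<noteq> 0" using assms(1) by (auto simp: vec3_eq_iff)
  then show ?thesis
  proof cases
    case 1 then show ?thesis using assms by (intro exI[of _ "b$1/a$1"]) (simp add: vec3_eq_iff field_simps)
  next
    case 2 then show ?thesis using assms by (intro exI[of _ "b$2/a$2"]) (simp add: vec3_eq_iff field_simps)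
  next
    case 3 then show ?thesis using assms by (intro exI[of _ "b$3/a$3"]) (simp add: vec3_eq_iff field_simps)
  qed
qed

lemma rank_one_rows:
  fixes N :: "complex^3^3"
  assumes "N \<noteq> 0" and "\<And>i. N$i$1 + N$i$2 + N$i$3 = 0"
    and "\<And>i j. N$i$1 * N$j$2 = N$i$2 * N$j$1"
  shows "\<exists>x m. m \<noteq> 0 \<and> m$1 + m$2 + m$3 = 0 \<and> (\<forall>i. N$i = x$i *s m)"
proof -
  obtain i where i: "N$i \<noteq> 0" using assms(1) by (auto simp: vec_eq_iff)
  have "\<exists>t. N$j = t *s N$i" for j
  proof (rule cross_zero[OF i assms(3)])
    have "N$i$3 = - N$i$1 - N$i$2" "N$j$3 = - N$j$1 - N$j$2"
      using assms(2)[of i] assms(2)[of j] by (simp_all add: algebra_simps eq_neg_iff_add_eq_0)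
    then have e: "N$i$3 = - N$i$1 - N$i$2" "N$j$3 = - N$j$1 - N$j$2" .
    show "N$i$2 * N$j$3 = N$i$3 * N$j$2" "N$i$3 * N$j$1 = N$i$1 * N$j$3"
      unfolding e using assms(3)[of i j] by (simp_all add: algebra_simps)
  qed
  then have "\<forall>j. \<exists>t. N$j = t *s N$i" by (rule allI)
  then obtain t where "\<forall>j. N$j = t j *s N$i" by (rule exE[OF choice])
  then have "\<forall>j. N$j = (\<chi> j. t j)$j *s N$i" unfolding vec_lambda_beta .
  then show ?thesis using i assms(2)[of i] by blast
qed

lemma sqrt5_nonzero: assumes "r * r = r + (1::complex)" shows "2 * r - 1 \<noteq> 0"
proof
  assume "2 * r - 1 = 0"
  then have "(5::complex) = 0" using assms by Groebner_Basis.algebra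
  then show False by simp
qed

text \<open>
  The quadrics say that the matrix of Segre coordinates has rank one and that the point lies on
  its conic; so they contain nothing but the surface.
\<close>

lemma quads_imp_incid:
  assumes r: "r * r = r + 1" and q: "quads r u v"
  shows "\<exists>x m. incid x m \<and> u = lin r x m \<and> v = lin (1 - r) x m"
proof (cases "rank_one_entry r u v = 0")
  case True
  then have z: "rank_one_entry r u v $ i $ j = 0" for i j by simp
  have "(2*r-1) * u$i = 0 \<and> (2*r-1) * v$i = 0" for i
  proof -
    have "(2*r-1) * u$1 = 0 \<and> (2*r-1) * v$1 = 0"
      using z[of 1 1] z[of 1 2] unfolding rank_one_entry_def vector_3 by Groebner_Basis.algebra
    moreover have "(2*r-1) * u$2 = 0 \<and> (2*r-1) * v$2 = 0"
      using z[of 2 2] z[of 2 3] unfolding rank_one_entry_def vector_3 by Groebner_Basis.algebra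
    moreover have "(2*r-1) * u$3 = 0 \<and> (2*r-1) * v$3 = 0"
      using z[of 3 3] z[of 3 1] unfolding rank_one_entry_def vector_3 by Groebner_Basis.algebra
    ultimately have "\<forall>i. (2*r-1) * u$i = 0 \<and> (2*r-1) * v$i = 0" unfolding forall_3 by blast
    then show ?thesis ..
  qed
  then have "u = 0" "v = 0" using sqrt5_nonzero[OF r] by (auto simp: vec_eq_iff)
  then show ?thesis by (intro exI[of _ 0]) (simp add: incid_def lin_def vec3_eq_iff)
next
  case False
  let ?N = "rank_one_entry r u v"
  note q' = q[unfolded quads_def]
  have minor: "?N$1$1 * ?N$2$2 = ?N$1$2 * ?N$2$1" "?N$2$1 * ?N$3$2 = ?N$2$2 * ?N$3$1" "?N$1$1 * ?N$3$2 = ?N$1$2 * ?N$3$1"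
    unfolding rank_one_entry_def vector_3 using q' r by Groebner_Basis.algebra+
  have "?N$i$1 * ?N$j$2 = ?N$i$2 * ?N$j$1" for i j
    using exhaust_3[of i] exhaust_3[of j] minor by (auto simp: mult.commute)
  moreover have "?N$i$1 + ?N$i$2 + ?N$i$3 = 0" for i
    using exhaust_3[of i] by (auto simp: rank_one_entry_def algebra_simps)
  ultimately obtain x m where m: "m \<noteq> 0" "m$1 + m$2 + m$3 = 0" and N: "\<And>i. ?N$i = x$i *s m"
    using rank_one_rows[OF False] by blast
  have e: "?N$i$j = x$i * m$j" for i j using N[of i] by simp
  note ee = e[of 1 1] e[of 1 2] e[of 1 3] e[of 2 1] e[of 2 2] e[of 2 3] e[of 3 1] e[of 3 2] e[of 3 3]
  define S where "S = m$1 * (x$1)\<^sup>2 + m$2 * (x$2)\<^sup>2 + m$3 * (x$3)\<^sup>2"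
  have "?N$1$1*?N$1$1 + ?N$2$2*?N$2$1 + ?N$3$3*?N$3$1 = 0" "?N$1$1*?N$1$2 + ?N$2$2*?N$2$2 + ?N$3$3*?N$3$2 = 0"
    unfolding rank_one_entry_def vector_3 using q' by Groebner_Basis.algebra+
  then have 1: "S * m$1 = 0" "S * m$2 = 0" unfolding e S_def by (simp_all add: power2_eq_square algebra_simps)
  have "S * m$3 = 0" using 1 m(2) by Groebner_Basis.algebra
  then have S: "S = 0" using 1 m(1) by (auto simp: vec3_eq_iff)
  define s where "s = 2 * r - 1"
  have s: "s \<noteq> 0" using sqrt5_nonzero[OF r] by (simp add: s_def)
  have "incid x (inverse s *s m)" using m(2) S s by (simp add: incid_def S_def mult.assoc flip: distrib_left)
  moreover have su: "s *s u = lin r x m" and sv: "s *s v = lin (1 - r) x m"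
    using ee unfolding rank_one_entry_def vector_3 vec3_eq_iff lin_def vector_smult_component s_def
    using r by (intro conjI; Groebner_Basis.algebra)+
  moreover have "lin q x (inverse s *s m) = inverse s *s lin q x m" for q
    by (simp add: lin_def vec3_eq_iff algebra_simps)
  ultimately show ?thesis using s
    by (intro exI[of _ x] exI[of _ "inverse s *s m"]) (simp add: vector_smult_assoc flip: su sv)
qed

lemma rank_one_entry_lin:
  assumes r: "r * r = r + 1" and "incid x m"
  shows "rank_one_entry r (lin r x m) (lin (1 - r) x m) $ i $ j = (2 * r - 1) * (x$i * m$j)"
proof -
  define a where "a = x$1" define b where "b = x$2" define c where "c = x$3"
  define d where "d = m$1" define e where "e = m$2"
  have m3: "m$3 = - d - e" using assms(2) by (simp add: incid_def d_def e_def algebra_simps eq_neg_iff_add_eq_0)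
  have "\<forall>i j. rank_one_entry r (lin r x m) (lin (1 - r) x m) $ i $ j = (2 * r - 1) * (x$i * m$j)"
    unfolding forall_3 rank_one_entry_def lin_def vector_3 m3
    unfolding a_def[symmetric] b_def[symmetric] c_def[symmetric] d_def[symmetric] e_def[symmetric]
    by (simp add: algebra_simps)
  then show ?thesis by blast
qed

text \<open>
  A column of the rank one matrix is \<open>m_j x\<close>; applying the cubic map to it gives a multiple of the
  given point. This is the local inverse of the anticanonical map.
\<close>

lemma lin_kap_scaled:
  assumes "incid x m"
  shows "lin r (m$j *s x) (kap (m$j *s x)) = kap (m$j *s x) $ j *s lin r x m"
proof -
  define a where "a = x$1" define b where "b = x$2" define c where "c = x$3"
  define d where "d = m$1" define e where "e = m$2" 
  have m3: "m$3 = - d - e" using assms by (simp add: incid_def d_def e_def algebra_simps eq_neg_iff_add_eq_0)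
  have h: "d * (a*a) + e * (b*b) = (d + e) * (c*c)"
    using assms m3 unfolding incid_def a_def b_def c_def d_def e_def
    by (simp add: power2_eq_square algebra_simps)
  have "\<forall>j. lin r (m$j *s x) (kap (m$j *s x)) = kap (m$j *s x) $ j *s lin r x m"
    unfolding forall_3 lin_def kap_def vec3_eq_iff vector_3 m3 vector_smult_component
    unfolding a_def[symmetric] b_def[symmetric] c_def[symmetric] d_def[symmetric] e_def[symmetric]
    using h by (intro conjI; Groebner_Basis.algebra)
  then show ?thesis by blast
qed

lemma incid_kap: "incid x (kap x)"
  by (simp add: incid_def kap_def algebra_simps)

definition conic :: "complex^3 \<Rightarrow> bool"
  where "conic a \<longleftrightarrow> (a$1)\<^sup>2 + (a$2)\<^sup>2 + (a$3)\<^sup>2 = 0"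

text \<open>
  The parametrisation of the ramification curve by the conic: \<open>cx\<close> gives the point of the plane
  and \<open>cm\<close> the conic of the pencil through it.
\<close>

definition cx :: "complex \<Rightarrow> complex^3 \<Rightarrow> complex^3"
  where "cx r a = vector [a$1 * ((r+1) * (a$3)\<^sup>2 - (a$2)\<^sup>2), a$2 * ((r+1) * (a$1)\<^sup>2 - (a$3)\<^sup>2), a$3 * ((r+1) * (a$2)\<^sup>2 - (a$1)\<^sup>2)]"

definition cm :: "complex \<Rightarrow> complex^3 \<Rightarrow> complex^3"
  where "cm r a = vector [(r+1) * (a$2)\<^sup>2 - (2-r) * (a$3)\<^sup>2, (r+1) * (a$3)\<^sup>2 - (2-r) * (a$1)\<^sup>2, (r+1) * (a$1)\<^sup>2 - (2-r) * (a$2)\<^sup>2]"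

definition nsq :: "complex^3 \<Rightarrow> complex"
  where "nsq u = (u$1)\<^sup>2 + (u$2)\<^sup>2 + (u$3)\<^sup>2"

lemma conic_alt: "conic a \<longleftrightarrow> (a$3)\<^sup>2 = - (a$1)\<^sup>2 - (a$2)\<^sup>2"
  unfolding conic_def by Groebner_Basis.algebra

lemma incid_curve:
  assumes r: "r * r = r + 1" and "conic a"
  shows "incid (cx r a) (cm r a)"
  using assms unfolding incid_def cx_def cm_def vector_3 conic_def by (intro conjI; Groebner_Basis.algebra)

text \<open>
  The components of both blocks along the curve; \<open>s\<close> is \<open>r\<close> for the first and \<open>1 - r\<close> for the
  second block.
\<close>

definition cu :: "complex \<Rightarrow> complex \<Rightarrow> complex \<Rightarrow> complex \<Rightarrow> complex \<Rightarrow> complex"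
  where "cu r s a b c = a * ((r+1)*c\<^sup>2-b\<^sup>2) * (s*((r+1)*c\<^sup>2-(2-r)*a\<^sup>2) + (s-1)*((r+1)*a\<^sup>2-(2-r)*b\<^sup>2))"

lemma lin_curve:
  "lin s (cx r a) (cm r a) = vector [cu r s (a$1) (a$2) (a$3), cu r s (a$2) (a$3) (a$1), cu r s (a$3) (a$1) (a$2)]"
  by (simp add: vec3_eq_iff lin_def cx_def cm_def cu_def)

lemma nsq_curve:
  assumes r: "r * r = r + 1" and a: "conic a"
  shows "nsq (lin r (cx r a) (cm r a)) = 4 * nsq (lin (1 - r) (cx r a) (cm r a))"
proof -
  define A where "A = (a$1)\<^sup>2" define B where "B = (a$2)\<^sup>2"
  have C: "(a$3)\<^sup>2 = - A - B" using a by (simp add: conic_alt A_def B_def)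
  show ?thesis
    unfolding lin_curve nsq_def vector_3 cu_def power_mult_distrib C A_def[symmetric] B_def[symmetric]
    using r by Groebner_Basis.algebra
qed

lemma cu_even: "cu r s (-a) b c = - cu r s a b c" "cu r s a (-b) c = cu r s a b c" "cu r s a b (-c) = cu r s a b c"
  by (simp_all add: cu_def)

lemma cu_half: "cu r s (a/2) (b/2) (c/2) = cu r s a b c / 32"
  by (simp add: cu_def power2_eq_square field_simps)

text \<open>
  The quadratic factors are first simplified modulo the equation of the conic; the remaining
  identities have degree five in \<open>a\<close>, \<open>b\<close>, \<open>c\<close>.
\<close>

lemma cu_rot5:
  fixes a b c :: complex
  assumes r: "r * r = r + (1::complex)" and c: "a\<^sup>2+b\<^sup>2+c\<^sup>2 = 0"
    and A: "A = -r*a - b - (1-r)*c" and B: "B = a+(1-r)*b+r*c" and C: "C = (1-r)*a+r*b+c"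
  shows "cu r r A B C = 16*((r-1)*cu r r a b c - cu r r b c a - r*cu r r c a b)"
    and "cu r (1-r) A B C = 16*(-r*cu r (1-r) a b c - cu r (1-r) b c a - (1-r)*cu r (1-r) c a b)"
proof -
  have 1: "(r+1)*C\<^sup>2-B\<^sup>2 = 4*(r*b*b-a*b-r*a*c+(r+1)*b*c)"
    "(r*((r+1)*C\<^sup>2-(2-r)*A\<^sup>2) + (r-1)*((r+1)*A\<^sup>2-(2-r)*B\<^sup>2)) = 8*((1-r)*a*b-a*c+r*b*c+b*b)"
    "((1-r)*((r+1)*C\<^sup>2-(2-r)*A\<^sup>2) + (1-r-1)*((r+1)*A\<^sup>2-(2-r)*B\<^sup>2)) = 4*(-(1+r)*a*b+3*a*c+(1-2*r)*a*a+(r-2)*b*c-r*b*b)"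
    unfolding A B C using r c by Groebner_Basis.algebra+
  have 2: "cu r r A B C = A * (4*(r*b*b-a*b-r*a*c+(r+1)*b*c)) * (8*((1-r)*a*b-a*c+r*b*c+b*b))"
    "cu r (1-r) A B C = A * (4*(r*b*b-a*b-r*a*c+(r+1)*b*c)) * (4*(-(1+r)*a*b+3*a*c+(1-2*r)*a*a+(r-2)*b*c-r*b*b))"
    unfolding cu_def 1 by (rule refl)+
  show "cu r r A B C = 16*((r-1)*cu r r a b c - cu r r b c a - r*cu r r c a b)"
    unfolding 2 unfolding A cu_def using r c by Groebner_Basis.algebra
  show "cu r (1-r) A B C = 16*(-r*cu r (1-r) a b c - cu r (1-r) b c a - (1-r)*cu r (1-r) c a b)"
    unfolding 2 unfolding A cu_def using r c by Groebner_Basis.algebra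
qed

text \<open>
  The parametrisation is equivariant for the rotation of order five, which acts on the conic like
  on the second block.
\<close>

lemma curve_rot5:
  assumes r: "r * r = r + 1" and a: "conic a"
  shows "lin r (cx r (rot5 (1 - r) *v a)) (cm r (rot5 (1 - r) *v a)) = rot5 r *v lin r (cx r a) (cm r a)"
    and "lin (1-r) (cx r (rot5 (1 - r) *v a)) (cm r (rot5 (1 - r) *v a)) = rot5 (1-r) *v lin (1-r) (cx r a) (cm r a)"
proof -
  define A where "A = (\<lambda>a b c. -r*a - b - (1-r)*c)"
  define f where "f = (\<lambda>s a b c. 16*((s-1)*cu r s a b c - cu r s b c a - s*cu r s c a b))"
  have 1: "cu r s (A a b c) (A c a b) (A b c a) = f s a b c" if "a\<^sup>2+b\<^sup>2+c\<^sup>2 = 0" "s \<in> {r, 1-r}" for a b c s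
  proof -
    have "cu r s (A a b c) (- A c a b) (- A b c a) = f s a b c"
      using cu_rot5[OF r that(1), of "A a b c" "- A c a b" "- A b c a"] that(2)
      unfolding A_def f_def by auto
    then show ?thesis by (simp add: cu_even)
  qed
  define x where "x = a$1" define y where "y = a$2" define z where "z = a$3"
  have c: "x\<^sup>2+y\<^sup>2+z\<^sup>2=0" "z\<^sup>2+x\<^sup>2+y\<^sup>2=0" "y\<^sup>2+z\<^sup>2+x\<^sup>2=0" using a by (auto simp: conic_def x_def y_def z_def add_ac)
  have 2: "(rot5 (1 - r) *v a)$1 = A x y z/2" "(rot5 (1 - r) *v a)$2 = -(A z x y/2)" "(rot5 (1 - r) *v a)$3 = -(A y z x/2)"
    unfolding rot5_mult A_def x_def y_def z_def by (simp_all add: field_simps)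
  have "lin s (cx r (rot5 (1 - r) *v a)) (cm r (rot5 (1 - r) *v a)) = rot5 s *v lin s (cx r a) (cm r a)" if "s \<in> {r, 1-r}" for s
    unfolding lin_curve vec3_eq_iff vector_3 2 cu_even cu_half
    unfolding x_def[symmetric] y_def[symmetric] z_def[symmetric] 1[OF c(1) that] 1[OF c(2) that] 1[OF c(3) that]
    unfolding f_def rot5_mult by (simp add: field_simps lin_curve x_def y_def z_def)
  then show "lin r (cx r (rot5 (1 - r) *v a)) (cm r (rot5 (1 - r) *v a)) = rot5 r *v lin r (cx r a) (cm r a)"
    and "lin (1-r) (cx r (rot5 (1 - r) *v a)) (cm r (rot5 (1 - r) *v a)) = rot5 (1-r) *v lin (1-r) (cx r a) (cm r a)"
    by auto
qed


text \<open>
  The map of the plane whose components are the first block of anticanonical sections.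
\<close>

definition cubic_map :: "complex \<Rightarrow> complex^3 \<Rightarrow> complex^3"
  where "cubic_map r x = lin r x (kap x)"

definition cubic_deriv :: "complex \<Rightarrow> complex^3 \<Rightarrow> complex^3^3"
  where "cubic_deriv r x = vector [
    vector [r * (x$3)\<^sup>2 - (r-1) * (x$2)\<^sup>2 - 3 * (x$1)\<^sup>2, - (2 * (r-1) * x$1 * x$2), 2 * r * x$1 * x$3],
    vector [2 * r * x$1 * x$2, r * (x$1)\<^sup>2 - (r-1) * (x$3)\<^sup>2 - 3 * (x$2)\<^sup>2, - (2 * (r-1) * x$2 * x$3)],
    vector [- (2 * (r-1) * x$1 * x$3), 2 * r * x$2 * x$3, r * (x$2)\<^sup>2 - (r-1) * (x$1)\<^sup>2 - 3 * (x$3)\<^sup>2]]"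

lemma cubic_map_nth:
  "cubic_map r x $ 1 = x$1 * (r * (x$3)\<^sup>2 - (r-1) * (x$2)\<^sup>2 - (x$1)\<^sup>2)"
  "cubic_map r x $ 2 = x$2 * (r * (x$1)\<^sup>2 - (r-1) * (x$3)\<^sup>2 - (x$2)\<^sup>2)"
  "cubic_map r x $ 3 = x$3 * (r * (x$2)\<^sup>2 - (r-1) * (x$1)\<^sup>2 - (x$3)\<^sup>2)"
  by (simp_all add: cubic_map_def lin_def kap_def algebra_simps)

lemma has_derivative_nth [derivative_intros]:
  "((\<lambda>x::complex^3. x $ i) has_derivative (\<lambda>v. v $ i)) (at x within S)"
  by (rule bounded_linear.has_derivative[OF bounded_linear_vec_nth has_derivative_ident])

lemma has_derivative_vec3:
  fixes f :: "'a::real_normed_vector \<Rightarrow> complex^3"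
  assumes "\<And>i. ((\<lambda>x. f x $ i) has_derivative (\<lambda>v. f' v $ i)) (at x within S)"
  shows "(f has_derivative f') (at x within S)"
  using assms by (subst has_derivative_componentwise_within) (auto simp: Basis_vec_def inner_axis intro!: derivative_eq_intros)

lemma cubic_map_has_derivative:
  "(cubic_map r has_derivative (\<lambda>v. cubic_deriv r x *v v)) (at x)"
proof (rule has_derivative_vec3)
  fix i :: 3
  have "\<forall>i. ((\<lambda>x. cubic_map r x $ i) has_derivative (\<lambda>v. (cubic_deriv r x *v v) $ i)) (at x)"
    unfolding forall_3 cubic_map_nth cubic_deriv_def matrix_vector_mult_def vec_lambda_beta sum_3 vector_3
    by (intro conjI; (rule derivative_eq_intros | rule refl)+; simp add: fun_eq_iff power2_eq_square algebra_simps)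
  then show "((\<lambda>x. cubic_map r x $ i) has_derivative (\<lambda>v. (cubic_deriv r x *v v) $ i)) (at x)" ..
qed

definition sextic :: "complex \<Rightarrow> complex^3 \<Rightarrow> complex"
  where "sextic r x = 4 * nsq (cubic_map (1 - r) x) - nsq (cubic_map r x)"

text \<open>
  The ramification sextic is three times this cubic in the squares of the coordinates.
\<close>

definition cub :: "complex \<Rightarrow> complex \<Rightarrow> complex \<Rightarrow> complex \<Rightarrow> complex"
  where "cub r X Y Z = X^3 + Y^3 + Z^3 - 6 * X * Y * Z + (5 * r - 2) * (X * Y\<^sup>2 + Y * Z\<^sup>2 + Z * X\<^sup>2)
     + (3 - 5 * r) * (X\<^sup>2 * Y + Y\<^sup>2 * Z + Z\<^sup>2 * X)"

lemma sextic_eq_cub: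
  assumes r: "r * r = r + 1"
  shows "sextic r x = 3 * cub r ((x$1)\<^sup>2) ((x$2)\<^sup>2) ((x$3)\<^sup>2)"
  unfolding sextic_def nsq_def cubic_map_nth cub_def power_mult_distrib using r by Groebner_Basis.algebra

lemma det_cubic_deriv:
  assumes r: "r * r = r + 1"
  shows "det (cubic_deriv r x) = sextic r x"
  unfolding sextic_eq_cub[OF r] cub_def det_3 cubic_deriv_def vector_3 using r by Groebner_Basis.algebra

lemma euler_cubic: "cubic_deriv r x *v x = 3 *s cubic_map r x"
  unfolding vec3_eq_iff cubic_map_nth cubic_deriv_def matrix_vector_mult_def vec_lambda_beta sum_3 vector_3 vector_smult_component
  by (intro conjI; Groebner_Basis.algebra)

definition cub1 :: "complex \<Rightarrow> complex \<Rightarrow> complex \<Rightarrow> complex \<Rightarrow> complex"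
  where "cub1 r X Y Z = 3 * X\<^sup>2 - 6 * Y * Z + (5 * r - 2) * (Y\<^sup>2 + 2 * Z * X) + (3 - 5 * r) * (2 * X * Y + Z\<^sup>2)"

text \<open>
  After the translation by \<open>Z\<close> the equations are homogeneous in two variables \<open>s\<close> and \<open>t\<close>;
  eliminating \<open>s\<close> leaves \<open>32 t^2 = 0\<close>.
\<close>

lemma cub_singular:
  assumes r: "r * r = r + 1"
    and z: "cub1 r X Y Z = 0" "cub1 r Y Z X = 0" "cub1 r Z X Y = 0"
  shows "X = Z \<and> Y = Z"
proof -
  define s where "s = X - Z" define t where "t = Y - Z"
  have X: "X = s + Z" "Y = t + Z" by (simp_all add: s_def t_def)
  have q: "s\<^sup>2 - s * t + t\<^sup>2 = 0"
    using z unfolding X cub1_def by Groebner_Basis.algebra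
  have "s^3 + t^3 + (5 * r - 2) * s * t\<^sup>2 + (3 - 5 * r) * s\<^sup>2 * t = 0"
    using z q unfolding X cub1_def by Groebner_Basis.algebra
  then have "(t * t) * (s - (3 - 5 * r) * t) = 0" using q by Groebner_Basis.algebra
  then have "t = 0 \<or> s = (3 - 5 * r) * t" by auto
  then have "t = 0"
  proof
    assume "s = (3 - 5 * r) * t"
    then have "32 * (t * t) = 0" using q r by Groebner_Basis.algebra
    then show "t = 0" by simp
  qed auto
  then show ?thesis using q X by auto
qed

lemma cub_singular_edge:
  assumes r: "r * r = r + 1" and z: "cub1 r Y Z 0 = 0" "cub1 r Z 0 Y = 0" and n: "Y \<noteq> 0 \<or> Z \<noteq> 0"
  shows "Y = (r + 1) * Z"
proof -
  have z1: "3 * Y\<^sup>2 + (5 * r - 2) * Z\<^sup>2 + (3 - 5 * r) * (2 * Y * Z) = 0"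
    and z2: "3 * Z\<^sup>2 + (5 * r - 2) * (2 * Y * Z) + (3 - 5 * r) * Y\<^sup>2 = 0"
    using z by (simp_all add: cub1_def)
  have "(Y - (r+1) * Z) * (3 * Y + (9 - 7 * r) * Z) = 0" "(Y - (r+1) * Z) * ((3 - 5 * r) * Y - 3 * (2 - r) * Z) = 0"
    using z1 z2 r by Groebner_Basis.algebra+
  moreover have False if "3 * Y + (9 - 7 * r) * Z = 0" "(3 - 5 * r) * Y - 3 * (2 - r) * Z = 0"
  proof -
    have "40 * Z = 0" using that r by Groebner_Basis.algebra
    then show False using that n by auto
  qed
  ultimately show ?thesis by auto
qed

section \<open>Coordinates adapted to the four points\<close>

definition qpt :: "4 \<Rightarrow> complex^3"
  where "qpt i = (if i = 1 then vector [1, 1, 1] else if i = 2 then vector [1, -1, -1]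
    else if i = 3 then vector [-1, 1, -1] else vector [-1, -1, 1])"

lemma qpt_simps: "qpt 1 = vector [1, 1, 1]" "qpt 2 = vector [1, -1, -1]" "qpt 3 = vector [-1, 1, -1]" "qpt 4 = vector [-1, -1, 1]"
  by (simp_all add: qpt_def)

lemma qpt_square: "(qpt i $ j)\<^sup>2 = 1" 
proof -
  have "\<forall>i j. (qpt i $ j)\<^sup>2 = 1" unfolding forall_4 forall_3 qpt_simps vector_3 by simp
  then show ?thesis by blast
qed

lemma kap_zero_iff: "kap x = 0 \<longleftrightarrow> (\<exists>i a. x = a *s qpt i)"
proof
  assume "kap x = 0"
  then have "kap x $ 2 = 0" "kap x $ 3 = 0" by simp_all
  then have h: "(x$2)\<^sup>2 = (x$1)\<^sup>2" "(x$3)\<^sup>2 = (x$1)\<^sup>2" unfolding kap_def vector_3 by Groebner_Basis.algebra+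
  have "x$2 = x$1 \<or> x$2 = - x$1" "x$3 = x$1 \<or> x$3 = - x$1" using h by (simp_all add: power2_eq_iff)
  then have "x = x$1 *s qpt 1 \<or> x = x$1 *s qpt 2 \<or> x = x$2 *s qpt 3 \<or> x = x$3 *s qpt 4"
    unfolding vec3_eq_iff qpt_simps vector_smult_component vector_3 by (elim disjE; simp)
  then show "\<exists>i a. x = a *s qpt i" by blast
next
  assume "\<exists>i a. x = a *s qpt i"
  then show "kap x = 0" by (auto simp: kap_def vec3_eq_iff power_mult_distrib qpt_square)
qed

text \<open>
  The derivative of \<open>kap\<close>; at a centre it identifies the tangent directions with the line
  \<open>m1 + m2 + m3 = 0\<close>, that is with the exceptional curve.
\<close>

definition dkap :: "complex^3 \<Rightarrow> complex^3 \<Rightarrow> complex^3"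
  where "dkap x v = 2 *s vector [x$2 * v$2 - x$3 * v$3, x$3 * v$3 - x$1 * v$1, x$1 * v$1 - x$2 * v$2]"

lemma kap_add: "kap (x + t *s v) = kap x + t *s (dkap x v + t *s kap v)"
  by (simp add: kap_def dkap_def vec3_eq_iff power2_eq_square algebra_simps)

lemma lin_smult_right: "lin r x (a *s m) = a *s lin r x m"
  by (simp add: lin_def vec3_eq_iff algebra_simps)

lemma lin_smult_left: "lin r (a *s x) m = a *s lin r x m"
  by (simp add: lin_def vec3_eq_iff algebra_simps)

lemma kap_smult: "kap (a *s x) = a\<^sup>2 *s kap x"
  by (simp add: kap_def vec3_eq_iff algebra_simps power_mult_distrib)

lemma cubic_map_smult: "cubic_map r (a *s x) = a ^ 3 *s cubic_map r x"
  by (simp add: cubic_map_def kap_smult lin_smult_left lin_smult_right vector_smult_assoc power3_eq_cube power2_eq_square mult_ac)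

text \<open>
  The cubics vanish at the four centres; the quotient by the parameter of a line through a centre
  gives the exceptional curve.
\<close>

lemma cubic_map_at_centre:
  "cubic_map r (a *s qpt i + t *s v) = t *s lin r (a *s qpt i + t *s v) (dkap (a *s qpt i) v + t *s kap v)"
proof -
  have "kap (a *s qpt i) = 0" using kap_zero_iff by blast
  then show ?thesis unfolding cubic_map_def kap_add by (simp only: add_0 lin_smult_right)
qed

lemma dkap_sum: "dkap x v $ 1 + dkap x v $ 2 + dkap x v $ 3 = 0"
  by (simp add: dkap_def algebra_simps)

lemma incid_centre: "m$1 + m$2 + m$3 = 0 \<Longrightarrow> incid (a *s qpt i) m"
proof -
  assume "m$1 + m$2 + m$3 = 0"
  moreover have "m$1 * (a\<^sup>2) + m$2 * (a\<^sup>2) + m$3 * (a\<^sup>2) = (m$1 + m$2 + m$3) * a\<^sup>2" by (simp add: algebra_simps)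
  ultimately show ?thesis by (simp add: incid_def power_mult_distrib qpt_square)
qed

lemma dkap_zero_iff: "dkap (a *s qpt i) v = 0 \<longleftrightarrow> a = 0 \<or> (\<exists>c. v = c *s qpt i)"
proof -
  have q: "qpt i $ j * qpt i $ j = 1" for j using qpt_square[of i j] by (simp add: power2_eq_square)
  show ?thesis
  proof
    assume z: "dkap (a *s qpt i) v = 0"
    have "a = 0 \<or> v = (qpt i $ 1 * v$1) *s qpt i"
    proof (cases "a = 0")
      case False
      have "dkap (a *s qpt i) v $ 2 = 0" "dkap (a *s qpt i) v $ 3 = 0" using z by simp_all
      then have "2 * a * (qpt i $ 3 * v$3 - qpt i $ 1 * v$1) = 0" "2 * a * (qpt i $ 1 * v$1 - qpt i $ 2 * v$2) = 0"
        unfolding dkap_def vector_3 vector_smult_component by Groebner_Basis.algebra+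
      then have e: "qpt i $ 3 * v$3 = qpt i $ 1 * v$1" "qpt i $ 2 * v$2 = qpt i $ 1 * v$1" using False by simp_all
      have "v$1 = qpt i $ 1 * v$1 * qpt i $ 1" using q[of 1] by Groebner_Basis.algebra
      moreover have "v$2 = qpt i $ 1 * v$1 * qpt i $ 2" using q[of 2] e by Groebner_Basis.algebra
      moreover have "v$3 = qpt i $ 1 * v$1 * qpt i $ 3" using q[of 3] e by Groebner_Basis.algebra
      ultimately show ?thesis unfolding vec3_eq_iff vector_smult_component by blast
    qed simp
    then show "a = 0 \<or> (\<exists>c. v = c *s qpt i)" by blast
  next
    assume "a = 0 \<or> (\<exists>c. v = c *s qpt i)"
    moreover have "dkap (a *s qpt i) (c *s qpt i) = 0" for c
      unfolding dkap_def vec3_eq_iff vector_smult_component vector_3 zero_index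
      using q[of 1] q[of 2] q[of 3] by (intro conjI; Groebner_Basis.algebra)
    moreover have "dkap 0 v = 0" by (simp add: dkap_def vec3_eq_iff)
    ultimately show "dkap (a *s qpt i) v = 0" by auto
  qed
qed

lemma dkap_onto:
  assumes "m$1 + m$2 + m$3 = 0" and "a \<noteq> 0"
  shows "\<exists>v. dkap (a *s qpt i) v = m"
proof -
  have q: "qpt i $ j * qpt i $ j = 1" for j using qpt_square[of i j] by (simp add: power2_eq_square)
  have m3: "m$3 = - m$1 - m$2" using assms(1) by Groebner_Basis.algebra
  let ?v = "inverse (2 * a) *s vector [0, qpt i $ 2 * (m$1 + m$2), qpt i $ 3 * m$2] :: complex^3"
  have *: "a * qpt i $ j * (inverse (2 * a) * (qpt i $ j * z)) = z / 2" for j z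
    using q[of j] assms(2) by (simp add: field_simps) 
  have "dkap (a *s qpt i) ?v = m"
    unfolding dkap_def vec3_eq_iff vector_smult_component vector_3 * m3 by (simp add: field_simps)
  then show ?thesis ..
qed

lemma lin_zero:
  assumes r: "r * r = r + 1" and "incid x m" and "lin r x m = 0" and "lin (1 - r) x m = 0"
  shows "x = 0 \<or> m = 0"
proof -
  have "(2 * r - 1) * (x$i * m$j) = 0" for i j
  proof -
    have "rank_one_entry r 0 0 $ i $ j = 0"
    proof -
      have "\<forall>i j. rank_one_entry r 0 0 $ i $ j = 0" unfolding forall_3 by (simp add: rank_one_entry_def)
      then show ?thesis by blast
    qed
    then show ?thesis using rank_one_entry_lin[OF r assms(2), of i j] assms(3,4) by simp
  qed
  then have "\<forall>i j. x$i = 0 \<or> m$j = 0" using sqrt5_nonzero[OF r] by simp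
  then show ?thesis unfolding vec_eq_iff zero_index by blast
qed

definition block_quadric :: "complex \<Rightarrow> complex^3 \<Rightarrow> complex^3 \<Rightarrow> complex"
  where "block_quadric r u v = 4 * nsq v - nsq u"

lemma nsq_smult: "nsq (a *s u) = a\<^sup>2 * nsq u"
  by (simp add: nsq_def power_mult_distrib algebra_simps)

lemma block_quadric_smult: "block_quadric r (a *s u) (a *s v) = a\<^sup>2 * block_quadric r u v"
  by (simp add: block_quadric_def nsq_smult algebra_simps)

lemma sextic_block_quadric: "sextic r x = block_quadric r (cubic_map r x) (cubic_map (1 - r) x)"
  by (simp add: sextic_def block_quadric_def)

text \<open>
  \<open>L\<close> maps the four points of \<open>qpt\<close> to the given ones. The matrices \<open>U\<close>, \<open>V\<close> are the projections
  of \<open>complex^6\<close> to the two blocks of coordinates and \<open>U'\<close>, \<open>V'\<close> the inclusions of the blocks.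
\<close>

locale split_coords =
  fixes r :: complex and p :: "4 \<Rightarrow> complex^3" and b :: "complex^3 \<Rightarrow> complex^6"
    and L Li :: "complex^3^3" and lam :: "4 \<Rightarrow> complex"
    and U V :: "complex^6^3" and U' V' :: "complex^3^6"
  assumes r: "r * r = r + 1"
    and LLi: "L ** Li = mat 1" "Li ** L = mat 1"
    and lam: "lam i \<noteq> 0" and p_eq: "p i = lam i *s (L *v qpt i)"
    and UU': "U *v (U' *v a) = a" and UV': "U *v (V' *v a) = 0"
    and VU': "V *v (U' *v a) = 0" and VV': "V *v (V' *v a) = a"
    and decomp: "U' *v (U *v w) + V' *v (V *v w) = w"
    and bU: "U *v b (L *v x) = cubic_map r x" and bV: "V *v b (L *v x) = cubic_map (1 - r) x"
begin

definition pt :: "complex^3 \<Rightarrow> complex^3 \<Rightarrow> complex^6"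
  where "pt u v = U' *v u + V' *v v"

lemma U_pt: "U *v pt u v = u" and V_pt: "V *v pt u v = v"
  by (simp_all add: pt_def matrix_vector_right_distrib UU' UV' VU' VV')

lemma pt_UV: "pt (U *v w) (V *v w) = w"
  by (simp add: pt_def decomp)

lemma pt_smult: "pt (a *s u) (a *s v) = a *s pt u v"
  by (simp add: pt_def vector_scalar_commute vector_add_ldistrib)

lemma pt_eq_0_iff: "pt u v = 0 \<longleftrightarrow> u = 0 \<and> v = 0"
  by (metis U_pt V_pt pt_def matrix_vector_mult_0_right add_0)

lemma L_Li: "L *v (Li *v x) = x" and Li_L: "Li *v (L *v x) = x"
  by (simp_all add: matrix_vector_mul_assoc LLi)

lemma b_L: "b (L *v x) = pt (cubic_map r x) (cubic_map (1 - r) x)"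
  by (metis pt_UV bU bV)

lemma b_eq: "b x = pt (cubic_map r (Li *v x)) (cubic_map (1 - r) (Li *v x))"
  by (metis b_L L_Li)

lemma off_centres_L: "off_centres p (L *v x) \<longleftrightarrow> kap x \<noteq> 0"
proof -
  have "L *v x \<in> ppoint (p i) \<longleftrightarrow> (\<exists>a. x = a *s qpt i)" for i
  proof
    assume "L *v x \<in> ppoint (p i)"
    then obtain a where "L *v x = a *s (lam i *s (L *v qpt i))" unfolding mem_ppoint p_eq by blast
    then have "L *v x = L *v ((a * lam i) *s qpt i)" by (simp add: vector_scalar_commute vector_smult_assoc)
    then show "\<exists>a. x = a *s qpt i" by (metis Li_L)
  next
    assume "\<exists>a. x = a *s qpt i"
    then obtain a where "x = a *s qpt i" ..
    then have "L *v x = (a / lam i) *s p i"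
      using lam[of i] by (simp add: p_eq vector_scalar_commute vector_smult_assoc)
    then show "L *v x \<in> ppoint (p i)" unfolding mem_ppoint by blast
  qed
  then show ?thesis unfolding off_centres_def kap_zero_iff by blast
qed

lemma off_centres_iff: "off_centres p x \<longleftrightarrow> kap (Li *v x) \<noteq> 0"
  by (metis off_centres_L L_Li)

definition yy :: "complex^3 \<Rightarrow> complex^3 \<Rightarrow> complex^6"
  where "yy x m = pt (lin r x m) (lin (1 - r) x m)"

lemma yy_smult: "yy (a *s x) m = a *s yy x m" "yy x (a *s m) = a *s yy x m"
  by (simp_all add: yy_def lin_smult_left lin_smult_right pt_smult)

lemma b_yy: "b (L *v x) = yy x (kap x)"
  by (simp add: b_L yy_def cubic_map_def)

lemma yy_eq_0_iff: "incid x m \<Longrightarrow> yy x m = 0 \<longleftrightarrow> x = 0 \<or> m = 0"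
  unfolding yy_def pt_eq_0_iff using lin_zero[OF r, of x m]
  by (auto simp: lin_def vec3_eq_iff)

lemma p_line: "p i + t *s (L *v v) = L *v (lam i *s qpt i + t *s v)"
  by (simp add: p_eq matrix_vector_right_distrib vector_scalar_commute)

lemma b_near_centre:
  "b (p i + t *s (L *v v)) = t *s yy (lam i *s qpt i + t *s v) (dkap (lam i *s qpt i) v + t *s kap v)"
  unfolding p_line b_L cubic_map_at_centre pt_smult yy_def ..

lemma continuous_yy:
  assumes "\<And>i. continuous_on S (\<lambda>z. x z $ i)" "\<And>i. continuous_on S (\<lambda>z. m z $ i)"
  shows "continuous_on S (\<lambda>z. yy (x z) (m z) $ j)"
  unfolding yy_def pt_def lin_def matrix_vector_mult_def vector_add_component vec_lambda_beta sum_3 vector_3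
  by (intro continuous_on_add continuous_on_mult continuous_on_const assms)

lemma exc_point_L: "exc_point p b i (L *v v) = ppoint (yy (lam i *s qpt i) (dkap (lam i *s qpt i) v))"
proof -
  have "deriv (\<lambda>t. b (p i + t *s (L *v v)) $ j) 0 = yy (lam i *s qpt i) (dkap (lam i *s qpt i) v) $ j" for j
  proof (rule DERIV_imp_deriv)
    let ?g = "\<lambda>t. yy (lam i *s qpt i + t *s v) (dkap (lam i *s qpt i) v + t *s kap v) $ j"
    have "continuous_on UNIV ?g"
      by (rule continuous_yy) (simp_all add: continuous_on_add continuous_on_mult continuous_on_const continuous_on_id)
    then have "isCont ?g 0" by (simp add: continuous_on_eq_continuous_at)
    then show "((\<lambda>t. b (p i + t *s (L *v v)) $ j) has_field_derivative yy (lam i *s qpt i) (dkap (lam i *s qpt i) v) $ j) (at 0)"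
      unfolding CARAT_DERIV b_near_centre by (intro exI[of _ ?g]) simp
  qed
  then show ?thesis unfolding exc_point_def by (simp add: vec_lambda_eta)
qed

lemma not_in_centre: "L *v v \<notin> ppoint (p i) \<longleftrightarrow> dkap (lam i *s qpt i) v \<noteq> 0"
proof -
  have "L *v v \<in> ppoint (p i) \<longleftrightarrow> (\<exists>c. v = c *s qpt i)"
    unfolding mem_ppoint p_eq vector_smult_assoc
  proof safe
    fix a assume "L *v v = (a * lam i) *s (L *v qpt i)"
    then have "L *v v = L *v ((a * lam i) *s qpt i)" by (simp add: vector_scalar_commute)
    then show "\<exists>c. v = c *s qpt i" by (metis Li_L)
  next
    fix c show "\<exists>a. L *v (c *s qpt i) = (a * lam i) *s (L *v qpt i)"
      using lam[of i] by (intro exI[of _ "c / lam i"]) (simp add: vector_scalar_commute)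
  qed
  then show ?thesis unfolding dkap_zero_iff using lam[of i] by simp
qed

text \<open>
  Off the exceptional curves a point of the surface is a pair with a nonzero conic determined by
  the point; on the curve over a centre the conic is the free parameter. The quadrics describe
  both cases at once.
\<close>

lemma del_pezzo_eq: "del_pezzo p b = {ppoint w | w. w \<noteq> 0 \<and> quads r (U *v w) (V *v w)}"
proof (intro equalityI subsetI)
  fix s assume "s \<in> del_pezzo p b"
  then consider x where "off_centres p x" "s = ppoint (b x)" | i v where "v \<notin> ppoint (p i)" "s = exc_point p b i v"
    unfolding del_pezzo_def by blast
  then have "\<exists>x m. incid x m \<and> x \<noteq> 0 \<and> m \<noteq> 0 \<and> s = ppoint (yy x m)"
  proof cases
    case 1
    define y where "y = Li *v x"
    have "kap y \<noteq> 0" "s = ppoint (yy y (kap y))" using 1 b_yy[of y] by (simp_all add: off_centres_iff y_def L_Li)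
    moreover then have "y \<noteq> 0" by (auto simp: kap_def vec3_eq_iff)
    ultimately show ?thesis using incid_kap by blast
  next
    case 2
    define y where "y = Li *v v"
    let ?x = "lam i *s qpt i"
    have "dkap ?x y \<noteq> 0" "s = ppoint (yy ?x (dkap ?x y))"
      using 2 not_in_centre[of y i] exc_point_L[of i y] by (simp_all add: y_def L_Li)
    moreover then have "?x \<noteq> 0" by (auto simp: dkap_def vec3_eq_iff)
    ultimately show ?thesis using incid_centre[OF dkap_sum] by blast
  qed
  then obtain x m where x: "incid x m" "x \<noteq> 0" "m \<noteq> 0" "s = ppoint (yy x m)" by blast
  then have "yy x m \<noteq> 0" using yy_eq_0_iff by blast
  moreover have "quads r (U *v yy x m) (V *v yy x m)"
    using quads_lin[OF r x(1)] by (simp add: yy_def U_pt V_pt)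
  ultimately have "yy x m \<noteq> 0 \<and> quads r (U *v yy x m) (V *v yy x m)" ..
  then show "s \<in> {ppoint w | w. w \<noteq> 0 \<and> quads r (U *v w) (V *v w)}" using x(4) by blast
next
  fix s assume "s \<in> {ppoint w | w. w \<noteq> 0 \<and> quads r (U *v w) (V *v w)}"
  then obtain w where w: "w \<noteq> 0" "quads r (U *v w) (V *v w)" "s = ppoint w" by blast
  then obtain x m where x: "incid x m" "U *v w = lin r x m" "V *v w = lin (1 - r) x m"
    using quads_imp_incid[OF r w(2)] by blast
  have wy: "w = yy x m" unfolding yy_def x(2,3)[symmetric] pt_UV ..
  have nz: "x \<noteq> 0" "m \<noteq> 0" using w(1) wy yy_eq_0_iff[OF x(1)] by auto
  show "s \<in> del_pezzo p b"
  proof (cases "kap x = 0")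
    case False
    obtain j where j: "m$j \<noteq> 0" using nz(2) by (auto simp: vec_eq_iff)
    have "lin q (m$j *s x) (kap (m$j *s x)) = kap (m$j *s x) $ j *s lin q x m" for q
      by (rule lin_kap_scaled[OF x(1)])
    then have e: "yy (m$j *s x) (kap (m$j *s x)) = kap (m$j *s x) $ j *s w"
      unfolding wy yy_def by (simp add: pt_smult)
    have k: "kap (m$j *s x) \<noteq> 0" using False j by (simp add: kap_smult)
    moreover have "m$j *s x \<noteq> 0" using j nz by simp
    ultimately have "yy (m$j *s x) (kap (m$j *s x)) \<noteq> 0" using yy_eq_0_iff[OF incid_kap] by blast
    then have "kap (m$j *s x) $ j \<noteq> 0" using e by auto
    then have "s = ppoint (b (L *v (m$j *s x)))" unfolding b_yy e w(3) by (simp add: ppoint_scale)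
    then show ?thesis using k unfolding del_pezzo_def by (auto simp: off_centres_L)
  next
    case True
    then obtain i a where a: "x = a *s qpt i" unfolding kap_zero_iff by blast
    then have a0: "a \<noteq> 0" using nz(1) by auto
    obtain v where v: "dkap (lam i *s qpt i) v = m" using dkap_onto[OF _ lam] x(1) unfolding incid_def by blast
    have "x = (a / lam i) *s (lam i *s qpt i)" using lam[of i] by (simp add: a vector_smult_assoc)
    then have "w = (a / lam i) *s yy (lam i *s qpt i) m" unfolding wy by (metis yy_smult(1))
    then have "s = exc_point p b i (L *v v)" using a0 lam[of i] unfolding w(3) exc_point_L v by (simp add: ppoint_scale)
    moreover have "L *v v \<notin> ppoint (p i)" unfolding not_in_centre v by (rule nz(2))
    ultimately show ?thesis unfolding del_pezzo_def by blast
  qed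
qed

lemma del_pezzo_ppoint: "w \<noteq> 0 \<Longrightarrow> ppoint w \<in> del_pezzo p b \<longleftrightarrow> quads r (U *v w) (V *v w)"
proof -
  have "quads r (U *v (a *s w)) (V *v (a *s w))" if q: "quads r (U *v w) (V *v w)" for a w
  proof -
    obtain x m where x: "incid x m" "U *v w = lin r x m" "V *v w = lin (1 - r) x m"
      using quads_imp_incid[OF r q] by blast
    have "incid (a *s x) m" using x(1)
      by (simp add: incid_def power_mult_distrib mult.left_commute[of _ "a\<^sup>2"] flip: distrib_left)
    then show ?thesis using quads_lin[OF r, of "a *s x" m] by (simp add: x vector_scalar_commute lin_smult_left)
  qed
  moreover assume "w \<noteq> 0"
  ultimately have "ppoint w \<in> del_pezzo p b \<Longrightarrow> quads r (U *v w) (V *v w)"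
    unfolding del_pezzo_eq by (auto simp: ppoint_eq_iff)
  then show ?thesis using \<open>w \<noteq> 0\<close> unfolding del_pezzo_eq by blast
qed

lemma yy_in_del_pezzo: "incid x m \<Longrightarrow> x \<noteq> 0 \<Longrightarrow> m \<noteq> 0 \<Longrightarrow> ppoint (yy x m) \<in> del_pezzo p b"
  unfolding del_pezzo_eq using quads_lin[OF r] yy_eq_0_iff by (auto simp: yy_def U_pt V_pt)

end

section \<open>The ramification curve and its singular points\<close>

context split_coords
begin

lemma block_quadric_lin_smult:
  "block_quadric r (lin r (a *s x) m) (lin (1 - r) (a *s x) m) = a\<^sup>2 * block_quadric r (lin r x m) (lin (1 - r) x m)"
  "block_quadric r (lin r x (a *s m)) (lin (1 - r) x (a *s m)) = a\<^sup>2 * block_quadric r (lin r x m) (lin (1 - r) x m)"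
  by (simp_all add: lin_smult_left lin_smult_right block_quadric_smult)

text \<open>
  The equation of the ramification curve as a function of the pair; it is of degree two in each
  argument, so it makes sense on the exceptional curves as well.
\<close>

definition ramification_form :: "complex^3 \<Rightarrow> complex^3 \<Rightarrow> complex"
  where "ramification_form x m = block_quadric r (lin r x m) (lin (1 - r) x m)"

lemma ramification_form_kap: "sextic r x = ramification_form x (kap x)"
  by (simp add: sextic_block_quadric ramification_form_def cubic_map_def)

lemma ramification_form_smult: "ramification_form (a *s x) m = a\<^sup>2 * ramification_form x m" "ramification_form x (a *s m) = a\<^sup>2 * ramification_form x m"
  by (simp_all add: ramification_form_def block_quadric_lin_smult)

lemma continuous_ramification_form:
  assumes "\<And>i. continuous_on S (\<lambda>z. x z $ i)" "\<And>i. continuous_on S (\<lambda>z. m z $ i)"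
  shows "continuous_on S (\<lambda>z. ramification_form (x z) (m z))"
  unfolding ramification_form_def block_quadric_def nsq_def lin_def vector_3
  by (intro continuous_on_add continuous_on_diff continuous_on_mult continuous_on_power continuous_on_const assms)

lemma ramification_form_centre:
  "m$1 + m$2 + m$3 = 0 \<Longrightarrow> ramification_form (a *s qpt i) m = 6 * a\<^sup>2 * nsq m"
proof -
  assume m: "m$1 + m$2 + m$3 = 0"
  have "ramification_form (qpt i) m = 6 * nsq m"
    unfolding ramification_form_def block_quadric_def nsq_def lin_def vector_3 power_mult_distrib qpt_square
    using r m by Groebner_Basis.algebra
  then show ?thesis by (simp add: ramification_form_smult)
qed

lemma dkap_add: "dkap x (v + u *s w) = dkap x v + u *s dkap x w"
  by (simp add: dkap_def vec3_eq_iff algebra_simps)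

lemma same_ramification_form:
  assumes "ppoint (yy x m) = ppoint (yy x' m')" "yy x m \<noteq> 0" 
  shows "ramification_form x m = 0 \<longleftrightarrow> ramification_form x' m' = 0"
proof -
  obtain a where a: "a \<noteq> 0" "yy x m = a *s yy x' m'" using assms ppoint_eq_iff by blast
  have "ramification_form x m = block_quadric r (U *v yy x m) (V *v yy x m)" for x m
    by (simp add: ramification_form_def yy_def U_pt V_pt)
  then have "ramification_form x m = a\<^sup>2 * ramification_form x' m'" unfolding a(2) by (simp add: vector_scalar_commute block_quadric_smult a(2))
  then show ?thesis using a(1) by simp
qed

lemma yy_kap_same:
  assumes "incid x m" "m \<noteq> 0" "kap x \<noteq> 0"
  shows "ppoint (yy x m) = ppoint (yy x (kap x))"
proof -
  have "\<exists>c. m = c *s kap x"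
    using assms(1) by (intro cross_zero[OF assms(3)]; unfold incid_def kap_def vector_3; Groebner_Basis.algebra)
  then obtain c where c: "m = c *s kap x" ..
  then have "c \<noteq> 0" using assms(2) by auto
  then show ?thesis unfolding c yy_smult by (rule ppoint_scale)
qed

text \<open>
  The points of the plane under the six nodes of the curve.
\<close>

definition node_vectors :: "(complex^3) set"
  where "node_vectors = (\<Union>e\<in>{r, -r}. {vector [0, e, 1], vector [1, 0, e], vector [e, 1, 0]})"

lemma edge_node:
  assumes "y\<^sup>2 = (r + 1) * z\<^sup>2" 
  shows "\<exists>e\<in>{r, -r}. y = e * z"
proof -
  have "(y - r * z) * (y + r * z) = 0" using assms r by Groebner_Basis.algebra
  then show ?thesis by (auto simp: eq_neg_iff_add_eq_0)
qed

definition nodes :: "(complex^6) set set"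
  where "nodes = (\<lambda>n. ppoint (yy n (kap n))) ` node_vectors"

lemma node_kap: "n \<in> node_vectors \<Longrightarrow> kap n \<noteq> 0"
proof
  assume n: "n \<in> node_vectors" and "kap n = 0"
  then obtain i a where a: "n = a *s qpt i" unfolding kap_zero_iff by blast
  have "(n$1)\<^sup>2 = a\<^sup>2" "(n$2)\<^sup>2 = a\<^sup>2" "(n$3)\<^sup>2 = a\<^sup>2" unfolding a by (simp_all add: power_mult_distrib qpt_square)
  moreover have "n$1 = 0 \<or> n$2 = 0 \<or> n$3 = 0" using n unfolding node_vectors_def by auto
  ultimately have "a = 0" by auto
  then have "n = 0" unfolding a by simp
  then show False using n unfolding node_vectors_def by (auto simp: vec3_eq_iff)
qed

end

lemma det_vector_zero:
  fixes x v w :: "complex^3"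
  assumes "det (vector [x, v, w] :: complex^3^3) \<noteq> 0"
  shows "x \<noteq> 0" "v \<noteq> 0" "w \<noteq> 0" "\<And>a. v \<noteq> a *s x"
  using assms by (auto simp: det_3 algebra_simps)

lemma det_matrix_rows:
  fixes M :: "complex^3^3"
  shows "det (vector [M *v x, M *v v, M *v w] :: complex^3^3) = det M * det (vector [x, v, w] :: complex^3^3)"
proof -
  have "(vector [M *v x, M *v v, M *v w] :: complex^3^3) = (vector [x, v, w] :: complex^3^3) ** transpose M"
    by (simp add: vec_eq_iff forall_3 matrix_matrix_mult_def matrix_vector_mult_def transpose_def sum_3 algebra_simps)
  then show ?thesis by (simp add: det_mul)
qed

lemma kernel_zero_basis:
  fixes x v w g :: "complex^3"
  assumes d: "det (vector [x, v, w] :: complex^3^3) \<noteq> 0"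
    and "g$1 * x$1 + g$2 * x$2 + g$3 * x$3 = 0" "g$1 * v$1 + g$2 * v$2 + g$3 * v$3 = 0" "g$1 * w$1 + g$2 * w$2 + g$3 * w$3 = 0"
  shows "g = 0"
proof -
  have "(vector [x, v, w] :: complex^3^3) *v g = 0"
    using assms(2-4) by (simp add: vec3_eq_iff matrix_vector_mult_def sum_3 mult.commute)
  moreover have "invertible (vector [x, v, w] :: complex^3^3)" using d by (simp add: invertible_det_nz)
  ultimately show ?thesis by (metis invertible_def matrix_left_invertible_ker)
qed

text \<open>
  The section \<open>f\<close> stands for the ramification section, which is a multiple of the sextic.
\<close>

locale ramification_coords = split_coords +
  fixes f :: "complex^3 \<Rightarrow> complex" and \<kappa> :: complex
  assumes kappa: "\<kappa> \<noteq> 0" and f_L: "f (L *v x) = \<kappa> * sextic r x"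
begin

lemma detL: "det L \<noteq> 0"
  using LLi by (metis invertible_def invertible_det_nz)

lemma f_eq: "f x = \<kappa> * sextic r (Li *v x)"
  by (metis f_L L_Li)

lemma continuous_chart:
  "continuous_on UNIV (\<lambda>(t, u). \<kappa> * ramification_form (x + t *s (v + u *s w)) (dkap x (v + u *s w) + t *s kap (v + u *s w)))"
proof -
  have 1: "continuous_on UNIV (\<lambda>z :: complex \<times> complex. (v + snd z *s w) $ i)" for i
    by (simp, intro continuous_intros)
  have 2: "continuous_on UNIV (\<lambda>z :: complex \<times> complex. dkap x (v + snd z *s w) $ i)"
    "continuous_on UNIV (\<lambda>z :: complex \<times> complex. kap (v + snd z *s w) $ i)" for i
  proof -
    have "\<forall>i. continuous_on UNIV (\<lambda>z :: complex \<times> complex. dkap x (v + snd z *s w) $ i)"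
      "\<forall>i. continuous_on UNIV (\<lambda>z :: complex \<times> complex. kap (v + snd z *s w) $ i)"
      unfolding forall_3 dkap_def kap_def vector_smult_component vector_3
      by (intro conjI continuous_on_mult continuous_on_diff continuous_on_power continuous_on_const 1)+
    then show "continuous_on UNIV (\<lambda>z :: complex \<times> complex. dkap x (v + snd z *s w) $ i)"
      "continuous_on UNIV (\<lambda>z :: complex \<times> complex. kap (v + snd z *s w) $ i)" by blast+
  qed
  show ?thesis unfolding case_prod_beta
    by (intro continuous_on_mult continuous_on_const continuous_ramification_form;
        unfold vector_add_component[of "dkap _ _"] vector_add_component[of x] vector_smult_component[of "fst _"];
        intro continuous_on_add continuous_on_mult continuous_on_const continuous_on_fst continuous_on_id 1 2)
qed

text \<open>
  All local equations are computable. On an exceptional curve the equation is determined off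
  \<open>t = 0\<close> by division, and on \<open>t = 0\<close> by continuity.
\<close>

lemma local_equation_cases:
  assumes "local_equation p b 2 f s h"
  obtains (off) x v w where "kap x \<noteq> 0" "s = ppoint (yy x (kap x))" "det (vector [x, v, w] :: complex^3^3) \<noteq> 0"
      "\<And>t u. h (t, u) = \<kappa> * sextic r (x + t *s v + u *s w)"
  | (exc) i v w where "s = ppoint (yy (lam i *s qpt i) (dkap (lam i *s qpt i) v))"
      "det (vector [qpt i, v, w] :: complex^3^3) \<noteq> 0"
      "\<And>t u. h (t, u) = \<kappa> * ramification_form (lam i *s qpt i + t *s (v + u *s w)) (dkap (lam i *s qpt i) (v + u *s w) + t *s kap (v + u *s w))"
  using assms unfolding local_equation_def
proof (elim disjE exE conjE)
  fix x v w assume *: "off_centres p x" "s = ppoint (b x)" "det (vector [x, v, w] :: complex^3^3) \<noteq> 0"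
    "\<forall>t u. h (t, u) = f (x + t *s v + u *s w)"
  have "det (vector [Li *v x, Li *v v, Li *v w] :: complex^3^3) \<noteq> 0"
    using *(3) det_matrix_rows[of L "Li *v x" "Li *v v" "Li *v w"] by (auto simp: L_Li)
  moreover have "s = ppoint (yy (Li *v x) (kap (Li *v x)))" using *(2) b_yy[of "Li *v x"] by (simp add: L_Li)
  ultimately show ?thesis using *(1,4)
    by (intro off[of "Li *v x" "Li *v v" "Li *v w"])
      (simp_all add: off_centres_iff f_eq matrix_vector_right_distrib vector_scalar_commute)
next
  fix i v w
  assume *: "s = exc_point p b i v" "det (vector [p i, v, w] :: complex^3^3) \<noteq> 0"
    "continuous_on UNIV h" "\<forall>t u. f (p i + t *s (v + u *s w)) = t\<^sup>2 * h (t, u)"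
  let ?v = "Li *v v" and ?w = "Li *v w" and ?x = "lam i *s qpt i"
  define g where "g = (\<lambda>(t, u). \<kappa> * ramification_form (?x + t *s (?v + u *s ?w)) (dkap ?x (?v + u *s ?w) + t *s kap (?v + u *s ?w)))"
  have "p i = L *v ?x" by (simp add: p_eq vector_scalar_commute)
  then have "det (vector [p i, v, w] :: complex^3^3) = det (vector [L *v ?x, L *v ?v, L *v ?w] :: complex^3^3)"
    by (simp add: L_Li)
  also have "\<dots> = det L * (lam i * det (vector [qpt i, ?v, ?w] :: complex^3^3))"
    unfolding det_matrix_rows by (simp add: det_3 algebra_simps)
  finally have d: "det (vector [qpt i, ?v, ?w] :: complex^3^3) \<noteq> 0" using *(2) by auto
  have s: "s = ppoint (yy ?x (dkap ?x ?v))" using exc_point_L[of i ?v] *(1) by (simp add: L_Li)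
  have gt: "t\<^sup>2 * g (t, u) = t\<^sup>2 * h (t, u)" for t u
  proof -
    have "t\<^sup>2 * h (t, u) = f (p i + t *s (L *v (?v + u *s ?w)))"
      using *(4) by (simp add: matrix_vector_right_distrib vector_scalar_commute L_Li)
    also have "\<dots> = \<kappa> * sextic r (?x + t *s (?v + u *s ?w))" unfolding p_line f_L ..
    also have "\<dots> = \<kappa> * (t\<^sup>2 * ramification_form (?x + t *s (?v + u *s ?w)) (dkap ?x (?v + u *s ?w) + t *s kap (?v + u *s ?w)))"
      unfolding sextic_block_quadric cubic_map_at_centre ramification_form_def block_quadric_smult ..
    finally show ?thesis unfolding g_def prod.case mult.left_commute[of "t\<^sup>2" \<kappa>] by (rule sym)
  qed
  have gc: "continuous_on UNIV g"
    unfolding g_def by (rule continuous_chart)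
  have "h (t, u) = g (t, u)" for t u
  proof -
    have c: "continuous_on UNIV (\<lambda>t. h (t, u) - g (t, u))"
      by (intro continuous_on_diff continuous_on_compose2[OF *(3)] continuous_on_compose2[OF gc] continuous_intros) auto
    have "h (t, u) - g (t, u) = 0"
    proof (rule continuous_constant_on_closure[of "UNIV - {0}" "\<lambda>t. h (t, u) - g (t, u)" 0 t])
      show "continuous_on (closure (UNIV - {0})) (\<lambda>t. h (t, u) - g (t, u))" using c continuous_on_subset by blast
      show "t \<in> closure (UNIV - {0})" by (simp add: closure_complement flip: Compl_eq_Diff_UNIV)
      show "h (t, u) - g (t, u) = 0" if "t \<in> UNIV - {0}" for t using gt[of t u] that by simp
    qed
    then show ?thesis by simp
  qed
  then show ?thesis using exc[OF s d] by (simp add: g_def)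
qed

lemma chart_off:
  assumes "kap x \<noteq> 0" and "det (vector [x, v, w] :: complex^3^3) \<noteq> 0"
  shows "local_equation p b 2 f (ppoint (yy x (kap x))) (\<lambda>(t, u). \<kappa> * sextic r (x + t *s v + u *s w))"
  unfolding local_equation_def
  by (rule disjI1, rule exI[of _ "L *v x"], rule exI[of _ "L *v v"], rule exI[of _ "L *v w"])
    (use assms detL in \<open>simp add: off_centres_L b_yy det_matrix_rows f_eq matrix_vector_right_distrib vector_scalar_commute Li_L\<close>)


lemma complete_basis:
  fixes x v :: "complex^3"
  assumes "x \<noteq> 0" and "\<And>c. v \<noteq> c *s x"
  shows "\<exists>w. det (vector [x, v, w] :: complex^3^3) \<noteq> 0"
proof (rule ccontr)
  assume "\<nexists>w. det (vector [x, v, w] :: complex^3^3) \<noteq> 0"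
  then have d: "det (vector [x, v, w] :: complex^3^3) = 0" for w by blast
  have "\<exists>c. v = c *s x"
    using d[of "axis 1 1"] d[of "axis 2 1"] d[of "axis 3 1"]
    by (intro cross_zero[OF assms(1)]) (simp_all add: det_3 axis_def algebra_simps)
  then show False using assms(2) by blast
qed

lemma chart_exc:
  assumes "det (vector [qpt i, v, w] :: complex^3^3) \<noteq> 0"
  shows "local_equation p b 2 f (ppoint (yy (lam i *s qpt i) (dkap (lam i *s qpt i) v)))
    (\<lambda>(t, u). \<kappa> * ramification_form (lam i *s qpt i + t *s (v + u *s w)) (dkap (lam i *s qpt i) (v + u *s w) + t *s kap (v + u *s w)))"
proof -
  let ?x = "lam i *s qpt i"
  let ?g = "\<lambda>(t, u). \<kappa> * ramification_form (?x + t *s (v + u *s w)) (dkap ?x (v + u *s w) + t *s kap (v + u *s w))"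
  have "p i = L *v ?x" by (simp add: p_eq vector_scalar_commute)
  then have "det (vector [p i, L *v v, L *v w] :: complex^3^3) = det L * (lam i * det (vector [qpt i, v, w] :: complex^3^3))"
    by (simp add: det_matrix_rows) (simp add: det_3 algebra_simps)
  then have "det (vector [p i, L *v v, L *v w] :: complex^3^3) \<noteq> 0" using assms detL lam by simp
  moreover have "f (p i + t *s (L *v v + u *s (L *v w))) = t\<^sup>2 * ?g (t, u)" for t u
  proof -
    have "p i + t *s (L *v v + u *s (L *v w)) = p i + t *s (L *v (v + u *s w))"
      by (simp add: matrix_vector_right_distrib vector_scalar_commute)
    then have "f (p i + t *s (L *v v + u *s (L *v w))) = \<kappa> * sextic r (?x + t *s (v + u *s w))"
      unfolding p_line using f_L by simp
    also have "\<dots> = \<kappa> * (t\<^sup>2 * ramification_form (?x + t *s (v + u *s w)) (dkap ?x (v + u *s w) + t *s kap (v + u *s w)))"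
      unfolding sextic_block_quadric cubic_map_at_centre ramification_form_def block_quadric_smult ..
    finally show ?thesis by simp
  qed
  moreover have "continuous_on UNIV ?g" by (rule continuous_chart)
  moreover have "ppoint (yy ?x (dkap ?x v)) = exc_point p b i (L *v v)" by (rule exc_point_L[symmetric])
  ultimately show ?thesis unfolding local_equation_def by blast
qed

lemma chart_exists:
  assumes "incid x m" "x \<noteq> 0" "m \<noteq> 0"
  shows "\<exists>h. local_equation p b 2 f (ppoint (yy x m)) h \<and> (h 0 = 0 \<longleftrightarrow> ramification_form x m = 0)"
proof (cases "kap x = 0")
  case False
  have "\<exists>v. \<forall>c. v \<noteq> c *s x"
  proof (rule ccontr)
    assume "\<nexists>v. \<forall>c. v \<noteq> c *s x"
    then obtain c d where "axis 1 1 = c *s x" "axis 2 1 = d *s x" by metis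
    then have "c * x$1 = 1" "c * x$2 = 0" "d * x$1 = 0" "d * x$2 = 1"
      by (auto simp: vec3_eq_iff axis_def)
    then show False by auto
  qed
  then obtain v w where vw: "det (vector [x, v, w] :: complex^3^3) \<noteq> 0" using complete_basis[OF assms(2)] by metis
  have s: "ppoint (yy x m) = ppoint (yy x (kap x))" by (rule yy_kap_same[OF assms(1,3) False])
  have "yy x m \<noteq> 0" using yy_eq_0_iff[OF assms(1)] assms by blast
  then have "ramification_form x m = 0 \<longleftrightarrow> ramification_form x (kap x) = 0" using same_ramification_form[OF s] by blast
  moreover define h where "h = (\<lambda>(t, u). \<kappa> * sextic r (x + t *s v + u *s w))"
  moreover have "h 0 = \<kappa> * ramification_form x (kap x)" by (simp add: h_def zero_prod_def ramification_form_kap)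
  ultimately have "h 0 = 0 \<longleftrightarrow> ramification_form x m = 0" using kappa by simp
  then show ?thesis unfolding s using chart_off[OF False vw, folded h_def] by blast
next
  case True
  then obtain i a where a: "x = a *s qpt i" unfolding kap_zero_iff by blast
  obtain v where v: "dkap (lam i *s qpt i) v = m" using dkap_onto[OF _ lam] assms(1) unfolding incid_def by blast
  have "v \<noteq> c *s qpt i" for c using v assms(3) dkap_zero_iff[of "lam i" i v] by blast
  moreover have "qpt i \<noteq> 0" using a assms(2) by auto
  ultimately obtain w where w: "det (vector [qpt i, v, w] :: complex^3^3) \<noteq> 0" using complete_basis by blast
  have a0: "a \<noteq> 0" using a assms(2) by auto
  have e: "x = (a / lam i) *s (lam i *s qpt i)" using lam[of i] by (simp add: a)
  then have s: "ppoint (yy x m) = ppoint (yy (lam i *s qpt i) m)"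
    using a0 lam[of i] by (metis yy_smult(1) ppoint_scale divide_eq_0_iff)
  have "yy x m \<noteq> 0" using yy_eq_0_iff[OF assms(1)] assms by blast
  then have "ramification_form x m = 0 \<longleftrightarrow> ramification_form (lam i *s qpt i) m = 0" using same_ramification_form[OF s] by blast
  moreover define h where "h = (\<lambda>(t, u). \<kappa> * ramification_form (lam i *s qpt i + t *s (v + u *s w)) (dkap (lam i *s qpt i) (v + u *s w) + t *s kap (v + u *s w)))"
  moreover have "h 0 = \<kappa> * ramification_form (lam i *s qpt i) m" by (simp add: h_def zero_prod_def v)
  ultimately have "h 0 = 0 \<longleftrightarrow> ramification_form x m = 0" using kappa by simp
  then show ?thesis unfolding s using chart_exc[OF w, folded h_def, unfolded v] by blast
qed

lemma local_equation_zero: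
  assumes "local_equation p b 2 f s h" "h 0 = 0"
  shows "\<exists>x m. incid x m \<and> x \<noteq> 0 \<and> m \<noteq> 0 \<and> s = ppoint (yy x m) \<and> ramification_form x m = 0"
  using assms(1)
proof (cases rule: local_equation_cases)
  case (off x v w)
  have "sextic r x = 0" using off(4)[of 0 0] assms(2) kappa by (simp add: zero_prod_def)
  then show ?thesis using off incid_kap det_vector_zero(1)[OF off(3)] ramification_form_kap by metis
next
  case (exc i v w)
  have "ramification_form (lam i *s qpt i) (dkap (lam i *s qpt i) v) = 0" using exc(3)[of 0 0] assms(2) kappa by (simp add: zero_prod_def)
  moreover have "lam i *s qpt i \<noteq> 0" using det_vector_zero(1)[OF exc(2)] lam[of i] by simp
  moreover have "dkap (lam i *s qpt i) v \<noteq> 0" unfolding dkap_zero_iff using det_vector_zero(4)[OF exc(2)] lam[of i] by auto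
  ultimately show ?thesis using exc(1) incid_centre[OF dkap_sum] by metis
qed

text \<open>
  The zeros of the local equations are the zeros of the quadric, in the plane as well as on the
  exceptional curves.
\<close>

lemma divisor_support_eq:
  "divisor_support p b 2 f = {ppoint (yy x m) | x m. incid x m \<and> x \<noteq> 0 \<and> m \<noteq> 0 \<and> ramification_form x m = 0}"
proof (intro equalityI subsetI)
  fix s assume "s \<in> divisor_support p b 2 f"
  then obtain h where "local_equation p b 2 f s h" "h 0 = 0" unfolding divisor_support_def by blast
  from local_equation_zero[OF this]
  show "s \<in> {ppoint (yy x m) | x m. incid x m \<and> x \<noteq> 0 \<and> m \<noteq> 0 \<and> ramification_form x m = 0}" by blast
next
  fix s assume "s \<in> {ppoint (yy x m) | x m. incid x m \<and> x \<noteq> 0 \<and> m \<noteq> 0 \<and> ramification_form x m = 0}"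
  then obtain x m where x: "incid x m" "x \<noteq> 0" "m \<noteq> 0" "ramification_form x m = 0" "s = ppoint (yy x m)" by blast
  then show "s \<in> divisor_support p b 2 f"
    unfolding divisor_support_def using chart_exists[OF x(1-3)] yy_in_del_pezzo[OF x(1-3)] by auto
qed

definition grad :: "complex^3 \<Rightarrow> complex^3"
  where "grad x = vector [6 * x$1 * cub1 r ((x$1)\<^sup>2) ((x$2)\<^sup>2) ((x$3)\<^sup>2), 6 * x$2 * cub1 r ((x$2)\<^sup>2) ((x$3)\<^sup>2) ((x$1)\<^sup>2),
    6 * x$3 * cub1 r ((x$3)\<^sup>2) ((x$1)\<^sup>2) ((x$2)\<^sup>2)]"

definition pair :: "complex^3 \<Rightarrow> complex^3 \<Rightarrow> complex"
  where "pair g x = g$1 * x$1 + g$2 * x$2 + g$3 * x$3"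

lemma sextic_has_derivative: "(sextic r has_derivative (\<lambda>v. pair (grad x) v)) (at x)"
proof -
  have "((\<lambda>x. 3 * cub r ((x$1)\<^sup>2) ((x$2)\<^sup>2) ((x$3)\<^sup>2)) has_derivative (\<lambda>v. pair (grad x) v)) (at x)"
    unfolding cub_def
    by ((rule derivative_eq_intros | rule refl)+) 
      (simp add: fun_eq_iff pair_def grad_def cub1_def power2_eq_square power3_eq_cube algebra_simps)
  then show ?thesis using sextic_eq_cub[OF r] by (metis (no_types, lifting) ext)
qed

lemma euler_sextic: "pair (grad x) x = 6 * sextic r x"
  unfolding sextic_eq_cub[OF r] pair_def grad_def vector_3 cub1_def cub_def by Groebner_Basis.algebra

text \<open>
  If no coordinate of a singular point vanishes, all the squares agree and the point is a centre.
  If one coordinate vanishes, the squares of the two others have the ratio \<open>r + 1\<close>, which is the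
  square of \<open>r\<close>.
\<close>

lemma grad_zero_node:
  assumes g: "grad x = 0" and k: "kap x \<noteq> 0"
  shows "\<exists>n\<in>node_vectors. \<exists>c. c \<noteq> 0 \<and> x = c *s n"
proof -
  let ?X = "(x$1)\<^sup>2" and ?Y = "(x$2)\<^sup>2" and ?Z = "(x$3)\<^sup>2"
  have z: "x$1 = 0 \<or> cub1 r ?X ?Y ?Z = 0" "x$2 = 0 \<or> cub1 r ?Y ?Z ?X = 0" "x$3 = 0 \<or> cub1 r ?Z ?X ?Y = 0"
    using g unfolding grad_def vec3_eq_iff vector_3 by simp_all
  have x0: "\<not> (x$1 = 0 \<and> x$2 = 0 \<and> x$3 = 0)" using k by (auto simp: kap_def vec3_eq_iff)
  have alone: "cub1 r (y\<^sup>2) 0 0 = 0 \<longleftrightarrow> y = 0" for y by (simp add: cub1_def)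
  have node: "x = c *s n \<Longrightarrow> n \<in> node_vectors \<Longrightarrow> ?thesis" for c n
    using x0 by (intro bexI exI[of _ c] conjI) auto
  have mem: "vector [0, e, 1] \<in> node_vectors" "vector [1, 0, e] \<in> node_vectors" "vector [e, 1, 0] \<in> node_vectors" if "e \<in> {r, -r}" for e
    using that unfolding node_vectors_def by blast+
  consider (all) "x$1 \<noteq> 0" "x$2 \<noteq> 0" "x$3 \<noteq> 0" | (1) "x$1 = 0" | (2) "x$2 = 0" | (3) "x$3 = 0" by blast
  then show ?thesis
  proof cases
    case all
    then have "?X = ?Z \<and> ?Y = ?Z" using cub_singular[OF r] z by blast
    then have "kap x = 0" by (simp add: kap_def vec3_eq_iff)
    then show ?thesis using k by blast
  next
    case 1
    have "x$2 \<noteq> 0" "x$3 \<noteq> 0" using z x0 1 by (auto simp: alone)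
    then have "?Y = (r + 1) * ?Z" using cub_singular_edge[OF r, of ?Y ?Z] z 1 by auto
    then obtain e where e: "e \<in> {r, -r}" "x$2 = e * x$3" using edge_node by blast
    then have "x = x$3 *s vector [0, e, 1]" using 1 unfolding vec3_eq_iff by simp
    then show ?thesis using node mem(1)[OF e(1)] by blast
  next
    case 2
    have "x$1 \<noteq> 0" "x$3 \<noteq> 0" using z x0 2 by (auto simp: alone)
    then have "?Z = (r + 1) * ?X" using cub_singular_edge[OF r, of ?Z ?X] z 2 by auto
    then obtain e where e: "e \<in> {r, -r}" "x$3 = e * x$1" using edge_node by blast
    then have "x = x$1 *s vector [1, 0, e]" using 2 unfolding vec3_eq_iff by simp
    then show ?thesis using node mem(2)[OF e(1)] by blast
  next
    case 3
    have "x$1 \<noteq> 0" "x$2 \<noteq> 0" using z x0 3 by (auto simp: alone)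
    then have "?X = (r + 1) * ?Y" using cub_singular_edge[OF r, of ?X ?Y] z 3 by auto
    then obtain e where e: "e \<in> {r, -r}" "x$1 = e * x$2" using edge_node by blast
    then have "x = x$2 *s vector [e, 1, 0]" using 3 unfolding vec3_eq_iff by simp
    then show ?thesis using node mem(3)[OF e(1)] by blast
  qed
qed

text \<open>
  On an exceptional curve the equation is a multiple of \<open>m1^2 + m2^2 + m3^2\<close> on the line
  \<open>m1 + m2 + m3 = 0\<close>, which has no double zero; so all singular points lie off the exceptional
  curves.
\<close>

lemma singular_subset: "singular_points p b 2 f \<subseteq> nodes"
proof
  fix s assume "s \<in> singular_points p b 2 f"
  then obtain h where h: "local_equation p b 2 f s h" "h 0 = 0" "(h has_derivative (\<lambda>_. 0)) (at 0)"
    unfolding singular_points_def by blast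
  show "s \<in> nodes" using h(1)
  proof (cases rule: local_equation_cases)
    case (off x v w)
    have "((\<lambda>z. x + fst z *s v + snd z *s w) has_derivative (\<lambda>z. fst z *s v + snd z *s w)) (at (0 :: complex \<times> complex))"
      by (rule has_derivative_vec3) (auto intro!: derivative_eq_intros)
    moreover have "(sextic r has_derivative (\<lambda>y. pair (grad x) y)) (at (x + fst (0 :: complex \<times> complex) *s v + snd (0 :: complex \<times> complex) *s w))"
      using sextic_has_derivative by simp
    ultimately have "((\<lambda>z. \<kappa> * sextic r (x + fst z *s v + snd z *s w)) has_derivative (\<lambda>z. \<kappa> * pair (grad x) (fst z *s v + snd z *s w))) (at 0)"
      by (intro has_derivative_mult_right) (rule has_derivative_compose)
    moreover have "h = (\<lambda>z. \<kappa> * sextic r (x + fst z *s v + snd z *s w))" using off(4) by auto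
    ultimately have "(\<lambda>z. \<kappa> * pair (grad x) (fst z *s v + snd z *s w)) = (\<lambda>_. 0)"
      using has_derivative_unique h(3) by blast
    from fun_cong[OF this, of "(1, 0)"] fun_cong[OF this, of "(0, 1)"]
    have "pair (grad x) v = 0" "pair (grad x) w = 0" using kappa by simp_all
    moreover have "sextic r x = 0" using off(4)[of 0 0] h(2) kappa by (simp add: zero_prod_def)
    then have "pair (grad x) x = 0" by (simp add: euler_sextic)
    ultimately have "grad x = 0" using kernel_zero_basis[OF off(3)] unfolding pair_def by blast
    then obtain n c where n: "n \<in> node_vectors" "c \<noteq> 0" "x = c *s n" using grad_zero_node off(1) by blast
    then have "s = ppoint (yy n (kap n))" unfolding off(2) by (simp add: kap_smult yy_smult ppoint_scale)
    then show ?thesis using n(1) unfolding nodes_def by blast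
  next
    case (exc i v w)
    define d where "d = dkap (lam i *s qpt i) v"
    define e where "e = dkap (lam i *s qpt i) w"
    have hu: "h (0, u) = \<kappa> * (6 * (lam i)\<^sup>2 * nsq (d + u *s e))" for u
      unfolding exc(3) d_def e_def using ramification_form_centre[OF dkap_sum, of "lam i" i "lam i *s qpt i" "v + u *s w"] by (simp add: dkap_add)
    have nz: "\<kappa> * (6 * (lam i)\<^sup>2) \<noteq> 0" using kappa lam by simp
    have "h (0, 0) = 0" using h(2) by (simp add: zero_prod_def)
    then have dd: "nsq d = 0" using hu[of 0] nz by simp
    have "((\<lambda>u. h (0, u)) has_derivative (\<lambda>_. 0)) (at 0)"
    proof -
      have "((\<lambda>u::complex. (0::complex, u)) has_derivative (\<lambda>u. (0, u))) (at 0)" by (auto intro!: derivative_eq_intros)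
      moreover have "(h has_derivative (\<lambda>_. 0)) (at (0, 0))" using h(3) by (simp add: zero_prod_def)
      ultimately show ?thesis using has_derivative_compose by fastforce
    qed
    moreover have "((\<lambda>u. h (0, u)) has_derivative (\<lambda>u. (\<kappa> * (6 * (lam i)\<^sup>2)) * (2 * pair d e * u))) (at 0)"
      unfolding hu nsq_def pair_def vector_add_component vector_smult_component
      by ((rule derivative_eq_intros | rule refl)+) (simp add: fun_eq_iff algebra_simps)
    ultimately have "(\<lambda>u. (\<kappa> * (6 * (lam i)\<^sup>2)) * (2 * pair d e * u)) = (\<lambda>_. 0)" by (rule has_derivative_unique[rotated])
    from fun_cong[OF this, of 1] have de: "pair d e = 0" using nz by simp
    have d0: "d \<noteq> 0" unfolding d_def dkap_zero_iff using det_vector_zero(4)[OF exc(2)] lam[of i] by auto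
    have s: "d$1 + d$2 + d$3 = 0" "e$1 + e$2 + e$3 = 0" by (simp_all add: d_def e_def dkap_sum)
    have "(d$1*e$2 - d$2*e$1)\<^sup>2 = 0" using dd de s unfolding nsq_def pair_def by Groebner_Basis.algebra
    then have m: "d$1*e$2 = d$2*e$1" by simp
      have "d$2*e$3 = d$3*e$2" "d$3*e$1 = d$1*e$3" using m s by Groebner_Basis.algebra+
    then obtain c where c: "e = c *s d" using cross_zero[OF d0 m] by blast
    have "dkap (lam i *s qpt i) (w + (-c) *s v) = 0" unfolding dkap_add using c by (simp add: d_def e_def)
    then obtain a where "w + (-c) *s v = a *s qpt i" unfolding dkap_zero_iff using lam by blast
    then have "w = c *s v + a *s qpt i" by (simp add: vec_eq_iff algebra_simps)
    then have "det (vector [qpt i, v, w] :: complex^3^3) = 0" by (simp add: det_3 algebra_simps)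
    then show ?thesis using exc(2) by blast
  qed
qed

end

lemma monomial_smallo:
  assumes "i + j \<ge> 3"
  shows "(\<lambda>z :: complex \<times> complex. fst z ^ i * snd z ^ j) \<in> o[at 0](\<lambda>z. of_real (norm z ^ 2) :: complex)"
proof (rule landau_o.smallI)
  fix c :: real assume c: "c > 0"
  have "\<forall>\<^sub>F z :: complex \<times> complex in at 0. dist z 0 < min 1 c"
    unfolding eventually_at using c by (intro exI[of _ "min 1 c"]) auto
  then show "\<forall>\<^sub>F z :: complex \<times> complex in at 0. norm (fst z ^ i * snd z ^ j) \<le> c * norm (of_real (norm z ^ 2) :: complex)"
  proof eventually_elim
    case (elim z)
    then have n: "norm z \<le> 1" "norm z \<le> c" by auto
    have "norm (fst z ^ i * snd z ^ j) \<le> norm z ^ i * norm z ^ j"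
      unfolding norm_mult norm_power
      using norm_fst_le[of "fst z" "snd z"] norm_snd_le[of "snd z" "fst z"]
      by (intro mult_mono power_mono) auto
    also have "\<dots> = norm z ^ (i + j)" by (simp add: power_add)
    also have "\<dots> \<le> norm z ^ 3" using n assms by (intro power_decreasing) auto
    also have "\<dots> = norm z * norm z ^ 2" by (simp add: power_numeral_reduce)
    also have "\<dots> \<le> c * norm z ^ 2" using n by (intro mult_right_mono) auto
    finally show ?case by (simp add: norm_power)
  qed
qed

context ramification_coords
begin

lemma smallo_cmult: "q \<in> o[F](g) \<Longrightarrow> (\<lambda>x. c * q x) \<in> o[F](g)" for c :: complex
  by (cases "c = 0") auto

lemma cub_one: "cub r X Y 1 = X^3 + Y^3 + 1 - 6 * X * Y + (5 * r - 2) * (X * Y\<^sup>2 + Y + X\<^sup>2)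
     + (3 - 5 * r) * (X\<^sup>2 * Y + Y\<^sup>2 + X)"
  by (simp add: cub_def)

text \<open>
  In the affine chart \<open>x3 = 1\<close> around \<open>(0, e, 1)\<close> the equation has no linear term, and its
  quadratic part is diagonal.
\<close>

lemma node_expansion:
  assumes e: "e\<^sup>2 = r + 1"
  shows "(\<lambda>z. 3 * \<kappa> * cub r ((fst z)\<^sup>2) ((e + snd z)\<^sup>2) 1 
     - ((3 * \<kappa> * (8 + 8 * r)) * (fst z)\<^sup>2 + 0 * fst z * snd z + (3 * \<kappa> * (16 + 8 * r)) * (snd z)\<^sup>2))
      \<in> o[at 0](\<lambda>z. of_real (norm z ^ 2))"
proof -
  let ?c = "\<lambda>i j a (z :: complex \<times> complex). (3 * \<kappa> * a) * (fst z ^ i * snd z ^ j)"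
  have "(\<lambda>z. 3 * \<kappa> * cub r ((fst z)\<^sup>2) ((e + snd z)\<^sup>2) 1 
     - ((3 * \<kappa> * (8 + 8 * r)) * (fst z)\<^sup>2 + 0 * fst z * snd z + (3 * \<kappa> * (16 + 8 * r)) * (snd z)\<^sup>2)) =
     (\<lambda>z. ?c 0 3 (32 * e) z + ?c 0 4 (18 + 10 * r) z + ?c 0 5 (6 * e) z + ?c 0 6 1 z + ?c 2 1 (32 * r * e) z
      + ?c 2 2 (12 + 48 * r) z + ?c 2 3 ((20 * r - 8) * e) z + ?c 2 4 (5 * r - 2) z + ?c 4 0 (-4 - 2 * r) z
      + ?c 4 1 ((6 - 10 * r) * e) z + ?c 4 2 (3 - 5 * r) z + ?c 6 0 1 z)" (is "_ = (\<lambda>z. ?R z)")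
  proof
    fix z :: "complex \<times> complex"
    show "3 * \<kappa> * cub r ((fst z)\<^sup>2) ((e + snd z)\<^sup>2) 1 
     - ((3 * \<kappa> * (8 + 8 * r)) * (fst z)\<^sup>2 + 0 * fst z * snd z + (3 * \<kappa> * (16 + 8 * r)) * (snd z)\<^sup>2) = ?R z"
      unfolding cub_one using e r by Groebner_Basis.algebra
  qed
  moreover have "(\<lambda>z. ?R z) \<in> o[at 0](\<lambda>z. of_real (norm z ^ 2))"
    by (intro sum_in_smallo(1) monomial_smallo[THEN smallo_cmult]) simp_all
  ultimately show ?thesis by simp
qed


lemma node_in_ordinary: "nodes \<subseteq> ordinary_nodes p b 2 f"
proof
  fix s assume "s \<in> nodes"
  then obtain n where n: "n \<in> node_vectors" "s = ppoint (yy n (kap n))" unfolding nodes_def by blast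
  obtain e where e: "e \<in> {r, -r}" "n \<in> {vector [0, e, 1], vector [1, 0, e], vector [e, 1, 0]}"
    using n(1) unfolding node_vectors_def by blast
  have e2: "e\<^sup>2 = r + 1" using e(1) r by (auto simp: power2_eq_square)
  define h where "h = (\<lambda>z. 3 * \<kappa> * cub r ((fst z)\<^sup>2) ((e + snd z)\<^sup>2) 1)"
  have h0: "h 0 = 0" unfolding h_def cub_one using e2 r by (simp add: algebra_simps) Groebner_Basis.algebra
  have "\<exists>v w. det (vector [n, v, w] :: complex^3^3) \<noteq> 0 \<and> (\<lambda>(t, u). \<kappa> * sextic r (n + t *s v + u *s w)) = h"
  proof -
    consider "n = vector [0, e, 1]" | "n = vector [1, 0, e]" | "n = vector [e, 1, 0]" using e(2) by blast
    then show ?thesis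
    proof cases
      case 1
      have "det (vector [n, axis 1 1, axis 2 1] :: complex^3^3) \<noteq> 0" unfolding 1 by (simp add: det_3 axis_def)
      moreover have "(\<lambda>(t, u). \<kappa> * sextic r (n + t *s axis 1 1 + u *s axis 2 1)) = h"
        unfolding 1 h_def sextic_eq_cub[OF r] by (simp add: axis_def case_prod_beta cub_def fun_eq_iff algebra_simps)
      ultimately show ?thesis by blast
    next
      case 2
      have "det (vector [n, axis 2 1, axis 3 1] :: complex^3^3) \<noteq> 0" unfolding 2 by (simp add: det_3 axis_def)
      moreover have "(\<lambda>(t, u). \<kappa> * sextic r (n + t *s axis 2 1 + u *s axis 3 1)) = h"
        unfolding 2 h_def sextic_eq_cub[OF r] by (simp add: axis_def case_prod_beta cub_def fun_eq_iff algebra_simps)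
      ultimately show ?thesis by blast
    next
      case 3
      have "det (vector [n, axis 3 1, axis 1 1] :: complex^3^3) \<noteq> 0" unfolding 3 by (simp add: det_3 axis_def)
      moreover have "(\<lambda>(t, u). \<kappa> * sextic r (n + t *s axis 3 1 + u *s axis 1 1)) = h"
        unfolding 3 h_def sextic_eq_cub[OF r] by (simp add: axis_def case_prod_beta cub_def fun_eq_iff algebra_simps)
      ultimately show ?thesis by blast
    qed
  qed
  then obtain v w where vw: "det (vector [n, v, w] :: complex^3^3) \<noteq> 0" "(\<lambda>(t, u). \<kappa> * sextic r (n + t *s v + u *s w)) = h" by blast
  have "kap n \<noteq> 0" by (rule node_kap[OF n(1)])
  then have le: "local_equation p b 2 f s h" using chart_off[OF _ vw(1)] unfolding vw(2) n(2) by blast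
  have nz: "0\<^sup>2 - 4 * (3 * \<kappa> * (8 + 8 * r)) * (3 * \<kappa> * (16 + 8 * r)) \<noteq> 0"
  proof -
    have "8 + 8 * r \<noteq> 0" "16 + 8 * r \<noteq> 0" using r by Groebner_Basis.algebra+
    then show ?thesis using kappa by simp
  qed
  have sS: "s \<in> del_pezzo p b" unfolding n(2)
  proof (rule yy_in_del_pezzo[OF incid_kap])
    show "n \<noteq> 0" using e(2) by (auto simp: vec3_eq_iff)
  qed fact
  show "s \<in> ordinary_nodes p b 2 f"
    unfolding ordinary_nodes_def
    by (rule CollectI, rule conjI, rule sS, rule exI[of _ h], rule exI[of _ "3 * \<kappa> * (8 + 8 * r)"], rule exI[of _ 0], 
         rule exI[of _ "3 * \<kappa> * (16 + 8 * r)"], intro conjI, rule le, rule h0, rule nz,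
         unfold h_def, rule node_expansion[OF e2])
qed

lemma ordinary_subset_singular: "ordinary_nodes p b 2 f \<subseteq> singular_points p b 2 f"
proof
  fix s assume "s \<in> ordinary_nodes p b 2 f"
  then obtain h \<alpha> \<beta> \<gamma> where s: "s \<in> del_pezzo p b" "local_equation p b 2 f s h" "h 0 = 0"
    "(\<lambda>z. h z - (\<alpha> * (fst z)\<^sup>2 + \<beta> * fst z * snd z + \<gamma> * (snd z)\<^sup>2)) \<in> o[at 0](\<lambda>z. of_real (norm z ^ 2))"
    unfolding ordinary_nodes_def by blast
  let ?q = "\<lambda>z :: complex \<times> complex. \<alpha> * (fst z)\<^sup>2 + \<beta> * fst z * snd z + \<gamma> * (snd z)\<^sup>2"
  have q: "(?q has_derivative (\<lambda>_. 0)) (at 0)"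
    by (auto intro!: derivative_eq_intros)
  have "((\<lambda>z. h z - ?q z) has_derivative (\<lambda>_. 0)) (at 0)"
  proof -
    have "((\<lambda>z. (h z - ?q z) /\<^sub>R norm z) \<longlongrightarrow> 0) (at 0)"
    proof (rule tendstoI)
      fix \<epsilon> :: real assume eps: "\<epsilon> > 0"
      have "\<forall>\<^sub>F z in at 0. norm (h z - ?q z) \<le> 1 * norm (of_real (norm z ^ 2) :: complex)"
        using landau_o.smallD[OF s(4), of 1] by simp
      moreover have "\<forall>\<^sub>F z :: complex \<times> complex in at 0. norm z < \<epsilon> \<and> z \<noteq> 0"
        unfolding eventually_at using eps by (intro exI[of _ \<epsilon>]) auto
      ultimately show "\<forall>\<^sub>F z in at 0. dist ((h z - ?q z) /\<^sub>R norm z) 0 < \<epsilon>"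
      proof eventually_elim
        case (elim z)
        have "norm ((h z - ?q z) /\<^sub>R norm z) \<le> norm z ^ 2 / norm z"
          using elim by (simp add: divide_right_mono norm_power divide_inverse mult.commute mult_right_mono)
        also have "\<dots> = norm z" by (simp add: power2_eq_square)
        finally show ?case using elim by simp
      qed
    qed
    then show ?thesis using s(3) by (simp add: has_derivative_at_within has_derivative_within)
  qed
  from has_derivative_add[OF this q] have "(h has_derivative (\<lambda>_. 0)) (at 0)" by simp
  then show "s \<in> singular_points p b 2 f" unfolding singular_points_def using s by blast
qed

theorem singular_points_eq: "singular_points p b 2 f = nodes" "ordinary_nodes p b 2 f = nodes"
  using singular_subset node_in_ordinary ordinary_subset_singular by blast+

end

section \<open>The parametrisation of the ramification curve by a conic\<close>

text \<open>
  The parametrisation of the conic \<open>a1^2 + a2^2 + a3^2 = 0\<close> by the line.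
\<close>

definition av :: "complex^2 \<Rightarrow> complex^3"
  where "av z = vector [2 * z$1 * z$2, (z$1)\<^sup>2 - (z$2)\<^sup>2, \<i> * ((z$1)\<^sup>2 + (z$2)\<^sup>2)]"

lemma vec2_eq_iff: "(z :: complex^2) = w \<longleftrightarrow> z$1 = w$1 \<and> z$2 = w$2"
  by (simp add: vec_eq_iff forall_2)

lemma conic_av: "conic (av z)"
  by (simp add: conic_def av_def power_mult_distrib) (simp add: power2_eq_square algebra_simps)

lemma av_smult: "av (c *s z) = c\<^sup>2 *s av z"
  by (simp add: av_def vec3_eq_iff power2_eq_square algebra_simps)

lemma av_proportional:
  assumes "av z = c *s av w" "w \<noteq> 0"
  shows "\<exists>d. z = d *s w"
proof -
  have i: "\<i> * \<i> = -1" by simp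
  have e: "2 * z$1 * z$2 = c * (2 * w$1 * w$2)" "(z$1)\<^sup>2 - (z$2)\<^sup>2 = c * ((w$1)\<^sup>2 - (w$2)\<^sup>2)"
    "\<i> * ((z$1)\<^sup>2 + (z$2)\<^sup>2) = c * (\<i> * ((w$1)\<^sup>2 + (w$2)\<^sup>2))"
    using assms(1) unfolding av_def vec3_eq_iff vector_3 vector_smult_component by blast+
  have "(z$1)\<^sup>2 + (z$2)\<^sup>2 = c * ((w$1)\<^sup>2 + (w$2)\<^sup>2)" using e(3) by simp
  then have "(z$1 * w$2 - z$2 * w$1)\<^sup>2 = 0" using e(1,2) by Groebner_Basis.algebra
  then have d: "z$1 * w$2 = z$2 * w$1" by simp
  consider "w$1 \<noteq> 0" | "w$2 \<noteq> 0" using assms(2) by (auto simp: vec2_eq_iff)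
  then show ?thesis
  proof cases
    case 1 then show ?thesis using d by (intro exI[of _ "z$1/w$1"]) (simp add: vec2_eq_iff field_simps)
  next
    case 2 then show ?thesis using d by (intro exI[of _ "z$2/w$2"]) (simp add: vec2_eq_iff field_simps)
  qed
qed

lemma av_eq_0_iff: "av z = 0 \<longleftrightarrow> z = 0"
proof
  assume z: "av z = 0"
  have "av z $ 2 = 0" "av z $ 3 = 0" using z by simp_all
  then have "(z$1)\<^sup>2 - (z$2)\<^sup>2 = 0" "(z$1)\<^sup>2 + (z$2)\<^sup>2 = 0" unfolding av_def vector_3 by simp_all
  then have "(z$1)\<^sup>2 = 0" "(z$2)\<^sup>2 = 0" by Groebner_Basis.algebra+
  then show "z = 0" by (simp add: vec2_eq_iff)
qed (simp add: av_def vec3_eq_iff)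

lemma av_onto:
  assumes "conic a"
  shows "\<exists>z. av z = a"
proof -
  have i: "\<i> * \<i> = -1" by simp
  define z where "z = csqrt ((a$2 - \<i> * a$3) / 2)"
  define w0 where "w0 = csqrt ((- a$2 - \<i> * a$3) / 2)"
  have z2: "z\<^sup>2 = (a$2 - \<i> * a$3) / 2" by (simp add: z_def)
  have w2: "w0\<^sup>2 = (- a$2 - \<i> * a$3) / 2" by (simp add: w0_def)
  have 4: "4 * (z\<^sup>2 * w0\<^sup>2) = (a$2 - \<i> * a$3) * (- a$2 - \<i> * a$3)" unfolding z2 w2 by simp
  have "(2 * z * w0 - a$1) * (2 * z * w0 + a$1) = 0"
    using 4 assms i unfolding conic_def by Groebner_Basis.algebra
  then have "2 * z * w0 = a$1 \<or> 2 * z * (- w0) = a$1" by (auto simp: eq_neg_iff_add_eq_0 neg_eq_iff_add_eq_0)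
  moreover have "(- w0)\<^sup>2 = (- a$2 - \<i> * a$3) / 2" using w2 by simp
  ultimately obtain w where w: "w\<^sup>2 = (- a$2 - \<i> * a$3) / 2" "2 * z * w = a$1" using w2 by blast
  have "av (vector [z, w]) = a"
    unfolding av_def vec3_eq_iff vector_3 vector_2 z2 w(1) w(2)
    using i by (simp add: field_simps)
  then show ?thesis ..
qed

text \<open>
  The quadratic factors of the components of \<open>cx\<close>. Their zeros on the conic are the twelve
  vertices of the icosahedron.
\<close>

definition vertex_forms :: "complex \<Rightarrow> complex^3 \<Rightarrow> complex^3"
  where "vertex_forms r a = vector [(r+1) * (a$3)\<^sup>2 - (a$2)\<^sup>2, (r+1) * (a$1)\<^sup>2 - (a$3)\<^sup>2, (r+1) * (a$2)\<^sup>2 - (a$1)\<^sup>2]"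

lemma cx_vertex_forms: "cx r a $ i = a $ i * vertex_forms r a $ i"
proof -
  have "\<forall>i. cx r a $ i = a $ i * vertex_forms r a $ i" unfolding forall_3 cx_def vertex_forms_def vector_3 by simp
  then show ?thesis ..
qed

lemma square_of_cm:
  assumes r: "r * r = r + 1" and a: "conic a"
  shows "8 * (a$1)\<^sup>2 = (r+1) * cm r a $ 3 - (2-r) * cm r a $ 2"
    "8 * (a$2)\<^sup>2 = (r+1) * cm r a $ 1 - (2-r) * cm r a $ 3"
    "8 * (a$3)\<^sup>2 = (r+1) * cm r a $ 2 - (2-r) * cm r a $ 1"
  using assms unfolding conic_def cm_def vector_3 by Groebner_Basis.algebra+

lemma square_zero:
  assumes r: "r * r = r + 1" and a: "conic a" and "(a$1)\<^sup>2 * vertex_forms r a $ 1 = 0" "(a$2)\<^sup>2 * vertex_forms r a $ 2 = 0" "(a$3)\<^sup>2 * vertex_forms r a $ 3 = 0"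
  shows "a = 0"
proof -
  define A where "A = (a$1)\<^sup>2" define B where "B = (a$2)\<^sup>2" define C where "C = (a$3)\<^sup>2"
  have C: "C = - A - B" using a by (simp add: A_def B_def C_def conic_alt)
  have e: "A * ((r+1)*C - B) = 0" "B * ((r+1)*A - C) = 0"
    using assms(3,4) unfolding vertex_forms_def vector_3 A_def B_def C_def by blast+
  have "A = 0"
  proof (rule ccontr)
    assume "A \<noteq> 0"
    then have 1: "(r+1)*C = B" using e(1) by simp
    have "B = 0 \<or> (r+1)*A = C" using e(2) by simp
    then have "A = 0"
    proof
      assume "B = 0" then have "A = 0" using 1 C r by Groebner_Basis.algebra
      then show ?thesis .
    next
      assume "(r+1)*A = C" then have "4 * A = 0" using 1 C r by Groebner_Basis.algebra
      then show ?thesis by simp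
    qed
    then show False using \<open>A \<noteq> 0\<close> by simp
  qed
  moreover have "B = 0" using e(2) C \<open>A = 0\<close> by simp
  ultimately show ?thesis using C by (simp add: A_def B_def C_def vec3_eq_iff)
qed

lemma cx_nonzero:
  assumes r: "r * r = r + 1" and a: "conic a" and "a \<noteq> 0"
  shows "cx r a \<noteq> 0"
proof
  assume "cx r a = 0"
  then have "a $ i * vertex_forms r a $ i = 0" for i using cx_vertex_forms[of r a i] by simp
  then have "(a $ i)\<^sup>2 * vertex_forms r a $ i = 0" for i by auto
  then show False using square_zero[OF r a] assms(3) by blast
qed

lemma cm_nonzero:
  assumes r: "r * r = r + 1" and a: "conic a" and "a \<noteq> 0"
  shows "cm r a \<noteq> 0"
proof
  assume "cm r a = 0"
  then have "a = 0" using square_of_cm[OF r a] by (simp add: vec3_eq_iff)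
  then show False using assms(3) by blast
qed

text \<open>
  The sign change of one coordinate; it exchanges the two vertices over a node.
\<close>

definition flip :: "3 \<Rightarrow> complex^3 \<Rightarrow> complex^3"
  where "flip i a = (\<chi> j. if j = i then - a $ j else a $ j)"

lemma three_numeral: "(4::3) = 1" "(5::3) = 2" by simp_all

lemma three_arith: "i + 1 + 1 = i + 2" "i + 1 + 2 = i" "i + 2 + 1 = i" "i + 2 + 2 = i + 1" for i :: 3
proof -
  have "\<forall>i::3. i + 1 + 1 = i + 2 \<and> i + 1 + 2 = i \<and> i + 2 + 1 = i \<and> i + 2 + 2 = i + 1" unfolding forall_3 by simp
  then show "i + 1 + 1 = i + 2" "i + 1 + 2 = i" "i + 2 + 1 = i" "i + 2 + 2 = i + 1" by blast+
qed

lemma three_shift_forall: "(\<forall>j. P j) \<longleftrightarrow> P i \<and> P (i+1) \<and> P (i+2)" for i :: 3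
proof -
  have "\<forall>i::3. (\<forall>j. P j) \<longleftrightarrow> P i \<and> P (i+1) \<and> P (i+2)" unfolding forall_3 by (auto simp: three_numeral)
  then show ?thesis ..
qed

lemma vertex_forms_nth: "vertex_forms r a $ i = (r+1) * (a $ (i+2))\<^sup>2 - (a $ (i+1))\<^sup>2"
proof -
  have "\<forall>i. vertex_forms r a $ i = (r+1) * (a $ (i+2))\<^sup>2 - (a $ (i+1))\<^sup>2" unfolding forall_3 vertex_forms_def vector_3 by (simp add: three_numeral)
  then show ?thesis ..
qed

lemma conic_nth: "conic a \<longleftrightarrow> (a $ i)\<^sup>2 + (a $ (i+1))\<^sup>2 + (a $ (i+2))\<^sup>2 = 0"
proof -
  have "\<forall>i. conic a \<longleftrightarrow> (a $ i)\<^sup>2 + (a $ (i+1))\<^sup>2 + (a $ (i+2))\<^sup>2 = 0" unfolding forall_3 conic_def by (simp add: three_numeral add_ac)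
  then show ?thesis ..
qed

lemma vertex_squares:
  assumes r: "r * r = r + 1" and a: "conic a" and m: "vertex_forms r a $ i = 0"
  shows "(a $ (i+1))\<^sup>2 = (r + 1) * (a $ (i+2))\<^sup>2" "(a $ i)\<^sup>2 = - (r + 2) * (a $ (i+2))\<^sup>2"
    "vertex_forms r a $ (i+1) = - 4 * (r + 1) * (a $ (i+2))\<^sup>2" "vertex_forms r a $ (i+2) = 4 * (r + 1) * (a $ (i+2))\<^sup>2"
  using m a r unfolding vertex_forms_nth three_arith conic_nth[of a i] by Groebner_Basis.algebra+

lemma golden_nonzero:
  assumes r: "r * r = r + (1::complex)"
  shows "r \<noteq> 0" "r + 1 \<noteq> 0" "r + 2 \<noteq> 0" "r \<noteq> 1"
  using r by Groebner_Basis.algebra+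

lemma vertex_nonzero:
  assumes r: "r * r = r + 1" and a: "conic a" "a \<noteq> 0" and m: "vertex_forms r a $ i = 0"
  shows "a $ j \<noteq> 0" and "j \<noteq> i \<Longrightarrow> vertex_forms r a $ j \<noteq> 0"
proof -
  note v = vertex_squares[OF r a(1) m]
  have nz: "a $ (i+2) \<noteq> 0"
  proof
    assume z: "a $ (i+2) = 0"
    then have "a $ i = 0" "a $ (i+1) = 0" using v by simp_all
    then have "\<forall>j. a $ j = 0" unfolding three_shift_forall[of _ i] using z by blast
    then show False using a(2) by (simp add: vec_eq_iff)
  qed
  have "a $ i \<noteq> 0" using v(2) nz golden_nonzero(3)[OF r]
    by (metis mult_eq_0_iff neg_equal_0_iff_equal power_not_zero zero_power2)
  moreover have "a $ (i+1) \<noteq> 0" using v(1) nz golden_nonzero(2)[OF r] by auto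
  ultimately have "\<forall>j. a $ j \<noteq> 0" unfolding three_shift_forall[of _ i] using nz by blast
  then show "a $ j \<noteq> 0" ..
  have "vertex_forms r a $ (i+1) \<noteq> 0" "vertex_forms r a $ (i+2) \<noteq> 0"
    unfolding v(3,4) using nz golden_nonzero(2)[OF r] by (simp_all del: distrib_left_numeral mult_minus_left)
  then have "\<forall>j. j \<noteq> i \<longrightarrow> vertex_forms r a $ j \<noteq> 0" unfolding three_shift_forall[of _ i] by blast
  then show "j \<noteq> i \<Longrightarrow> vertex_forms r a $ j \<noteq> 0" by blast
qed

lemma flip_nth: "flip i a $ j = (if j = i then - a $ j else a $ j)"
  by (simp add: flip_def)

lemma vertex_forms_flip: "vertex_forms r (flip i a) = vertex_forms r a"
  unfolding vec_eq_iff vertex_forms_nth by (simp add: flip_nth)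

lemma cm_flip: "cm r (flip i a) = cm r a"
  unfolding vec3_eq_iff cm_def vector_3 by (simp add: flip_nth)

lemma conic_flip: "conic (flip i a) = conic a"
  unfolding conic_def by (simp add: flip_nth)

lemma flip_flip: "flip i (flip i a) = a"
  by (simp add: vec_eq_iff flip_nth)

lemma cx_smult: "cx r (c *s a) = c ^ 3 *s cx r a"
  by (simp add: cx_def vec3_eq_iff power_mult_distrib power3_eq_cube power2_eq_square algebra_simps)

lemma cm_smult: "cm r (c *s a) = c\<^sup>2 *s cm r a"
  by (simp add: cm_def vec3_eq_iff power_mult_distrib algebra_simps)

lemma vertex_forms_smult: "vertex_forms r (c *s a) = c\<^sup>2 *s vertex_forms r a"
  by (simp add: vertex_forms_def vec3_eq_iff power_mult_distrib algebra_simps)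

lemma cx_flip: "vertex_forms r a $ i = 0 \<Longrightarrow> cx r (flip i a) = cx r a"
  by (simp add: vec_eq_iff cx_vertex_forms vertex_forms_flip flip_nth)

text \<open>
  The squares of the coordinates are linear in \<open>cm\<close>, so the conic of the pencil determines the
  parameter up to signs. The signs are determined by \<open>cx\<close> except for a coordinate at which the
  quadratic factor vanishes.
\<close>

lemma curve_fibre:
  assumes r: "r * r = r + 1" and a: "conic a" "a \<noteq> 0" and b: "conic b" "b \<noteq> 0"
    and x: "cx r a = s *s cx r b" and m: "cm r a = t *s cm r b"
  shows "(\<exists>c. a = c *s b) \<or> (\<exists>i. vertex_forms r b $ i = 0 \<and> (\<exists>c. a = c *s flip i b))"
proof -
  have t0: "t \<noteq> 0" using m cm_nonzero[OF r a] by auto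
  have s0: "s \<noteq> 0" using x cx_nonzero[OF r a] by auto
  have "8 * (a$1)\<^sup>2 = 8 * (t * (b$1)\<^sup>2) \<and> 8 * (a$2)\<^sup>2 = 8 * (t * (b$2)\<^sup>2) \<and> 8 * (a$3)\<^sup>2 = 8 * (t * (b$3)\<^sup>2)"
    unfolding square_of_cm[OF r a(1)] m using square_of_cm[OF r b(1)] unfolding vector_smult_component by Groebner_Basis.algebra
  then have "\<forall>i. (a $ i)\<^sup>2 = t * (b $ i)\<^sup>2" unfolding forall_3 by simp
  then have block_quadric: "(a $ i)\<^sup>2 = t * (b $ i)\<^sup>2" for i ..
  have mm: "vertex_forms r a $ i = t * vertex_forms r b $ i" for i unfolding vertex_forms_nth block_quadric by (simp add: algebra_simps)
  have xx: "a $ i * (t * vertex_forms r b $ i) = s * (b $ i * vertex_forms r b $ i)" for i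
    using arg_cong[OF x, of "\<lambda>v. v $ i"] unfolding vector_smult_component cx_vertex_forms mm .
  define c where "c = s / t"
  have icosahedral: "a $ i = c * b $ i" if "vertex_forms r b $ i \<noteq> 0" for i
    using xx[of i] that t0 by (simp add: c_def field_simps)
  show ?thesis
  proof (cases "\<exists>i. vertex_forms r b $ i = 0")
    case False
    then have "a = c *s b" using icosahedral by (simp add: vec_eq_iff)
    then show ?thesis by blast
  next
    case True
    then obtain i where i: "vertex_forms r b $ i = 0" ..
    have o: "a $ j = c * b $ j" if "j \<noteq> i" for j using icosahedral vertex_nonzero(2)[OF r b i that] by blast
    obtain j where j: "j \<noteq> i" by (metis zero_neq_one)
    have "c\<^sup>2 = t"
    proof -
      have "(c\<^sup>2 - t) * (b $ j)\<^sup>2 = 0" using block_quadric[of j] o[OF j] by (simp add: power_mult_distrib algebra_simps)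
      then show ?thesis using vertex_nonzero(1)[OF r b i, of j] by simp
    qed
    then have "(a $ i)\<^sup>2 = (c * b $ i)\<^sup>2" using block_quadric[of i] by (simp add: power_mult_distrib)
    then consider "a $ i = c * b $ i" | "a $ i = - (c * b $ i)" by (auto simp: power2_eq_iff)
    then show ?thesis
    proof cases
      case 1
      then have "a $ k = c * b $ k" for k using o[of k] by (cases "k = i") auto
      then have "a = c *s b" by (simp add: vec_eq_iff)
      then show ?thesis by blast
    next
      case 2
      then have "a $ k = (c *s flip i b) $ k" for k using o[of k] by (cases "k = i") (auto simp: flip_nth)
      then have "a = c *s flip i b" by (simp add: vec_eq_iff)
      then show ?thesis using i by blast
    qed
  qed
qed

text \<open>
  The squares of the parameter are recovered from the conic \<open>m\<close> of the pencil, and the signs are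
  chosen so that the point \<open>x\<close> comes out.
\<close>

lemma curve_onto:
  assumes r: "r * r = r + 1" and x: "incid x m" "x \<noteq> 0" "m \<noteq> 0"
    and q: "4 * nsq (lin (1 - r) x m) - nsq (lin r x m) = 0"
  shows "\<exists>a c d. conic a \<and> a \<noteq> 0 \<and> c \<noteq> 0 \<and> d \<noteq> 0 \<and> x = c *s cx r a \<and> m = d *s cm r a"
proof -
  define a0 where "a0 = (vector [csqrt ((r+1) * m$3 - (2-r) * m$2), csqrt ((r+1) * m$1 - (2-r) * m$3), csqrt ((r+1) * m$2 - (2-r) * m$1)] :: complex^3)"
  have a0: "(a0$1)\<^sup>2 = (r+1) * m$3 - (2-r) * m$2" "(a0$2)\<^sup>2 = (r+1) * m$1 - (2-r) * m$3" "(a0$3)\<^sup>2 = (r+1) * m$2 - (2-r) * m$1"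
    by (simp_all add: a0_def)
  have ms: "m$1 + m$2 + m$3 = 0" and mx: "m$1 * (x$1)\<^sup>2 + m$2 * (x$2)\<^sup>2 + m$3 * (x$3)\<^sup>2 = 0" using x(1) by (auto simp: incid_def)
  have con: "conic a0" unfolding conic_def a0 using ms by Groebner_Basis.algebra
  have cm: "cm r a0 = 8 *s m" unfolding cm_def vec3_eq_iff vector_3 vector_smult_component a0 using ms r by (intro conjI; Groebner_Basis.algebra)
  have a0n: "a0 \<noteq> 0" using cm x(3) by (auto simp: cm_def vec3_eq_iff)
  define X where "X = (\<chi> i. (x $ i)\<^sup>2)"
  define Y where "Y = (\<chi> i. (cx r a0 $ i)\<^sup>2)"
  have Yn: "Y \<noteq> 0" using cx_nonzero[OF r con a0n] by (auto simp: Y_def vec_eq_iff)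
  define k where "k = (\<lambda>i j. 4 * ((1-r) * m$i - r * m$j)\<^sup>2 - (r * m$i + (r-1) * m$j)\<^sup>2)"
  have qX: "k 2 3 * X$1 + k 3 1 * X$2 + k 1 2 * X$3 = 0"
    using q unfolding nsq_def lin_def vector_3 X_def k_def vec_lambda_beta power_mult_distrib by Groebner_Basis.algebra
  have mX: "m$1 * X$1 + m$2 * X$2 + m$3 * X$3 = 0" using mx by (simp add: X_def)
  have m3: "m$3 = - m$1 - m$2" using ms by Groebner_Basis.algebra
  have vertex_forms: "vertex_forms r a0 $ 1 = 4 * (r * m$2 - m$1)" "vertex_forms r a0 $ 2 = 4 * (r * m$3 - m$2)" "vertex_forms r a0 $ 3 = 4 * (r * m$1 - m$3)"
    unfolding vertex_forms_def vector_3 a0 m3 using r by Groebner_Basis.algebra+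
  have Y1: "3 * Y$1 = -16 * (r+1) * (m$2 * k 1 2 - m$3 * k 3 1)"
    unfolding Y_def vec_lambda_beta cx_vertex_forms vertex_forms power_mult_distrib a0 k_def m3 using r by Groebner_Basis.algebra
  have Y2: "3 * Y$2 = -16 * (r+1) * (m$3 * k 2 3 - m$1 * k 1 2)"
    unfolding Y_def vec_lambda_beta cx_vertex_forms vertex_forms power_mult_distrib a0 k_def m3 using r by Groebner_Basis.algebra
  have Y3: "3 * Y$3 = -16 * (r+1) * (m$1 * k 3 1 - m$2 * k 2 3)"
    unfolding Y_def vec_lambda_beta cx_vertex_forms vertex_forms power_mult_distrib a0 k_def m3 using r by Groebner_Basis.algebra
  note Y = Y1 Y2 Y3
  have "\<exists>t. X = t *s Y"
    using Y mX qX by (intro cross_zero[OF Yn]; Groebner_Basis.algebra)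
  then obtain t where t: "X = t *s Y" ..
  define \<tau> where "\<tau> = csqrt t"
  have tt: "t = \<tau>\<^sup>2" by (simp add: \<tau>_def)
  have "X \<noteq> 0" using x(2) by (auto simp: X_def vec_eq_iff)
  then have tn: "\<tau> \<noteq> 0" using t tt by auto
  have "(x $ i)\<^sup>2 = (\<tau> * cx r a0 $ i)\<^sup>2" for i
    using arg_cong[OF t, of "\<lambda>v. v $ i"] by (simp add: X_def Y_def tt power_mult_distrib)
  then have sg: "x $ i = \<tau> * cx r a0 $ i \<or> x $ i = - (\<tau> * cx r a0 $ i)" for i by (simp add: power2_eq_iff)
  define a where "a = (\<chi> i. if x $ i = \<tau> * cx r a0 $ i then a0 $ i else - a0 $ i)"
  have a2: "(a $ i)\<^sup>2 = (a0 $ i)\<^sup>2" for i by (simp add: a_def)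
  have "vertex_forms r a = vertex_forms r a0" unfolding vec_eq_iff vertex_forms_nth a2 by simp
  then have "x $ i = \<tau> * cx r a $ i" for i using sg[of i] by (auto simp: cx_vertex_forms a_def)
  then have "x = \<tau> *s cx r a" by (simp add: vec_eq_iff)
  moreover have "cm r a = 8 *s m" using cm unfolding cm_def a2 .
  then have "m = (1/8) *s cm r a" by (simp add: vec_eq_iff)
  moreover have "conic a" using con unfolding conic_def a2 .
  moreover have "a \<noteq> 0"
  proof
    assume "a = 0" then have "(a0 $ i)\<^sup>2 = 0" for i using a2[of i] by simp
    then show False using a0n by (simp add: vec_eq_iff)
  qed
  ultimately show ?thesis using tn by (intro exI[of _ a] exI[of _ \<tau>] exI[of _ "1/8"]) simp
qed

context split_coords
begin

definition yc :: "complex^2 \<Rightarrow> complex^6"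
  where "yc z = yy (cx r (av z)) (cm r (av z))"

lemma curve_incid: "incid (cx r (av z)) (cm r (av z))"
  by (rule incid_curve[OF r conic_av])

lemma curve_nz: "z \<noteq> 0 \<Longrightarrow> cx r (av z) \<noteq> 0" "z \<noteq> 0 \<Longrightarrow> cm r (av z) \<noteq> 0"
  using cx_nonzero[OF r conic_av] cm_nonzero[OF r conic_av] av_eq_0_iff by blast+

lemma yc_nonzero: "z \<noteq> 0 \<Longrightarrow> yc z \<noteq> 0"
  unfolding yc_def yy_eq_0_iff[OF curve_incid] using curve_nz by blast

lemma yc_smult: "yc (c *s z) = c ^ 10 *s yc z"
  by (simp add: yc_def av_smult cx_smult cm_smult yy_smult vector_smult_assoc flip: power_mult power_add)

definition nu :: "(complex^2) set \<Rightarrow> (complex^6) set"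
  where "nu s = ppoint (yc (SOME z. z \<noteq> 0 \<and> s = ppoint z))"

lemma nu_ppoint: assumes "z \<noteq> 0" shows "nu (ppoint z) = ppoint (yc z)"
proof -
  define w where "w = (SOME w. w \<noteq> 0 \<and> ppoint z = ppoint w)"
  have "w \<noteq> 0 \<and> ppoint z = ppoint w" unfolding w_def by (rule someI[of _ z]) (use assms in simp)
  then obtain c where "c \<noteq> 0" "w = c *s z" using ppoint_eq_iff by metis
  then show ?thesis unfolding nu_def w_def[symmetric] by (simp add: yc_smult ppoint_scale)
qed

lemma proj_space_cases:
  assumes "s \<in> proj_space" obtains z where "z \<noteq> 0" "s = ppoint z"
  using assms unfolding proj_space_def by blast

lemma nu_in_del_pezzo: "s \<in> proj_space \<Longrightarrow> nu s \<in> del_pezzo p b"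
  by (erule proj_space_cases) (simp add: nu_ppoint yc_def yy_in_del_pezzo curve_incid curve_nz)

lemma forms_yc: "(\<lambda>z. yc z $ j) \<in> forms 10"
proof -
  have f: "f \<in> forms d \<Longrightarrow> d = e \<Longrightarrow> f \<in> forms e" for f :: "complex^2 \<Rightarrow> complex" and d e by simp
  have m: "f \<in> forms d \<Longrightarrow> g \<in> forms e \<Longrightarrow> (\<lambda>x. f x * g x) \<in> forms k" if "d + e = k" for f g :: "complex^2 \<Rightarrow> complex" and d e k
    using forms_mult[of f d g e] that by simp
  have block_quadric: "f \<in> forms d \<Longrightarrow> (\<lambda>x. (f x)\<^sup>2) \<in> forms k" if "2 * d = k" for f :: "complex^2 \<Rightarrow> complex" and d k
    using forms_power[of f d 2] that by simp
  have av: "\<forall>i. (\<lambda>z. av z $ i) \<in> forms 2"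
    unfolding forall_3 av_def vector_3
    by (intro conjI forms_add forms_diff forms_cmult block_quadric[OF _ forms_coord] m[OF _ forms_cmult[OF forms_coord] forms_coord]) simp_all
  then have av2: "(\<lambda>z. (av z $ i)\<^sup>2) \<in> forms 4" for i by (intro block_quadric[of 2]) simp_all
  have cx: "\<forall>i. (\<lambda>z. cx r (av z) $ i) \<in> forms 6"
    unfolding forall_3 cx_def vector_3 using av av2
    by (intro conjI m[of 2 4] forms_diff forms_cmult) simp_all
  have cm: "\<forall>i. (\<lambda>z. cm r (av z) $ i) \<in> forms 4"
    unfolding forall_3 cm_def vector_3 using av2 by (intro conjI forms_diff forms_cmult) simp_all
  have l: "\<forall>i. (\<lambda>z. lin q (cx r (av z)) (cm r (av z)) $ i) \<in> forms 10" for q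
    unfolding forall_3 lin_def vector_3 using cx cm
    by (intro conjI m[of 6 4] forms_add forms_cmult) simp_all
  show ?thesis
    unfolding yc_def yy_def pt_def matrix_vector_mult_def vector_add_component vec_lambda_beta
    using l by (intro forms_add forms_sum forms_cmult) simp_all
qed

lemma nu_regular: "regular_map proj_space (del_pezzo p b) nu"
  unfolding regular_map_def
proof (intro conjI ballI)
  show "nu \<in> proj_space \<rightarrow> del_pezzo p b" using nu_in_del_pezzo by blast
  fix s :: "(complex^2) set" assume "s \<in> proj_space"
  then obtain z where "z \<noteq> 0" "s = ppoint z" by (rule proj_space_cases)
  moreover have "v \<noteq> 0" if "ppoint v \<in> proj_space" for v :: "complex^2"
    using that ppoint_nonzero unfolding proj_space_def by blast
  ultimately show "\<exists>d Q. (\<forall>i. (\<lambda>v. Q v $ i) \<in> forms d) \<and> (\<exists>v. s = ppoint v \<and> Q v \<noteq> 0) \<and>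
         (\<forall>v. ppoint v \<in> proj_space \<and> Q v \<noteq> 0 \<longrightarrow> nu (ppoint v) = ppoint (Q v))"
    using forms_yc yc_nonzero nu_ppoint by (intro exI[of _ 10] exI[of _ yc]) blast
qed

lemma yy_proportional:
  assumes "incid x m" "incid x' m'" "yy x m = c *s yy x' m'" "yy x m \<noteq> 0"
  shows "\<exists>s t. x = s *s x' \<and> m = t *s m'"
proof -
  have "lin r x m = c *s lin r x' m'" "lin (1-r) x m = c *s lin (1-r) x' m'"
    using arg_cong[OF assms(3), of "\<lambda>w. U *v w"] arg_cong[OF assms(3), of "\<lambda>w. V *v w"]
    by (simp_all add: yy_def U_pt V_pt vector_scalar_commute)
  then have l: "lin r x m = lin r (c *s x') m'" "lin (1-r) x m = lin (1-r) (c *s x') m'" by (simp_all add: lin_smult_left)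
  have i: "incid (c *s x') m'" using assms(2)
    by (simp add: incid_def power_mult_distrib mult.left_commute[of _ "c\<^sup>2"] flip: distrib_left)
  have e: "x $ i * m $ j = c * x' $ i * m' $ j" for i j
    using rank_one_entry_lin[OF r assms(1), of i j] rank_one_entry_lin[OF r i, of i j] l sqrt5_nonzero[OF r] by simp
  have "x \<noteq> 0" "m \<noteq> 0" using assms(4) yy_eq_0_iff[OF assms(1)] by auto
  then obtain i j where "x $ i \<noteq> 0" "m $ j \<noteq> 0" by (auto simp: vec_eq_iff)
  then have "x = (c * m' $ j / m $ j) *s x'" "m = (c * x' $ i / x $ i) *s m'"
    using e by (auto simp: vec_eq_iff field_simps)
  then show ?thesis by blast
qed

lemma nu_eq_iff:
  assumes "z \<noteq> 0" "w \<noteq> 0"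
  shows "nu (ppoint z) = nu (ppoint w) \<longleftrightarrow> ppoint z = ppoint w \<or>
    (\<exists>i. vertex_forms r (av w) $ i = 0 \<and> (\<exists>c. av z = c *s flip i (av w)))"
proof
  assume "nu (ppoint z) = nu (ppoint w)"
  then obtain c where c: "yc z = c *s yc w" using assms by (auto simp: nu_ppoint ppoint_eq_iff yc_nonzero)
  then obtain s t where "cx r (av z) = s *s cx r (av w)" "cm r (av z) = t *s cm r (av w)"
    using yy_proportional[OF curve_incid curve_incid] yc_nonzero[OF assms(1)] unfolding yc_def by blast
  then have "(\<exists>c. av z = c *s av w) \<or> (\<exists>i. vertex_forms r (av w) $ i = 0 \<and> (\<exists>c. av z = c *s flip i (av w)))"
    using curve_fibre[OF r conic_av _ conic_av] assms av_eq_0_iff by blast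
  moreover have "ppoint z = ppoint w" if "av z = c *s av w" for c
    using av_proportional[OF that assms(2)] assms by (metis ppoint_scale vector_smult_lzero)
  ultimately show "ppoint z = ppoint w \<or> (\<exists>i. vertex_forms r (av w) $ i = 0 \<and> (\<exists>c. av z = c *s flip i (av w)))" by blast
next
  assume "ppoint z = ppoint w \<or> (\<exists>i. vertex_forms r (av w) $ i = 0 \<and> (\<exists>c. av z = c *s flip i (av w)))"
  then show "nu (ppoint z) = nu (ppoint w)"
  proof (elim disjE exE conjE)
    fix i c assume i: "vertex_forms r (av w) $ i = 0" and c: "av z = c *s flip i (av w)"
    have "av z \<noteq> 0" using av_eq_0_iff assms by blast
    then have "c \<noteq> 0" using c by auto
    moreover have "yc z = c ^ 5 *s yc w" unfolding yc_def c cx_smult cm_smult cx_flip[OF i] cm_flip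
      by (simp add: yy_smult vector_smult_assoc flip: power_add)
    ultimately show ?thesis using assms by (simp add: nu_ppoint ppoint_scale)
  qed simp
qed

lemma nu_image: "nu ` proj_space = {ppoint (yy x m) | x m. incid x m \<and> x \<noteq> 0 \<and> m \<noteq> 0 \<and> ramification_form x m = 0}"
proof (intro equalityI subsetI)
  fix s assume "s \<in> nu ` proj_space"
  then obtain z where z: "z \<noteq> 0" "s = ppoint (yc z)" by (metis imageE nu_ppoint proj_space_cases)
  then show "s \<in> {ppoint (yy x m) | x m. incid x m \<and> x \<noteq> 0 \<and> m \<noteq> 0 \<and> ramification_form x m = 0}"
  proof -
    have "ramification_form (cx r (av z)) (cm r (av z)) = 0"
      using nsq_curve[OF r conic_av] unfolding ramification_form_def block_quadric_def by simp
    then show ?thesis using curve_incid curve_nz[OF z(1)] unfolding z(2) yc_def by blast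
  qed
next
  fix s assume "s \<in> {ppoint (yy x m) | x m. incid x m \<and> x \<noteq> 0 \<and> m \<noteq> 0 \<and> ramification_form x m = 0}"
  then obtain x m where x: "incid x m" "x \<noteq> 0" "m \<noteq> 0" "ramification_form x m = 0" "s = ppoint (yy x m)" by blast
  obtain a c d where a: "conic a" "a \<noteq> 0" "c \<noteq> 0" "d \<noteq> 0" "x = c *s cx r a" "m = d *s cm r a"
    using curve_onto[OF r x(1-3)] x(4) unfolding ramification_form_def block_quadric_def by blast
  obtain z where z: "av z = a" using av_onto[OF a(1)] by blast
  then have "z \<noteq> 0" using a(2) av_eq_0_iff by blast
  moreover have "yy x m = (c * d) *s yc z" unfolding yc_def z a(5,6) by (simp add: yy_smult vector_smult_assoc mult_ac)
  ultimately have "s = nu (ppoint z)" using a(3,4) by (simp add: x(5) nu_ppoint ppoint_scale)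
  then show "s \<in> nu ` proj_space" using \<open>z \<noteq> 0\<close> unfolding proj_space_def by blast
qed

text \<open>
  A product of two forms that vanishes on the curve pulls back to a product that vanishes on the
  line, so that one of the factors vanishes on the curve.
\<close>

lemma irreducible_image: "irreducible_subset (nu ` proj_space)"
  unfolding irreducible_subset_def
proof (intro conjI allI impI)
  have "ppoint (axis 1 1 :: complex^2) \<in> proj_space" unfolding proj_space_def by (auto simp: vec2_eq_iff axis_def)
  then show "nu ` proj_space \<noteq> {}" by blast
  fix Z Z' assume *: "zariski_closed Z \<and> zariski_closed Z' \<and> nu ` proj_space \<subseteq> Z \<union> Z'"
  obtain Q where Q: "Q \<subseteq> (\<Union>d. forms d)" "Z = {s \<in> proj_space. \<forall>f\<in>Q. \<forall>v\<in>s. f v = 0}" using * unfolding zariski_closed_def by blast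
  obtain Q' where Q': "Q' \<subseteq> (\<Union>d. forms d)" "Z' = {s \<in> proj_space. \<forall>f\<in>Q'. \<forall>v\<in>s. f v = 0}" using * unfolding zariski_closed_def by blast
  have nz: "\<exists>f z d. f \<in> Q \<and> f \<in> forms d \<and> z \<noteq> 0 \<and> f (yc z) \<noteq> 0" 
    if Q: "Q \<subseteq> (\<Union>d. forms d)" "Z = {s \<in> proj_space. \<forall>f\<in>Q. \<forall>v\<in>s. f v = 0}" and n: "\<not> nu ` proj_space \<subseteq> Z" for Q Z
  proof -
    obtain z where z: "z \<noteq> 0" "ppoint (yc z) \<notin> Z" using n by (metis image_subsetI nu_ppoint proj_space_cases)
    moreover have "ppoint (yc z) \<in> proj_space" unfolding proj_space_def using yc_nonzero[OF z(1)] by blast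
    ultimately obtain f a where f: "f \<in> Q" "f (a *s yc z) \<noteq> 0" unfolding Q(2) by (auto simp: mem_ppoint)
    obtain d where d: "f \<in> forms d" using f(1) Q(1) by blast
    then have "f (yc z) \<noteq> 0" using f(2) forms_homogeneous[OF d] by auto
    then show ?thesis using f(1) d z(1) by blast
  qed
  show "nu ` proj_space \<subseteq> Z \<or> nu ` proj_space \<subseteq> Z'"
  proof (rule ccontr)
    assume "\<not> (nu ` proj_space \<subseteq> Z \<or> nu ` proj_space \<subseteq> Z')"
    then obtain f z d f' z' d' where f: "f \<in> Q" "f \<in> forms d" "z \<noteq> 0" "f (yc z) \<noteq> 0" "f' \<in> Q'" "f' \<in> forms d'" "z' \<noteq> 0" "f' (yc z') \<noteq> 0"
      using nz[OF Q] nz[OF Q'] by blast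
    have lp: "line_poly (\<lambda>z. f (yc z))" "line_poly (\<lambda>z. f' (yc z))"
      using line_poly_forms[OF forms_compose[OF f(2) forms_yc]] line_poly_forms[OF forms_compose[OF f(6) forms_yc]] by blast+
    obtain w where w: "f (yc w) \<noteq> 0" "f' (yc w) \<noteq> 0" using line_poly_domain[OF lp f(4,8)] by blast
    have "\<exists>w. w \<noteq> 0 \<and> f (yc w) \<noteq> 0 \<and> f' (yc w) \<noteq> 0"
    proof (cases "w = 0")
      case True
      have c: "f (yc u) = f (yc 0)" "f' (yc u) = f' (yc 0)" for u
      proof -
        have y: "yc 0 = 0" using yc_smult[of 0 0] by simp
        have "f (yc 0) = 0 ^ d * f 0" "f' (yc 0) = 0 ^ d' * f' 0"
          using forms_homogeneous[OF f(2), of 0 0] forms_homogeneous[OF f(6), of 0 0] by (simp_all add: y)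
        then have "d = 0" "d' = 0" using w True by (cases d; cases d'; simp)+
        then show "f (yc u) = f (yc 0)" "f' (yc u) = f' (yc 0)"
          using forms_homogeneous[OF f(2), of 0 "yc u"] forms_homogeneous[OF f(6), of 0 "yc u"] by (simp_all add: y)
      qed
      have "f (yc z) \<noteq> 0" "f' (yc z) \<noteq> 0" using c(1)[of z] c(2)[of z] w True by simp_all
      then show ?thesis using f(3) by blast
    qed (use w in blast)
    then obtain w where w: "w \<noteq> 0" "f (yc w) \<noteq> 0" "f' (yc w) \<noteq> 0" by blast
    have "nu (ppoint w) \<in> nu ` proj_space" unfolding proj_space_def using w(1) by blast
    then have "ppoint (yc w) \<in> Z \<union> Z'" using * unfolding nu_ppoint[OF w(1)] by blast
    moreover have "ppoint (yc w) \<notin> Z" unfolding Q(2) using f(1) w(2) ppoint_self[of "yc w"] by blast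
    moreover have "ppoint (yc w) \<notin> Z'" unfolding Q'(2) using f(5) w(3) ppoint_self[of "yc w"] by blast
    ultimately show False by blast
  qed
qed

end

section \<open>Icosahedral symmetries and the pullback of sections\<close>

definition curve_u :: "complex \<Rightarrow> complex^2 \<Rightarrow> complex^3"
  where "curve_u r z = lin r (cx r (av z)) (cm r (av z))"
definition curve_v :: "complex \<Rightarrow> complex^2 \<Rightarrow> complex^3"
  where "curve_v r z = lin (1 - r) (cx r (av z)) (cm r (av z))"

text \<open>
  \<open>S\<close> and \<open>T\<close> act on the two blocks by orthogonal matrices, preserve the surface together with
  their inverses, and lift to a linear map \<open>M\<close> of the line that is compatible with the
  parametrisations of the conic and of the curve.
\<close>

definition icosahedral :: "complex \<Rightarrow> complex^3^3 \<Rightarrow> complex^3^3 \<Rightarrow> bool"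
  where "icosahedral r S T \<longleftrightarrow> transpose S ** S = mat 1 \<and> transpose T ** T = mat 1 \<and> det S = 1 \<and>
    (\<forall>u v. quads r u v \<longrightarrow> quads r (S *v u) (T *v v)) \<and>
    (\<forall>u v. quads r u v \<longrightarrow> quads r (transpose S *v u) (transpose T *v v)) \<and>
    (\<exists>M c d. invertible M \<and> c \<noteq> 0 \<and> d \<noteq> 0 \<and> (\<forall>z. av (M *v z) = d *s (T *v av z) \<and> curve_u r (M *v z) = c *s (S *v curve_u r z) \<and> curve_v r (M *v z) = c *s (T *v curve_v r z)))"

lemma orthogonal_right:
  fixes S :: "complex^'n^'n"
  shows "transpose S ** S = mat 1 \<Longrightarrow> S ** transpose S = mat 1"
  by (simp add: matrix_left_right_inverse)

lemma icosahedral_mult: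
  assumes "icosahedral r S T" "icosahedral r S' T'"
  shows "icosahedral r (S ** S') (T ** T')"
proof -
  have o: "transpose (A ** B) ** (A ** B) = mat 1" if "transpose A ** A = mat 1" "transpose B ** B = mat 1" for A B :: "complex^3^3"
  proof -
    have "transpose (A ** B) ** (A ** B) = transpose B ** (transpose A ** A) ** B"
      by (simp add: matrix_transpose_mul matrix_mul_assoc)
    then show ?thesis using that by simp
  qed
  obtain M c d where M: "invertible M" "c \<noteq> 0" "\<And>z. curve_u r (M *v z) = c *s (S *v curve_u r z)" "\<And>z. curve_v r (M *v z) = c *s (T *v curve_v r z)"
    "d \<noteq> 0" "\<And>z. av (M *v z) = d *s (T *v av z)"
    using assms(1) unfolding icosahedral_def by blast
  obtain M' c' d' where M': "invertible M'" "c' \<noteq> 0" "\<And>z. curve_u r (M' *v z) = c' *s (S' *v curve_u r z)" "\<And>z. curve_v r (M' *v z) = c' *s (T' *v curve_v r z)"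
    "d' \<noteq> 0" "\<And>z. av (M' *v z) = d' *s (T' *v av z)"
    using assms(2) unfolding icosahedral_def by blast
  have "invertible (M ** M') \<and> c * c' \<noteq> 0 \<and> d * d' \<noteq> 0 \<and> (\<forall>z. av ((M ** M') *v z) = (d * d') *s ((T ** T') *v av z) \<and> curve_u r ((M ** M') *v z) = (c * c') *s ((S ** S') *v curve_u r z) \<and> curve_v r ((M ** M') *v z) = (c * c') *s ((T ** T') *v curve_v r z))"
    using M M' invertible_mult[of M M'] by (auto simp: matrix_vector_mul_assoc[symmetric] vector_scalar_commute vector_smult_assoc)
  then have "\<exists>M c d. invertible M \<and> c \<noteq> 0 \<and> d \<noteq> 0 \<and> (\<forall>z. av (M *v z) = d *s ((T ** T') *v av z) \<and> curve_u r (M *v z) = c *s ((S ** S') *v curve_u r z) \<and> curve_v r (M *v z) = c *s ((T ** T') *v curve_v r z))"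
    by blast
  then show ?thesis using assms o unfolding icosahedral_def
    by (auto simp: det_mul matrix_transpose_mul matrix_vector_mul_assoc[symmetric])
qed

lemma icosahedral_transpose:
  assumes "icosahedral r S T"
  shows "icosahedral r (transpose S) (transpose T)"
proof -
  have S: "S ** transpose S = mat 1" "T ** transpose T = mat 1" using assms orthogonal_right unfolding icosahedral_def by blast+
  obtain M c d where M: "invertible M" "c \<noteq> 0" "\<And>z. curve_u r (M *v z) = c *s (S *v curve_u r z)" "\<And>z. curve_v r (M *v z) = c *s (T *v curve_v r z)"
    "d \<noteq> 0" "\<And>z. av (M *v z) = d *s (T *v av z)"
    using assms unfolding icosahedral_def by blast
  obtain M' where M': "M ** M' = mat 1" "M' ** M = mat 1" using M(1) unfolding invertible_def by blast
  have MM: "M *v (M' *v z) = z" for z by (simp add: matrix_vector_mul_assoc M')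
  have tS: "transpose S *v (S *v u) = u" and tT: "transpose T *v (T *v u) = u" for u
    using assms unfolding icosahedral_def by (simp_all add: matrix_vector_mul_assoc)
  then have "curve_u r (M' *v z) = inverse c *s (transpose S *v curve_u r z) \<and> curve_v r (M' *v z) = inverse c *s (transpose T *v curve_v r z)" for z
    using M(2) M(3)[of "M' *v z"] M(4)[of "M' *v z"] unfolding MM by (simp add: vector_scalar_commute vector_smult_assoc)
  moreover have "av (M' *v z) = inverse d *s (transpose T *v av z)" for z
    using M(5) M(6)[of "M' *v z"] tT unfolding MM by (simp add: vector_scalar_commute vector_smult_assoc)
  moreover have "invertible M'" using M' unfolding invertible_def by blast
  ultimately have "\<exists>M c d. invertible M \<and> c \<noteq> 0 \<and> d \<noteq> 0 \<and> (\<forall>z. av (M *v z) = d *s (transpose T *v av z) \<and> curve_u r (M *v z) = c *s (transpose S *v curve_u r z) \<and> curve_v r (M *v z) = c *s (transpose T *v curve_v r z))"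
    using M(2,5) by (intro exI[of _ M'] exI[of _ "inverse c"] exI[of _ "inverse d"]) auto
  then show ?thesis using assms S unfolding icosahedral_def by (auto simp: det_transpose)
qed

lemma icosahedral_one: "icosahedral r (mat 1) (mat 1)"
  unfolding icosahedral_def
  by (auto simp: transpose_mat invertible_def intro!: exI[of _ "mat 1 :: complex^2^2"] exI[of _ "1::complex"] exI[of _ "1::complex"])

lemma golden_conj: "r * r = r + 1 \<Longrightarrow> (1 - r) * (1 - r) = (1 - r) + (1::complex)"
  by (simp add: algebra_simps)

lemma curve_scaled:
  assumes "av (M *v z) = c *s a"
  shows "curve_u r (M *v z) = c ^ 5 *s lin r (cx r a) (cm r a)" "curve_v r (M *v z) = c ^ 5 *s lin (1 - r) (cx r a) (cm r a)"
  unfolding curve_u_def curve_v_def assms cx_smult cm_smult lin_smult_left lin_smult_right vector_smult_assoc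
  by (simp_all flip: power_add)

definition rot5_lift :: "complex \<Rightarrow> complex^2^2"
  where "rot5_lift r = vector [vector [2 - r, 1 + \<i> * (r - 1)], vector [-1 + \<i> * (r - 1), 2 - r]]"

lemma av_rot5:
  assumes r: "r * r = r + 1"
  shows "av (rot5_lift r *v z) = (8 - 4 * r) *s (rot5 (1 - r) *v av z)"
proof -
  have i: "\<i> * \<i> = -1" by simp
  have M: "(rot5_lift r *v z) $ 1 = (2 - r) * z$1 + (1 + \<i> * (r - 1)) * z$2" "(rot5_lift r *v z) $ 2 = (-1 + \<i> * (r - 1)) * z$1 + (2 - r) * z$2"
    by (simp_all add: rot5_lift_def matrix_vector_mult_def sum_2)
  define j where "j = \<i>"
  have j: "j * j = -1" by (simp add: j_def)
  have h: "(8 - 4 * r) * (x / 2) = (4 - 2 * r) * x" for x :: complex by (simp add: field_simps)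
  show ?thesis unfolding vec3_eq_iff vector_smult_component rot5_mult h
    unfolding av_def vector_3 M j_def[symmetric] using r j apply (intro conjI)
    subgoal by Groebner_Basis.algebra
    subgoal by Groebner_Basis.algebra
    subgoal by Groebner_Basis.algebra
    done
qed

lemma quads_rot5_transpose:
  assumes r: "r * r = r + 1" and q: "quads r u v"
  shows "quads r (transpose (rot5 r) *v u) (transpose (rot5 (1 - r)) *v v)"
proof -
  have t: "(transpose (rot5 s) *v u)$1 = ((s-1)*u$1 + u$2 + s*u$3)/2" "(transpose (rot5 s) *v u)$2 = (- u$1 + s*u$2 + (1-s)*u$3)/2"
    "(transpose (rot5 s) *v u)$3 = (- s*u$1+(1-s)*u$2+u$3)/2" for u s
    by (simp_all add: rot5_def transpose_def matrix_vector_mult_def sum_3 field_simps)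
  define a where "a = u$1" define b where "b = u$2" define c where "c = u$3"
  define d where "d = v$1" define e where "e = v$2" define f where "f = v$3"
  define h where "h = (1/2::complex)"
  have hh: "x / 2 = h * x" for x by (simp add: h_def)
  note q' = q[unfolded quads_def a_def[symmetric] b_def[symmetric] c_def[symmetric] d_def[symmetric] e_def[symmetric] f_def[symmetric]]
  show ?thesis unfolding quads_def t hh
    unfolding a_def[symmetric] b_def[symmetric] c_def[symmetric] d_def[symmetric] e_def[symmetric] f_def[symmetric]
    using q' r apply (intro conjI)
    subgoal by Groebner_Basis.algebra
    subgoal by Groebner_Basis.algebra
    subgoal by Groebner_Basis.algebra
    subgoal by Groebner_Basis.algebra
    subgoal by Groebner_Basis.algebra
    done
qed

lemma icosahedral_rot5:
  assumes r: "r * r = r + 1"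
  shows "icosahedral r (rot5 r) (rot5 (1 - r))"
proof -
  have nz: "8 - 4 * r \<noteq> 0" using r by Groebner_Basis.algebra
  moreover have "det (rot5_lift r) = 8 - 4 * r"
  proof -
    define j where "j = \<i>"
    have j: "j * j = -1" by (simp add: j_def)
    show ?thesis unfolding det_2 rot5_lift_def vector_2 j_def[symmetric] using r j by Groebner_Basis.algebra
  qed
  ultimately have "invertible (rot5_lift r)" "(8 - 4 * r) ^ 5 \<noteq> 0" by (simp_all add: invertible_det_nz)
  moreover have "curve_u r (rot5_lift r *v z) = (8 - 4 * r) ^ 5 *s (rot5 r *v curve_u r z)"
    "curve_v r (rot5_lift r *v z) = (8 - 4 * r) ^ 5 *s (rot5 (1 - r) *v curve_v r z)" for z
    unfolding curve_scaled[OF av_rot5[OF r]] curve_rot5[OF r conic_av] unfolding curve_u_def curve_v_def by simp_all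
  ultimately show ?thesis
    unfolding icosahedral_def using orth_rot5[OF r] orth_rot5[OF golden_conj[OF r]] det_rot5[OF r] quads_rot5[OF r] quads_rot5_transpose[OF r] nz av_rot5[OF r]
    by blast
qed

definition rot3 :: "complex^3^3"
  where "rot3 = vector [vector [0, 1, 0], vector [0, 0, 1], vector [1, 0, 0]]"
definition rot2 :: "complex^3^3"
  where "rot2 = vector [vector [1, 0, 0], vector [0, -1, 0], vector [0, 0, -1]]"

lemma rot3_mult: "rot3 *v u = vector [u$2, u$3, u$1]" "transpose rot3 *v u = vector [u$3, u$1, u$2]"
  by (simp_all add: rot3_def vec3_eq_iff matrix_vector_mult_def transpose_def sum_3)

lemma rot2_mult: "rot2 *v u = vector [u$1, - u$2, - u$3]" "transpose rot2 *v u = vector [u$1, - u$2, - u$3]"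
  by (simp_all add: rot2_def vec3_eq_iff matrix_vector_mult_def transpose_def sum_3)

lemma icosahedral_rot3: "icosahedral r rot3 rot3"
proof -
  define M where "M = (vector [vector [1 + \<i>, -1 - \<i>], vector [1 - \<i>, 1 - \<i>]] :: complex^2^2)"
  define j where "j = \<i>"
  have j: "j * j = -1" by (simp add: j_def)
  have M1: "(M *v z) $ 1 = (1 + j) * z$1 + (-1 - j) * z$2" "(M *v z) $ 2 = (1 - j) * z$1 + (1 - j) * z$2" for z
    by (simp_all add: M_def j_def matrix_vector_mult_def sum_2)
  have av: "av (M *v z) = 4 *s (rot3 *v av z)" for z
    unfolding vec3_eq_iff vector_smult_component rot3_mult av_def vector_3 M1 j_def[symmetric] using j by (intro conjI; Groebner_Basis.algebra)
  have "det M = 4" unfolding M_def det_2 vector_2 j_def[symmetric] using j by Groebner_Basis.algebra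
  then have "invertible M" by (simp add: invertible_det_nz)
  moreover have "lin s (cx r (rot3 *v a)) (cm r (rot3 *v a)) = rot3 *v lin s (cx r a) (cm r a)" for s a
    unfolding lin_curve rot3_mult vec3_eq_iff vector_3 by simp
  then have "curve_u r (M *v z) = 4 ^ 5 *s (rot3 *v curve_u r z)" "curve_v r (M *v z) = 4 ^ 5 *s (rot3 *v curve_v r z)" for z
    unfolding curve_scaled[OF av] unfolding curve_u_def curve_v_def by simp_all
  moreover have "(4::complex) ^ 5 \<noteq> 0" "(4::complex) \<noteq> 0" by simp_all
  moreover have "transpose rot3 ** rot3 = mat 1" 
    by (simp add: rot3_def vec_eq_iff forall_3 matrix_matrix_mult_def transpose_def mat_def sum_3)
  moreover have "det rot3 = 1" by (simp add: rot3_def det_3)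
  moreover have "quads r (rot3 *v u) (rot3 *v v)" "quads r (transpose rot3 *v u) (transpose rot3 *v v)" if "quads r u v" for u v
    using that unfolding quads_def rot3_mult vector_3 by (intro conjI; Groebner_Basis.algebra)+
  ultimately show ?thesis unfolding icosahedral_def using av by blast
qed

lemma icosahedral_rot2: "icosahedral r rot2 rot2"
proof -
  define M where "M = (vector [vector [\<i>, 0], vector [0, - \<i>]] :: complex^2^2)"
  define j where "j = \<i>"
  have j: "j * j = -1" by (simp add: j_def)
  have M1: "(M *v z) $ 1 = j * z$1" "(M *v z) $ 2 = - j * z$2" for z
    by (simp_all add: M_def j_def matrix_vector_mult_def sum_2)
  have av: "av (M *v z) = 1 *s (rot2 *v av z)" for z
    unfolding vec3_eq_iff vector_smult_component rot2_mult av_def vector_3 M1 j_def[symmetric] using j by (intro conjI; Groebner_Basis.algebra)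
  have "det M = 1" unfolding M_def det_2 vector_2 j_def[symmetric] using j by Groebner_Basis.algebra
  then have "invertible M" by (simp add: invertible_det_nz)
  moreover have "lin s (cx r (rot2 *v a)) (cm r (rot2 *v a)) = rot2 *v lin s (cx r a) (cm r a)" for s a
    unfolding lin_curve rot2_mult vec3_eq_iff vector_3 cu_even by simp
  then have "curve_u r (M *v z) = 1 ^ 5 *s (rot2 *v curve_u r z)" "curve_v r (M *v z) = 1 ^ 5 *s (rot2 *v curve_v r z)" for z
    unfolding curve_scaled[OF av] unfolding curve_u_def curve_v_def by simp_all
  moreover have "(1::complex) ^ 5 \<noteq> 0" "(1::complex) \<noteq> 0" by simp_all
  moreover have "transpose rot2 ** rot2 = mat 1" 
    by (simp add: rot2_def vec_eq_iff forall_3 matrix_matrix_mult_def transpose_def mat_def sum_3)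
  moreover have "det rot2 = 1" by (simp add: rot2_def det_3)
  moreover have "quads r (rot2 *v u) (rot2 *v v)" "quads r (transpose rot2 *v u) (transpose rot2 *v v)" if "quads r u v" for u v
    using that unfolding quads_def rot2_mult vector_3 by (intro conjI; Groebner_Basis.algebra)+
  ultimately show ?thesis unfolding icosahedral_def using av by blast
qed

lemma nsq_orthogonal:
  assumes "transpose S ** S = mat 1" shows "nsq (S *v u) = nsq u"
proof -
  have e: "(transpose S ** S) $ i $ j = (if i = j then 1 else 0)" for i j unfolding assms by (simp add: mat_def)
  note ee = e[of 1 1] e[of 1 2] e[of 1 3] e[of 2 2] e[of 2 3] e[of 3 3]
  show ?thesis
    using ee unfolding nsq_def matrix_vector_mult_def matrix_matrix_mult_def transpose_def vec_lambda_beta sum_3 by simp Groebner_Basis.algebra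
qed

lemma bounded_linear_matrix: "bounded_linear (\<lambda>x. (A :: complex^'n^'m) *v x)"
proof -
  have "linear (\<lambda>x. A *v x)"
    by (rule linearI) (simp_all add: vec_eq_iff matrix_vector_mult_def scaleR_sum_right sum.distrib distrib_left)
  then show ?thesis by (simp add: linear_conv_bounded_linear)
qed

lemmas has_derivative_matrix = bounded_linear.has_derivative[OF bounded_linear_matrix]

text \<open>
  Differentiating a relation of proportionality gives the same relation up to a multiple of the
  vector itself, whether or not the factor is differentiable.
\<close>

lemma proportional_derivative:
  fixes A B :: "'a::real_normed_vector \<Rightarrow> complex^3"
  assumes A: "(A has_derivative A') (at x)" and B: "(B has_derivative B') (at x)"
    and S: "open S" "x \<in> S" and pr: "\<And>u. u \<in> S \<Longrightarrow> \<exists>m. A u = m *s B u"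
    and m: "A x = m *s B x" and nz: "B x \<noteq> 0"
  shows "\<exists>l. A' v = m *s B' v + l *s B x"
proof -
  obtain i where i: "B x $ i \<noteq> 0" using nz by (auto simp: vec_eq_iff)
  define l where "l = (A' v $ i - m * B' v $ i) / B x $ i"
  have "A' v $ j = m * B' v $ j + l * B x $ j" for j
  proof -
    have nth: "((\<lambda>u. A u $ k) has_derivative (\<lambda>v. A' v $ k)) (at x)" "((\<lambda>u. B u $ k) has_derivative (\<lambda>v. B' v $ k)) (at x)" for k
      by (rule bounded_linear.has_derivative[OF bounded_linear_vec_nth] A B)+
    have d1: "((\<lambda>u. A u $ i * B u $ j - A u $ j * B u $ i) has_derivative
       (\<lambda>v. (A x $ i * B' v $ j + A' v $ i * B x $ j) - (A x $ j * B' v $ i + A' v $ j * B x $ i))) (at x)"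
      by (intro has_derivative_diff has_derivative_mult nth)
    have d2: "((\<lambda>u. A u $ i * B u $ j - A u $ j * B u $ i) has_derivative (\<lambda>v. 0)) (at x)"
    proof (rule has_derivative_transform_within_open[OF _ S])
      show "((\<lambda>u. 0 :: complex) has_derivative (\<lambda>v. 0)) (at x)" by (rule has_derivative_const)
      fix u assume "u \<in> S"
      then obtain m where "A u = m *s B u" using pr by blast
      then show "0 = A u $ i * B u $ j - A u $ j * B u $ i" by (simp add: mult_ac)
    qed
    have "A x $ i * B' v $ j + A' v $ i * B x $ j - (A x $ j * B' v $ i + A' v $ j * B x $ i) = 0"
      by (rule fun_cong[OF has_derivative_unique[OF d1 d2]])
    then have e: "m * B x $ i * B' v $ j + A' v $ i * B x $ j - (m * B x $ j * B' v $ i + A' v $ j * B x $ i) = 0"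
      by (simp add: m)
    have "B x $ i * (A' v $ j) = B x $ i * (m * B' v $ j) + (A' v $ i - m * B' v $ i) * B x $ j"
      using e by Groebner_Basis.algebra
    then show ?thesis unfolding l_def using i by (simp add: field_simps)
  qed
  then show ?thesis by (intro exI[of _ l]) (simp add: vec_eq_iff)
qed

text \<open>
  By Euler's relation this is the formula that compares the 2-forms on both planes.
\<close>

lemma det_cubic:
  assumes r: "r * r = r + 1"
  shows "3 * det (vector [cubic_map r x, cubic_deriv r x *v v, cubic_deriv r x *v w] :: complex^3^3)
    = sextic r x * det (vector [x, v, w] :: complex^3^3)"
proof -
  have "3 * det (vector [cubic_map r x, cubic_deriv r x *v v, cubic_deriv r x *v w] :: complex^3^3)
     = det (vector [3 *s cubic_map r x, cubic_deriv r x *v v, cubic_deriv r x *v w] :: complex^3^3)"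
    by (simp add: det_3 algebra_simps)
  also have "\<dots> = sextic r x * det (vector [x, v, w] :: complex^3^3)"
    unfolding euler_cubic[symmetric] det_matrix_rows det_cubic_deriv[OF r] ..
  finally show ?thesis .
qed

lemma sextic_equivariant:
  assumes "transpose S ** S = mat 1" "transpose T ** T = mat 1"
    and "cubic_map r y = m *s (S *v cubic_map r x)" "cubic_map (1 - r) y = m *s (T *v cubic_map (1 - r) x)"
  shows "sextic r y = m\<^sup>2 * sextic r x"
  unfolding sextic_def assms(3,4) nsq_smult nsq_orthogonal[OF assms(1)] nsq_orthogonal[OF assms(2)]
  by (simp add: algebra_simps)

text \<open>
  The 2-form of the target plane, transported along \<open>H\<close> and along the cubic map, gains the factor
  \<open>m^3\<close>, of which \<open>m^2\<close> is accounted for by the sextic.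
\<close>

lemma jacobian_cocycle:
  assumes r: "r * r = r + 1" and S: "transpose S ** S = mat 1" "transpose T ** T = mat 1" "det S = 1"
    and H: "(H has_derivative (\<lambda>v. K *v v)) (at x)" and O: "open O'" "x \<in> O'"
    and pr: "\<And>u. u \<in> O' \<Longrightarrow> \<exists>m. cubic_map r (H u) = m *s (S *v cubic_map r u)"
    and m: "cubic_map r (H x) = m *s (S *v cubic_map r x)" "cubic_map (1 - r) (H x) = m *s (T *v cubic_map (1 - r) x)"
    and m0: "m \<noteq> 0" and nz: "sextic r x \<noteq> 0"
  shows "det (vector [H x, K *v v, K *v w] :: complex^3^3) = m * det (vector [x, v, w] :: complex^3^3)"
proof -
  define B where "B = S *v cubic_map r x"
  define B' where "B' = (\<lambda>v. S *v (cubic_deriv r x *v v))"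
  define A' where "A' = (\<lambda>v. cubic_deriv r (H x) *v (K *v v))"
  have dA: "((\<lambda>u. cubic_map r (H u)) has_derivative A') (at x)"
    unfolding A'_def by (rule has_derivative_compose[OF H cubic_map_has_derivative])
  have dB: "((\<lambda>u. S *v cubic_map r u) has_derivative B') (at x)"
    unfolding B'_def by (rule has_derivative_matrix[OF cubic_map_has_derivative])
  have dd: "3 * det (vector [B, B' v, B' w] :: complex^3^3) = sextic r x * det (vector [x, v, w] :: complex^3^3)"
    unfolding B_def B'_def det_matrix_rows S(3) using det_cubic[OF r] by simp
  have B0: "B \<noteq> 0" 
  proof
    assume "B = 0"
    then have "transpose S *v (S *v cubic_map r x) = 0" by (simp add: B_def)
    then have z: "cubic_map r x = 0" by (simp add: matrix_vector_mul_assoc S)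
    have "sextic r x * det (vector [x, v, w] :: complex^3^3) = 0" for v w
      using det_cubic[OF r, of x v w] unfolding z by (simp add: det_3)
    then have d: "det (vector [x, v, w] :: complex^3^3) = 0" for v w using nz by simp
    have "x = 0" using d[of "axis 2 1" "axis 3 1"] d[of "axis 3 1" "axis 1 1"] d[of "axis 1 1" "axis 2 1"]
      unfolding vec3_eq_iff by (simp add: det_3 axis_def)
    then show False using nz by (simp add: sextic_def nsq_def cubic_map_nth)
  qed
  obtain l where l: "A' v = m *s B' v + l *s B" using proportional_derivative[OF dA dB O pr m(1), of v] B0 unfolding B_def by blast
  obtain k where k: "A' w = m *s B' w + k *s B" using proportional_derivative[OF dA dB O pr m(1), of w] B0 unfolding B_def by blast
  have "sextic r (H x) * det (vector [H x, K *v v, K *v w] :: complex^3^3) = 3 * det (vector [m *s B, A' v, A' w] :: complex^3^3)"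
    unfolding det_cubic[OF r, symmetric] A'_def B_def m(1) ..
  also have "\<dots> = 3 * (m ^ 3 * det (vector [B, B' v, B' w] :: complex^3^3))"
    unfolding l k by (simp add: det_3 power3_eq_cube algebra_simps)
  also have "\<dots> = m ^ 3 * (sextic r x * det (vector [x, v, w] :: complex^3^3))" using dd by (simp add: algebra_simps)
  finally have "m\<^sup>2 * sextic r x * det (vector [H x, K *v v, K *v w] :: complex^3^3) = m\<^sup>2 * sextic r x * (m * det (vector [x, v, w] :: complex^3^3))"
    unfolding sextic_equivariant[OF S(1,2) m] by (simp add: power3_eq_cube power2_eq_square algebra_simps)
  then show ?thesis using m0 nz by simp
qed


text \<open>
  A column of the rank one matrix of the transformed point. It is a lift of the automorphism to
  the plane wherever it is not a centre, and it is polynomial of degree three.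
\<close>

definition lift :: "complex \<Rightarrow> complex^3^3 \<Rightarrow> complex^3^3 \<Rightarrow> 3 \<Rightarrow> complex^3 \<Rightarrow> complex^3"
  where "lift r S T j x = (\<chi> i. rank_one_entry r (S *v cubic_map r x) (T *v cubic_map (1 - r) x) $ i $ j)"

definition lift_deriv :: "complex \<Rightarrow> complex^3^3 \<Rightarrow> complex^3^3 \<Rightarrow> 3 \<Rightarrow> complex^3 \<Rightarrow> complex^3^3"
  where "lift_deriv r S T j x = (\<chi> i k. rank_one_entry r (\<chi> i. 1) 0 $ i $ j * (S ** cubic_deriv r x) $ i $ k
     + rank_one_entry r 0 (\<chi> i. 1) $ i $ j * (T ** cubic_deriv (1 - r) x) $ i $ k)"

lemma rank_one_entry_diagonal: "rank_one_entry r u v $ i $ j = rank_one_entry r (\<chi> i. 1) 0 $ i $ j * u $ i + rank_one_entry r 0 (\<chi> i. 1) $ i $ j * v $ i"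
proof -
  have "\<forall>i j. rank_one_entry r u v $ i $ j = rank_one_entry r (\<chi> i. 1) 0 $ i $ j * u $ i + rank_one_entry r 0 (\<chi> i. 1) $ i $ j * v $ i"
    unfolding forall_3 rank_one_entry_def vector_3 by (simp add: algebra_simps)
  then show ?thesis by blast
qed

lemma rank_one_entry_smult: "rank_one_entry r (a *s u) (a *s v) $ i $ j = a * rank_one_entry r u v $ i $ j"
  unfolding rank_one_entry_diagonal[of r "a *s u"] rank_one_entry_diagonal[of r u] by (simp add: algebra_simps)

lemma lift_has_derivative: "(lift r S T j has_derivative (\<lambda>v. lift_deriv r S T j x *v v)) (at x)"
proof (rule has_derivative_vec3)
  fix i
  let ?c = "rank_one_entry r (\<chi> i. 1) 0 $ i $ j" and ?d = "rank_one_entry r 0 (\<chi> i. 1) $ i $ j"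
  have "((\<lambda>x. (A *v cubic_map s x) $ i) has_derivative (\<lambda>v. (A *v (cubic_deriv s x *v v)) $ i)) (at x)" for A :: "complex^3^3" and s
    by (rule bounded_linear.has_derivative[OF bounded_linear_vec_nth has_derivative_matrix[OF cubic_map_has_derivative]])
  then have "((\<lambda>x. ?c * (S *v cubic_map r x) $ i + ?d * (T *v cubic_map (1 - r) x) $ i) has_derivative
    (\<lambda>v. ?c * (S *v (cubic_deriv r x *v v)) $ i + ?d * (T *v (cubic_deriv (1 - r) x *v v)) $ i)) (at x)"
    by (intro has_derivative_add has_derivative_mult_right)
  moreover have "lift r S T j x $ i = ?c * (S *v cubic_map r x) $ i + ?d * (T *v cubic_map (1 - r) x) $ i" for x
    unfolding lift_def by (simp add: rank_one_entry_diagonal[of r "S *v _"])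
  moreover have "(lift_deriv r S T j x *v v) $ i = ?c * (S *v (cubic_deriv r x *v v)) $ i + ?d * (T *v (cubic_deriv (1 - r) x *v v)) $ i" for v
    unfolding matrix_vector_mul_assoc lift_deriv_def matrix_vector_mult_def[of "\<chi> i k. _"] vec_lambda_beta
    by (simp add: matrix_vector_mult_def sum_3 algebra_simps)
  ultimately show "((\<lambda>x. lift r S T j x $ i) has_derivative (\<lambda>v. (lift_deriv r S T j x *v v) $ i)) (at x)" by simp
qed

lemma lift_property:
  assumes r: "r * r = r + 1" and g: "icosahedral r S T"
  shows "cubic_map r (lift r S T j x) = ((2 * r - 1) * kap (lift r S T j x) $ j) *s (S *v cubic_map r x)"
    "cubic_map (1 - r) (lift r S T j x) = ((2 * r - 1) * kap (lift r S T j x) $ j) *s (T *v cubic_map (1 - r) x)"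
proof -
  have "quads r (cubic_map r x) (cubic_map (1 - r) x)"
    unfolding cubic_map_def by (rule quads_lin[OF r incid_kap])
  then have "quads r (S *v cubic_map r x) (T *v cubic_map (1 - r) x)" using g unfolding icosahedral_def by blast
  then obtain y m where y: "incid y m" "S *v cubic_map r x = lin r y m" "T *v cubic_map (1 - r) x = lin (1 - r) y m"
    using quads_imp_incid[OF r] by blast
  define s where "s = 2 * r - 1"
  have s0: "s \<noteq> 0" unfolding s_def by (rule sqrt5_nonzero[OF r])
  have l: "lift r S T j x = s *s (m $ j *s y)"
    unfolding lift_def y(2,3) rank_one_entry_lin[OF r y(1)] by (simp add: vec_eq_iff s_def algebra_simps)
  have "cubic_map q (lift r S T j x) = (s * kap (lift r S T j x) $ j) *s lin q y m" for q
  proof -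
    have "cubic_map q (lift r S T j x) = s ^ 3 *s cubic_map q (m $ j *s y)" unfolding l by (rule cubic_map_smult)
    also have "\<dots> = s ^ 3 *s (kap (m $ j *s y) $ j *s lin q y m)" unfolding cubic_map_def lin_kap_scaled[OF y(1)] ..
    also have "\<dots> = (s * kap (lift r S T j x) $ j) *s lin q y m"
      unfolding l kap_smult[of s] unfolding vector_smult_component vector_smult_assoc by (simp add: power3_eq_cube power2_eq_square mult_ac)
    finally show ?thesis .
  qed
  then show "cubic_map r (lift r S T j x) = ((2 * r - 1) * kap (lift r S T j x) $ j) *s (S *v cubic_map r x)"
    "cubic_map (1 - r) (lift r S T j x) = ((2 * r - 1) * kap (lift r S T j x) $ j) *s (T *v cubic_map (1 - r) x)"
    unfolding y(2,3) s_def by blast+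
qed

lemma lift_of_multiple:
  assumes r: "r * r = r + 1"
    and "S *v cubic_map r x = m *s cubic_map r y" "T *v cubic_map (1 - r) x = m *s cubic_map (1 - r) y"
  shows "lift r S T j x = (m * (2 * r - 1) * kap y $ j) *s y"
proof -
  have "rank_one_entry r (cubic_map r y) (cubic_map (1 - r) y) $ i $ j = (2 * r - 1) * (y $ i * kap y $ j)" for i
    unfolding cubic_map_def by (rule rank_one_entry_lin[OF r incid_kap])
  then show ?thesis unfolding vec_eq_iff lift_def assms(2,3) vec_lambda_beta rank_one_entry_smult by (simp add: mult_ac)
qed

context split_coords
begin

definition act :: "complex^3^3 \<Rightarrow> complex^3^3 \<Rightarrow> complex^6^6"
  where "act S T = U' ** S ** U + V' ** T ** V"

lemma act_mult: "act S T *v w = pt (S *v (U *v w)) (T *v (V *v w))"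
  by (simp add: act_def pt_def matrix_vector_mult_add_rdistrib matrix_vector_mul_assoc[symmetric])

lemma U_act: "U *v (act S T *v w) = S *v (U *v w)" and V_act: "V *v (act S T *v w) = T *v (V *v w)"
  by (simp_all add: act_mult U_pt V_pt)

lemma yc_pt: "yc z = pt (curve_u r z) (curve_v r z)"
  by (simp add: yc_def yy_def curve_u_def curve_v_def)

lemma eq_by_UV: "U *v w = U *v w' \<Longrightarrow> V *v w = V *v w' \<Longrightarrow> w = w'"
  by (metis pt_UV)

lemma b_off_nonzero: "kap x \<noteq> 0 \<Longrightarrow> b (L *v x) \<noteq> 0"
  unfolding b_yy yy_eq_0_iff[OF incid_kap] by (auto simp: kap_def vec3_eq_iff)

lemma lift_b:
  assumes g: "icosahedral r S T"
  shows "b (L *v lift r S T j x) = ((2 * r - 1) * kap (lift r S T j x) $ j) *s (act S T *v b (L *v x))"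
  by (rule eq_by_UV) (simp_all add: U_act V_act bU bV lift_property[OF r g] vector_scalar_commute)

lemma open_kap: "open {u. kap (Li *v u) \<noteq> 0}" "open {u. kap (lift r S T j (Li *v u)) \<noteq> 0}"
proof -
  have k: "continuous_on UNIV kap"
  proof -
    have "\<forall>i. continuous_on UNIV (\<lambda>x. kap x $ i)"
      unfolding forall_3 kap_def vector_3 by (intro conjI continuous_intros)
    then show ?thesis using continuous_on_vec_lambda[of UNIV "\<lambda>i x. kap x $ i"] by (simp add: vec_lambda_eta)
  qed
  have l: "continuous_on UNIV (\<lambda>u. Li *v u)"
    by (intro linear_continuous_on bounded_linear_matrix)
  have m: "continuous_on UNIV (lift r S T j)"
    using lift_has_derivative has_derivative_continuous by (metis continuous_at_imp_continuous_on)
  have "open ((\<lambda>u. kap (Li *v u)) -` (- {0}))"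
    by (intro open_vimage continuous_on_compose2[OF k l]) auto
  then show "open {u. kap (Li *v u) \<noteq> 0}" by (simp add: vimage_def)
  have "open ((\<lambda>u. kap (lift r S T j (Li *v u))) -` (- {0}))"
    by (intro open_vimage continuous_on_compose2[OF k continuous_on_compose2[OF m l]]) auto
  then show "open {u. kap (lift r S T j (Li *v u)) \<noteq> 0}" by (simp add: vimage_def)
qed

lemma lift_at:
  assumes g: "icosahedral r S T" and x: "kap x \<noteq> 0" and y: "kap y \<noteq> 0"
    and e: "ppoint (act S T *v b (L *v x)) = ppoint (b (L *v y))"
  shows "\<exists>j. kap (lift r S T j x) \<noteq> 0"
proof -
  obtain m where m: "m \<noteq> 0" "b (L *v y) = m *s (act S T *v b (L *v x))"
    using e ppoint_eq_iff[OF b_off_nonzero[OF y]] by metis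
  have "cubic_map r y = m *s (S *v cubic_map r x)" "cubic_map (1 - r) y = m *s (T *v cubic_map (1 - r) x)"
    using arg_cong[OF m(2), of "\<lambda>w. U *v w"] arg_cong[OF m(2), of "\<lambda>w. V *v w"]
    by (simp_all add: bU bV vector_scalar_commute U_act V_act)
  then have "S *v cubic_map r x = inverse m *s cubic_map r y" "T *v cubic_map (1 - r) x = inverse m *s cubic_map (1 - r) y"
    using m(1) by (simp_all add: vector_smult_assoc)
  note l = lift_of_multiple[OF r this]
  obtain j where "kap y $ j \<noteq> 0" using y by (auto simp: vec_eq_iff)
  then have "kap (lift r S T j x) \<noteq> 0" unfolding l kap_smult using m(1) y sqrt5_nonzero[OF r] by simp
  then show ?thesis ..
qed

end

context ramification_coords
begin

lemma act_on_section:
  assumes g: "icosahedral r S T" and k: "kap (lift r S T j x) \<noteq> 0"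
  shows "act S T *v b (L *v x) = inverse ((2 * r - 1) * kap (lift r S T j x) $ j) *s b (L *v lift r S T j x)"
    "(2 * r - 1) * kap (lift r S T j x) $ j \<noteq> 0"
proof -
  show *: "(2 * r - 1) * kap (lift r S T j x) $ j \<noteq> 0"
    using lift_b[OF g, of j x] b_off_nonzero[OF k] by auto
  show "act S T *v b (L *v x) = inverse ((2 * r - 1) * kap (lift r S T j x) $ j) *s b (L *v lift r S T j x)"
    using * lift_b[OF g, of j x] by (simp add: vector_smult_assoc del: mult_eq_0_iff inverse_mult_distrib)
qed

text \<open>
  The sextic is the value of a quadratic form on the anticanonical coordinates, which is invariant
  under orthogonal blocks; its weight and the Jacobian cocycle cancel.
\<close>

lemma pullback_f:
  assumes g: "icosahedral r S T" and act: "\<And>w. w \<noteq> 0 \<Longrightarrow> ppoint w \<in> del_pezzo p b \<Longrightarrow> \<gamma> (ppoint w) = ppoint (act S T *v w)"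
  shows "pullback p b \<gamma> 2 f f"
  unfolding pullback_def
proof (intro allI impI)
  fix x y assume xy: "off_centres p x \<and> off_centres p y \<and> \<gamma> (ppoint (b x)) = ppoint (b y)"
  define x' where "x' = Li *v x"
  define y' where "y' = Li *v y"
  have x: "x = L *v x'" "y = L *v y'" by (simp_all add: x'_def y'_def L_Li)
  have k: "kap x' \<noteq> 0" "kap y' \<noteq> 0" using xy by (simp_all add: off_centres_iff x'_def y'_def)
  have ga: "\<gamma> (ppoint (b (L *v u))) = ppoint (act S T *v b (L *v u))" if "kap u \<noteq> 0" for u
    by (rule act[OF b_off_nonzero[OF that]]) (use that in \<open>auto simp: del_pezzo_def off_centres_L\<close>)
  have "ppoint (act S T *v b (L *v x')) = ppoint (b (L *v y'))" using xy ga[OF k(1)] by (simp add: x)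
  then obtain j where j: "kap (lift r S T j x') \<noteq> 0" using lift_at[OF g k] by blast
  define G where "G = (\<lambda>u. L *v lift r S T j (Li *v u))"
  define K where "K = lift_deriv r S T j x'"
  define M where "M = L ** K ** Li"
  define O' where "O' = {u. kap (Li *v u) \<noteq> 0} \<inter> {u. kap (lift r S T j (Li *v u)) \<noteq> 0}"
  have "open O'" unfolding O'_def by (intro open_Int open_kap)
  moreover have "x \<in> O'" using k(1) j by (simp add: O'_def x Li_L)
  moreover have "\<forall>u\<in>O'. off_centres p u \<and> off_centres p (G u) \<and> \<gamma> (ppoint (b u)) = ppoint (b (G u))"
  proof
    fix u assume u: "u \<in> O'"
    define u' where "u' = Li *v u"
    have uu: "u = L *v u'" by (simp add: u'_def L_Li)
    have ku: "kap u' \<noteq> 0" "kap (lift r S T j u') \<noteq> 0" using u by (simp_all add: O'_def u'_def)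
    have "ppoint (act S T *v b u) = ppoint (b (G u))"
      unfolding G_def u'_def[symmetric] using act_on_section[OF g ku(2)] by (simp add: uu ppoint_scale)
    then show "off_centres p u \<and> off_centres p (G u) \<and> \<gamma> (ppoint (b u)) = ppoint (b (G u))"
      using ku ga[OF ku(1)] unfolding uu by (simp add: off_centres_L G_def Li_L)
  qed
  moreover have "(G has_derivative (\<lambda>v. M *v v)) (at x)"
  proof -
    have "((\<lambda>u. lift r S T j (Li *v u)) has_derivative (\<lambda>v. K *v (Li *v v))) (at x)"
      unfolding K_def x'_def
      by (rule has_derivative_compose[OF bounded_linear_imp_has_derivative[OF bounded_linear_matrix] lift_has_derivative])
    then have "(G has_derivative (\<lambda>v. L *v (K *v (Li *v v)))) (at x)" unfolding G_def by (rule has_derivative_matrix)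
    then show ?thesis unfolding M_def by (simp add: matrix_vector_mul_assoc matrix_mul_assoc)
  qed
  moreover have "f x * det (vector [G x, M *v v, M *v w] :: complex^3^3) ^ 2 = f (G x) * det (vector [x, v, w] :: complex^3^3) ^ 2" for v w
  proof -
    let ?H = "lift r S T j" and ?v = "Li *v v" and ?w = "Li *v w"
    define m where "m = (2 * r - 1) * kap (?H x') $ j"
    have orth: "transpose S ** S = mat 1" "transpose T ** T = mat 1" "det S = 1" using g unfolding icosahedral_def by blast+
    note lp = lift_property[OF r g, of j x', folded m_def]
    have fx: "f x = \<kappa> * sextic r x'" and fG: "f (G x) = \<kappa> * (m\<^sup>2 * sextic r x')"
      using sextic_equivariant[OF orth(1,2) lp] f_L by (simp_all add: x G_def Li_L)
    show ?thesis
    proof (cases "sextic r x' = 0")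
      case False
      have "m \<noteq> 0" using act_on_section(2)[OF g j] by (simp add: m_def)
      then have "det (vector [?H x', K *v ?v, K *v ?w] :: complex^3^3) = m * det (vector [x', ?v, ?w] :: complex^3^3)"
        unfolding K_def using lift_property(1)[OF r g]
        by (intro jacobian_cocycle[OF r orth lift_has_derivative open_UNIV UNIV_I _ lp _ False]) blast+
      moreover have "det (vector [G x, M *v v, M *v w] :: complex^3^3) = det L * det (vector [?H x', K *v ?v, K *v ?w] :: complex^3^3)"
        unfolding det_matrix_rows[symmetric] M_def G_def x'_def by (simp add: matrix_vector_mul_assoc matrix_mul_assoc)
      moreover have "det (vector [x, v, w] :: complex^3^3) = det L * det (vector [x', ?v, ?w] :: complex^3^3)"
        unfolding det_matrix_rows[symmetric] by (simp add: x L_Li Li_L)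
      ultimately show ?thesis unfolding fx fG by (simp add: power_mult_distrib)
    qed (simp add: fx fG)
  qed
  ultimately show "\<exists>U G M. open U \<and> x \<in> U \<and>
         (\<forall>u\<in>U. off_centres p u \<and> off_centres p (G u) \<and> \<gamma> (ppoint (b u)) = ppoint (b (G u))) \<and>
         (G has_derivative (\<lambda>v. M *v v)) (at x) \<and>
         (\<forall>v w. f x * det (vector [G x, M *v v, M *v w] :: complex^3^3) ^ 2 =
                f (G x) * det (vector [x, v, w] :: complex^3^3) ^ 2)" by blast
qed

end

section \<open>Automorphisms of the surface given by block matrices\<close>

lemma forms_cubic: "(\<lambda>x. cubic_map s x $ i) \<in> forms 3"
proof -
  have m: "f \<in> forms d \<Longrightarrow> g \<in> forms e \<Longrightarrow> (\<lambda>x. f x * g x) \<in> forms k" if "d + e = k" for f g :: "complex^3 \<Rightarrow> complex" and d e k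
    using forms_mult[of f d g e] that by simp
  have block_quadric: "(\<lambda>x. (x $ i)\<^sup>2) \<in> forms 2" for i :: 3
    using forms_power[OF forms_coord, of i 2] by simp
  have "\<forall>i. (\<lambda>x. cubic_map s x $ i) \<in> forms 3"
    unfolding forall_3 cubic_map_nth by (intro conjI m[of 1 2, OF _ forms_coord] forms_diff forms_cmult block_quadric) simp_all
  then show ?thesis ..
qed

lemma forms_nsq: "(\<And>i. (\<lambda>x. F x $ i) \<in> forms d) \<Longrightarrow> (\<lambda>x. nsq (F x)) \<in> forms (2 * d)"
  unfolding nsq_def by (intro forms_add forms_power)

lemma forms_kap: "(\<And>i. (\<lambda>x. F x $ i) \<in> forms d) \<Longrightarrow> (\<lambda>x. kap (F x) $ i) \<in> forms (2 * d)"
proof -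
  assume F: "\<And>i. (\<lambda>x. F x $ i) \<in> forms d"
  have "\<forall>i. (\<lambda>x. kap (F x) $ i) \<in> forms (2 * d)"
    unfolding forall_3 kap_def vector_3 by (intro conjI forms_diff forms_power F)
  then show ?thesis ..
qed

lemma forms_sextic: "sextic r \<in> forms 6"
  using forms_diff[OF forms_cmult[OF forms_nsq[OF forms_cubic[of "1 - r"]], of 4] forms_nsq[OF forms_cubic[of r]]]
  by (simp add: sextic_def[abs_def])

lemma forms_matrix_vector: "(\<And>i. (\<lambda>x. F x $ i) \<in> forms d) \<Longrightarrow> (\<lambda>x. ((A :: complex^'n^'m) *v F x) $ i) \<in> forms d"
  unfolding matrix_vector_mult_def vec_lambda_beta by (intro forms_sum forms_cmult)

lemma forms_lift: "(\<lambda>x. lift r S T j x $ i) \<in> forms 3"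
  unfolding lift_def vec_lambda_beta rank_one_entry_diagonal[of r "S *v _"]
  by (intro forms_add forms_cmult forms_matrix_vector forms_cubic)

definition polyfun :: "(complex \<Rightarrow> complex) \<Rightarrow> bool"
  where "polyfun h \<longleftrightarrow> (\<exists>q. \<forall>t. h t = poly q t)"

lemma polyfun_intros:
  "polyfun (\<lambda>t. a)" "polyfun (\<lambda>t. t)"
  "polyfun f \<Longrightarrow> polyfun g \<Longrightarrow> polyfun (\<lambda>t. f t + g t)"
  "polyfun f \<Longrightarrow> polyfun g \<Longrightarrow> polyfun (\<lambda>t. f t - g t)"
  "polyfun f \<Longrightarrow> polyfun g \<Longrightarrow> polyfun (\<lambda>t. f t * g t)"
proof -
  show "polyfun (\<lambda>t. a)" unfolding polyfun_def by (intro exI[of _ "[:a:]"]) simp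
  show "polyfun (\<lambda>t. t)" unfolding polyfun_def by (intro exI[of _ "[:0, 1:]"]) simp
  show "polyfun f \<Longrightarrow> polyfun g \<Longrightarrow> polyfun (\<lambda>t. f t + g t)" unfolding polyfun_def by (metis poly_add)
  show "polyfun f \<Longrightarrow> polyfun g \<Longrightarrow> polyfun (\<lambda>t. f t - g t)" unfolding polyfun_def by (metis poly_diff)
  show "polyfun f \<Longrightarrow> polyfun g \<Longrightarrow> polyfun (\<lambda>t. f t * g t)" unfolding polyfun_def by (metis poly_mult)
qed

context split_coords
begin

lemma polyfun_ramification_form:
  "polyfun (\<lambda>t. ramification_form (x + t *s v) (d + t *s e))"
proof -
  have c: "polyfun (\<lambda>t. (y + t *s w) $ i)" for y w :: "complex^3" and i by (simp, intro polyfun_intros)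
  show ?thesis unfolding ramification_form_def block_quadric_def nsq_def lin_def vector_3 power2_eq_square by (intro polyfun_intros c)
qed

lemma forms_b: "(\<lambda>x. b x $ j) \<in> forms 3"
proof -
  have "(\<lambda>y. pt (cubic_map r y) (cubic_map (1 - r) y) $ j) \<in> forms 3"
    unfolding pt_def vector_add_component by (intro forms_add forms_matrix_vector forms_cubic)
  from forms_compose[OF this forms_matrix[of Li]] show ?thesis by (simp add: b_eq)
qed

definition gact :: "complex^3^3 \<Rightarrow> complex^3^3 \<Rightarrow> (complex^6) set \<Rightarrow> (complex^6) set"
  where "gact S T = restrict (\<lambda>s. (\<lambda>w. act S T *v w) ` s) (del_pezzo p b)"

lemma act_compose: "act S T *v (act S' T' *v w) = act (S ** S') (T ** T') *v w"
  by (simp add: act_mult U_pt V_pt matrix_vector_mul_assoc matrix_mul_assoc)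

lemma act_one: "act (mat 1) (mat 1) *v w = w"
  by (simp add: act_mult pt_UV)

lemma act_transpose: "icosahedral r S T \<Longrightarrow> act (transpose S) (transpose T) *v (act S T *v w) = w"
  unfolding act_compose icosahedral_def by (simp add: act_one)

lemma act_nonzero: "icosahedral r S T \<Longrightarrow> w \<noteq> 0 \<Longrightarrow> act S T *v w \<noteq> 0"
  using act_transpose by (metis matrix_vector_mult_0_right)

lemma del_pezzo_proj: "del_pezzo p b \<subseteq> proj_space"
  unfolding del_pezzo_eq proj_space_def by blast

lemma del_pezzo_cases:
  assumes "s \<in> del_pezzo p b" obtains w where "w \<noteq> 0" "s = ppoint w" "quads r (U *v w) (V *v w)"
  using assms unfolding del_pezzo_eq by blast

lemma gact_ppoint: "ppoint w \<in> del_pezzo p b \<Longrightarrow> gact S T (ppoint w) = ppoint (act S T *v w)"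
  by (simp add: gact_def ppoint_matrix)

lemma gact_in:
  assumes g: "icosahedral r S T" and s: "s \<in> del_pezzo p b" shows "gact S T s \<in> del_pezzo p b"
proof -
  obtain w where w: "w \<noteq> 0" "s = ppoint w" "quads r (U *v w) (V *v w)" using del_pezzo_cases[OF s] .
  have "quads r (U *v (act S T *v w)) (V *v (act S T *v w))" using g w(3) unfolding U_act V_act icosahedral_def by blast
  then show ?thesis using gact_ppoint s act_nonzero[OF g w(1)] del_pezzo_ppoint unfolding w(2) by simp
qed

lemma gact_compose:
  assumes g: "icosahedral r S' T'" and s: "s \<in> del_pezzo p b"
  shows "gact S T (gact S' T' s) = gact (S ** S') (T ** T') s"
proof -
  have "(\<lambda>w. act S T *v w) ` (\<lambda>w. act S' T' *v w) ` s = (\<lambda>w. act (S ** S') (T ** T') *v w) ` s"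
    by (simp add: image_image act_compose)
  then show ?thesis using s gact_in[OF g s] by (simp add: gact_def)
qed

lemma gact_one: "s \<in> del_pezzo p b \<Longrightarrow> gact (mat 1) (mat 1) s = s"
  by (simp add: gact_def act_one)

lemma gact_transpose:
  assumes g: "icosahedral r S T" and s: "s \<in> del_pezzo p b"
  shows "gact (transpose S) (transpose T) (gact S T s) = s" "gact S T (gact (transpose S) (transpose T) s) = s"
proof -
  have t: "transpose S ** S = mat 1" "transpose T ** T = mat 1" using g unfolding icosahedral_def by blast+
  show "gact (transpose S) (transpose T) (gact S T s) = s" unfolding gact_compose[OF g s] t by (rule gact_one[OF s])
  show "gact S T (gact (transpose S) (transpose T) s) = s"
    unfolding gact_compose[OF icosahedral_transpose[OF g] s] orthogonal_right[OF t(1)] orthogonal_right[OF t(2)] by (rule gact_one[OF s])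
qed

lemma gact_bij: assumes g: "icosahedral r S T" shows "bij_betw (gact S T) (del_pezzo p b) (del_pezzo p b)"
  by (rule bij_betw_byWitness[of _ "gact (transpose S) (transpose T)"])
    (use gact_transpose[OF g] gact_in[OF g] gact_in[OF icosahedral_transpose[OF g]] in auto)

lemma gact_inv:
  assumes g: "icosahedral r S T" and s: "s \<in> del_pezzo p b"
  shows "inv_into (del_pezzo p b) (gact S T) s = gact (transpose S) (transpose T) s"
proof (rule inv_into_f_eq)
  show "inj_on (gact S T) (del_pezzo p b)" using gact_bij[OF g] by (rule bij_betw_imp_inj_on)
qed (use gact_transpose[OF g s] gact_in[OF icosahedral_transpose[OF g] s] in auto)

lemma gact_aut: assumes g: "icosahedral r S T" shows "gact S T \<in> carrier (aut_group (del_pezzo p b))"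
proof -
  have "gact S T \<in> Bij (del_pezzo p b)" unfolding Bij_def using gact_bij[OF g] by (simp add: gact_def)
  moreover have "regular_map (del_pezzo p b) (del_pezzo p b) (gact S T)"
    by (rule regular_map_matrix[OF del_pezzo_proj _ _ del_pezzo_proj, of _ "act S T"])
      (use gact_in[OF g] in \<open>auto simp: gact_def\<close>)
  moreover have "regular_map (del_pezzo p b) (del_pezzo p b) (inv_into (del_pezzo p b) (gact S T))"
    by (rule regular_map_matrix[OF del_pezzo_proj _ _ del_pezzo_proj, of _ "act (transpose S) (transpose T)"])
      (use gact_in[OF icosahedral_transpose[OF g]] gact_inv[OF g] in \<open>auto simp: gact_def\<close>)
  ultimately show ?thesis by (simp add: aut_group_def)
qed

lemma gact_mult:
  assumes "icosahedral r S T" "icosahedral r S' T'"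
  shows "mult (aut_group (del_pezzo p b)) (gact S T) (gact S' T') = gact (S ** S') (T ** T')"
proof -
  have "gact A B \<in> Bij (del_pezzo p b)" if "icosahedral r A B" for A B using gact_aut[OF that] by (simp add: aut_group_def)
  then have "mult (aut_group (del_pezzo p b)) (gact S T) (gact S' T') = compose (del_pezzo p b) (gact S T) (gact S' T')"
    using assms by (simp add: aut_group_def BijGroup_def)
  also have "\<dots> = gact (S ** S') (T ** T')"
  proof
    fix s
    show "compose (del_pezzo p b) (gact S T) (gact S' T') s = gact (S ** S') (T ** T') s"
    proof (cases "s \<in> del_pezzo p b")
      case True
      then show ?thesis using gact_compose[OF assms(2) True] by (simp add: compose_def)
    next
      case False
      then show ?thesis by (simp add: compose_def gact_def)
    qed
  qed
  finally show ?thesis .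
qed

text \<open>
  The vector is the first block of the point \<open>((1,1,1), (1,-1,0))\<close> of the surface, on an
  exceptional curve.
\<close>

lemma gact_nontrivial:
  assumes "icosahedral r S T" and "\<And>c. S *v vector [- r, r - 1, 1] \<noteq> c *s vector [- r, r - 1, 1]"
  shows "gact S T \<noteq> gact (mat 1) (mat 1)"
proof
  assume e: "gact S T = gact (mat 1) (mat 1)"
  let ?x = "vector [1, 1, 1] :: complex^3" and ?m = "vector [1, -1, 0] :: complex^3"
  have i: "incid ?x ?m" by (simp add: incid_def)
  have nz: "?x \<noteq> 0" "?m \<noteq> 0" by (simp_all add: vec3_eq_iff)
  have s: "ppoint (yy ?x ?m) \<in> del_pezzo p b" by (rule yy_in_del_pezzo[OF i nz])
  have y: "yy ?x ?m \<noteq> 0" using yy_eq_0_iff[OF i] nz by blast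
  have "ppoint (act S T *v yy ?x ?m) = ppoint (yy ?x ?m)"
    using gact_ppoint[OF s, of S T] gact_one[OF s] e by simp
  then obtain c where "act S T *v yy ?x ?m = c *s yy ?x ?m" using ppoint_eq_iff[OF act_nonzero[OF assms(1) y]] by blast
  then have "S *v (U *v yy ?x ?m) = c *s (U *v yy ?x ?m)"
    using arg_cong[of _ _ "\<lambda>w. U *v w"] by (metis U_act vector_scalar_commute)
  moreover have "U *v yy ?x ?m = vector [- r, r - 1, 1]"
    by (simp add: yy_def U_pt lin_def vec3_eq_iff algebra_simps)
  ultimately show False using assms(2) by simp
qed

end

lemma rot3_cube: "rot3 ** rot3 ** rot3 = mat 1"
  by (simp add: rot3_def vec_eq_iff forall_3 matrix_matrix_mult_def mat_def sum_3)

lemma rot2_square: "rot2 ** rot2 = mat 1"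
  by (simp add: rot2_def vec_eq_iff forall_3 matrix_matrix_mult_def mat_def sum_3)

lemma rot5_fifth:
  assumes r: "r * r = r + 1"
  shows "rot5 r ** rot5 r ** rot5 r ** rot5 r ** rot5 r = mat 1"
proof -
  have rr: "r * (r * x) = r * x + x" for x using r by Groebner_Basis.algebra
  let ?t = "transpose (rot5 r)"
  have "rot5 r ** rot5 r ** rot5 r = ?t ** ?t"
    using r by (simp add: rot5_def vec_eq_iff forall_3 matrix_matrix_mult_def transpose_def mat_def sum_3) (simp add: field_simps rr)
  then have "rot5 r ** rot5 r ** rot5 r ** rot5 r ** rot5 r = ?t ** (?t ** rot5 r) ** rot5 r"
    by (simp add: matrix_mul_assoc)
  then show ?thesis using orth_rot5[OF r] by simp
qed

definition rot2' :: "complex^3^3" where "rot2' = rot3 ** rot2 ** transpose rot3"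

lemma rot2'_eq: "rot2' = vector [vector [-1, 0, 0], vector [0, -1, 0], vector [0, 0, 1]]"
  by (simp add: rot2'_def rot3_def rot2_def vec_eq_iff forall_3 matrix_matrix_mult_def transpose_def sum_3)

lemma rot2_commutator: "rot2 = rot3 ** rot2' ** transpose rot3 ** rot2'"
  unfolding rot2'_eq by (simp add: rot3_def rot2_def vec_eq_iff forall_3 matrix_matrix_mult_def transpose_def sum_3)

context ramification_coords
begin

lemma f_antican: "f \<in> antican_sections p 2"
proof -
  have "(\<lambda>x. \<kappa> * sextic r (Li *v x)) \<in> forms 6"
    using forms_cmult[OF forms_compose[OF forms_sextic forms_matrix[of Li]]] by simp
  then have "f \<in> forms (3 * 2)" using f_eq by (simp add: fun_eq_iff[symmetric]) (metis (no_types, lifting) ext)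
  moreover have "\<exists>h. \<forall>t. f (p i + t *s v) = t\<^sup>2 * poly h t" for i v
  proof -
    let ?x = "lam i *s qpt i" and ?v = "Li *v v"
    have "f (p i + t *s v) = t\<^sup>2 * (\<kappa> * ramification_form (?x + t *s ?v) (dkap ?x ?v + t *s kap ?v))" for t
    proof -
      have "f (p i + t *s v) = \<kappa> * sextic r (?x + t *s ?v)"
        using f_L p_line[of i t ?v] by (simp add: L_Li)
      also have "\<dots> = \<kappa> * (t\<^sup>2 * ramification_form (?x + t *s ?v) (dkap ?x ?v + t *s kap ?v))"
        unfolding sextic_block_quadric cubic_map_at_centre ramification_form_def block_quadric_smult ..
      finally show ?thesis by (simp add: mult_ac)
    qed
    moreover have "polyfun (\<lambda>t. \<kappa> * ramification_form (?x + t *s ?v) (dkap ?x ?v + t *s kap ?v))"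
      by (intro polyfun_intros(5) polyfun_ramification_form polyfun_intros(1))
    ultimately show ?thesis unfolding polyfun_def by metis
  qed
  ultimately show ?thesis unfolding antican_sections_def by blast
qed

lemma f_nonzero: "f \<noteq> (\<lambda>_. 0)"
proof
  assume "f = (\<lambda>_. 0)"
  then have "\<kappa> * sextic r (axis 1 1) = 0" using f_L[of "axis 1 1"] by simp
  moreover have "sextic r (axis 1 1) = 3" unfolding sextic_eq_cub[OF r] cub_def by (simp add: axis_def)
  ultimately show False using kappa by simp
qed

lemma generic_point:
  assumes g: "icosahedral r S T"
  shows "\<exists>x j. kap (lift r S T j x) \<noteq> 0"
proof -
  obtain M c where M: "invertible M" "c \<noteq> 0" "\<And>z. curve_u r (M *v z) = c *s (S *v curve_u r z)" "\<And>z. curve_v r (M *v z) = c *s (T *v curve_v r z)"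
    using g unfolding icosahedral_def by blast
  obtain M' where M': "M ** M' = mat 1" using M(1) unfolding invertible_def by blast
  define q where "q = (\<lambda>z. kap (cx r (av z)) $ 1)"
  have av: "(\<lambda>z. av z $ i) \<in> forms 2" for i
  proof -
    have m: "f \<in> forms d \<Longrightarrow> g \<in> forms e \<Longrightarrow> (\<lambda>x. f x * g x) \<in> forms k" if "d + e = k" for f g :: "complex^2 \<Rightarrow> complex" and d e k
      using forms_mult[of f d g e] that by simp
    have block_quadric: "(\<lambda>x :: complex^2. (x $ i)\<^sup>2) \<in> forms 2" for i using forms_power[OF forms_coord, of i 2] by simp
    have "\<forall>i. (\<lambda>z. av z $ i) \<in> forms 2"
      unfolding forall_3 av_def vector_3
      by (intro conjI forms_add forms_diff forms_cmult block_quadric m[OF _ forms_cmult[OF forms_coord] forms_coord]) simp_all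
    then show ?thesis ..
  qed
  have av4: "(\<lambda>z. (av z $ i)\<^sup>2) \<in> forms 4" for i using forms_power[OF av, of i 2] by simp
  have "\<forall>i. (\<lambda>z. cx r (av z) $ i) \<in> forms 6"
    unfolding forall_3 cx_def vector_3
    using forms_mult[OF av forms_diff[OF forms_cmult[OF av4] av4]] by simp
  then have qf: "q \<in> forms 12" unfolding q_def using forms_kap[of "\<lambda>z. cx r (av z)" 6 1] by simp
  obtain z0 where z0: "av z0 = vector [0, 1, \<i>]" using av_onto[of "vector [0, 1, \<i>]"] by (auto simp: conic_def)
  have q0: "q z0 \<noteq> 0"
  proof -
    have "q z0 = 1 + (r + 1)\<^sup>2" unfolding q_def z0 kap_def cx_def by (simp add: power_mult_distrib)
    also have "\<dots> = 3 * (r + 1)" using r by Groebner_Basis.algebra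
    finally have "q z0 = 3 * (r + 1)" .
    moreover have "3 * (r + 1) \<noteq> 0" using golden_nonzero(2)[OF r] by (simp del: distrib_left_numeral)
    ultimately show ?thesis by simp
  qed
  have "(\<lambda>z. q (M *v z)) \<in> forms 12" using forms_compose[OF qf forms_matrix[of M]] by simp
  moreover have "q (M *v (M' *v z0)) \<noteq> 0" using q0 by (simp add: matrix_vector_mul_assoc M')
  ultimately obtain z where z: "q z \<noteq> 0" "q (M *v z) \<noteq> 0"
    using line_poly_domain[OF line_poly_forms[OF qf] line_poly_forms q0, of "\<lambda>z. q (M *v z)"] by blast
  define x where "x = cx r (av z)"
  define y where "y = cx r (av (M *v z))"
  have k: "kap x \<noteq> 0" "kap y \<noteq> 0" using z unfolding q_def x_def y_def by auto
  have z1: "z \<noteq> 0" "M *v z \<noteq> 0"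
  proof -
    have "q 0 = 0" using forms_homogeneous[OF qf, of 0 0] by simp
    then show "z \<noteq> 0" "M *v z \<noteq> 0" using z by auto
  qed
  have e: "ppoint (b (L *v cx r (av u))) = ppoint (yc u)" if "kap (cx r (av u)) \<noteq> 0" "u \<noteq> 0" for u
    unfolding b_yy yc_def by (rule yy_kap_same[OF curve_incid curve_nz(2)[OF that(2)] that(1), symmetric])
  have "yc (M *v z) = c *s (act S T *v yc z)" unfolding yc_pt act_mult U_pt V_pt M(3,4) pt_smult ..
  moreover obtain d where d: "d \<noteq> 0" "b (L *v x) = d *s yc z"
    using e[of z] k(1) z1(1) b_off_nonzero[OF k(1)] ppoint_eq_iff unfolding x_def by metis
  ultimately have "ppoint (act S T *v b (L *v x)) = ppoint (yc (M *v z))"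
    using M(2) by (simp add: vector_scalar_commute ppoint_scale)
  then have "ppoint (act S T *v b (L *v x)) = ppoint (b (L *v y))" using e[of "M *v z"] k(2) z1(2) unfolding y_def by simp
  then show ?thesis using lift_at[OF g k] by blast
qed

text \<open>
  The pullback of a section is unique: the relation determines it on a dense open set, and both
  sides are polynomial along lines. On sections given by linear forms it is the transposed linear
  map.
\<close>

lemma pullback_linear:
  assumes g: "icosahedral r S T" and act: "\<And>w. w \<noteq> 0 \<Longrightarrow> ppoint w \<in> del_pezzo p b \<Longrightarrow> \<gamma> (ppoint w) = ppoint (act S T *v w)"
    and pb: "pullback p b \<gamma> 1 (comb b c) (comb b c')"
  shows "(\<Sum>j\<in>UNIV. c' $ j * b (L *v x) $ j) = (\<Sum>j\<in>UNIV. c $ j * (act S T *v b (L *v x)) $ j)"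
proof (rule ccontr)
  define E where "E = (\<lambda>x. (\<Sum>j\<in>UNIV. c' $ j * b (L *v x) $ j) - (\<Sum>j\<in>UNIV. c $ j * (act S T *v b (L *v x)) $ j))"
  assume "(\<Sum>j\<in>UNIV. c' $ j * b (L *v x) $ j) \<noteq> (\<Sum>j\<in>UNIV. c $ j * (act S T *v b (L *v x)) $ j)"
  then have E: "E x \<noteq> 0" by (simp add: E_def)
  have bL: "(\<lambda>x. b (L *v x) $ j) \<in> forms 3" for j using forms_compose[OF forms_b forms_matrix[of L]] by simp
  have lE: "line_poly E" unfolding E_def
    by (rule line_poly_forms[of _ 3]) (intro forms_diff forms_sum forms_cmult forms_matrix_vector bL)
  obtain x0 j where "kap (lift r S T j x0) \<noteq> 0" using generic_point[OF g] by blast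
  then obtain i where i: "kap (lift r S T j x0) $ i \<noteq> 0" by (auto simp: vec_eq_iff)
  have l1: "line_poly (\<lambda>x. kap (lift r S T j x) $ i)" by (rule line_poly_forms[OF forms_kap[OF forms_lift]])
  have l2: "line_poly (sextic r)" by (rule line_poly_forms[OF forms_sextic])
  have s1: "sextic r (axis 1 1) \<noteq> 0" unfolding sextic_eq_cub[OF r] cub_def by (simp add: axis_def)
  have l3: "line_poly (\<lambda>x. kap x $ 2)" by (rule line_poly_forms[OF forms_kap[of "\<lambda>x. x" 1 2]]) (rule forms_coord)
  have s3: "kap (axis 1 1) $ 2 \<noteq> 0" by (simp add: kap_def axis_def)
  obtain y1 where y1: "E y1 \<noteq> 0" "kap (lift r S T j y1) $ i \<noteq> 0" using line_poly_domain[OF lE l1 E i] by blast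
  obtain y2 where y2: "sextic r y2 \<noteq> 0" "kap y2 $ 2 \<noteq> 0" using line_poly_domain[OF l2 l3 s1 s3] by blast
  have "E y1 * kap (lift r S T j y1) $ i \<noteq> 0" "sextic r y2 * kap y2 $ 2 \<noteq> 0" using y1 y2 by simp_all
  from line_poly_domain[OF line_poly_mult[OF lE l1] line_poly_mult[OF l2 l3] this]
  obtain y where "E y * kap (lift r S T j y) $ i \<noteq> 0" "sextic r y * kap y $ 2 \<noteq> 0" by blast
  then have y: "E y \<noteq> 0" "kap (lift r S T j y) \<noteq> 0" "sextic r y \<noteq> 0" "kap y \<noteq> 0" by auto
  define x1 where "x1 = L *v y"
  define y1 where "y1 = L *v lift r S T j y"
  have ga: "\<gamma> (ppoint (b (L *v u))) = ppoint (act S T *v b (L *v u))" if "kap u \<noteq> 0" for u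
    by (rule act[OF b_off_nonzero[OF that]]) (use that in \<open>auto simp: del_pezzo_def off_centres_L\<close>)
  have "off_centres p x1 \<and> off_centres p y1 \<and> \<gamma> (ppoint (b x1)) = ppoint (b y1)"
    using y ga[OF y(4)] act_on_section[OF g y(2)] by (simp add: x1_def y1_def off_centres_L ppoint_scale)
  then have "\<exists>U G M. open U \<and> x1 \<in> U \<and>
         (\<forall>u\<in>U. off_centres p u \<and> off_centres p (G u) \<and> \<gamma> (ppoint (b u)) = ppoint (b (G u))) \<and>
         (G has_derivative (\<lambda>v. M *v v)) (at x1) \<and>
         (\<forall>v w. comb b c' x1 * det (vector [G x1, M *v v, M *v w] :: complex^3^3) ^ 1 =
                comb b c (G x1) * det (vector [x1, v, w] :: complex^3^3) ^ 1)"
    by (rule pb[unfolded pullback_def, rule_format])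
  then obtain O' G M where *: "open O' \<and> x1 \<in> O' \<and>
         (\<forall>u\<in>O'. off_centres p u \<and> off_centres p (G u) \<and> \<gamma> (ppoint (b u)) = ppoint (b (G u))) \<and>
         (G has_derivative (\<lambda>v. M *v v)) (at x1) \<and>
         (\<forall>v w. comb b c' x1 * det (vector [G x1, M *v v, M *v w] :: complex^3^3) ^ 1 =
                comb b c (G x1) * det (vector [x1, v, w] :: complex^3^3) ^ 1)"
    by (elim exE)
  note O' = *[THEN conjunct1] *[THEN conjunct2, THEN conjunct1]
  note G = *[THEN conjunct2, THEN conjunct2, THEN conjunct1, rule_format]
  note M = *[THEN conjunct2, THEN conjunct2, THEN conjunct2, THEN conjunct1]
  note d = *[THEN conjunct2, THEN conjunct2, THEN conjunct2, THEN conjunct2, rule_format, unfolded power_one_right]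
  define H where "H = (\<lambda>u. Li *v G (L *v u))"
  define K where "K = Li ** M ** L"
  define Q where "Q = (\<lambda>u. L *v u) -` O'"
  have lc: "continuous_on UNIV (\<lambda>u. L *v u)" by (intro linear_continuous_on bounded_linear_matrix)
  have Q: "open Q" "y \<in> Q" using open_vimage[OF O'(1) lc] O'(2) by (simp_all add: Q_def x1_def)
  have Hd: "(H has_derivative (\<lambda>v. K *v v)) (at y)"
  proof -
    have "((\<lambda>u. G (L *v u)) has_derivative (\<lambda>v. M *v (L *v v))) (at y)"
      by (rule has_derivative_compose[OF bounded_linear_imp_has_derivative[OF bounded_linear_matrix]]) (use M in \<open>simp add: x1_def\<close>)
    then have "(H has_derivative (\<lambda>v. Li *v (M *v (L *v v)))) (at y)" unfolding H_def by (rule has_derivative_matrix)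
    then show ?thesis unfolding K_def by (simp add: matrix_vector_mul_assoc matrix_mul_assoc)
  qed
  have pr: "\<exists>m. m \<noteq> 0 \<and> b (L *v H u) = m *s (act S T *v b (L *v u))" if "u \<in> Q" for u
  proof -
    have u: "L *v u \<in> O'" using that by (simp add: Q_def)
    have "ppoint (b (G (L *v u))) = ppoint (act S T *v b (L *v u))" using G[OF u] ga[of u] off_centres_L by simp
    moreover have "b (L *v H u) = b (G (L *v u))" by (simp add: H_def L_Li)
    moreover have "b (L *v H u) \<noteq> 0"
      by (rule b_off_nonzero) (use G[OF u] in \<open>simp add: H_def off_centres_iff\<close>)
    ultimately show ?thesis using ppoint_eq_iff by metis
  qed
  have cu: "cubic_map r (H u) = m *s (S *v cubic_map r u) \<and> cubic_map (1 - r) (H u) = m *s (T *v cubic_map (1 - r) u)"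
    if "b (L *v H u) = m *s (act S T *v b (L *v u))" for u m
    using arg_cong[OF that, of "\<lambda>w. U *v w"] arg_cong[OF that, of "\<lambda>w. V *v w"]
    by (simp add: bU bV vector_scalar_commute U_act V_act)
  obtain m where m: "m \<noteq> 0" "b (L *v H y) = m *s (act S T *v b (L *v y))" using pr[OF Q(2)] by blast
  have orth: "transpose S ** S = mat 1" "transpose T ** T = mat 1" "det S = 1" using g unfolding icosahedral_def by blast+
  have pr': "\<exists>m. cubic_map r (H u) = m *s (S *v cubic_map r u)" if "u \<in> Q" for u using pr[OF that] cu by blast
  have det: "det (vector [H y, K *v v, K *v w] :: complex^3^3) = m * det (vector [y, v, w] :: complex^3^3)" for v w
    by (rule jacobian_cocycle[OF r orth Hd Q pr' cu[OF m(2), THEN conjunct1] cu[OF m(2), THEN conjunct2] m(1) y(3)])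
  have "y \<noteq> 0" using y(4) by (auto simp: kap_def vec3_eq_iff)
  have "\<exists>v w. det (vector [y, v, w] :: complex^3^3) \<noteq> 0"
  proof (rule ccontr)
    assume "\<nexists>v w. det (vector [y, v, w] :: complex^3^3) \<noteq> 0"
    then have d: "det (vector [y, v, w] :: complex^3^3) = 0" for v w by blast
    have "y = 0" using d[of "axis 2 1" "axis 3 1"] d[of "axis 3 1" "axis 1 1"] d[of "axis 1 1" "axis 2 1"]
      unfolding vec3_eq_iff by (simp add: det_3 axis_def)
    then show False using \<open>y \<noteq> 0\<close> by blast
  qed
  then obtain v w where vw: "det (vector [y, v, w] :: complex^3^3) \<noteq> 0" by blast
  have "comb b c' x1 * (det L * det (vector [H y, K *v v, K *v w] :: complex^3^3)) = comb b c (G x1) * (det L * det (vector [y, v, w] :: complex^3^3))"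
    using d[of "L *v v" "L *v w"] unfolding det_matrix_rows[symmetric]
    by (simp add: H_def K_def x1_def L_Li matrix_vector_mul_assoc matrix_mul_assoc LLi)
  then have 1: "comb b c' x1 * m = comb b c (G x1)" unfolding det using vw detL by simp
  have "G x1 = L *v H y" by (simp add: H_def x1_def L_Li)
  then have "comb b c (G x1) = m * (\<Sum>j\<in>UNIV. c $ j * (act S T *v b (L *v y)) $ j)"
    unfolding comb_def by (simp add: m(2) sum_distrib_left mult_ac)
  then have "E y = 0" using 1 m(1) unfolding E_def by (simp add: comb_def x1_def)
  then show False using y(1) by blast
qed

end

section \<open>The alternating group acts by the icosahedral group\<close>

lemma permutation_of_carrier: "p \<in> carrier (sym_group 5) \<Longrightarrow> permutation p"
  by (rule sym_group_carrier')

lemma sign_sym: "p \<in> carrier (sym_group 5) \<Longrightarrow> q \<in> carrier (sym_group 5) \<Longrightarrow> sign (p \<circ> q) = sign p * sign q"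
  by (simp add: sign_compose permutation_of_carrier)

lemma alt_iff_sign: "p \<in> carrier (alt_group 5) \<longleftrightarrow> p \<in> carrier (sym_group 5) \<and> sign p = 1"
  by (simp add: alt_group_carrier sym_group_carrier sign_def)

lemma sym_comp_closed: "p \<in> carrier (sym_group 5) \<Longrightarrow> q \<in> carrier (sym_group 5) \<Longrightarrow> p \<circ> q \<in> carrier (sym_group 5)"
  by (simp add: sym_group_carrier permutes_compose)

text \<open>
  The given action of the symmetric group is related to the coordinates only through the
  automorphism group of the surface.
\<close>

locale split_coords_action = split_coords +
  fixes \<theta> :: "(nat \<Rightarrow> nat) \<Rightarrow> (complex^6) set \<Rightarrow> (complex^6) set"
  assumes theta: "\<theta> \<in> iso (sym_group 5) (aut_group (del_pezzo p b))"
begin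

abbreviation "X \<equiv> del_pezzo p b"

lemma theta_comp: "g \<in> carrier (sym_group 5) \<Longrightarrow> h \<in> carrier (sym_group 5) \<Longrightarrow> \<theta> (g \<circ> h) = mult (aut_group X) (\<theta> g) (\<theta> h)"
  using theta unfolding iso_def hom_def sym_group_mult by blast

lemma theta_inj: "g \<in> carrier (sym_group 5) \<Longrightarrow> h \<in> carrier (sym_group 5) \<Longrightarrow> \<theta> g = \<theta> h \<Longrightarrow> g = h"
  using theta unfolding iso_def bij_betw_def inj_on_def by blast

lemma theta_surj: "a \<in> carrier (aut_group X) \<Longrightarrow> \<exists>g\<in>carrier (sym_group 5). \<theta> g = a"
proof -
  assume a: "a \<in> carrier (aut_group X)"
  have "\<theta> ` carrier (sym_group 5) = carrier (aut_group X)" using theta unfolding iso_def bij_betw_def by blast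
  then show ?thesis using a by (metis imageE)
qed

definition acts_by :: "(nat \<Rightarrow> nat) \<Rightarrow> complex^3^3 \<Rightarrow> complex^3^3 \<Rightarrow> bool"
  where "acts_by g S T \<longleftrightarrow> g \<in> carrier (sym_group 5) \<and> icosahedral r S T \<and> \<theta> g = gact S T"

lemma acts_by_exists: "icosahedral r S T \<Longrightarrow> \<exists>g. acts_by g S T"
  unfolding acts_by_def using theta_surj[OF gact_aut] by blast

lemma acts_by_mult: "acts_by g S T \<Longrightarrow> acts_by h S' T' \<Longrightarrow> acts_by (g \<circ> h) (S ** S') (T ** T')"
  unfolding acts_by_def using sym_comp_closed icosahedral_mult theta_comp gact_mult by metis

lemma acts_by_unique: "acts_by g S T \<Longrightarrow> acts_by h S T \<Longrightarrow> g = h"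
  unfolding acts_by_def using theta_inj by metis

lemma acts_by_id: "acts_by id (mat 1) (mat 1)"
proof -
  obtain g where g: "acts_by g (mat 1) (mat 1)" using acts_by_exists[OF icosahedral_one] by blast
  then have "acts_by (g \<circ> g) (mat 1) (mat 1)" using acts_by_mult[OF g g] by simp
  then have gg: "g \<circ> g = g" using acts_by_unique g by blast
  have "g permutes {1..5}" using g unfolding acts_by_def sym_group_carrier by blast
  then have "bij g" by (rule permutes_bij)
  then have "g x = x" for x using fun_cong[OF gg, of x] bij_is_inj by (metis comp_apply injD)
  then have "g = id" by auto
  then show ?thesis using g by simp
qed

lemma acts_by_transpose:
  assumes "acts_by g S T"
  obtains h where "acts_by h (transpose S) (transpose T)" "g \<circ> h = id" "h \<circ> g = id"
proof -
  have gd: "icosahedral r S T" using assms unfolding acts_by_def by blast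
  obtain h where h: "acts_by h (transpose S) (transpose T)" using acts_by_exists[OF icosahedral_transpose[OF gd]] by blast
  have o: "transpose S ** S = mat 1" "transpose T ** T = mat 1" using gd unfolding icosahedral_def by blast+
  have "h \<circ> g = id" using acts_by_unique[OF acts_by_mult[OF h assms]] acts_by_id unfolding o by blast
  moreover have "g \<circ> h = id" using acts_by_unique[OF acts_by_mult[OF assms h]] acts_by_id
    unfolding orthogonal_right[OF o(1)] orthogonal_right[OF o(2)] by blast
  ultimately show ?thesis using that h by blast
qed

lemma acts_by_nontrivial: "acts_by g S T \<Longrightarrow> gact S T \<noteq> gact (mat 1) (mat 1) \<Longrightarrow> g \<noteq> id"
  using acts_by_id unfolding acts_by_def by auto

lemma sign_one_cases: "sign (g :: nat \<Rightarrow> nat) = 1 \<or> sign g = - 1"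
  by (simp add: sign_def)

lemma vec3_neq:
  fixes x y z :: complex
  shows "vector [x, y, z] = (c *s vector [x', y', z'] :: complex^3) \<longleftrightarrow> x = c * x' \<and> y = c * y' \<and> z = c * z'"
  by (simp add: vec3_eq_iff)

lemma nontrivial_rot5: "gact (rot5 r) (rot5 (1 - r)) \<noteq> gact (mat 1) (mat 1)"
proof (rule gact_nontrivial[OF icosahedral_rot5[OF r]])
  fix c
  have 1: "(rot5 r *v vector [- r, r - 1, 1]) $ 1 = - r" "(rot5 r *v vector [- r, r - 1, 1]) $ 2 = 1 - r"
    unfolding rot5_mult vector_3 using r by (simp_all add: field_simps) 
  show "rot5 r *v vector [- r, r - 1, 1] \<noteq> c *s vector [- r, r - 1, 1]"
  proof
    assume "rot5 r *v vector [- r, r - 1, 1] = c *s vector [- r, r - 1, 1]"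
    then have c: "- r = c * (- r)" "1 - r = c * (r - 1)" using 1 by simp_all
    then have "c = 1" using golden_nonzero(1)[OF r] by simp
    then have "r = 1" using c(2) by simp
    then show False using golden_nonzero(4)[OF r] by simp
  qed
qed

lemma nontrivial_rot3: "gact rot3 rot3 \<noteq> gact (mat 1) (mat 1)"
proof (rule gact_nontrivial[OF icosahedral_rot3])
  fix c
  show "rot3 *v vector [- r, r - 1, 1] \<noteq> c *s vector [- r, r - 1, 1]"
  proof
    assume "rot3 *v vector [- r, r - 1, 1] = c *s vector [- r, r - 1, 1]"
    then have h: "r - 1 = c * (- r) \<and> 1 = c * (r - 1) \<and> - r = c * 1" unfolding rot3_mult vector_3 vec3_neq .
    have c: "c = - r" using h[THEN conjunct2, THEN conjunct2] by simp
    have "1 = - r * (r - 1)" using h[THEN conjunct2, THEN conjunct1] unfolding c .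
    then have "1 = - (r * r) + r" by (simp add: algebra_simps)
    then show False unfolding r by simp
  qed
qed

lemma icosahedral_rot2': "icosahedral r rot2' rot2'"
  unfolding rot2'_def by (intro icosahedral_mult icosahedral_rot3 icosahedral_rot2 icosahedral_transpose)

lemma rot2_relations: "rot2' ** rot2' = mat 1" "rot2 ** rot2' = rot2' ** rot2"
  "rot2 ** rot2' = vector [vector [-1, 0, 0], vector [0, 1, 0], vector [0, 0, -1]]"
  unfolding rot2'_eq by (simp_all add: rot2_def vec_eq_iff forall_3 matrix_matrix_mult_def mat_def sum_3)

lemma nontrivial_rot2: "gact rot2 rot2 \<noteq> gact (mat 1) (mat 1)" "gact rot2' rot2' \<noteq> gact (mat 1) (mat 1)"
  "gact (rot2 ** rot2') (rot2 ** rot2') \<noteq> gact (mat 1) (mat 1)"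
proof -
  have n: "r \<noteq> 0" "r - 1 \<noteq> 0" using golden_nonzero[OF r] by auto
  show "gact rot2 rot2 \<noteq> gact (mat 1) (mat 1)"
    by (rule gact_nontrivial[OF icosahedral_rot2]) (use n in \<open>auto simp: rot2_mult vec3_neq\<close>)
  show "gact rot2' rot2' \<noteq> gact (mat 1) (mat 1)"
    by (rule gact_nontrivial[OF icosahedral_rot2']) 
      (use n in \<open>auto simp: rot2'_eq vec3_eq_iff matrix_vector_mult_def sum_3\<close>)
  show "gact (rot2 ** rot2') (rot2 ** rot2') \<noteq> gact (mat 1) (mat 1)"
    by (rule gact_nontrivial[OF icosahedral_mult[OF icosahedral_rot2 icosahedral_rot2']])
      (use n in \<open>auto simp: rot2_relations(3) vec3_eq_iff matrix_vector_mult_def sum_3\<close>)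
qed

text \<open>
  An element of odd order is an even permutation.
\<close>

lemma acts_by_alt_rot3: assumes "acts_by g rot3 rot3" shows "g \<in> carrier (alt_group 5)" "g \<circ> g \<circ> g = id" "g \<noteq> id"
proof -
  have g: "g \<in> carrier (sym_group 5)" using assms unfolding acts_by_def by blast
  show ggg: "g \<circ> g \<circ> g = id"
    using acts_by_unique[OF acts_by_mult[OF acts_by_mult[OF assms assms] assms]] acts_by_id unfolding rot3_cube by blast
  have "sign (g \<circ> g \<circ> g) = 1" unfolding ggg by simp
  then have "sign g * sign g * sign g = 1" using sign_sym g sym_comp_closed by simp
  then have "sign g = 1" using sign_one_cases[of g] by auto
  then show "g \<in> carrier (alt_group 5)" using g alt_iff_sign by blast
  show "g \<noteq> id" using acts_by_nontrivial[OF assms nontrivial_rot3] .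
qed

lemma acts_by_alt_rot5: assumes "acts_by g (rot5 r) (rot5 (1 - r))" 
  shows "g \<in> carrier (alt_group 5)" "g \<circ> g \<circ> g \<circ> g \<circ> g = id" "g \<noteq> id"
proof -
  have g: "g \<in> carrier (sym_group 5)" using assms unfolding acts_by_def by blast
  show ggg: "g \<circ> g \<circ> g \<circ> g \<circ> g = id"
    using acts_by_unique[OF acts_by_mult[OF acts_by_mult[OF acts_by_mult[OF acts_by_mult[OF assms assms] assms] assms] assms]] acts_by_id
    unfolding rot5_fifth[OF r] rot5_fifth[OF golden_conj[OF r]] by blast
  have "sign (g \<circ> g \<circ> g \<circ> g \<circ> g) = 1" unfolding ggg by simp
  then have "sign g * sign g * sign g * sign g * sign g = 1" using sign_sym g sym_comp_closed by simp
  then have "sign g = 1" using sign_one_cases[of g] by auto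
  then show "g \<in> carrier (alt_group 5)" using g alt_iff_sign by blast
  show "g \<noteq> id" using acts_by_nontrivial[OF assms nontrivial_rot5] .
qed

lemma sign_square: "g \<in> carrier (sym_group 5) \<Longrightarrow> sign g * sign g = 1"
  using sign_one_cases[of g] by auto

text \<open>
  The sign change is a commutator, so it is an even permutation.
\<close>

lemma acts_by_alt_rot2:
  assumes a: "acts_by a rot2 rot2" and a': "acts_by a' rot2' rot2'"
  shows "a \<in> carrier (alt_group 5)" "a' \<in> carrier (alt_group 5)"
proof -
  obtain t where t: "acts_by t rot3 rot3" using acts_by_exists[OF icosahedral_rot3] by blast
  obtain t' where t': "acts_by t' (transpose rot3) (transpose rot3)" "t \<circ> t' = id" by (rule acts_by_transpose[OF t])
  have m: "a \<in> carrier (sym_group 5)" "a' \<in> carrier (sym_group 5)" "t \<in> carrier (sym_group 5)" "t' \<in> carrier (sym_group 5)"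
    using a a' t t' unfolding acts_by_def by blast+
  have st: "sign t * sign t' = 1" using sign_sym[OF m(3,4)] t'(2) by simp
  have "a = t \<circ> a' \<circ> t' \<circ> a'"
    using acts_by_unique[OF a] acts_by_mult[OF acts_by_mult[OF acts_by_mult[OF t a'] t'(1)] a'] unfolding rot2_commutator[symmetric] by blast
  then have "sign a = sign t * sign a' * sign t' * sign a'" using sign_sym m sym_comp_closed by metis
  also have "\<dots> = (sign t * sign t') * (sign a' * sign a')" by (simp add: mult_ac)
  finally have sa: "sign a = 1" using st sign_square[OF m(2)] by simp
  have "a' = t \<circ> a \<circ> t'"
    using acts_by_unique[OF a'] acts_by_mult[OF acts_by_mult[OF t a] t'(1)] unfolding rot2'_def[symmetric] by blast
  then have "sign a' = sign t * sign a * sign t'" using sign_sym m sym_comp_closed by metis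
  then have "sign a' = 1" using sa st by simp
  then show "a \<in> carrier (alt_group 5)" "a' \<in> carrier (alt_group 5)" using m sa alt_iff_sign by blast+
qed

definition K :: "(nat \<Rightarrow> nat) set"
  where "K = {g \<in> carrier (alt_group 5). \<exists>S T. acts_by g S T}"

lemma K_subgroup: "subgroup K (alt_group 5)"
proof
  show "K \<subseteq> carrier (alt_group 5)" unfolding K_def by blast
  show "x \<otimes>\<^bsub>alt_group 5\<^esub> y \<in> K" if "x \<in> K" "y \<in> K" for x y
  proof -
    have "x \<otimes>\<^bsub>alt_group 5\<^esub> y \<in> carrier (alt_group 5)"
      using monoid.m_closed[OF group.is_monoid[OF alt_group_is_group]] that unfolding K_def by blast
    moreover have "\<exists>S T. acts_by (x \<otimes>\<^bsub>alt_group 5\<^esub> y) S T"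
      using that acts_by_mult unfolding K_def alt_group_mult by blast
    ultimately show ?thesis unfolding K_def by blast
  qed
  show "\<one>\<^bsub>alt_group 5\<^esub> \<in> K"
    unfolding K_def alt_group_one using acts_by_id alt_iff_sign[of id] unfolding acts_by_def by auto
  show "inv\<^bsub>alt_group 5\<^esub> x \<in> K" if x: "x \<in> K" for x
  proof -
    obtain S T where t: "acts_by x S T" and xa: "x \<in> carrier (alt_group 5)" using x unfolding K_def by blast
    obtain h where h: "acts_by h (transpose S) (transpose T)" "x \<circ> h = id" "h \<circ> x = id" by (rule acts_by_transpose[OF t])
    have hs: "h \<in> carrier (sym_group 5)" using h(1) unfolding acts_by_def by blast
    have "sign h * sign x = 1" using sign_sym[OF hs] h(3) xa alt_iff_sign by (metis sign_id)
    then have ha: "h \<in> carrier (alt_group 5)" using hs xa alt_iff_sign by simp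
    have "inv\<^bsub>alt_group 5\<^esub> x = h"
      by (rule group.inv_equality[OF alt_group_is_group]) (use h xa ha in \<open>simp_all add: alt_group_mult alt_group_one\<close>)
    then show ?thesis unfolding K_def using h(1) ha by blast
  qed
qed

lemma finite_alt: "finite (carrier (alt_group 5))"
proof -
  have "carrier (alt_group 5) \<subseteq> carrier (sym_group 5)" using alt_iff_sign by blast
  moreover have "finite (carrier (sym_group 5))" using sym_group_card_carrier[of 5] by (metis card.infinite fact_nonzero)
  ultimately show ?thesis by (rule finite_subset)
qed

lemma card_alt: "card (carrier (alt_group 5)) = 60"
  using alt_group_card_carrier[of 5] by (simp add: fact_numeral)

definition GK :: "(nat \<Rightarrow> nat) monoid" where "GK = (alt_group 5)\<lparr>carrier := K\<rparr>"

lemma GK: "group GK" "carrier GK = K" "mult GK = (\<circ>)" "one GK = id" "order GK = card K"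
  unfolding GK_def using subgroup.subgroup_is_group[OF K_subgroup alt_group_is_group]
  by (simp_all add: alt_group_mult alt_group_one order_def)

lemma finite_K: "finite K"
  using finite_subset[OF subgroup.subset[OF K_subgroup] finite_alt] .

lemma prime_order_dvd:
  assumes g: "g \<in> K" "g \<noteq> id" and n: "g [^]\<^bsub>GK\<^esub> n = id" and p: "prime (n::nat)"
  shows "n dvd card K"
proof -
  have "group.ord GK g dvd n" using group.pow_eq_id[OF GK(1), of g n] g n by (simp add: GK)
  moreover have "group.ord GK g \<noteq> 1" using group.ord_eq_1[OF GK(1), of g] g by (simp add: GK)
  ultimately have "group.ord GK g = n" using p by (metis prime_nat_iff)
  then show ?thesis using group.ord_dvd_group_order[OF GK(1), of g] g by (simp add: GK)
qed

lemma klein_subgroup: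
  assumes a: "acts_by a rot2 rot2" and a': "acts_by a' rot2' rot2'"
  shows "subgroup {id, a, a', a \<circ> a'} GK" "card {id, a, a', a \<circ> a'} = 4"
proof -
  have aa: "a \<circ> a = id" using acts_by_unique[OF acts_by_mult[OF a a]] acts_by_id unfolding rot2_square by blast
  have bb: "a' \<circ> a' = id" using acts_by_unique[OF acts_by_mult[OF a' a']] acts_by_id unfolding rot2_relations by blast
  have ab: "a' \<circ> a = a \<circ> a'" using acts_by_unique[OF acts_by_mult[OF a' a]] acts_by_mult[OF a a'] unfolding rot2_relations(2) by blast
  have aax: "a (a x) = x" and bbx: "a' (a' x) = x" and abx: "a' (a x) = a (a' x)" for x
    using fun_cong[OF aa, of x] fun_cong[OF bb, of x] fun_cong[OF ab, of x] by simp_all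
  have n: "a \<noteq> id" "a' \<noteq> id" "a \<circ> a' \<noteq> id"
    using acts_by_nontrivial[OF a nontrivial_rot2(1)] acts_by_nontrivial[OF a' nontrivial_rot2(2)]
      acts_by_nontrivial[OF acts_by_mult[OF a a'] nontrivial_rot2(3)] by blast+
  have "a \<noteq> a'" using n(3) aa by auto
  moreover have "a \<noteq> a \<circ> a'" using n(2) aax by (metis comp_apply eq_id_iff)
  moreover have "a' \<noteq> a \<circ> a'" using n(1) bbx abx by (metis comp_apply eq_id_iff)
  ultimately show "card {id, a, a', a \<circ> a'} = 4" using n by (auto simp: card_insert_if)
  have inK: "a \<in> K" "a' \<in> K" "id \<in> K" "a \<circ> a' \<in> K"
    using acts_by_alt_rot2[OF a a'] a a' subgroup.one_closed[OF K_subgroup] subgroup.m_closed[OF K_subgroup, of a a']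
    unfolding alt_group_one alt_group_mult K_def by blast+
  show "subgroup {id, a, a', a \<circ> a'} GK"
  proof (rule group.subgroupI[OF GK(1)])
    show "{id, a, a', a \<circ> a'} \<subseteq> carrier GK" using inK by (simp add: GK)
    fix x assume x: "x \<in> {id, a, a', a \<circ> a'}"
    have "x \<circ> x = id" using x by (auto simp: fun_eq_iff aax bbx abx)
    then have "inv\<^bsub>GK\<^esub> x = x" using x inK by (intro group.inv_equality[OF GK(1)]) (auto simp: GK)
    then show "inv\<^bsub>GK\<^esub> x \<in> {id, a, a', a \<circ> a'}" using x by simp
    fix y assume y: "y \<in> {id, a, a', a \<circ> a'}"
    have "x \<circ> y \<in> {id, a, a', a \<circ> a'}"
      using x y aa bb ab by (elim insertE emptyE) (simp_all add: fun_eq_iff aax bbx abx o_def id_def)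
    then show "x \<otimes>\<^bsub>GK\<^esub> y \<in> {id, a, a', a \<circ> a'}" by (simp add: GK)
  qed simp
qed

text \<open>
  The order of this subgroup is divisible by 3, 5 and 4, the order of the sign changes, hence by
  60.
\<close>

lemma K_eq: "K = carrier (alt_group 5)"
proof -
  obtain t3 where t3: "acts_by t3 rot3 rot3" using acts_by_exists[OF icosahedral_rot3] by blast
  obtain t5 where t5: "acts_by t5 (rot5 r) (rot5 (1 - r))" using acts_by_exists[OF icosahedral_rot5[OF r]] by blast
  obtain a where a: "acts_by a rot2 rot2" using acts_by_exists[OF icosahedral_rot2] by blast
  obtain a' where a': "acts_by a' rot2' rot2'" using acts_by_exists[OF icosahedral_rot2'] by blast
  have m: "t3 \<in> K" "t5 \<in> K" using acts_by_alt_rot3[OF t3] acts_by_alt_rot5[OF t5] t3 t5 unfolding K_def by blast+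
  have mon: "monoid GK" using GK(1) by (rule group.is_monoid)
  have "t3 [^]\<^bsub>GK\<^esub> (3::nat) = id"
    using acts_by_alt_rot3(2)[OF t3] monoid.nat_pow_Suc[OF mon] monoid.nat_pow_0[OF mon] by (simp add: numeral_3_eq_3 GK)
  then have 3: "3 dvd card K" using prime_order_dvd[OF m(1) acts_by_alt_rot3(3)[OF t3], of 3] by simp
  have "t5 [^]\<^bsub>GK\<^esub> (5::nat) = id"
    using acts_by_alt_rot5(2)[OF t5] monoid.nat_pow_Suc[OF mon] monoid.nat_pow_0[OF mon] by (simp add: eval_nat_numeral GK)
  then have 5: "5 dvd card K" using prime_order_dvd[OF m(2) acts_by_alt_rot5(3)[OF t5], of 5] by simp
  have 4: "4 dvd card K"
    using group.lagrange[OF GK(1) klein_subgroup(1)[OF a a']] klein_subgroup(2)[OF a a'] unfolding GK(5) by (metis dvd_triv_right)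
  have "card K > 0" using finite_K m by (auto simp: card_gt_0_iff)
  moreover have "60 dvd card K"
    using 3 4 5 by presburger
  ultimately have "card (carrier (alt_group 5)) \<le> card K" unfolding card_alt by (rule dvd_imp_le[rotated])
  then show ?thesis using card_seteq[OF finite_alt subgroup.subset[OF K_subgroup]] by blast
qed

theorem theta_alt:
  assumes "g \<in> carrier (alt_group 5)"
  shows "\<exists>S T. acts_by g S T"
  using assms K_eq unfolding K_def by blast

end

section \<open>The action on the projective line\<close>

definition projectivity :: "complex^2^2 \<Rightarrow> (complex^2) set \<Rightarrow> (complex^2) set"
  where "projectivity M = restrict (\<lambda>s. (\<lambda>w. M *v w) ` s) proj_space"

lemma ppoint_in_proj: "z \<noteq> 0 \<Longrightarrow> ppoint z \<in> proj_space"
  unfolding proj_space_def by blast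

lemma proj_cases: assumes "s \<in> proj_space" obtains z where "z \<noteq> 0" "s = ppoint z"
  using assms unfolding proj_space_def by blast

lemma invertible_nz: "invertible (M :: complex^2^2) \<Longrightarrow> z \<noteq> 0 \<Longrightarrow> M *v z \<noteq> 0"
  unfolding invertible_def by (metis matrix_left_invertible_ker)

lemma projectivity_ppoint: "z \<noteq> 0 \<Longrightarrow> projectivity M (ppoint z) = ppoint (M *v z)"
  by (simp add: projectivity_def ppoint_matrix ppoint_in_proj)

lemma projectivity_in: "invertible M \<Longrightarrow> s \<in> proj_space \<Longrightarrow> projectivity M s \<in> proj_space"
  by (erule proj_cases) (simp add: projectivity_ppoint ppoint_in_proj invertible_nz)

lemma projectivity_compose:
  assumes "invertible M'" "s \<in> proj_space" shows "projectivity M (projectivity M' s) = projectivity (M ** M') s"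
  using assms by (elim proj_cases) (simp add: projectivity_ppoint invertible_nz matrix_vector_mul_assoc)

lemma projectivity_one: "s \<in> proj_space \<Longrightarrow> projectivity (mat 1) s = s"
  by (erule proj_cases) (simp add: projectivity_ppoint)

lemma projectivity_aut:
  assumes M: "invertible M" shows "projectivity M \<in> carrier (aut_group proj_space)"
proof -
  obtain M' where M': "M ** M' = mat 1" "M' ** M = mat 1" using M unfolding invertible_def by blast
  have iM': "invertible M'" using M' unfolding invertible_def by blast
  have i1: "projectivity M' (projectivity M s) = s" if "s \<in> proj_space" for s
    unfolding projectivity_compose[OF M that] M' by (rule projectivity_one[OF that])
  have i2: "projectivity M (projectivity M' s) = s" if "s \<in> proj_space" for s
    unfolding projectivity_compose[OF iM' that] M' by (rule projectivity_one[OF that])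
  have bij: "bij_betw (projectivity M) proj_space proj_space"
    by (rule bij_betw_byWitness[of _ "projectivity M'"]) (use i1 i2 projectivity_in[OF M] projectivity_in[OF iM'] in auto)
  have inv: "inv_into proj_space (projectivity M) s = projectivity M' s" if "s \<in> proj_space" for s
    by (rule inv_into_f_eq[OF bij_betw_imp_inj_on[OF bij]]) (use i2 projectivity_in[OF iM'] that in auto)
  have "projectivity M \<in> Bij proj_space" unfolding Bij_def using bij by (simp add: projectivity_def)
  moreover have "regular_map proj_space proj_space (projectivity M)"
    by (rule regular_map_matrix[of _ _ M]) (use projectivity_in[OF M] in \<open>auto simp: projectivity_def\<close>)
  moreover have "regular_map proj_space proj_space (inv_into proj_space (projectivity M))"
    by (rule regular_map_matrix[of _ _ M']) (use projectivity_in[OF iM'] inv in \<open>auto simp: projectivity_def\<close>)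
  ultimately show ?thesis by (simp add: aut_group_def)
qed

lemma projectivity_mult:
  assumes "invertible M" "invertible M'"
  shows "mult (aut_group proj_space) (projectivity M) (projectivity M') = projectivity (M ** M')"
proof -
  have "projectivity M \<in> Bij proj_space" if "invertible M" for M using projectivity_aut[OF that] by (simp add: aut_group_def)
  then have "mult (aut_group proj_space) (projectivity M) (projectivity M') = compose proj_space (projectivity M) (projectivity M')"
    using assms by (simp add: aut_group_def BijGroup_def)
  also have "\<dots> = projectivity (M ** M')"
  proof
    fix s show "compose proj_space (projectivity M) (projectivity M') s = projectivity (M ** M') s"
    proof (cases "s \<in> proj_space")
      case True then show ?thesis using projectivity_compose[OF assms(2) True] by (simp add: compose_def)
    next
      case False then show ?thesis by (simp add: compose_def projectivity_def)
    qed
  qed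
  finally show ?thesis .
qed

lemma det2_zero_proportional:
  fixes z w :: "complex^2"
  assumes "w \<noteq> 0" "z$1 * w$2 = z$2 * w$1"
  shows "\<exists>d. z = d *s w"
proof -
  consider "w$1 \<noteq> 0" | "w$2 \<noteq> 0" using assms(1) by (auto simp: vec2_eq_iff)
  then show ?thesis
  proof cases
    case 1 then show ?thesis using assms by (intro exI[of _ "z$1/w$1"]) (simp add: vec2_eq_iff field_simps)
  next
    case 2 then show ?thesis using assms by (intro exI[of _ "z$2/w$2"]) (simp add: vec2_eq_iff field_simps)
  qed
qed

text \<open>
  The matrix has three pairwise independent eigenvectors in the plane, so it is a scalar.
\<close>

lemma three_fixed_points:
  fixes M :: "complex^2^2"
  assumes "x \<noteq> 0" "y \<noteq> 0" "z \<noteq> 0" "ppoint x \<noteq> ppoint y" "ppoint x \<noteq> ppoint z" "ppoint y \<noteq> ppoint z"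
    and "M *v x = a *s x" "M *v y = b *s y" "M *v z = c *s z"
  shows "\<forall>w. M *v w = a *s w"
proof -
  have np: "u$1 * v$2 - u$2 * v$1 \<noteq> 0" if uv: "u \<noteq> 0" "v \<noteq> 0" "ppoint u \<noteq> ppoint v" for u v :: "complex^2"
  proof
    assume "u$1 * v$2 - u$2 * v$1 = 0"
    then obtain d where "u = d *s v" using det2_zero_proportional[OF uv(2)] by auto
    then show False using uv by (metis ppoint_scale vector_smult_lzero)
  qed
  define D where "D = x$1 * y$2 - x$2 * y$1"
  have D: "D \<noteq> 0" unfolding D_def using np[OF assms(1,2,4)] .
  define s where "s = (\<lambda>w :: complex^2. (w$1 * y$2 - w$2 * y$1) / D)"
  define t where "t = (\<lambda>w :: complex^2. (x$1 * w$2 - x$2 * w$1) / D)"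
  have dec: "w = s w *s x + t w *s y" for w
    using D unfolding vec2_eq_iff s_def t_def by (simp add: field_simps) (simp add: D_def algebra_simps)
  have sz: "s z \<noteq> 0" "t z \<noteq> 0" using D np[OF assms(3,2)] np[OF assms(1,3)] assms(5,6) unfolding s_def t_def by auto
  have Mw: "M *v w = (s w * a) *s x + (t w * b) *s y" for w
    by (subst dec[of w]) (simp add: matrix_vector_right_distrib vector_scalar_commute assms(7,8))
  have u: "\<alpha> = \<alpha>' \<and> \<beta> = \<beta>'" if "\<alpha> *s x + \<beta> *s y = \<alpha>' *s x + \<beta>' *s y" for \<alpha> \<beta> \<alpha>' \<beta>'
  proof -
    define \<delta> where "\<delta> = \<alpha> - \<alpha>'"
    define \<epsilon> where "\<epsilon> = \<beta> - \<beta>'"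
    have e: "\<delta> * x$1 + \<epsilon> * y$1 = 0" "\<delta> * x$2 + \<epsilon> * y$2 = 0"
      using that by (simp_all add: vec2_eq_iff \<delta>_def \<epsilon>_def algebra_simps)
    have "D * \<delta> = y$2 * (\<delta> * x$1 + \<epsilon> * y$1) - y$1 * (\<delta> * x$2 + \<epsilon> * y$2)"
      "D * \<epsilon> = x$1 * (\<delta> * x$2 + \<epsilon> * y$2) - x$2 * (\<delta> * x$1 + \<epsilon> * y$1)"
      unfolding D_def by (simp_all add: algebra_simps)
    then have "D * \<delta> = 0" "D * \<epsilon> = 0" unfolding e by simp_all
    then have "\<delta> = 0" "\<epsilon> = 0" using D by simp_all
    then have "\<alpha> - \<alpha>' = 0 \<and> \<beta> - \<beta>' = 0" unfolding \<delta>_def \<epsilon>_def by simp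
    then show ?thesis using D by simp
  qed
  have "(s z * a) *s x + (t z * b) *s y = (c * s z) *s x + (c * t z) *s y"
    using Mw[of z] assms(9) dec[of z] by (metis vector_add_ldistrib vector_smult_assoc)
  from u[OF this] have "a = c" "b = c" using sz by auto
  then have "M *v w = a *s w" for w unfolding Mw by (subst (3) dec[of w]) (simp add: vector_add_ldistrib mult.commute)
  then show ?thesis by blast
qed

context split_coords
begin

text \<open>
  The points of the line at which the map to the surface fails to be injective: the vertices of
  the icosahedron.
\<close>

definition vertices :: "(complex^2) set set"
  where "vertices = {ppoint z | z. z \<noteq> 0 \<and> (\<exists>i. vertex_forms r (av z) $ i = 0)}"

lemma vertex_forms_scale_invariant: "ppoint z = ppoint w \<Longrightarrow> z \<noteq> 0 \<Longrightarrow> vertex_forms r (av z) $ i = 0 \<longleftrightarrow> vertex_forms r (av w) $ i = 0"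
proof -
  assume "ppoint z = ppoint w" "z \<noteq> 0"
  then obtain a where a: "a \<noteq> 0" "z = a *s w" using ppoint_eq_iff by blast
  show ?thesis unfolding a(2) av_smult vertex_forms_smult using a(1) by simp
qed

lemma vertices_iff: "z \<noteq> 0 \<Longrightarrow> ppoint z \<in> vertices \<longleftrightarrow> (\<exists>i. vertex_forms r (av z) $ i = 0)"
  unfolding vertices_def using vertex_forms_scale_invariant by blast

lemma nu_fibre:
  assumes "s \<in> proj_space" "t \<in> proj_space" "nu s = nu t" "s \<noteq> t"
  shows "s \<in> vertices" "t \<in> vertices"
proof -
  have "t \<in> vertices" if st: "s \<in> proj_space" "t \<in> proj_space" "nu s = nu t" "s \<noteq> t" for s t
  proof -
    obtain z where z: "z \<noteq> 0" "s = ppoint z" using st(1) by (rule proj_cases)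
    obtain w where w: "w \<noteq> 0" "t = ppoint w" using st(2) by (rule proj_cases)
    show ?thesis using nu_eq_iff[OF z(1) w(1)] st(3,4) vertices_iff[OF w(1)] unfolding z(2) w(2) by blast
  qed
  then show "s \<in> vertices" "t \<in> vertices" using assms by metis+
qed

text \<open>
  The second vertex over a node is obtained by changing the sign of a coordinate of the conic.
\<close>

lemma partner_exists:
  assumes "s \<in> vertices" shows "\<exists>t\<in>vertices. t \<noteq> s \<and> nu t = nu s"
proof -
  obtain z i where z: "z \<noteq> 0" "s = ppoint z" "vertex_forms r (av z) $ i = 0" using assms unfolding vertices_def by blast
  have a: "av z \<noteq> 0" using av_eq_0_iff z(1) by blast
  obtain w where w: "av w = flip i (av z)" using av_onto[of "flip i (av z)"] conic_av conic_flip by blast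
  have "w \<noteq> 0"
  proof
    assume "w = 0"
    then have "flip i (av z) = 0" using w av_eq_0_iff by metis
    then have "av z = flip i 0" using flip_flip[of i "av z"] by simp
    then have "av z = 0" by (simp add: vec_eq_iff flip_nth)
    then show False using a by blast
  qed
  have "nu (ppoint w) = nu (ppoint z)"
    unfolding nu_eq_iff[OF \<open>w \<noteq> 0\<close> z(1)] using z(3) w by (metis vector_smult_lid)
  moreover have "ppoint w \<noteq> ppoint z"
  proof
    assume "ppoint w = ppoint z"
    then obtain c where "w = c *s z" using \<open>w \<noteq> 0\<close> ppoint_eq_iff by blast
    then have e: "flip i (av z) $ j = c\<^sup>2 * av z $ j" for j using w by (metis av_smult vector_smult_component)
    have "- av z $ i = c\<^sup>2 * av z $ i" "av z $ (i+1) = c\<^sup>2 * av z $ (i+1)"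
      using e[of i] e[of "i+1"] by (simp_all add: flip_nth)
    then have "c\<^sup>2 = - 1" "c\<^sup>2 = 1" using vertex_nonzero(1)[OF r conic_av a z(3)]
      by (metis mult_cancel_right mult_minus_left mult_1)+
    then show False by simp
  qed
  moreover have "ppoint w \<in> vertices" using vertices_iff[OF \<open>w \<noteq> 0\<close>] z(3) w by (metis vertex_forms_flip)
  ultimately show ?thesis unfolding z(2) by blast
qed

lemma partner_unique:
  assumes s: "s \<in> vertices" and t: "t \<in> proj_space" "t \<noteq> s" "nu t = nu s" and u: "u \<in> proj_space" "u \<noteq> s" "nu u = nu s"
  shows "t = u"
proof -
  obtain z where z: "z \<noteq> 0" "s = ppoint z" using s unfolding vertices_def by blast
  have a: "av z \<noteq> 0" using av_eq_0_iff z(1) by blast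
  obtain x where x: "x \<noteq> 0" "t = ppoint x" using t(1) by (rule proj_cases)
  obtain y where y: "y \<noteq> 0" "u = ppoint y" using u(1) by (rule proj_cases)
  obtain i c where i: "vertex_forms r (av z) $ i = 0" "av x = c *s flip i (av z)" using nu_eq_iff[OF x(1) z(1)] t(2,3) z(2) x(2) by blast
  obtain j d where j: "vertex_forms r (av z) $ j = 0" "av y = d *s flip j (av z)" using nu_eq_iff[OF y(1) z(1)] u(2,3) z(2) y(2) by blast
  have ij: "i = j" using vertex_nonzero(2)[OF r conic_av a i(1), of j] j(1) by auto
  have "d \<noteq> 0"
  proof
    assume "d = 0"
    then have "av y = 0" using j(2) by simp
    then show False using y(1) av_eq_0_iff by blast
  qed
  then have "av x = (c / d) *s av y" unfolding i(2) j(2) ij vector_smult_assoc by simp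
  then obtain e where "x = e *s y" using av_proportional y(1) by blast
  then show ?thesis using x y by (metis ppoint_scale vector_smult_lzero)
qed

lemma vertices_sub: "vertices \<subseteq> proj_space"
  unfolding vertices_def using ppoint_in_proj by blast

text \<open>
  At a vertex one coordinate of the point in the plane vanishes, and the ratio of the others is
  that of a node.
\<close>

lemma vertex_over_node:
  assumes z: "z \<noteq> 0" and m: "vertex_forms r (av z) $ i = 0"
  shows "\<exists>n\<in>node_vectors. nu (ppoint z) = ppoint (yy n (kap n))"
proof -
  let ?a = "av z"
  have a: "?a \<noteq> 0" using av_eq_0_iff z by blast
  define x where "x = cx r ?a"
  note v = vertex_squares[OF r conic_av m]
  have xi: "x $ i = 0" unfolding x_def cx_vertex_forms using m by simp
  have x1: "x $ (i+1) = - 4 * (r + 1) * (?a $ (i+2))\<^sup>2 * ?a $ (i+1)" "x $ (i+2) = 4 * (r + 1) * (?a $ (i+2))\<^sup>2 * ?a $ (i+2)"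
    unfolding x_def cx_vertex_forms v by simp_all
  have "r + 1 \<noteq> 0" using golden_nonzero[OF r] by auto
  then have x2: "x $ (i+2) \<noteq> 0" unfolding x1 using vertex_nonzero(1)[OF r conic_av a m] by (simp del: distrib_left_numeral)
  have "(x $ (i+1))\<^sup>2 = (r + 1) * (x $ (i+2))\<^sup>2" unfolding x1 power_mult_distrib v(1) by (simp add: power2_eq_square)
  then obtain e where e: "e \<in> {r, -r}" "x $ (i+1) = e * x $ (i+2)" using edge_node by blast
  have "\<exists>n\<in>node_vectors. x = x $ (i+2) *s n"
  proof -
    have mem: "vector [0, e, 1] \<in> node_vectors" "vector [1, 0, e] \<in> node_vectors" "vector [e, 1, 0] \<in> node_vectors"
      using e(1) unfolding node_vectors_def by blast+
    have "i = 1 \<or> i = 2 \<or> i = 3" by (rule exhaust_3)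
    then show ?thesis
    proof (elim disjE)
      assume i: "i = 1"
      have "x = x $ (i+2) *s vector [0, e, 1]" using xi e(2) unfolding i vec3_eq_iff by simp
      then show ?thesis using mem by blast
    next
      assume i: "i = 2"
      have "x = x $ (i+2) *s vector [1, 0, e]" using xi e(2) unfolding i vec3_eq_iff by (simp add: three_numeral)
      then show ?thesis using mem by blast
    next
      assume i: "i = 3"
      have "x = x $ (i+2) *s vector [e, 1, 0]" using xi e(2) unfolding i vec3_eq_iff by (simp add: three_numeral)
      then show ?thesis using mem by blast
    qed
  qed
  then obtain n where n: "n \<in> node_vectors" "x = x $ (i+2) *s n" by blast
  then have k: "kap x \<noteq> 0" using node_kap[OF n(1)] x2 by (metis kap_smult power_not_zero vector_mul_eq_0)
  have "nu (ppoint z) = ppoint (yy x (kap x))"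
    unfolding nu_ppoint[OF z] yc_def x_def by (rule yy_kap_same[OF curve_incid curve_nz(2)[OF z] k[unfolded x_def]])
  also have "\<dots> = ppoint (yy n (kap n))"
    using x2 by (subst (1 2) n(2)) (simp add: kap_smult yy_smult ppoint_scale vector_smult_assoc)
  finally show ?thesis using n(1) by blast
qed

lemma nu_at_node:
  assumes z: "z \<noteq> 0" and x: "cx r (av z) = c *s n" "c \<noteq> 0" and k: "kap n \<noteq> 0"
  shows "nu (ppoint z) = ppoint (yy n (kap n))"
proof -
  have kx: "kap (cx r (av z)) \<noteq> 0" unfolding x(1) kap_smult using x(2) k by simp
  have "nu (ppoint z) = ppoint (yy (cx r (av z)) (kap (cx r (av z))))"
    unfolding nu_ppoint[OF z] yc_def by (rule yy_kap_same[OF curve_incid curve_nz(2)[OF z] kx])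
  also have "yy (cx r (av z)) (kap (cx r (av z))) = (c\<^sup>2 * c) *s yy n (kap n)"
    unfolding x(1) kap_smult yy_smult vector_smult_assoc ..
  finally show ?thesis using x(2) by (simp add: ppoint_scale)
qed

lemma node_under_vertex:
  assumes n: "n \<in> node_vectors"
  shows "\<exists>s\<in>vertices. nu s = ppoint (yy n (kap n))"
proof -
  obtain e where e: "e \<in> {r, -r}" "n \<in> {vector [0, e, 1], vector [1, 0, e], vector [e, 1, 0]}"
    using n unfolding node_vectors_def by blast
  have e2: "e\<^sup>2 = r + 1" using e(1) r by (auto simp: power2_eq_square)
  define q where "q = csqrt (- (r + 2))"
  have q2: "q\<^sup>2 = - (r + 2)" by (simp add: q_def)
  have "\<exists>a i. conic a \<and> a \<noteq> 0 \<and> vertex_forms r a $ i = 0 \<and> cx r a = (4 * (r + 1)) *s n"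
  proof -
    consider "n = vector [0, e, 1]" | "n = vector [1, 0, e]" | "n = vector [e, 1, 0]" using e(2) by blast
    then show ?thesis
    proof cases
      case 1
      show ?thesis unfolding 1
        by (rule exI[of _ "vector [q, - e, 1]"], rule exI[of _ 1])
          (simp add: conic_def vertex_forms_def cx_def vec3_eq_iff e2 q2, simp add: algebra_simps r)
    next
      case 2
      show ?thesis unfolding 2
        by (rule exI[of _ "vector [1, q, - e]"], rule exI[of _ 2])
          (simp add: conic_def vertex_forms_def cx_def vec3_eq_iff e2 q2, simp add: algebra_simps r)
    next
      case 3
      show ?thesis unfolding 3
        by (rule exI[of _ "vector [- e, 1, q]"], rule exI[of _ 3])
          (simp add: conic_def vertex_forms_def cx_def vec3_eq_iff e2 q2, simp add: algebra_simps r)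
    qed
  qed
  then obtain a i where a: "conic a" "a \<noteq> 0" "vertex_forms r a $ i = 0" "cx r a = (4 * (r + 1)) *s n" by blast
  obtain z where z: "av z = a" using av_onto[OF a(1)] by blast
  have z0: "z \<noteq> 0" using z a(2) av_eq_0_iff by blast
  have "4 * (r + 1) \<noteq> 0" using golden_nonzero(2)[OF r] by (simp del: distrib_left_numeral)
  then have "nu (ppoint z) = ppoint (yy n (kap n))" using nu_at_node[OF z0, of "4 * (r + 1)" n] a(4) z node_kap[OF n] by simp
  moreover have "ppoint z \<in> vertices" using vertices_iff[OF z0] a(3) z by blast
  ultimately show ?thesis by blast
qed

lemma nu_vertices: "nu ` vertices = nodes"
proof (intro equalityI subsetI)
  fix t assume "t \<in> nu ` vertices"
  then obtain z i where "z \<noteq> 0" "vertex_forms r (av z) $ i = 0" "t = nu (ppoint z)" unfolding vertices_def by blast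
  then show "t \<in> nodes" using vertex_over_node unfolding nodes_def by blast
next
  fix t assume "t \<in> nodes"
  then obtain n where n: "n \<in> node_vectors" "t = ppoint (yy n (kap n))" unfolding nodes_def by blast
  then show "t \<in> nu ` vertices" using node_under_vertex[OF n(1)] by (metis image_eqI)
qed

lemma card_nodes: "card nodes = 6"
proof -
  have rn: "r \<noteq> - r" using golden_nonzero(1)[OF r] by simp
  have "inj_on (\<lambda>n. ppoint (yy n (kap n))) node_vectors"
  proof (rule inj_onI)
    fix n n' assume n: "n \<in> node_vectors" "n' \<in> node_vectors" "ppoint (yy n (kap n)) = ppoint (yy n' (kap n'))"
    have nz: "yy n (kap n) \<noteq> 0" using node_kap[OF n(1)] yy_eq_0_iff[OF incid_kap] by (auto simp: kap_def vec3_eq_iff)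
    then obtain c where "yy n (kap n) = c *s yy n' (kap n')" using n(3) ppoint_eq_iff by blast
    then obtain s where s: "n = s *s n'" using yy_proportional[OF incid_kap incid_kap _ nz] by blast
    show "n = n'" using n(1,2) s golden_nonzero(1)[OF r] unfolding node_vectors_def
      by (auto simp: vec3_eq_iff)
  qed
  then have "card nodes = card node_vectors" unfolding nodes_def by (rule card_image)
  also have "\<dots> = 6"
  proof -
    have "node_vectors = {vector [0, r, 1], vector [1, 0, r], vector [r, 1, 0], vector [0, -r, 1], vector [1, 0, -r], vector [-r, 1, 0]}"
      unfolding node_vectors_def by auto
    then show ?thesis using rn golden_nonzero(1)[OF r] by (simp add: card_insert_if vec3_eq_iff)
  qed
  finally show ?thesis .
qed

lemma card_vertices: "card vertices = 12" and finite_vertices: "finite vertices"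
proof -
  have fib: "card {s \<in> vertices. nu s = t} = 2" if t: "t \<in> nodes" for t
  proof -
    have "t \<in> nu ` vertices" unfolding nu_vertices by (rule t)
    then obtain s where s: "s \<in> vertices" "nu s = t" by (elim imageE) simp
    obtain u where u: "u \<in> vertices" "u \<noteq> s" "nu u = nu s" using partner_exists[OF s(1)] by (elim bexE conjE)
    have "{v \<in> vertices. nu v = t} = {s, u}"
    proof (intro equalityI subsetI)
      fix v assume "v \<in> {v \<in> vertices. nu v = t}"
      then have v: "v \<in> proj_space" "nu v = nu s" using s(2) vertices_sub by auto
      have u': "u \<in> proj_space" using u(1) vertices_sub by blast
      show "v \<in> {s, u}" using partner_unique[OF s(1) v(1) _ v(2) u' u(2,3)] by (cases "v = s") simp_all
    qed (use s u in auto)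
    then have "card {v \<in> vertices. nu v = t} = card {s, u}" by (rule arg_cong)
    also have "\<dots> = 2" using u(2) by (intro card_2_iff[THEN iffD2] exI[of _ s] exI[of _ u]) auto
    finally show ?thesis .
  qed
  define F where "F = (\<lambda>t. {v \<in> vertices. nu v = t})"
  have F: "card (F t) = 2" "finite (F t)" if "t \<in> nodes" for t
    using fib[OF that] card.infinite[of "F t"] unfolding F_def by fastforce+
  have fn: "finite nodes" using card_nodes card.infinite[of nodes] by fastforce
  have "nu s \<in> nodes" if "s \<in> vertices" for s using imageI[OF that, of nu] unfolding nu_vertices .
  then have "vertices \<subseteq> \<Union> (F ` nodes)" unfolding F_def by blast
  moreover have "\<Union> (F ` nodes) \<subseteq> vertices" unfolding F_def by blast
  ultimately have un: "\<Union> (F ` nodes) = vertices" by (intro equalityI)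
  have "finite (\<Union> (F ` nodes))" using fn F(2) by blast
  then show "finite vertices" unfolding un .
  have "card (\<Union> (F ` nodes)) = (\<Sum>t\<in>nodes. card (F t))"
  proof (rule card_UN_disjoint[OF fn])
    show "\<forall>t\<in>nodes. finite (F t)" using F(2) by blast
    show "\<forall>t\<in>nodes. \<forall>t'\<in>nodes. t \<noteq> t' \<longrightarrow> F t \<inter> F t' = {}" unfolding F_def by blast
  qed
  also have "\<dots> = (\<Sum>t\<in>nodes. 2)" by (rule sum.cong[OF refl F(1)])
  also have "\<dots> = 12" by (simp add: card_nodes)
  finally show "card vertices = 12" unfolding un .
qed

lemma forms_av: "(\<lambda>z. av z $ i) \<in> forms 2"
proof -
  have m: "f \<in> forms d \<Longrightarrow> g \<in> forms e \<Longrightarrow> (\<lambda>x. f x * g x) \<in> forms k" if "d + e = k" for f g :: "complex^2 \<Rightarrow> complex" and d e k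
    using forms_mult[of f d g e] that by simp
  have block_quadric: "(\<lambda>x :: complex^2. (x $ i)\<^sup>2) \<in> forms 2" for i using forms_power[OF forms_coord, of i 2] by simp
  have "\<forall>i. (\<lambda>z. av z $ i) \<in> forms 2"
    unfolding forall_3 av_def vector_3
    by (intro conjI forms_add forms_diff forms_cmult block_quadric m[OF _ forms_cmult[OF forms_coord] forms_coord]) simp_all
  then show ?thesis ..
qed

text \<open>
  The two maps agree off the vertices, and their determinant is a form; hence it vanishes
  identically.
\<close>

lemma lift_unique:
  fixes M M' :: "complex^2^2"
  assumes M: "invertible M" and M': "invertible M'"
    and e: "\<And>z. z \<noteq> 0 \<Longrightarrow> nu (ppoint (M *v z)) = nu (ppoint (M' *v z))"
    and z: "z \<noteq> 0"
  shows "ppoint (M *v z) = ppoint (M' *v z)"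
proof (rule ccontr)
  assume ne: "ppoint (M *v z) \<noteq> ppoint (M' *v z)"
  define d where "d = (\<lambda>z. (M *v z) $ 1 * (M' *v z) $ 2 - (M *v z) $ 2 * (M' *v z) $ 1)"
  have df: "d \<in> forms 2" unfolding d_def
    using forms_diff[OF forms_mult[OF forms_matrix[of M 1] forms_matrix[of M' 2]] forms_mult[OF forms_matrix[of M 2] forms_matrix[of M' 1]]]
    unfolding one_add_one .
  have dz: "d w \<noteq> 0" if w: "w \<noteq> 0" "ppoint (M *v w) \<noteq> ppoint (M' *v w)" for w
  proof
    assume "d w = 0"
    then obtain c where "M *v w = c *s (M' *v w)"
      using det2_zero_proportional[OF invertible_nz[OF M' w(1)]] unfolding d_def by auto
    then show False using w(2) invertible_nz[OF M w(1)] by (metis ppoint_scale vector_smult_lzero)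
  qed
  define v where "v = (\<lambda>z. vertex_forms r (av z) $ 1 * vertex_forms r (av z) $ 2 * vertex_forms r (av z) $ 3)"
  have mff: "(\<lambda>z. vertex_forms r (av z) $ i) \<in> forms 4" for i
    unfolding vertex_forms_nth using forms_diff[OF forms_cmult[OF forms_power[OF forms_av, of _ 2]] forms_power[OF forms_av, of _ 2]] by simp
  have "v \<in> forms 12" unfolding v_def using forms_mult[OF forms_mult[OF mff mff] mff] by simp
  then have lv: "line_poly (\<lambda>z. v (M' *v z))" using line_poly_forms[OF forms_compose[OF _ forms_matrix[of M']]] by blast
  obtain z0 where z0: "av z0 = vector [0, 1, \<i>]" using av_onto[of "vector [0, 1, \<i>]"] by (auto simp: conic_def)
  obtain N where N: "M' ** N = mat 1" using M' unfolding invertible_def by blast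
  have "v (M' *v (N *v z0)) \<noteq> 0"
  proof -
    have m0: "vertex_forms r (av z0) $ 1 = - (r + 2)" "vertex_forms r (av z0) $ 2 = 1" "vertex_forms r (av z0) $ 3 = r + 1"
      unfolding z0 vertex_forms_def by (simp_all add: power_mult_distrib)
    show ?thesis unfolding matrix_vector_mul_assoc N matrix_vector_mul_lid v_def m0 using golden_nonzero[OF r] by (simp add: neg_eq_iff_add_eq_0)
  qed
  from line_poly_domain[OF line_poly_forms[OF df] lv dz[OF z ne] this]
  obtain w where w: "d w \<noteq> 0" "v (M' *v w) \<noteq> 0" by blast
  have w0: "w \<noteq> 0" using w(1) unfolding d_def by auto
  have "\<not> (\<exists>i. vertex_forms r (av (M' *v w)) $ i = 0)"
  proof
    assume "\<exists>i. vertex_forms r (av (M' *v w)) $ i = 0"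
    then obtain i where "vertex_forms r (av (M' *v w)) $ i = 0" ..
    then show False using w(2) exhaust_3[of i] unfolding v_def by auto
  qed
  then have "ppoint (M *v w) = ppoint (M' *v w)"
    using nu_eq_iff[OF invertible_nz[OF M w0] invertible_nz[OF M' w0]] e[OF w0] by blast
  then obtain c where "M *v w = c *s (M' *v w)" using ppoint_eq_iff invertible_nz[OF M w0] by blast
  then show False using w(1) unfolding d_def by simp
qed

end

context split_coords_action
begin

definition lifts :: "complex^2^2 \<Rightarrow> (nat \<Rightarrow> nat) \<Rightarrow> bool"
  where "lifts M g \<longleftrightarrow> invertible M \<and> (\<forall>z. z \<noteq> 0 \<longrightarrow> nu (ppoint (M *v z)) = \<theta> g (nu (ppoint z)))"

lemma acts_by_lift:
  assumes t: "acts_by g S T"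
  shows "\<exists>M d. lifts M g \<and> d \<noteq> 0 \<and> (\<forall>z. av (M *v z) = d *s (T *v av z))"
proof -
  have gd: "icosahedral r S T" using t unfolding acts_by_def by blast
  then obtain M c d where M: "invertible M" "c \<noteq> 0" "\<And>z. curve_u r (M *v z) = c *s (S *v curve_u r z)" "\<And>z. curve_v r (M *v z) = c *s (T *v curve_v r z)"
    "d \<noteq> 0" "\<And>z. av (M *v z) = d *s (T *v av z)"
    unfolding icosahedral_def by blast
  have yc: "yc (M *v z) = c *s (act S T *v yc z)" for z unfolding yc_pt act_mult U_pt V_pt M(3,4) pt_smult ..
  have "nu (ppoint (M *v z)) = \<theta> g (nu (ppoint z))" if z: "z \<noteq> 0" for z
  proof -
    have "\<theta> g (nu (ppoint z)) = ppoint (act S T *v yc z)"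
      using t gact_ppoint[of "yc z"] nu_in_del_pezzo[OF ppoint_in_proj[OF z]] nu_ppoint[OF z] unfolding acts_by_def by simp
    then show ?thesis unfolding nu_ppoint[OF invertible_nz[OF M(1) z]] yc using M(2) by (simp add: ppoint_scale)
  qed
  then show ?thesis unfolding lifts_def using M by blast
qed

definition mlift :: "(nat \<Rightarrow> nat) \<Rightarrow> complex^2^2" where "mlift g = (SOME M. lifts M g)"

definition tau :: "(nat \<Rightarrow> nat) \<Rightarrow> (complex^2) set \<Rightarrow> (complex^2) set" where "tau g = projectivity (mlift g)"

lemma mlift: "g \<in> carrier (alt_group 5) \<Longrightarrow> lifts (mlift g) g"
  unfolding mlift_def using theta_alt acts_by_lift by (metis someI_ex)

lemma mlift_inv: "g \<in> carrier (alt_group 5) \<Longrightarrow> invertible (mlift g)"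
  using mlift unfolding lifts_def by blast

lemma nu_tau: "g \<in> carrier (alt_group 5) \<Longrightarrow> s \<in> proj_space \<Longrightarrow> nu (tau g s) = \<theta> g (nu s)"
  using mlift[of g] unfolding lifts_def tau_def by (elim proj_cases) (simp add: projectivity_ppoint)

lemma tau_eq:
  assumes g: "g \<in> carrier (alt_group 5)" and M: "lifts M g" shows "tau g = projectivity M"
proof
  fix s
  show "tau g s = projectivity M s"
  proof (cases "s \<in> proj_space")
    case True
    then obtain z where z: "z \<noteq> 0" "s = ppoint z" by (rule proj_cases)
    have "ppoint (mlift g *v z) = ppoint (M *v z)"
      using mlift[OF g] M z(1) by (intro lift_unique) (auto simp: lifts_def)
    then show ?thesis unfolding tau_def z(2) projectivity_ppoint[OF z(1)] .
  qed (simp add: tau_def projectivity_def)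
qed

lemma alt_comp: "g \<in> carrier (alt_group 5) \<Longrightarrow> h \<in> carrier (alt_group 5) \<Longrightarrow> g \<circ> h \<in> carrier (alt_group 5)"
  using monoid.m_closed[OF group.is_monoid[OF alt_group_is_group]] unfolding alt_group_mult by blast

lemma theta_apply:
  assumes g: "g \<in> carrier (alt_group 5)" and h: "h \<in> carrier (alt_group 5)" and s: "s \<in> X"
  shows "\<theta> (g \<circ> h) s = \<theta> g (\<theta> h s)"
proof -
  obtain S T where t: "acts_by g S T" using theta_alt[OF g] by blast
  obtain S' T' where t': "acts_by h S' T'" using theta_alt[OF h] by blast
  have "\<theta> (g \<circ> h) = gact (S ** S') (T ** T')" using acts_by_mult[OF t t'] unfolding acts_by_def by blast
  then show ?thesis using t t' gact_compose[of S' T' s S T] s unfolding acts_by_def by simp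
qed

text \<open>
  The product of two lifts is a lift of the product; lifts are unique up to a scalar.
\<close>

lemma tau_mult:
  assumes g: "g \<in> carrier (alt_group 5)" and h: "h \<in> carrier (alt_group 5)"
  shows "tau (g \<circ> h) = mult (aut_group proj_space) (tau g) (tau h)"
proof -
  have "lifts (mlift g ** mlift h) (g \<circ> h)"
    unfolding lifts_def
  proof (intro conjI allI impI)
    show "invertible (mlift g ** mlift h)" using mlift_inv[OF g] mlift_inv[OF h] by (rule invertible_mult)
    fix z :: "complex^2" assume z: "z \<noteq> 0"
    have "nu (ppoint (mlift g *v (mlift h *v z))) = \<theta> g (\<theta> h (nu (ppoint z)))"
      using mlift[OF g] mlift[OF h] z invertible_nz[OF mlift_inv[OF h] z] unfolding lifts_def by simp
    then show "nu (ppoint ((mlift g ** mlift h) *v z)) = \<theta> (g \<circ> h) (nu (ppoint z))"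
      using theta_apply[OF g h nu_in_del_pezzo[OF ppoint_in_proj[OF z]]] by (simp add: matrix_vector_mul_assoc)
  qed
  then have "tau (g \<circ> h) = projectivity (mlift g ** mlift h)" by (rule tau_eq[OF alt_comp[OF g h]])
  then show ?thesis unfolding tau_def using projectivity_mult[OF mlift_inv[OF g] mlift_inv[OF h]] by simp
qed

lemma tau_hom: "tau \<in> hom (alt_group 5) (aut_group proj_space)"
  unfolding hom_def using tau_mult projectivity_aut[OF mlift_inv] by (auto simp: alt_group_mult tau_def)

lemma tau_in: "g \<in> carrier (alt_group 5) \<Longrightarrow> s \<in> proj_space \<Longrightarrow> tau g s \<in> proj_space"
  unfolding tau_def by (rule projectivity_in[OF mlift_inv])

lemma tau_action: "group_action (alt_group 5) proj_space tau"
proof -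
  have "tau \<in> hom (alt_group 5) (BijGroup proj_space)"
    using tau_hom unfolding hom_def by (auto simp: aut_group_def BijGroup_def)
  then show ?thesis
    unfolding group_action_def group_hom_def group_hom_axioms_def using alt_group_is_group group_BijGroup by blast
qed

end

section \<open>The orbit of twelve vertices\<close>

text \<open>
  The set is the disjoint union of the cycles of the permutation, which all have length five.
\<close>

lemma five_dvd_card:
  assumes fin: "finite A" and fA: "\<And>a. a \<in> A \<Longrightarrow> f a \<in> A" and f5: "\<And>a. a \<in> A \<Longrightarrow> f (f (f (f (f a)))) = a"
    and nf: "\<And>a. a \<in> A \<Longrightarrow> f a \<noteq> a"
  shows "5 dvd card A"
proof -
  define O' where "O' = (\<lambda>a. {a, f a, f (f a), f (f (f a)), f (f (f (f a)))})"
  have d2: "f (f a) \<noteq> a" if "a \<in> A" for a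
  proof
    assume "f (f a) = a"
    then have "f a = a" using f5[OF that] by simp
    then show False using nf[OF that] by blast
  qed
  have d3: "f (f (f a)) \<noteq> a" if "a \<in> A" for a
  proof
    assume "f (f (f a)) = a"
    then have "f (f a) = a" using f5[OF that] by simp
    then show False using d2[OF that] by blast
  qed
  have d4: "f (f (f (f a))) \<noteq> a" if "a \<in> A" for a
  proof
    assume "f (f (f (f a))) = a"
    then have "f a = a" using f5[OF that] by simp
    then show False using nf[OF that] by blast
  qed
  have sub: "O' a \<subseteq> A" if "a \<in> A" for a unfolding O'_def using that fA by auto
  have c5: "card (O' a) = 5" if a: "a \<in> A" for a
  proof -
    have m: "f a \<in> A" "f (f a) \<in> A" "f (f (f a)) \<in> A" using a fA by blast+
    have "distinct [a, f a, f (f a), f (f (f a)), f (f (f (f a)))]"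
      using nf[OF a] d2[OF a] d3[OF a] d4[OF a] nf[OF m(1)] d2[OF m(1)] d3[OF m(1)] nf[OF m(2)] d2[OF m(2)] nf[OF m(3)]
      by (simp only: distinct.simps list.set insert_iff empty_iff not_sym simp_thms)
    from distinct_card[OF this] show ?thesis by (simp add: O'_def)
  qed
  have inv: "O' b = O' a" if a: "a \<in> A" and b: "b \<in> O' a" for a b
    using b f5[OF a] unfolding O'_def by auto
  have "5 * card (O' ` A) = card (\<Union> (O' ` A))"
  proof (rule card_partition)
    show "finite (O' ` A)" using fin by blast
    show "finite (\<Union> (O' ` A))" using fin sub by (meson UN_least finite_subset)
    show "card c = 5" if "c \<in> O' ` A" for c using that c5 by blast
    show "c1 \<inter> c2 = {}" if c: "c1 \<in> O' ` A" "c2 \<in> O' ` A" "c1 \<noteq> c2" for c1 c2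
    proof (rule ccontr)
      assume "c1 \<inter> c2 \<noteq> {}"
      then obtain x where x: "x \<in> c1" "x \<in> c2" by blast
      obtain a1 a2 where a: "a1 \<in> A" "c1 = O' a1" "a2 \<in> A" "c2 = O' a2" using c(1,2) by blast
      then have "c1 = O' x" "c2 = O' x" using inv x by blast+
      then show False using c(3) by blast
    qed
  qed
  moreover have "\<Union> (O' ` A) = A" using sub unfolding O'_def by blast
  ultimately show ?thesis by (metis dvd_triv_left)
qed

text \<open>
  Two vectors with proportional squares differ, up to a factor, by a sign change; up to the
  overall sign it is even.
\<close>

lemma sign_cases:
  fixes a b :: "complex^3"
  assumes "\<And>k. (a $ k)\<^sup>2 = t * (b $ k)\<^sup>2"
  shows "\<exists>S\<in>{mat 1, rot2, rot2', rot2 ** rot2'}. \<exists>c. a = c *s (S *v b)"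
proof -
  define q where "q = csqrt t"
  have t: "t = q\<^sup>2" by (simp add: q_def)
  have k: "a $ k = q * b $ k \<or> a $ k = - (q * b $ k)" for k
    using assms[of k] unfolding t by (simp add: power2_eq_iff flip: power_mult_distrib)
  have m: "(rot2 *v b) $ 1 = b $ 1" "(rot2 *v b) $ 2 = - b $ 2" "(rot2 *v b) $ 3 = - b $ 3"
    "(rot2' *v b) $ 1 = - b $ 1" "(rot2' *v b) $ 2 = - b $ 2" "(rot2' *v b) $ 3 = b $ 3"
    "((rot2 ** rot2') *v b) $ 1 = - b $ 1" "((rot2 ** rot2') *v b) $ 2 = b $ 2" "((rot2 ** rot2') *v b) $ 3 = - b $ 3"
    unfolding rot2'_eq rot2_mult
    by (simp_all add: rot2_def matrix_vector_mult_def matrix_matrix_mult_def sum_3)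
  have "a = q *s b \<or> a = - q *s b \<or> a = q *s (rot2 *v b) \<or> a = - q *s (rot2 *v b) \<or> a = q *s (rot2' *v b) \<or> a = - q *s (rot2' *v b)
     \<or> a = q *s ((rot2 ** rot2') *v b) \<or> a = - q *s ((rot2 ** rot2') *v b)"
    unfolding vec3_eq_iff vector_smult_component m using k[of 1] k[of 2] k[of 3] by (elim disjE) simp_all
  then show ?thesis by (elim disjE) (auto intro: exI[of _ q] exI[of _ "- q"])
qed

lemma scalar_of_eigenvectors:
  fixes S :: "complex^3^3" and p q l :: complex
  assumes p: "p \<noteq> 0" "q \<noteq> 0"
    and e: "S *v vector [0, p, q] = l *s vector [0, p, q]" "S *v vector [0, -p, q] = l *s vector [0, -p, q]"
      "S *v vector [p, q, 0] = l *s vector [p, q, 0]"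
  shows "S *v x = l *s x"
proof -
  have lin: "S *v x = l *s x" if "x = a *s u + b *s v" "S *v u = l *s u" "S *v v = l *s v" for a b u v x
    unfolding that(1) using that(2,3) by (simp add: matrix_vector_right_distrib vector_scalar_commute vector_add_ldistrib vector_smult_assoc mult.commute)
  have "vector [0, 0, 1] = (1/(2*q)) *s vector [0, p, q] + (1/(2*q)) *s (vector [0, -p, q] :: complex^3)"
    using p by (simp add: vec3_eq_iff field_simps)
  then have e3: "S *v vector [0, 0, 1] = l *s vector [0, 0, 1]" by (rule lin[OF _ e(1,2)])
  have "vector [0, 1, 0] = (1/(2*p)) *s vector [0, p, q] + (-1/(2*p)) *s (vector [0, -p, q] :: complex^3)"
    using p by (simp add: vec3_eq_iff field_simps)
  then have e2: "S *v vector [0, 1, 0] = l *s vector [0, 1, 0]" by (rule lin[OF _ e(1,2)])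
  have "vector [1, 0, 0] = (1/p) *s vector [p, q, 0] + (-q/p) *s (vector [0, 1, 0] :: complex^3)"
    using p by (simp add: vec3_eq_iff field_simps)
  then have e1: "S *v vector [1, 0, 0] = l *s vector [1, 0, 0]" by (rule lin[OF _ e(3) e2])
  have "x = 1 *s (x$1 *s vector [1, 0, 0] + x$2 *s vector [0, 1, 0]) + x$3 *s vector [0, 0, 1]" by (simp add: vec3_eq_iff)
  then show ?thesis by (rule lin[OF _ lin[OF refl e1 e2] e3])
qed

context split_coords_action
begin

lemma tau_comp: "g \<in> carrier (alt_group 5) \<Longrightarrow> h \<in> carrier (alt_group 5) \<Longrightarrow> s \<in> proj_space \<Longrightarrow> tau (g \<circ> h) s = tau g (tau h s)"
  using group_action.composition_rule[OF tau_action, of s g h] by (simp add: alt_group_mult)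

lemma tau_inj: "g \<in> carrier (alt_group 5) \<Longrightarrow> s \<in> proj_space \<Longrightarrow> t \<in> proj_space \<Longrightarrow> tau g s = tau g t \<Longrightarrow> s = t"
  using group_action.inj_prop[OF tau_action, of g] unfolding inj_on_def by blast

lemma tau_vertices: assumes g: "g \<in> carrier (alt_group 5)" and s: "s \<in> vertices" shows "tau g s \<in> vertices"
proof -
  obtain t where t: "t \<in> vertices" "t \<noteq> s" "nu t = nu s" using partner_exists[OF s] by blast
  have p: "s \<in> proj_space" "t \<in> proj_space" using s t(1) vertices_sub by blast+
  have "nu (tau g s) = nu (tau g t)" using nu_tau[OF g] p t(3) by simp
  moreover have "tau g s \<noteq> tau g t" using tau_inj[OF g p] t(2) by blast
  ultimately show ?thesis using nu_fibre(1)[OF tau_in[OF g p(1)] tau_in[OF g p(2)]] by blast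
qed

text \<open>
  On the conic the action is given by the second block.
\<close>

lemma tau_by_conic:
  assumes g: "g \<in> carrier (alt_group 5)" and t: "acts_by g S T" and z: "z \<noteq> 0" "w \<noteq> 0" "av w = c *s (T *v av z)"
  shows "tau g (ppoint z) = ppoint w"
proof -
  obtain M d where M: "lifts M g" "d \<noteq> 0" "\<And>z. av (M *v z) = d *s (T *v av z)" using acts_by_lift[OF t] by blast
  have i: "invertible M" using M(1) unfolding lifts_def by blast
  have "av w \<noteq> 0" using z(2) av_eq_0_iff by blast
  then have "c \<noteq> 0" using z(3) by auto
  then have "av (M *v z) = (d / c) *s av w" unfolding M(3) z(3) by (simp add: vector_smult_assoc)
  then obtain e where "M *v z = e *s w" using av_proportional z(2) by blast
  then have "ppoint (M *v z) = ppoint w" using invertible_nz[OF i z(1)] by (metis ppoint_scale vector_smult_lzero)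
  then show ?thesis unfolding tau_eq[OF g M(1)] projectivity_ppoint[OF z(1)] .
qed

lemma conic_rotated: 
  assumes "acts_by g S T" "z \<noteq> 0" shows "\<exists>w. w \<noteq> 0 \<and> (\<exists>c. av w = c *s (T *v av z))"
proof -
  obtain M d where M: "lifts M g" "d \<noteq> 0" "\<And>z. av (M *v z) = d *s (T *v av z)" using acts_by_lift[OF assms(1)] by blast
  then show ?thesis using invertible_nz[of M z] assms(2) unfolding lifts_def by blast
qed

definition moves :: "(complex^2) set \<Rightarrow> (complex^2) set \<Rightarrow> bool"
  where "moves s t \<longleftrightarrow> (\<exists>g\<in>carrier (alt_group 5). tau g s = t)"

lemma moves_trans: "s \<in> proj_space \<Longrightarrow> moves s t \<Longrightarrow> moves t u \<Longrightarrow> moves s u"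
  unfolding moves_def using tau_comp alt_comp by metis

lemma moves_same_index:
  assumes z: "z \<noteq> 0" "vertex_forms r (av z) $ i = 0" and w: "w \<noteq> 0" "vertex_forms r (av w) $ i = 0"
  shows "moves (ppoint z) (ppoint w)"
proof -
  note vz = vertex_squares[OF r conic_av z(2)] and vw = vertex_squares[OF r conic_av w(2)]
  have az: "av z \<noteq> 0" using av_eq_0_iff z(1) by blast
  define t where "t = (av w $ (i+2))\<^sup>2 / (av z $ (i+2))\<^sup>2"
  have t: "(av w $ (i+2))\<^sup>2 = t * (av z $ (i+2))\<^sup>2"
    using vertex_nonzero(1)[OF r conic_av az z(2)] by (simp add: t_def)
  have "\<forall>k. (av w $ k)\<^sup>2 = t * (av z $ k)\<^sup>2"
    unfolding three_shift_forall[of _ i] vz(1,2) vw(1,2) t by simp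
  then obtain S c where S: "S \<in> {mat 1, rot2, rot2', rot2 ** rot2'}" "av w = c *s (S *v av z)"
    using sign_cases[of "av w" t "av z"] by blast
  obtain a where a: "acts_by a rot2 rot2" using acts_by_exists[OF icosahedral_rot2] by blast
  obtain a' where a': "acts_by a' rot2' rot2'" using acts_by_exists[OF icosahedral_rot2'] by blast
  note al = acts_by_alt_rot2[OF a a']
  have "id \<in> carrier (alt_group 5)" using alt_iff_sign[of id] acts_by_id unfolding acts_by_def by simp
  then have "\<exists>g\<in>carrier (alt_group 5). acts_by g S S"
    using S(1) a a' al acts_by_id acts_by_mult[OF a a'] alt_comp[OF al] by blast
  then show ?thesis unfolding moves_def using tau_by_conic[OF _ _ z(1) w(1) S(2)] by blast
qed

lemma vertex_forms_rot3: "vertex_forms r (rot3 *v a) $ i = vertex_forms r a $ (i+1)"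
proof -
  have "\<forall>i. (rot3 *v a) $ i = a $ (i+1)" unfolding forall_3 rot3_mult vector_3 by (simp add: three_numeral)
  then show ?thesis unfolding vertex_forms_nth by (simp add: three_arith)
qed

lemma moves_next_index:
  assumes z: "z \<noteq> 0" "vertex_forms r (av z) $ i = 0"
  shows "\<exists>w. w \<noteq> 0 \<and> vertex_forms r (av w) $ (i+2) = 0 \<and> moves (ppoint z) (ppoint w)"
proof -
  obtain t where t: "acts_by t rot3 rot3" using acts_by_exists[OF icosahedral_rot3] by blast
  obtain w c where w: "w \<noteq> 0" "av w = c *s (rot3 *v av z)" using conic_rotated[OF t z(1)] by blast
  have "vertex_forms r (av w) $ (i+2) = 0" unfolding w(2) vertex_forms_smult using z(2) by (simp add: vertex_forms_rot3 three_arith)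
  moreover have "moves (ppoint z) (ppoint w)" unfolding moves_def
    using tau_by_conic[OF acts_by_alt_rot3(1)[OF t] t z(1) w] acts_by_alt_rot3(1)[OF t] by blast
  ultimately show ?thesis using w(1) by blast
qed

text \<open>
  Vertices with the same vanishing form \<open>i\<close> have proportional squares, so they are related by sign
  changes; the cyclic permutation moves the index \<open>i\<close>.
\<close>

lemma vertices_transitive:
  assumes "s \<in> vertices" "t \<in> vertices" shows "moves s t"
proof -
  obtain z i where z: "z \<noteq> 0" "s = ppoint z" "vertex_forms r (av z) $ i = 0" using assms(1) unfolding vertices_def by blast
  obtain w j where w: "w \<noteq> 0" "t = ppoint w" "vertex_forms r (av w) $ j = 0" using assms(2) unfolding vertices_def by blast
  obtain z1 where z1: "z1 \<noteq> 0" "vertex_forms r (av z1) $ (i+2) = 0" "moves (ppoint z) (ppoint z1)" using moves_next_index[OF z(1,3)] by blast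
  obtain z2 where z2: "z2 \<noteq> 0" "vertex_forms r (av z2) $ (i+1) = 0" "moves (ppoint z1) (ppoint z2)"
    using moves_next_index[OF z1(1,2)] unfolding three_arith by blast
  have "\<forall>j. vertex_forms r (av w) $ j = 0 \<longrightarrow> moves s t"
    unfolding three_shift_forall[of _ i] z(2) w(2)
    using moves_same_index[OF z(1,3) w(1)] moves_same_index[OF z1(1,2) w(1)] moves_same_index[OF z2(1,2) w(1)]
      z1(3) z2(3) moves_trans ppoint_in_proj z(1) z1(1) by metis
  then show ?thesis using w(3) by blast
qed

lemma orbit_vertices: "s \<in> vertices \<Longrightarrow> orbit (alt_group 5) tau s = vertices"
  unfolding orbit_def using tau_vertices vertices_transitive unfolding moves_def by blast

text \<open>
  If the action on the line is trivial, its lift is a scalar, and the vectors of the curve are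
  eigenvectors of the block matrices for one and the same eigenvalue. They span both blocks, so
  the automorphism is trivial.
\<close>

lemma tau_faithful:
  assumes g: "g \<in> carrier (alt_group 5)" and id: "\<And>s. s \<in> proj_space \<Longrightarrow> tau g s = s"
  shows "g = id"
proof -
  obtain S T where t: "acts_by g S T" using theta_alt[OF g] by blast
  then have gd: "icosahedral r S T" unfolding acts_by_def by blast
  then obtain M c d where M: "invertible M" "c \<noteq> 0" "\<And>z. curve_u r (M *v z) = c *s (S *v curve_u r z)" "\<And>z. curve_v r (M *v z) = c *s (T *v curve_v r z)"
    unfolding icosahedral_def by blast
  have yc: "yc (M *v z) = c *s (act S T *v yc z)" for z unfolding yc_pt act_mult U_pt V_pt M(3,4) pt_smult ..
  have "lifts M g" unfolding lifts_def
  proof (intro conjI allI impI M(1))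
    fix z :: "complex^2" assume z: "z \<noteq> 0"
    have "\<theta> g (nu (ppoint z)) = ppoint (act S T *v yc z)"
      using t gact_ppoint[of "yc z"] nu_in_del_pezzo[OF ppoint_in_proj[OF z]] nu_ppoint[OF z] unfolding acts_by_def by simp
    then show "nu (ppoint (M *v z)) = \<theta> g (nu (ppoint z))"
      unfolding nu_ppoint[OF invertible_nz[OF M(1) z]] yc using M(2) by (simp add: ppoint_scale)
  qed
  then have tp: "tau g = projectivity M" by (rule tau_eq[OF g])
  have fix1: "\<exists>a. M *v z = a *s z" if z: "z \<noteq> 0" for z
  proof -
    have "ppoint (M *v z) = ppoint z" using id[OF ppoint_in_proj[OF z]] unfolding tp projectivity_ppoint[OF z] .
    then show ?thesis using ppoint_eq_iff[OF invertible_nz[OF M(1) z]] by blast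
  qed
  let ?e1 = "vector [1, 0] :: complex^2" and ?e2 = "vector [0, 1] :: complex^2" and ?e3 = "vector [1, 1] :: complex^2"
  have nz: "?e1 \<noteq> 0" "?e2 \<noteq> 0" "?e3 \<noteq> 0" by (simp_all add: vec2_eq_iff)
  have ne: "ppoint ?e1 \<noteq> ppoint ?e2" "ppoint ?e1 \<noteq> ppoint ?e3" "ppoint ?e2 \<noteq> ppoint ?e3"
    by (auto simp: ppoint_eq_iff[OF nz(1)] ppoint_eq_iff[OF nz(2)] vec2_eq_iff)
  obtain m where m: "\<forall>w. M *v w = m *s w"
    using three_fixed_points[OF nz ne] fix1[OF nz(1)] fix1[OF nz(2)] fix1[OF nz(3)] by metis
  define l where "l = m ^ 10 / c"
  have act: "act S T *v yc z = l *s yc z" for z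
  proof -
    have "c *s (act S T *v yc z) = m ^ 10 *s yc z" using yc[of z] m yc_smult by metis
    then have "inverse c *s (c *s (act S T *v yc z)) = inverse c *s (m ^ 10 *s yc z)" by simp
    then show ?thesis using M(2) by (simp add: l_def vector_smult_assoc field_simps)
  qed
  have Su: "S *v curve_u r z = l *s curve_u r z" and Tv: "T *v curve_v r z = l *s curve_v r z" for z
    using arg_cong[OF act[of z], of "\<lambda>w. U *v w"] arg_cong[OF act[of z], of "\<lambda>w. V *v w"]
    by (simp_all add: U_act V_act vector_scalar_commute yc_pt U_pt V_pt)
  have cu0: "cu r s 0 x y = 0" for s x y by (simp add: cu_def)
  have vals: "lin s (cx r a) (cm r a) \<in> {curve_u r z, curve_v r z}" if "s \<in> {r, 1 - r}" "av z = a" for s a z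
    using that unfolding curve_u_def curve_v_def by auto
  have con: "conic (vector [0, 1, \<i>])" "conic (vector [0, -1, \<i>])" "conic (vector [1, \<i>, 0])" by (simp_all add: conic_def)
  have cuv: "lin s (cx r (vector [0, 1, \<i>])) (cm r (vector [0, 1, \<i>])) = vector [0, cu r s 1 \<i> 0, cu r s \<i> 0 1]"
    "lin s (cx r (vector [0, -1, \<i>])) (cm r (vector [0, -1, \<i>])) = vector [0, - cu r s 1 \<i> 0, cu r s \<i> 0 1]"
    "lin s (cx r (vector [1, \<i>, 0])) (cm r (vector [1, \<i>, 0])) = vector [cu r s 1 \<i> 0, cu r s \<i> 0 1, 0]" for s
    unfolding lin_curve by (simp_all add: cu0 cu_even)
  obtain z1 z2 z3 where z: "av z1 = vector [0, 1, \<i>]" "av z2 = vector [0, -1, \<i>]" "av z3 = vector [1, \<i>, 0]"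
    using con av_onto by metis
  have p: "cu r r 1 \<i> 0 = 2 * (r - 1)" "cu r r \<i> 0 1 = \<i> * (2 * (r * (r + 1)))"
    "cu r (1 - r) 1 \<i> 0 = - (r + 3)" "cu r (1 - r) \<i> 0 1 = \<i> * ((r + 1) * (4 - r))"
  proof -
    show "cu r r 1 \<i> 0 = 2 * (r - 1)" "cu r (1 - r) 1 \<i> 0 = - (r + 3)"
      unfolding cu_def using r by (simp_all add: algebra_simps)
    have e: "r * 3 - (r - 1) * (r + 1) = 2 * r" "(1 - r) * 3 + r * (r + 1) = 4 - r" using r by (simp_all add: algebra_simps)
    have c: "cu r r \<i> 0 1 = \<i> * ((r + 1) * (r * 3 - (r - 1) * (r + 1)))"
      "cu r (1 - r) \<i> 0 1 = \<i> * ((r + 1) * ((1 - r) * 3 + r * (r + 1)))"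
      unfolding cu_def by (simp_all add: algebra_simps)
    show "cu r r \<i> 0 1 = \<i> * (2 * (r * (r + 1)))" unfolding c e by (simp only: mult_ac)
    show "cu r (1 - r) \<i> 0 1 = \<i> * ((r + 1) * (4 - r))" unfolding c e by (rule refl)
  qed
  have n3: "r + 3 \<noteq> 0" "4 - r \<noteq> 0"
  proof -
    show "r + 3 \<noteq> 0"
    proof
      assume "r + 3 = 0"
      then have "r = - 3" by (simp add: eq_neg_iff_add_eq_0)
      then show False using r by simp
    qed
    show "4 - r \<noteq> 0"
    proof
      assume "4 - r = 0"
      then have "r = 4" by simp
      then show False using r by simp
    qed
  qed
  have "r - 1 \<noteq> 0" using golden_nonzero(4)[OF r] by simp
  then have pn: "cu r r 1 \<i> 0 \<noteq> 0" "cu r r \<i> 0 1 \<noteq> 0" "cu r (1 - r) 1 \<i> 0 \<noteq> 0" "cu r (1 - r) \<i> 0 1 \<noteq> 0"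
    unfolding p mult_eq_0_iff neg_equal_0_iff_equal using golden_nonzero(1,2)[OF r] n3 complex_i_not_zero zero_neq_numeral[where 'a=complex, symmetric] by blast+
  have S: "S *v x = l *s x" for x
    using Su[of z1] Su[of z2] Su[of z3] unfolding curve_u_def z cuv by (rule scalar_of_eigenvectors[OF pn(1,2)])
  have T: "T *v x = l *s x" for x
    using Tv[of z1] Tv[of z2] Tv[of z3] unfolding curve_v_def z cuv by (rule scalar_of_eigenvectors[OF pn(3,4)])
  have aw: "act S T *v w = l *s w" for w unfolding act_mult S T pt_smult pt_UV ..
  have l0: "l \<noteq> 0"
  proof
    assume "l = 0"
    then have "act S T *v yc ?e1 = 0" using aw by simp
    then show False using act_nonzero[OF gd yc_nonzero[OF nz(1)]] by blast
  qed
  have "gact S T s = gact (mat 1) (mat 1) s" for s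
  proof (cases "s \<in> X")
    case True
    then obtain w where w: "s = ppoint w" by (rule del_pezzo_cases)
    show ?thesis using True gact_ppoint[of w] l0 unfolding w by (simp add: aw act_one ppoint_scale)
  qed (simp add: gact_def)
  then have "\<theta> g = \<theta> id" using t acts_by_id unfolding acts_by_def by auto
  then show "g = id" using theta_inj t acts_by_id unfolding acts_by_def by metis
qed

lemma at_most_two_fixed:
  assumes g: "g \<in> carrier (alt_group 5)" "g \<noteq> id"
    and s: "s \<in> proj_space" "t \<in> proj_space" "u \<in> proj_space" "s \<noteq> t" "s \<noteq> u" "t \<noteq> u"
    and f: "tau g s = s" "tau g t = t" "tau g u = u"
  shows False
proof -
  obtain x where x: "x \<noteq> 0" "s = ppoint x" using s(1) by (rule proj_cases)
  obtain y where y: "y \<noteq> 0" "t = ppoint y" using s(2) by (rule proj_cases)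
  obtain z where z: "z \<noteq> 0" "u = ppoint z" using s(3) by (rule proj_cases)
  note i = mlift_inv[OF g(1)]
  have e: "\<exists>a. mlift g *v w = a *s w" if w: "w \<noteq> 0" "tau g (ppoint w) = ppoint w" for w
    using w ppoint_eq_iff[OF invertible_nz[OF i w(1)]] unfolding tau_def projectivity_ppoint[OF w(1)] by blast
  obtain a where a: "\<forall>w. mlift g *v w = a *s w"
    using three_fixed_points[OF x(1) y(1) z(1)] s(4-6) e[OF x(1)] e[OF y(1)] e[OF z(1)] f unfolding x(2) y(2) z(2) by metis
  have "tau g v = v" if v: "v \<in> proj_space" for v
  proof -
    obtain w where w: "w \<noteq> 0" "v = ppoint w" using v by (rule proj_cases)
    have "a \<noteq> 0" using a invertible_nz[OF i w(1)] by auto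
    then show ?thesis unfolding w(2) tau_def projectivity_ppoint[OF w(1)] using a by (simp add: ppoint_scale)
  qed
  then show False using tau_faithful[OF g(1)] g(2) by blast
qed

lemma orbit_card: "s \<in> proj_space \<Longrightarrow> card (orbit (alt_group 5) tau s) * card (stabilizer (alt_group 5) tau s) = 60"
  using group_action.orbit_stabilizer_theorem[OF tau_action, of s] by (simp add: order_def card_alt)

lemma stabilizer_element:
  assumes s: "s \<in> proj_space" and c: "card (orbit (alt_group 5) tau s) = 12"
  shows "\<exists>g\<in>stabilizer (alt_group 5) tau s. g \<noteq> id \<and> g \<circ> g \<circ> g \<circ> g \<circ> g = id"
proof -
  let ?St = "stabilizer (alt_group 5) tau s"
  have c5: "card ?St = 5" using orbit_card[OF s] c by simp
  have sub: "subgroup ?St (alt_group 5)" using group_action.stabilizer_subgroup[OF tau_action s] .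
  have "\<not> ?St \<subseteq> {id}"
  proof
    assume "?St \<subseteq> {id}"
    then have "card ?St \<le> card {id :: nat \<Rightarrow> nat}" by (intro card_mono) auto
    then show False using c5 by simp
  qed
  then obtain g where g: "g \<in> ?St" "g \<noteq> id" by blast
  define H where "H = (alt_group 5)\<lparr>carrier := ?St\<rparr>"
  have H: "group H" "carrier H = ?St" "mult H = (\<circ>)" "one H = id" "order H = 5"
    unfolding H_def using subgroup.subgroup_is_group[OF sub alt_group_is_group] c5
    by (simp_all add: alt_group_mult alt_group_one order_def)
  have "g [^]\<^bsub>H\<^esub> (5::nat) = id" using group.pow_order_eq_1[OF H(1), of g] g(1) by (simp add: H)
  then have "g \<circ> g \<circ> g \<circ> g \<circ> g = id"
    using monoid.nat_pow_Suc[OF group.is_monoid[OF H(1)]] monoid.nat_pow_0[OF group.is_monoid[OF H(1)]]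
    by (simp add: eval_nat_numeral H)
  then show ?thesis using g by blast
qed

text \<open>
  An element of order five in the stabilizer of a point has at least \<open>12 mod 5\<close> fixed points among
  the twelve vertices, but no more than two in all.
\<close>

lemma vertex_orbit_eq: "vertex_orbit tau = vertices"
proof (intro equalityI subsetI)
  fix s assume "s \<in> vertices"
  then show "s \<in> vertex_orbit tau" unfolding vertex_orbit_def using orbit_vertices card_vertices vertices_sub by auto
next
  fix s assume "s \<in> vertex_orbit tau"
  then have s: "s \<in> proj_space" "card (orbit (alt_group 5) tau s) = 12" unfolding vertex_orbit_def by auto
  show "s \<in> vertices"
  proof (rule ccontr)
    assume ns: "s \<notin> vertices"
    obtain g where gs: "g \<in> stabilizer (alt_group 5) tau s" "g \<noteq> id" "g \<circ> g \<circ> g \<circ> g \<circ> g = id"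
      using stabilizer_element[OF s] by blast
    then have g: "g \<in> carrier (alt_group 5)" "tau g s = s" unfolding stabilizer_def by auto
    define F where "F = {v \<in> vertices. tau g v = v}"
    have t5: "tau g (tau g (tau g (tau g (tau g v)))) = v" if v: "v \<in> vertices" for v
    proof -
      have p: "v \<in> proj_space" using v vertices_sub by blast
      have c: "g \<circ> g \<in> carrier (alt_group 5)" "g \<circ> g \<circ> g \<in> carrier (alt_group 5)" "g \<circ> g \<circ> g \<circ> g \<in> carrier (alt_group 5)"
        using alt_comp g(1) by blast+
      have "tau id v = v" using group_action.id_eq_one[OF tau_action] p unfolding alt_group_one by (metis restrict_apply')
      then have "v = tau (g \<circ> g \<circ> g \<circ> g \<circ> g) v" unfolding gs(3) by simp
      also have "\<dots> = tau g (tau g (tau g (tau g (tau g v))))"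
        using tau_comp[OF c(3) g(1) p] tau_comp[OF c(2) g(1)] tau_comp[OF c(1) g(1)] tau_comp[OF g(1) g(1)] tau_in[OF g(1)] p by simp
      finally show ?thesis by simp
    qed
    have N: "5 dvd card (vertices - F)"
    proof (rule five_dvd_card[where f = "tau g"])
      show "finite (vertices - F)" using finite_vertices by blast
      show "tau g v \<in> vertices - F" if "v \<in> vertices - F" for v
        using that tau_vertices[OF g(1)] tau_inj[OF g(1)] vertices_sub unfolding F_def by blast
      show "tau g (tau g (tau g (tau g (tau g v)))) = v" if "v \<in> vertices - F" for v using that t5 by blast
      show "tau g v \<noteq> v" if "v \<in> vertices - F" for v using that unfolding F_def by blast
    qed
    have "card F \<le> 1"
    proof (rule ccontr)
      assume "\<not> card F \<le> 1"
      then obtain v w where vw: "v \<in> F" "w \<in> F" "v \<noteq> w" by (metis card_le_Suc0_iff_eq One_nat_def card.infinite le_zero_eq nle_le)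
      then show False using at_most_two_fixed[OF g(1) gs(2) s(1), of v w] vertices_sub ns g(2) unfolding F_def by blast
    qed
    moreover have "card (vertices - F) = 12 - card F"
      using card_Diff_subset[of F vertices] finite_subset[OF _ finite_vertices] card_vertices unfolding F_def by auto
    ultimately have "card (vertices - F) = 11 \<or> card (vertices - F) = 12" by auto
    then show False using N by presburger
  qed
qed

text \<open>
  The stabilizer of a vertex permutes the two vertices over the node, so it fixes the second one.
  Conversely, a nontrivial element of the stabilizer has no third fixed point.
\<close>

lemma nu_eq_antipodal:
  assumes x: "x \<in> proj_space" and y: "y \<in> proj_space"
  shows "nu x = nu y \<longleftrightarrow> x = y \<or> antipodal tau x y"
proof
  assume e: "nu x = nu y"
  show "x = y \<or> antipodal tau x y"
  proof (cases "x = y")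
    case False
    have v: "x \<in> vertices" "y \<in> vertices" using nu_fibre[OF x y e False] by blast+
    have st: "stabilizer (alt_group 5) tau a \<subseteq> stabilizer (alt_group 5) tau c"
      if a: "a \<in> vertices" and c: "c \<in> vertices" and ac: "c \<noteq> a" "nu c = nu a" for a c
    proof
      fix g assume "g \<in> stabilizer (alt_group 5) tau a"
      then have g: "g \<in> carrier (alt_group 5)" "tau g a = a" unfolding stabilizer_def by auto
      have p: "a \<in> proj_space" "c \<in> proj_space" using a c vertices_sub by blast+
      have "tau g c \<noteq> a" using tau_inj[OF g(1) p(2) p(1)] g(2) ac(1) by auto
      moreover have "nu (tau g c) = nu a" using nu_tau[OF g(1) p(2)] nu_tau[OF g(1) p(1)] g(2) ac(2) by simp
      ultimately have "tau g c = c" using partner_unique[OF a tau_in[OF g(1) p(2)] _ _ p(2) ac] by blast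
      then show "g \<in> stabilizer (alt_group 5) tau c" using g(1) unfolding stabilizer_def by auto
    qed
    have "stabilizer (alt_group 5) tau x = stabilizer (alt_group 5) tau y"
      using st[OF v] st[OF v(2) v(1)] False e by auto
    then show ?thesis unfolding antipodal_def vertex_orbit_eq using v False by blast
  qed blast
next
  assume "x = y \<or> antipodal tau x y"
  then show "nu x = nu y"
  proof
    assume "antipodal tau x y"
    then have a: "x \<in> vertices" "y \<in> vertices" "x \<noteq> y" "stabilizer (alt_group 5) tau x = stabilizer (alt_group 5) tau y"
      unfolding antipodal_def vertex_orbit_eq by blast+
    obtain u where u: "u \<in> vertices" "u \<noteq> x" "nu u = nu x" using partner_exists[OF a(1)] by blast
    show ?thesis
    proof (rule ccontr)
      assume ne: "nu x \<noteq> nu y"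
      have "card (orbit (alt_group 5) tau x) = 12" using orbit_vertices[OF a(1)] card_vertices by simp
      then obtain g where gs: "g \<in> stabilizer (alt_group 5) tau x" "g \<noteq> id" using stabilizer_element[OF x] by blast
      then have g: "g \<in> carrier (alt_group 5)" "tau g x = x" "tau g y = y" using a(4) unfolding stabilizer_def by auto
      have pu: "u \<in> proj_space" using u(1) vertices_sub by blast
      have "tau g u \<noteq> x" using tau_inj[OF g(1) pu x] g(2) u(2) by auto
      moreover have "nu (tau g u) = nu x" using nu_tau[OF g(1) pu] nu_tau[OF g(1) x] g(2) u(3) by simp
      ultimately have "tau g u = u" using partner_unique[OF a(1) tau_in[OF g(1) pu] _ _ pu u(2,3)] by blast
      moreover have "u \<noteq> y" using ne u(3) by auto
      ultimately show False using at_most_two_fixed[OF g(1) gs(2) x y pu a(3)] g(2,3) u(2) by auto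
    qed
  qed simp
qed

end

section \<open>Existence of adapted coordinates\<close>

text \<open>
  Cramer's rule expresses \<open>p 4\<close> by the other three points, and the four vectors of \<open>qpt\<close> have the
  sum zero.
\<close>

lemma frame_of_points:
  assumes "no_three_collinear p"
  shows "\<exists>L Li lam. L ** Li = mat 1 \<and> Li ** L = mat 1 \<and> (\<forall>i. lam i \<noteq> 0 \<and> p i = lam i *s ((L :: complex^3^3) *v qpt i))"
proof -
  define D where "D = (\<lambda>i j k. det (vector [p i, p j, p k] :: complex^3^3))"
  have D: "D i j k \<noteq> 0" if "distinct [i, j, k]" for i j k using assms that unfolding no_three_collinear_def D_def by blast
  define a where "a = D 4 2 3 *s p 1"
  define b where "b = D 1 4 3 *s p 2"
  define c where "c = D 1 2 4 *s p 3"
  have p4: "D 1 2 3 *s p 4 = a + b + c"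
    unfolding a_def b_def c_def D_def vec3_eq_iff vector_smult_component vector_add_component det_3 vector_3
    by (simp add: algebra_simps)
  define L where "L = (transpose (vector [(1/2) *s (a + b), (1/2) *s (a + c), (-1/2) *s (b + c)]) :: complex^3^3)"
  have Lx: "L *v x = (x$1/2) *s (a + b) + (x$2/2) *s (a + c) - (x$3/2) *s (b + c)" for x
    by (simp add: L_def vec3_eq_iff matrix_vector_mult_def transpose_def sum_3 algebra_simps)
  have Lq: "L *v qpt 1 = a" "L *v qpt 2 = b" "L *v qpt 3 = c" "L *v qpt 4 = - (D 1 2 3 *s p 4)"
    unfolding Lx qpt_simps p4 by (simp_all add: vec3_eq_iff field_simps)
  have "4 * det L = det (vector [a, b, c] :: complex^3^3)"
    unfolding L_def det_transpose by (simp add: det_3 field_simps)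
  also have "\<dots> = D 4 2 3 * D 1 4 3 * D 1 2 4 * D 1 2 3"
    unfolding a_def b_def c_def fun_cong[OF fun_cong[OF fun_cong[OF D_def]], of 1 2 3] by (simp add: det_3 algebra_simps)
  finally have "det L \<noteq> 0" using D[of 4 2 3] D[of 1 4 3] D[of 1 2 4] D[of 1 2 3] by auto
  then obtain Li where Li: "L ** Li = mat 1" "Li ** L = mat 1" unfolding invertible_det_nz[symmetric] invertible_def by blast
  define lam where "lam = (\<lambda>i :: 4. if i = 1 then 1 / D 4 2 3 else if i = 2 then 1 / D 1 4 3 else if i = 3 then 1 / D 1 2 4 else - 1 / D 1 2 3)"
  have "\<forall>i. lam i \<noteq> 0 \<and> p i = lam i *s (L *v qpt i)"
    unfolding forall_4 Lq lam_def a_def b_def c_def using D[of 4 2 3] D[of 1 4 3] D[of 1 2 4] D[of 1 2 3]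
    by (simp add: vector_smult_assoc vector_smult_lneg vector_smult_rneg)
  then show ?thesis using Li by blast
qed

text \<open>
  The values at the coordinate vectors give the coefficients of the cubes; the values at vectors
  such as \<open>(1, 0, 1)\<close> and \<open>(-1, 0, 1)\<close> separate the remaining monomials.
\<close>

lemma cubics_independent:
  assumes r: "r * r = r + 1"
    and z: "\<And>x. (\<Sum>i\<in>UNIV. d $ i * cubic_map r x $ i) + (\<Sum>i\<in>UNIV. e $ i * cubic_map (1 - r) x $ i) = 0"
  shows "d = 0 \<and> e = 0"
proof -
  define F where "F = (\<lambda>x. d$1 * cubic_map r x $ 1 + d$2 * cubic_map r x $ 2 + d$3 * cubic_map r x $ 3
    + (e$1 * cubic_map (1 - r) x $ 1 + e$2 * cubic_map (1 - r) x $ 2 + e$3 * cubic_map (1 - r) x $ 3))"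
  have F: "F x = 0" for x using z[of x] by (simp add: F_def sum_3)
  have "F (vector [1, 0, 0]) = - (d $ 1 + e $ 1)" "F (vector [0, 1, 0]) = - (d $ 2 + e $ 2)" "F (vector [0, 0, 1]) = - (d $ 3 + e $ 3)"
    unfolding F_def cubic_map_nth vector_3 by simp_all
  then have s: "e $ 1 = - d $ 1" "e $ 2 = - d $ 2" "e $ 3 = - d $ 3" unfolding F by (simp_all add: eq_neg_iff_add_eq_0 add.commute)
  have "(2 * r - 1) * d $ 1 = (F (vector [1, 0, 1]) - F (vector [-1, 0, 1])) / 2"
    "(2 * r - 1) * d $ 2 = (F (vector [1, 1, 0]) - F (vector [1, -1, 0])) / 2"
    "(2 * r - 1) * d $ 3 = (F (vector [0, 1, 1]) - F (vector [0, 1, -1])) / 2"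
    unfolding F_def cubic_map_nth vector_3 s by (simp_all add: algebra_simps)
  then have "(2 * r - 1) * d $ 1 = 0" "(2 * r - 1) * d $ 2 = 0" "(2 * r - 1) * d $ 3 = 0" unfolding F by simp_all
  then have "d $ 1 = 0" "d $ 2 = 0" "d $ 3 = 0" using sqrt5_nonzero[OF r] by auto
  then show ?thesis using s by (simp add: vec3_eq_iff)
qed

lemma cubic_antican:
  assumes LLi: "Li ** L = mat 1" and p: "\<And>i. p i = lam i *s ((L :: complex^3^3) *v qpt i)"
  shows "(\<lambda>x. cubic_map s (Li *v x) $ j) \<in> antican_sections p 1"
proof -
  have "(\<lambda>x. cubic_map s (Li *v x) $ j) \<in> forms (3 * 1)" using forms_compose[OF forms_cubic forms_matrix] .
  moreover have "\<exists>h. \<forall>t. cubic_map s (Li *v (p i + t *s v)) $ j = t ^ 1 * poly h t" for i v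
  proof -
    have "Li *v (p i + t *s v) = lam i *s qpt i + t *s (Li *v v)" for t
      by (simp add: p matrix_vector_right_distrib vector_scalar_commute matrix_vector_mul_assoc LLi)
    then have e: "cubic_map s (Li *v (p i + t *s v)) $ j = t * lin s (lam i *s qpt i + t *s (Li *v v))
        (dkap (lam i *s qpt i) (Li *v v) + t *s kap (Li *v v)) $ j" for t
      by (simp add: cubic_map_at_centre)
    have c: "polyfun (\<lambda>t. (y + t *s w) $ k)" for y w :: "complex^3" and k by (simp, intro polyfun_intros)
    have "\<forall>j. polyfun (\<lambda>t. lin s (y + t *s w) (d + t *s e) $ j)" for y w d e
      unfolding forall_3 lin_def vector_3 by (intro conjI polyfun_intros c)
    then obtain h where "\<And>t. lin s (lam i *s qpt i + t *s (Li *v v)) (dkap (lam i *s qpt i) (Li *v v) + t *s kap (Li *v v)) $ j = poly h t"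
      unfolding polyfun_def by meson
    then show ?thesis unfolding e by auto
  qed
  ultimately show ?thesis unfolding antican_sections_def by blast
qed

lemma square_right_inverse:
  fixes W :: "'a::field^'n^'m" and B :: "'a^'m^'n"
  assumes c: "CARD('n) = CARD('m)" and WB: "W ** B = mat 1"
  shows "B ** W = mat 1"
proof -
  have WBv: "W *v (B *v d) = d" for d by (simp add: matrix_vector_mul_assoc WB)
  have inj: "inj ((*v) B)" by (rule inj_on_inverseI[of _ "(*v) W"]) (rule WBv)
  have "vec.dim (range ((*v) B)) = vec.dim (UNIV :: ('a^'m) set)"
    by (rule vec.dim_image_eq[OF matrix_vector_mul_linear_gen]) (use inj in \<open>auto simp: vec.span_UNIV\<close>)
  then have "vec.dim (range ((*v) B)) = vec.dim (UNIV :: ('a^'n) set)" unfolding vec_dim_card c .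
  moreover have "vec.subspace (range ((*v) B))" using vec.linear_subspace_image[OF matrix_vector_mul_linear_gen vec.subspace_UNIV] .
  ultimately have onto: "range ((*v) B) = UNIV"
    by (intro vec.subspace_dim_equal) (simp_all only: vec.subspace_UNIV subset_UNIV order_refl)
  have "(B ** W) *v x = mat 1 *v x" for x
  proof -
    obtain d where "x = B *v d" using onto by (metis UNIV_I imageE)
    then have "B *v (W *v x) = x" by (simp only: WBv)
    then show ?thesis by (simp only: matrix_vector_mul_assoc matrix_vector_mul_lid)
  qed
  then show ?thesis by (intro matrix_eq[THEN iffD2] allI)
qed

text \<open>
  The six cubics are linearly independent and six is the number of sections in the given basis; so
  they form a basis too, and the matrix of the change of basis is invertible.
\<close>

lemma split_coords_exists:
  assumes p: "no_three_collinear p" and b: "antican_basis p b"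
  shows "\<exists>r L Li lam U V U' V'. split_coords r p b L Li lam U V U' V'"
proof -
  define r where "r = complex_of_real ((1 + sqrt 5) / 2)"
  have "((1 + sqrt 5) / 2) * ((1 + sqrt 5) / 2) = (1 + sqrt 5) / 2 + 1" by (simp add: field_simps)
  then have r: "r * r = r + 1" unfolding r_def by (metis of_real_1 of_real_add of_real_mult)
  obtain L Li lam where L: "L ** Li = mat 1" "Li ** L = mat 1" "\<And>i. lam i \<noteq> 0" "\<And>i. p i = lam i *s ((L :: complex^3^3) *v qpt i)"
    using frame_of_points[OF p] by blast
  have LiL: "Li *v (L *v x) = x" for x by (simp add: matrix_vector_mul_assoc L(2))
  have "\<exists>c. (\<lambda>x. cubic_map s (Li *v x) $ j) = comb b c" for s j
    by (rule ex1_implies_ex, rule b[unfolded antican_basis_def, rule_format, THEN iffD1], rule cubic_antican[OF L(2,4)])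
  then obtain c where "\<And>s j. (\<lambda>x. cubic_map s (Li *v x) $ j) = comb b (c s j)" by metis
  then have c: "cubic_map s (Li *v x) $ j = comb b (c s j) x" for s j x by (rule fun_cong)
  define U where "U = (\<chi> j. c r j)"
  define V where "V = (\<chi> j. c (1 - r) j)"
  have bU: "U *v b (L *v x) = cubic_map r x" for x
    using c[of r "L *v x"] unfolding LiL vec_eq_iff by (simp add: U_def comb_def matrix_vector_mult_def)
  have bV: "V *v b (L *v x) = cubic_map (1 - r) x" for x
    using c[of "1 - r" "L *v x"] unfolding LiL vec_eq_iff by (simp add: V_def comb_def matrix_vector_mult_def)
  define W :: "complex^6^(3 + 3)" where "W = (\<chi> k. case k of Inl i \<Rightarrow> U $ i | Inr i \<Rightarrow> V $ i)"
  have sum_sum: "(\<Sum>k\<in>UNIV. g k) = (\<Sum>i\<in>UNIV. g (Inl i)) + (\<Sum>i\<in>UNIV. g (Inr i))" for g :: "3 + 3 \<Rightarrow> complex"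
    using sum.Plus[of UNIV UNIV g] unfolding UNIV_Plus_UNIV by simp
  have Wv: "(W *v w) $ Inl i = (U *v w) $ i" "(W *v w) $ Inr i = (V *v w) $ i" for w i
    by (simp_all add: W_def matrix_vector_mult_def)
  have "inj ((*v) (transpose W))"
  proof (rule injI)
    fix d d' assume e: "transpose W *v d = transpose W *v d'"
    define g where "g = d - d'"
    have g: "transpose W *v g = 0" using e by (simp add: g_def matrix_vector_mult_diff_distrib)
    have "(\<Sum>k\<in>UNIV. g $ k * (W *v w) $ k) = 0" for w
    proof -
      have "(\<Sum>k\<in>UNIV. g $ k * (W *v w) $ k) = (\<Sum>j\<in>UNIV. (transpose W *v g) $ j * w $ j)"
        unfolding matrix_vector_mult_def transpose_def vec_lambda_beta sum_distrib_left sum_distrib_right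
        by (subst sum.swap) (simp add: mult_ac)
      then show ?thesis unfolding g by simp
    qed
    then have "(\<Sum>i\<in>UNIV. g $ Inl i * (U *v w) $ i) + (\<Sum>i\<in>UNIV. g $ Inr i * (V *v w) $ i) = 0" for w
      unfolding sum_sum Wv .
    from this[of "b (L *v _)"] have "(\<chi> i. g $ Inl i) = 0 \<and> (\<chi> i. g $ Inr i) = 0"
      unfolding bU bV by (intro cubics_independent[OF r]) simp
    then have "g $ k = 0" for k by (cases k) (simp_all add: vec_eq_iff)
    then show "d = d'" by (simp add: g_def vec_eq_iff)
  qed
  then obtain B where "B ** transpose W = mat 1" using matrix_left_invertible_injective[of "transpose W"] by blast
  then have "W ** transpose B = mat 1"
    by (metis matrix_transpose_mul transpose_mat transpose_transpose)
  then obtain B where WB: "W ** B = mat 1" by blast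
  have BW: "B ** W = mat 1" by (rule square_right_inverse[OF _ WB]) simp
  define U' where "U' = (\<chi> j i. B $ j $ Inl i)"
  define V' where "V' = (\<chi> j i. B $ j $ Inr i)"
  have Bd: "B *v d = U' *v (\<chi> i. d $ Inl i) + V' *v (\<chi> i. d $ Inr i)" for d
    by (simp add: vec_eq_iff U'_def V'_def matrix_vector_mult_def sum_sum)
  have WBd: "W *v (B *v d) = d" for d by (simp add: matrix_vector_mul_assoc WB)
  have UVB: "U *v (U' *v a + V' *v c) = a" "V *v (U' *v a + V' *v c) = c" for a c
  proof -
    define d :: "complex^(3+3)" where "d = (\<chi> k. case k of Inl i \<Rightarrow> a $ i | Inr i \<Rightarrow> c $ i)"
    have e: "B *v d = U' *v a + V' *v c" unfolding Bd d_def by simp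
    show "U *v (U' *v a + V' *v c) = a" "V *v (U' *v a + V' *v c) = c"
      unfolding e[symmetric] vec_eq_iff Wv[symmetric] WBd by (simp_all add: d_def)
  qed
  have dec: "U' *v (U *v w) + V' *v (V *v w) = w" for w
  proof -
    have "U' *v (U *v w) + V' *v (V *v w) = B *v (W *v w)" unfolding Bd Wv vec_lambda_eta ..
    then show ?thesis by (simp add: matrix_vector_mul_assoc BW)
  qed
  have "split_coords r p b L Li lam U V U' V'"
  proof (unfold_locales, goal_cases)
    case 6 show ?case using UVB(1)[of _ 0] by simp
  next
    case 7 show ?case using UVB(1)[of 0] by simp
  next
    case 8 show ?case using UVB(2)[of _ 0] by simp
  next
    case 9 show ?case using UVB(2)[of 0] by simp
  qed (fact r L dec bU bV)+
  then show ?thesis by blast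
qed

text \<open>
  Conjugation of \<open>r\<close> exchanges the two blocks.
\<close>

lemma split_coords_swap: "split_coords r p b L Li lam U V U' V' \<Longrightarrow> split_coords (1 - r) p b L Li lam V U V' U'"
  unfolding split_coords_def by (intro conjI allI; elim conjE; (rule golden_conj)?; simp add: add.commute)

section \<open>The invariant subspaces and the projection\<close>

lemma matrix_axis: "(S :: complex^'n^'m) *v axis k a = (\<chi> i. S $ i $ k * a)"
  by (simp add: vec_eq_iff matrix_vector_mult_def axis_def if_distrib cong: if_cong)

text \<open>
  By the sign changes and the cyclic permutation an invariant subspace consists of the pairs whose
  three components lie in one and the same subspace of the plane. The rotations of order five of
  the two blocks differ, which forces this subspace to be spanned by coordinate vectors.
\<close>

lemma A5_invariant_blocks:
  fixes J :: "complex^3 \<Rightarrow> complex^3 \<Rightarrow> bool"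
  assumes r: "r * r = r + 1"
    and add: "\<And>d e d' e'. J d e \<Longrightarrow> J d' e' \<Longrightarrow> J (d + d') (e + e')"
    and smult: "\<And>a d e. J d e \<Longrightarrow> J (a *s d) (a *s e)"
    and inv: "\<And>S T d e. J d e \<Longrightarrow> (S, T) \<in> {(rot2, rot2), (rot3, rot3), (rot5 r, rot5 (1 - r))}
      \<Longrightarrow> J (transpose S *v d) (transpose T *v e)"
  shows "(\<forall>d e. J d e \<longrightarrow> d = 0 \<and> e = 0) \<or> (\<forall>d e. J d e \<longleftrightarrow> e = 0) \<or> (\<forall>d e. J d e \<longleftrightarrow> d = 0) \<or> (\<forall>d e. J d e)"
proof -
  define m where "m = (\<lambda>a b. J (axis 1 a) (axis 1 b))"
  define cyc where "cyc = (\<lambda>d :: complex^3. vector [d$3, d$1, d$2] :: complex^3)"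
  have cyc: "J (cyc d) (cyc e)" if "J d e" for d e
    using inv[OF that, of rot3 rot3] unfolding rot3_mult cyc_def by simp
  have proj: "m (d $ 1) (e $ 1)" if "J d e" for d e
  proof -
    have half: "axis 1 (u $ 1) = (1/2) *s (u + transpose rot2 *v u)" for u :: "complex^3"
      unfolding rot2_mult by (simp add: vec3_eq_iff axis_def)
    show ?thesis unfolding m_def half by (intro smult add that inv) simp
  qed
  have mem: "J d e \<longleftrightarrow> m (d $ 1) (e $ 1) \<and> m (d $ 2) (e $ 2) \<and> m (d $ 3) (e $ 3)" for d e
  proof
    assume J: "J d e"
    have "m (cyc (cyc d) $ 1) (cyc (cyc e) $ 1)" "m (cyc d $ 1) (cyc e $ 1)" using J cyc proj by blast+
    then show "m (d $ 1) (e $ 1) \<and> m (d $ 2) (e $ 2) \<and> m (d $ 3) (e $ 3)" using proj[OF J] by (simp add: cyc_def)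
  next
    assume "m (d $ 1) (e $ 1) \<and> m (d $ 2) (e $ 2) \<and> m (d $ 3) (e $ 3)"
    then have "J (axis 1 (d $ 1) + cyc (axis 1 (d $ 2)) + cyc (cyc (axis 1 (d $ 3)))) (axis 1 (e $ 1) + cyc (axis 1 (e $ 2)) + cyc (cyc (axis 1 (e $ 3))))"
      unfolding m_def by (intro add cyc) simp_all
    moreover have "axis 1 (u $ 1) + cyc (axis 1 (u $ 2)) + cyc (cyc (axis 1 (u $ 3))) = u" for u
      by (simp add: vec3_eq_iff cyc_def axis_def)
    ultimately show "J d e" by simp
  qed
  have madd: "m (a + a') (b + b')" if "m a b" "m a' b'" for a b a' b'
  proof -
    have "(axis 1 (x + y) :: complex^3) = axis 1 x + axis 1 y" for x y by (simp add: vec3_eq_iff axis_def)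
    then show ?thesis using add[OF that[unfolded m_def]] unfolding m_def by simp
  qed
  have mmul: "m (c * a) (c * b)" if "m a b" for a b c
  proof -
    have "c *s axis 1 x = (axis 1 (c * x) :: complex^3)" for x by (simp add: vec3_eq_iff axis_def)
    then show ?thesis using smult[OF that[unfolded m_def], of c] unfolding m_def by simp
  qed
  have s5: "2 * r - 1 \<noteq> 0" by (rule sqrt5_nonzero[OF r])
  \<comment> \<open>The first diagonal entries of the two rotations of order five differ.\<close>
  have split: "m a 0 \<and> m 0 b" if ab: "m a b" for a b
  proof -
    have "J (transpose (rot5 r) *v axis 1 a) (transpose (rot5 (1 - r)) *v axis 1 b)"
      using inv[OF ab[unfolded m_def]] by simp
    then have "m ((transpose (rot5 r) *v axis 1 a) $ 1) ((transpose (rot5 (1 - r)) *v axis 1 b) $ 1)" by (rule proj)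
    then have "m ((r - 1) / 2 * a) (- r / 2 * b)" unfolding matrix_axis by (simp add: transpose_def rot5_def)
    then have "m (2 * ((r - 1) / 2 * a) + r * a) (2 * (- r / 2 * b) + r * b)" by (intro madd mmul ab)
    moreover have "2 * ((r - 1) / 2 * a) + r * a = (2 * r - 1) * a" "2 * (- r / 2 * b) + r * b = 0" by (simp_all add: field_simps)
    ultimately have "m ((2 * r - 1) * a) 0" by (simp only:)
    from mmul[OF this, of "1 / (2 * r - 1)"] have "m a 0" using s5 by simp
    moreover from madd[OF ab mmul[OF this, of "-1"]] have "m 0 b" by simp
    ultimately show ?thesis ..
  qed
  have scale: "m x 0" if "m a 0" "a \<noteq> 0" for a x using mmul[OF that(1), of "x / a"] that(2) by simp
  have scale': "m 0 x" if "m 0 b" "b \<noteq> 0" for b x using mmul[OF that(1), of "x / b"] that(2) by simp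
  have zero: "m 0 0" if "m a b" for a b using mmul[OF that, of 0] by simp
  show ?thesis
  proof (cases "\<exists>a. a \<noteq> 0 \<and> m a 0"; cases "\<exists>b. b \<noteq> 0 \<and> m 0 b")
    assume 1: "\<exists>a. a \<noteq> 0 \<and> m a 0" and 2: "\<exists>b. b \<noteq> 0 \<and> m 0 b"
    have "m x y" for x y
    proof -
      have "m x 0" "m 0 y" using 1 2 scale scale' by blast+
      from madd[OF this] show ?thesis by simp
    qed
    then show ?thesis unfolding mem by blast
  next
    assume 1: "\<exists>a. a \<noteq> 0 \<and> m a 0" and 2: "\<not> (\<exists>b. b \<noteq> 0 \<and> m 0 b)"
    have "m x y \<longleftrightarrow> y = 0" for x y using 1 2 scale split by blast
    then show ?thesis unfolding mem by (simp add: vec3_eq_iff)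
  next
    assume 1: "\<not> (\<exists>a. a \<noteq> 0 \<and> m a 0)" and 2: "\<exists>b. b \<noteq> 0 \<and> m 0 b"
    have "m x y \<longleftrightarrow> x = 0" for x y using 1 2 scale' split by blast
    then show ?thesis unfolding mem by (simp add: vec3_eq_iff)
  next
    assume 1: "\<not> (\<exists>a. a \<noteq> 0 \<and> m a 0)" and 2: "\<not> (\<exists>b. b \<noteq> 0 \<and> m 0 b)"
    have "m x y \<Longrightarrow> x = 0 \<and> y = 0" for x y using 1 2 split by blast
    then show ?thesis unfolding mem vec3_eq_iff zero_index by blast
  qed
qed

lemma dot_matrix: "(\<Sum>i\<in>UNIV. d $ i * ((M :: complex^'n^'m) *v w) $ i) = (\<Sum>j\<in>UNIV. (transpose M *v d) $ j * w $ j)"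
  unfolding matrix_vector_mult_def transpose_def vec_lambda_beta sum_distrib_left sum_distrib_right
  by (subst sum.swap) (simp add: mult_ac)

lemma dot_separates: "(\<And>w. (\<Sum>j\<in>UNIV. c $ j * w $ j) = 0) \<Longrightarrow> c = (0 :: complex^'n)"
proof -
  assume c: "\<And>w. (\<Sum>j\<in>UNIV. c $ j * w $ j) = 0"
  have "c $ k = (\<Sum>j\<in>UNIV. c $ j * axis k 1 $ j)" for k by (simp add: axis_def if_distrib cong: if_cong)
  then show "c = 0" unfolding vec_eq_iff by (simp add: c)
qed

context split_coords
begin

lemma dot_blocks: "(\<Sum>j\<in>UNIV. c $ j * w $ j)
   = (\<Sum>i\<in>UNIV. (transpose U' *v c) $ i * (U *v w) $ i) + (\<Sum>i\<in>UNIV. (transpose V' *v c) $ i * (V *v w) $ i)"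
proof -
  have "(\<Sum>j\<in>UNIV. c $ j * w $ j) = (\<Sum>j\<in>UNIV. c $ j * (U' *v (U *v w) + V' *v (V *v w)) $ j)" unfolding decomp ..
  also have "\<dots> = (\<Sum>j\<in>UNIV. c $ j * (U' *v (U *v w)) $ j) + (\<Sum>j\<in>UNIV. c $ j * (V' *v (V *v w)) $ j)"
    by (simp only: vector_add_component distrib_left sum.distrib)
  finally show ?thesis unfolding dot_matrix .
qed

lemma blocks_determine:
  assumes "transpose U' *v c = 0" "transpose V' *v c = 0" shows "c = 0"
  by (rule dot_separates) (simp only: dot_blocks assms, simp)

lemma blocks_onto: "\<exists>c. transpose U' *v c = d \<and> transpose V' *v c = e"
proof -
  let ?c = "transpose U *v d + transpose V *v e"
  have t: "transpose A *v (transpose B *v x) = M *v x" if "\<And>a. B *v (A *v a) = transpose M *v a"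
    for A :: "complex^3^6" and B :: "complex^6^3" and M :: "complex^3^3" and x
  proof -
    have "B ** A = transpose M" using that by (simp add: matrix_eq matrix_vector_mul_assoc)
    then have "transpose A ** transpose B = M" by (metis matrix_transpose_mul transpose_transpose)
    then show ?thesis by (simp only: matrix_vector_mul_assoc)
  qed
  have "transpose U' *v (transpose U *v d) = mat 1 *v d" "transpose V' *v (transpose V *v e) = mat 1 *v e"
    "transpose U' *v (transpose V *v e) = 0 *v e" "transpose V' *v (transpose U *v d) = 0 *v d"
    by (rule t; simp add: UU' UV' VU' VV' transpose_mat; simp add: transpose_def vec_eq_iff matrix_vector_mult_def)+
  then have "transpose U' *v ?c = d \<and> transpose V' *v ?c = e"
    by (simp add: matrix_vector_right_distrib)
  then show ?thesis by blast
qed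

lemma pullback_blocks:
  assumes g: "icosahedral r S T" and act: "\<And>w. w \<noteq> 0 \<Longrightarrow> ppoint w \<in> del_pezzo p b \<Longrightarrow> \<gamma> (ppoint w) = ppoint (act S T *v w)"
    and pb: "pullback p b \<gamma> 1 (comb b c) (comb b c')"
  shows "transpose U' *v c' = transpose S *v (transpose U' *v c)" "transpose V' *v c' = transpose T *v (transpose V' *v c)"
proof -
  interpret ramification_coords r p b L Li lam U V U' V' "\<lambda>x. sextic r (Li *v x)" 1
    by unfold_locales (simp_all add: Li_L)
  let ?d = "transpose U' *v c' - transpose S *v (transpose U' *v c)"
  let ?e = "transpose V' *v c' - transpose T *v (transpose V' *v c)"
  have "(\<Sum>i\<in>UNIV. ?d $ i * cubic_map r x $ i) + (\<Sum>i\<in>UNIV. ?e $ i * cubic_map (1 - r) x $ i) = 0" for x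
  proof -
    have "(\<Sum>j\<in>UNIV. c' $ j * b (L *v x) $ j) = (\<Sum>j\<in>UNIV. c $ j * (act S T *v b (L *v x)) $ j)"
      by (rule pullback_linear[OF g act pb])
    note h = this[unfolded dot_blocks U_act V_act bU bV, unfolded dot_matrix]
    have "x1 - x2 + (y1 - y2) = 0" if "x1 + y1 = x2 + y2" for x1 x2 y1 y2 :: complex
    proof -
      have "x1 - x2 + (y1 - y2) = (x1 + y1) - (x2 + y2)" by (simp add: algebra_simps)
      then show ?thesis unfolding that by simp
    qed
    from this[OF h] show ?thesis unfolding vector_minus_component left_diff_distrib sum_subtractf .
  qed
  from cubics_independent[OF r this]
  show "transpose U' *v c' = transpose S *v (transpose U' *v c)" "transpose V' *v c' = transpose T *v (transpose V' *v c)"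
    by simp_all
qed

end

text \<open>
  Pullback acts on the coefficients of linear forms by the transposed blocks.
\<close>

lemma (in split_coords_action) A5_invariant_cases:
  assumes I: "A5_invariant p b \<theta> I" "vec.dim I = 3"
  shows "I = {c. transpose V' *v c = 0} \<or> I = {c. transpose U' *v c = 0}"
proof -
  have sub: "vec.subspace I" using I(1) unfolding A5_invariant_def by blast
  define J where "J = (\<lambda>d e. \<exists>c\<in>I. transpose U' *v c = d \<and> transpose V' *v c = e)"
  have inI: "c \<in> I \<longleftrightarrow> J (transpose U' *v c) (transpose V' *v c)" for c
  proof
    assume "J (transpose U' *v c) (transpose V' *v c)"
    then obtain c' where c': "c' \<in> I" "transpose U' *v c' = transpose U' *v c" "transpose V' *v c' = transpose V' *v c"
      unfolding J_def by blast
    have "c' - c = 0" by (rule blocks_determine) (simp_all add: c' matrix_vector_mult_diff_distrib del: transpose_matrix_vector)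
    then show "c \<in> I" using c'(1) by simp
  qed (auto simp: J_def)
  have inv: "J (transpose S *v d) (transpose T *v e)"
    if J: "J d e" and t: "acts_by g S T" "g \<in> carrier (alt_group 5)" for S T d e g
  proof -
    obtain c where c: "c \<in> I" "transpose U' *v c = d" "transpose V' *v c = e" using J unfolding J_def by blast
    obtain c' where c': "c' \<in> I" "pullback p b (\<theta> g) 1 (comb b c) (comb b c')"
      using I(1) c(1) t(2) unfolding A5_invariant_def by blast
    have gd: "icosahedral r S T" "\<theta> g = gact S T" using t(1) unfolding acts_by_def by blast+
    have "transpose U' *v c' = transpose S *v d \<and> transpose V' *v c' = transpose T *v e"
      using pullback_blocks[OF gd(1) _ c'(2)[unfolded gd(2)]] gact_ppoint unfolding c(2,3) by blast
    then show ?thesis using c'(1) unfolding J_def by blast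
  qed
  obtain a where a: "acts_by a rot2 rot2" using acts_by_exists[OF icosahedral_rot2] by blast
  obtain a' where a': "acts_by a' rot2' rot2'" using acts_by_exists[OF icosahedral_rot2'] by blast
  obtain t where t: "acts_by t rot3 rot3" using acts_by_exists[OF icosahedral_rot3] by blast
  obtain f where f: "acts_by f (rot5 r) (rot5 (1 - r))" using acts_by_exists[OF icosahedral_rot5[OF r]] by blast
  have J_zero: "J 0 0" unfolding J_def using vec.subspace_0[OF sub] by (metis matrix_vector_mult_0_right)
  have "(\<forall>d e. J d e \<longrightarrow> d = 0 \<and> e = 0) \<or> (\<forall>d e. J d e \<longleftrightarrow> e = 0) \<or> (\<forall>d e. J d e \<longleftrightarrow> d = 0) \<or> (\<forall>d e. J d e)"
  proof (rule A5_invariant_blocks[OF r])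
    fix d e d' e' assume "J d e" "J d' e'"
    then show "J (d + d') (e + e')" unfolding J_def using vec.subspace_add[OF sub] matrix_vector_right_distrib by metis
  next
    fix x d e assume "J d e"
    then show "J (x *s d) (x *s e)" unfolding J_def using vec.subspace_scale[OF sub] vector_scalar_commute by metis
  next
    fix S T d e assume J: "J d e" and "(S, T) \<in> {(rot2, rot2), (rot3, rot3), (rot5 r, rot5 (1 - r))}"
    then consider "S = rot2" "T = rot2" | "S = rot3" "T = rot3" | "S = rot5 r" "T = rot5 (1 - r)" by blast
    then show "J (transpose S *v d) (transpose T *v e)"
    proof cases
      case 1 then show ?thesis using inv[OF J] a acts_by_alt_rot2(1)[OF a a'] by blast
    next
      case 2 then show ?thesis using inv[OF J] t acts_by_alt_rot3(1)[OF t] by blast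
    next
      case 3 then show ?thesis using inv[OF J] f acts_by_alt_rot5(1)[OF f] by blast
    qed
  qed
  then show ?thesis
  proof (elim disjE)
    assume "\<forall>d e. J d e \<longrightarrow> d = 0 \<and> e = 0"
    then have "I \<subseteq> {0}" using inI blocks_determine by blast
    then have "vec.dim I \<le> vec.dim ({0} :: (complex^6) set)" by (rule vec.dim_subset)
    then show ?thesis using I(2) by (simp add: vec.dim_insert)
  next
    assume "\<forall>d e. J d e"
    then have "I = UNIV" using inI by blast
    then have "vec.dim I = 6" by (simp only: vec_dim_card) simp
    then show ?thesis using I(2) by simp
  qed (use inI in blast)+
qed

lemma icosahedral_coordinates_exist:
  assumes p: "no_three_collinear p" and b: "antican_basis p b"
    and th: "\<theta> \<in> iso (sym_group 5) (aut_group (del_pezzo p b))"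
    and I: "A5_invariant p b \<theta> I" "vec.dim I = 3"
  shows "\<exists>r L Li lam U V U' V'. split_coords_action r p b L Li lam U V U' V' \<theta> \<and> I = {c. transpose V' *v c = 0}"
proof -
  obtain r L Li lam U V U' V' where split_coords: "split_coords r p b L Li lam U V U' V'" using split_coords_exists[OF p b] by blast
  have da: "split_coords_action r p b L Li lam U V U' V' \<theta>" if "split_coords r p b L Li lam U V U' V'" for r L Li lam U V U' V'
    using that th unfolding split_coords_action_def split_coords_action_axioms_def by blast
  show ?thesis using split_coords_action.A5_invariant_cases[OF da[OF split_coords] I]
  proof
    assume "I = {c. transpose V' *v c = 0}"
    then show ?thesis using da[OF split_coords] by blast
  next
    assume "I = {c. transpose U' *v c = 0}"
    then show ?thesis using da[OF split_coords_swap[OF split_coords]] by blast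
  qed
qed

context split_coords_action
begin

lemma annihilator_block: "annihilator {c. transpose V' *v c = 0} = {v. U *v v = 0}"
proof (intro equalityI subsetI)
  fix v assume v: "v \<in> annihilator {c. transpose V' *v c = 0}"
  have "(\<Sum>i\<in>UNIV. d $ i * (U *v v) $ i) = 0" for d
  proof -
    obtain c where c: "transpose U' *v c = d" "transpose V' *v c = 0" using blocks_onto by blast
    then have "(\<Sum>j\<in>UNIV. c $ j * v $ j) = 0" using v unfolding annihilator_def by blast
    then show ?thesis unfolding dot_blocks c by simp
  qed
  then have "U *v v = 0" by (intro dot_separates) (simp add: mult.commute)
  then show "v \<in> {v. U *v v = 0}" by blast
next
  fix v assume "v \<in> {v. U *v v = 0}"
  then have "U *v v = 0" by blast
  then have "(\<Sum>j\<in>UNIV. c $ j * v $ j) = 0" if "transpose V' *v c = 0" for c unfolding dot_blocks that by simp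
  then show "v \<in> annihilator {c. transpose V' *v c = 0}" unfolding annihilator_def by blast
qed

text \<open>
  The matrix factors through the first block, so the projection is the cubic map up to linear
  coordinate changes.
\<close>

lemma ramification_coords_projection:
  assumes A: "{v. A *v v = 0} = {v. U *v v = 0}"
  shows "\<exists>\<kappa>. ramification_coords r p b L Li lam U V U' V' (ramification_section b A) \<kappa>"
proof -
  define N where "N = A ** U'"
  have AN: "A *v w = N *v (U *v w)" for w
  proof -
    have "A *v (V' *v a) = 0" for a using A UV'[of a] by blast
    then have "A *v (U' *v (U *v w) + V' *v (V *v w)) = A *v (U' *v (U *v w))" by (simp add: matrix_vector_right_distrib)
    then show ?thesis unfolding decomp by (simp only: N_def matrix_vector_mul_assoc matrix_mul_assoc)
  qed
  have "a = 0" if "N *v a = 0" for a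
  proof -
    have "A *v (U' *v a) = 0" unfolding AN UU' by (rule that)
    then have "U *v (U' *v a) = 0" using A by blast
    then show ?thesis by (simp add: UU')
  qed
  then have "inj ((*v) N)" by (simp add: vec.inj_iff_eq_0)
  then have N0: "det N \<noteq> 0" using invertible_det_nz[of N] matrix_left_invertible_injective[of N] invertible_left_inverse[of N] by blast
  have "det L \<noteq> 0" "det Li \<noteq> 0" using LLi by (metis invertible_def invertible_det_nz)+
  moreover have "ramification_section b A (L *v x) = (det N * det Li) * sextic r x" for x
  proof -
    have F: "A *v b y = N *v cubic_map r (Li *v y)" for y using bU[of "Li *v y"] unfolding L_Li AN by simp
    have "deriv (\<lambda>t. (A *v b (L *v x + t *s axis j 1)) $ i) 0 = (N ** cubic_deriv r x ** Li) $ i $ j" for i j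
    proof -
      have D1: "((\<lambda>t. Li *v (L *v x + t *s axis j 1)) has_derivative (\<lambda>t. t *s (Li *v axis j 1))) (at 0)"
        unfolding matrix_vector_right_distrib Li_L vector_scalar_commute
        by (rule has_derivative_vec3) (auto intro!: derivative_eq_intros)
      have D2: "(cubic_map r has_derivative (\<lambda>v. cubic_deriv r x *v v)) (at (Li *v (L *v x + 0 *s axis j 1)))"
        using cubic_map_has_derivative[of r x] by (simp add: Li_L)
      have "((\<lambda>t. cubic_map r (Li *v (L *v x + t *s axis j 1))) has_derivative (\<lambda>t. cubic_deriv r x *v (t *s (Li *v axis j 1)))) (at 0)"
        by (rule has_derivative_compose[where f = "\<lambda>t. Li *v (L *v x + t *s axis j 1)" and g = "cubic_map r", OF D1 D2])
      then have "((\<lambda>t. (N *v cubic_map r (Li *v (L *v x + t *s axis j 1))) $ i) has_derivative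
         (\<lambda>t. (N *v (cubic_deriv r x *v (t *s (Li *v axis j 1)))) $ i)) (at 0)"
        by (intro bounded_linear.has_derivative[OF bounded_linear_vec_nth] has_derivative_matrix)
      moreover have "(\<lambda>t. (N *v (cubic_deriv r x *v (t *s (Li *v axis j 1)))) $ i) = (*) ((N ** cubic_deriv r x ** Li) $ i $ j)"
        unfolding vector_scalar_commute unfolding matrix_vector_mul_assoc unfolding matrix_axis by (simp add: fun_eq_iff mult.commute matrix_mul_assoc)
      ultimately have "((\<lambda>t. (A *v b (L *v x + t *s axis j 1)) $ i) has_field_derivative (N ** cubic_deriv r x ** Li) $ i $ j) (at 0)"
        unfolding F has_field_derivative_def by (simp only:)
      then show ?thesis by (rule DERIV_imp_deriv)
    qed
    then have "ramification_section b A (L *v x) = det (N ** cubic_deriv r x ** Li)"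
      unfolding ramification_section_def jacobian_det_def by (simp add: vec_lambda_eta)
    then show ?thesis by (simp add: det_mul det_cubic_deriv[OF r])
  qed
  ultimately have "ramification_coords r p b L Li lam U V U' V' (ramification_section b A) (det N * det Li)"
    by unfold_locales (use N0 in simp_all)
  then show ?thesis by blast
qed

end

section \<open>The ramification curve as a nodal rational curve\<close>

context split_coords_action
begin
text \<open>
  The point of the conic \<open>(0, 1, \<i>)\<close> is not a vertex.
\<close>

lemma nodes_proper: "nodes \<noteq> nu ` proj_space"
proof
  assume e: "nodes = nu ` proj_space"
  obtain z where z: "av z = vector [0, 1, \<i>]" using av_onto[of "vector [0, 1, \<i>]"] by (auto simp: conic_def)
  have z0: "z \<noteq> 0" using z av_eq_0_iff[of z] by (auto simp: vec3_eq_iff)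
  have "\<forall>i. vertex_forms r (av z) $ i \<noteq> 0" unfolding forall_3 z vertex_forms_def using golden_nonzero[OF r] by (simp add: neg_eq_iff_add_eq_0 add.commute)
  then have n: "ppoint z \<notin> vertices" using vertices_iff[OF z0] by blast
  have p: "ppoint z \<in> proj_space" by (rule ppoint_in_proj[OF z0])
  then obtain s where s: "s \<in> vertices" "nu s = nu (ppoint z)" using e nu_vertices by (metis imageE image_eqI)
  have "s \<in> proj_space" using s(1) vertices_sub by blast
  moreover have "ppoint z \<noteq> s" using s(1) n by blast
  ultimately show False using nu_fibre(1)[OF p _ s(2)[symmetric]] n by blast
qed

lemma tau_nontrivial: "\<exists>g\<in>carrier (alt_group 5). \<exists>x\<in>proj_space. tau g x \<noteq> x"
proof -
  obtain f where f: "acts_by f (rot5 r) (rot5 (1 - r))" using acts_by_exists[OF icosahedral_rot5[OF r]] by blast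
  show ?thesis using tau_faithful[OF acts_by_alt_rot5(1)[OF f]] acts_by_alt_rot5(1,3)[OF f] by blast
qed

end

theorem proposition4p3:
  fixes p :: "4 \<Rightarrow> complex^3"
    and b :: "complex^3 \<Rightarrow> complex^6"
    and \<theta> :: "(nat \<Rightarrow> nat) \<Rightarrow> (complex^6) set \<Rightarrow> (complex^6) set"
    and I I' :: "(complex^6) set"
    and A :: "complex^6^3"
  assumes "no_three_collinear p"
    and "antican_basis p b"
    and "\<theta> \<in> iso (sym_group 5) (aut_group (del_pezzo p b))"
    and "A5_irreducible p b \<theta> I" and "vec.dim I = 3"
    and "A5_irreducible p b \<theta> I'" and "vec.dim I' = 3"
    and "\<not> A5_equivalent p b \<theta> I I'"
    and "I \<inter> I' = {0}" and "\<forall>c. \<exists>x\<in>I. \<exists>y\<in>I'. c = x + y"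
    and "{v. A *v v = 0} = annihilator I"
  shows "ramification_section b A \<in> wiman_edge_sections p b \<theta> - {\<lambda>_. 0}
    \<and> irreducible_divisor p b 2 (ramification_section b A)
    \<and> singular_points p b 2 (ramification_section b A) \<noteq> {}
    \<and> (\<exists>\<tau> \<nu>.
         \<tau> \<in> hom (alt_group 5) (aut_group (proj_space :: (complex^2) set set))
       \<and> (\<exists>g\<in>carrier (alt_group 5). \<exists>x\<in>proj_space. \<tau> g x \<noteq> x)
       \<and> regular_map proj_space (del_pezzo p b) \<nu>
       \<and> \<nu> ` proj_space = divisor_support p b 2 (ramification_section b A)
       \<and> (\<forall>g\<in>carrier (alt_group 5). \<forall>x\<in>proj_space. \<nu> (\<tau> g x) = \<theta> g (\<nu> x))
       \<and> (\<forall>x\<in>proj_space. \<forall>y\<in>proj_space. \<nu> x = \<nu> y \<longleftrightarrow> x = y \<or> antipodal \<tau> x y)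
       \<and> singular_points p b 2 (ramification_section b A) = \<nu> ` vertex_orbit \<tau>
       \<and> ordinary_nodes p b 2 (ramification_section b A) = \<nu> ` vertex_orbit \<tau>
       \<and> card (\<nu> ` vertex_orbit \<tau>) = 6)"
proof -
  have inv: "A5_invariant p b \<theta> I" using assms(4) unfolding A5_irreducible_def by blast
  obtain r L Li lam U V U' V' where da: "split_coords_action r p b L Li lam U V U' V' \<theta>" and I: "I = {c. transpose V' *v c = 0}"
    using icosahedral_coordinates_exist[OF assms(1-3) inv assms(5)] by blast
  interpret split_coords_action r p b L Li lam U V U' V' \<theta> by (rule da)
  have "{v. A *v v = 0} = {v. U *v v = 0}" using assms(11) unfolding I annihilator_block .
  then obtain \<kappa> where ra: "ramification_coords r p b L Li lam U V U' V' (ramification_section b A) \<kappa>"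
    using ramification_coords_projection by blast
  interpret ramification_coords r p b L Li lam U V U' V' "ramification_section b A" \<kappa> by (rule ra)
  let ?f = "ramification_section b A"
  have we: "?f \<in> wiman_edge_sections p b \<theta>"
  proof -
    have "pullback p b (\<theta> g) 2 ?f ?f" if g: "g \<in> carrier (alt_group 5)" for g
    proof -
      obtain S T where t: "acts_by g S T" using theta_alt[OF g] by blast
      then have "icosahedral r S T" "\<theta> g = gact S T" unfolding acts_by_def by blast+
      then show ?thesis using pullback_f gact_ppoint by metis
    qed
    then show ?thesis unfolding wiman_edge_sections_def using f_antican by blast
  qed
  have supp: "nu ` proj_space = divisor_support p b 2 ?f" unfolding nu_image divisor_support_eq ..
  have sing: "singular_points p b 2 ?f = nu ` vertex_orbit tau" "ordinary_nodes p b 2 ?f = nu ` vertex_orbit tau"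
    unfolding singular_points_eq vertex_orbit_eq nu_vertices by (rule refl)+
  have card: "card (nu ` vertex_orbit tau) = 6" unfolding vertex_orbit_eq nu_vertices by (rule card_nodes)
  have irr: "irreducible_divisor p b 2 ?f" unfolding irreducible_divisor_def
  proof
    show "irreducible_subset (divisor_support p b 2 ?f)" unfolding supp[symmetric] by (rule irreducible_image)
    show "singular_points p b 2 ?f \<noteq> divisor_support p b 2 ?f"
      unfolding supp[symmetric] sing vertex_orbit_eq nu_vertices by (rule nodes_proper)
  qed
  have ne: "singular_points p b 2 ?f \<noteq> {}" using card unfolding sing by force
  show ?thesis
  proof (intro conjI exI)
    show "?f \<in> wiman_edge_sections p b \<theta> - {\<lambda>_. 0}" using we f_nonzero by blast
    show "tau \<in> hom (alt_group 5) (aut_group proj_space)" by (rule tau_hom)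
    show "\<exists>g\<in>carrier (alt_group 5). \<exists>x\<in>proj_space. tau g x \<noteq> x" by (rule tau_nontrivial)
    show "regular_map proj_space (del_pezzo p b) nu" by (rule nu_regular)
    show "\<forall>g\<in>carrier (alt_group 5). \<forall>x\<in>proj_space. nu (tau g x) = \<theta> g (nu x)" using nu_tau by blast
    show "\<forall>x\<in>proj_space. \<forall>y\<in>proj_space. nu x = nu y \<longleftrightarrow> x = y \<or> antipodal tau x y" using nu_eq_antipodal by blast
  qed (fact irr ne supp sing card)+
qed

end
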